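(* Let $\{G(n,m)\}_{m\ge 0}$ be the random graph process on $n$ vertices, and let $\tau=\min\{m : G(n,m)\text{ is connected}\}$. Then with high probability (i.e. with probability tending to $1$ as $n\to\infty$), $G(n,m)$ is globally synchronizing for all $m\ge\tau$ simultaneously.
   Context: The random graph process $\{G(n,m)\}_{m\ge0}$ starts with $G(n,0)$ the empty graph on $n$ vertices, and $G(n,m+1)$ is obtained from $G(n,m)$ by adding a uniformly random edge not already present. For a graph $G=(V,E)$ with adjacency matrix $A$, the homogeneous Kuramoto model is the gradient flow $\frac{d\theta}{dt}=-\nabla\mathcal{E}_G(\theta)$ on $(\mathbb{S}^1)^V$, where $\mathcal{E}_G(\theta)=\frac12\sum_{u,v\in V}A_{u,v}(1-\cos(\theta_u-\theta_v))$. A state is fully synchronized if $\theta_u=\theta_v$ for all $u,v\in V$. The graph $G$ is globally synchronizing if, for an initial state chosen uniformly at random from $(\mathbb{S}^1)^V$, this flow converges to a fully synchronized state with probability one. *)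

theory Defs
  imports "HOL-Probability.Probability"
begin

section \<open>Graphs on the vertex set {0..<n}\<close>

text \<open>A simple graph is given by its vertex set V and its edge set E, a set of
  2-element subsets of V. Its adjacency matrix is adj E u v.\<close>

definition adj :: "nat set set \<Rightarrow> nat \<Rightarrow> nat \<Rightarrow> real" where
  "adj E u v = (if {u, v} \<in> E \<and> u \<noteq> v then 1 else 0)"

definition graph_connected :: "nat set \<Rightarrow> nat set set \<Rightarrow> bool" where
  "graph_connected V E \<longleftrightarrow>
     (\<forall>u\<in>V. \<forall>v\<in>V. (u, v) \<in> {(x, y). x \<noteq> y \<and> {x, y} \<in> E}\<^sup>*)"

section \<open>Random graph process\<close>

text \<open>All possible edges of the complete graph on {0..<n}.\<close>
definition all_edges :: "nat \<Rightarrow> nat set set" where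
  "all_edges n = {e. \<exists>u v. u < n \<and> v < n \<and> u \<noteq> v \<and> e = {u, v}}"

text \<open>The random graph process G(n,m), m \<ge> 0, is equivalent to a uniformly random
  ordering of all edges of K_n; G(n,m) consists of the first m edges (for m beyond
  the number of edges the process has stopped at the complete graph).\<close>
definition edge_orderings :: "nat \<Rightarrow> nat set list set" where
  "edge_orderings n = {xs. distinct xs \<and> set xs = all_edges n}"

definition random_graph_process :: "nat \<Rightarrow> nat set list pmf" where
  "random_graph_process n = pmf_of_set (edge_orderings n)"

definition Gnm :: "nat set list \<Rightarrow> nat \<Rightarrow> nat set set" where
  "Gnm xs m = set (take m xs)"

text \<open>Hitting time of connectivity.\<close>
definition conn_time :: "nat \<Rightarrow> nat set list \<Rightarrow> nat" where
  "conn_time n xs = (LEAST m. graph_connected {..<n} (Gnm xs m))"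

section \<open>Homogeneous Kuramoto model\<close>

text \<open>States on the torus (S^1)^V are represented by their lifts V \<Rightarrow> real (angles mod 2 pi).\<close>

definition kuramoto_energy :: "nat set \<Rightarrow> nat set set \<Rightarrow> (nat \<Rightarrow> real) \<Rightarrow> real" where
  "kuramoto_energy V E \<theta> =
     (1/2) * (\<Sum>u\<in>V. \<Sum>v\<in>V. adj E u v * (1 - cos (\<theta> u - \<theta> v)))"

text \<open>The flow d theta/dt = - grad E_G(theta), written coordinatewise:
  the partial derivative of the energy with respect to theta_u is
  sum_v A_{u,v} sin(theta_u - theta_v).\<close>
definition kuramoto_solution :: "nat set \<Rightarrow> nat set set \<Rightarrow> (real \<Rightarrow> nat \<Rightarrow> real) \<Rightarrow> bool" where
  "kuramoto_solution V E \<theta> \<longleftrightarrow>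
     (\<forall>u\<in>V. \<forall>t\<ge>0. ((\<lambda>s. \<theta> s u) has_real_derivative
         (- (\<Sum>v\<in>V. adj E u v * sin (\<theta> t u - \<theta> t v)))) (at t within {0..}))"

definition fully_synchronized :: "nat set \<Rightarrow> (nat \<Rightarrow> real) \<Rightarrow> bool" where
  "fully_synchronized V \<phi> \<longleftrightarrow> (\<forall>u\<in>V. \<forall>v\<in>V. \<exists>k::int. \<phi> u - \<phi> v = 2 * pi * of_int k)"

text \<open>Convergence on the torus of a continuous trajectory is equivalent to
  convergence of its continuous lift.\<close>
definition converges_to_sync :: "nat set \<Rightarrow> (real \<Rightarrow> nat \<Rightarrow> real) \<Rightarrow> bool" where
  "converges_to_sync V \<theta> \<longleftrightarrow>
     (\<exists>\<phi>. fully_synchronized V \<phi> \<and> (\<forall>u\<in>V. ((\<lambda>t. \<theta> t u) \<longlongrightarrow> \<phi> u) at_top))"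

text \<open>Uniform initial state on the torus, and global synchronization.\<close>
definition torus_uniform :: "nat set \<Rightarrow> (nat \<Rightarrow> real) measure" where
  "torus_uniform V = PiM V (\<lambda>_. uniform_measure lborel {0..<2*pi})"

definition globally_synchronizing :: "nat set \<Rightarrow> nat set set \<Rightarrow> bool" where
  "globally_synchronizing V E \<longleftrightarrow>
     (AE \<theta>0 in torus_uniform V. \<forall>\<theta>. kuramoto_solution V E \<theta> \<and> (\<forall>u\<in>V. \<theta> 0 u = \<theta>0 u)
         \<longrightarrow> converges_to_sync V \<theta>)"

end

theory Submission
  imports Defs "HOL-Computational_Algebra.Polynomial" "HOL-Real_Asymp.Real_Asymp"
begin

text \<open>
  Let \<open>p\<close> be the edge density and \<open>d = p n\<close>. If \<open>A - p\<close> has operator norm at most \<open>\<epsilon> d\<close>, then an equilibrium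
  \<open>\<theta>\<close> with positive semidefinite Hessian has a large order parameter, so after a rotation most oscillators are near
  phase 0. With \<open>t\<^sub>u = exp (i \<theta>\<^sub>u) - 1\<close> one has \<open>\<bar>t\<^sub>u\<bar> \<le> 2 \<bar>(A t)\<^sub>u\<bar> / deg u\<close>, and the operator norm bound makes this a
  contraction on the vertices of degree at least \<open>c d\<close>. The remaining vertices are pairwise at distance at least 3, so
  each is controlled by its neighbours. Hence \<open>t = 0\<close>, and every stable equilibrium is synchronized.

  Every trajectory converges, by Kurdyka's talweg argument: in the coordinates \<open>(cos \<theta>, sin \<theta>)\<close> the energy is a
  polynomial, and a definable selection of the points of least gradient on the energy levels has finite length.
  Definability is handled by quantifier elimination in the style of Cohen and Hormander. The points converging to
  equilibria with an unstable direction form a countable union of images of Lipschitz graphs over hyperplanes, hence a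
  null set.

  In the random graph process, Chernoff bounds give discrepancy and degree bounds simultaneously for all
  \<open>m \<ge> 2/5 n ln n\<close>, and decomposing vectors into binary digits turns them into the operator norm bound.
  A first moment bound shows that no two vertices of low degree are within distance 2, and a second moment bound shows
  that \<open>G(n, m)\<close> still has an isolated vertex when \<open>m\<close> is about \<open>2/5 n ln n\<close>.
\<close>

section \<open>Stable equilibria of pseudorandom graphs\<close>

text \<open>Instability of an equilibrium can be exploited only for trajectories known to have a
  limit. Rotating all phases turns each equilibrium into a circle of equilibria, so arguments for
  nondegenerate critical points do not apply, and the set of equilibria is uncountable; the null
  sets are therefore indexed by rational approximations of an equilibrium. For the graph, the
  obstacle is that degree 1 must be allowed at the connectivity time although the mean degree is of
  order \<open>ln n\<close>, so the spectral estimate alone gives no contraction at some vertices.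
  The hitting time is random, so the estimates are made simultaneously for all \<open>m\<close>
  above a deterministic threshold \<open>a n ln n\<close>. For a < 1/2 an isolated vertex survives
  at the threshold, so connectivity comes later. Two given vertices both have low degree with
  probability about n^(-4a), up to a small loss in the exponent, while the expected number of pairs
  within distance 2 is n times a power of \<open>ln n\<close>; this asks for a > 1/4. The value 2/5
  lies between the two.\<close>

definition stable_critical :: "nat set \<Rightarrow> nat set set \<Rightarrow> (nat \<Rightarrow> real) \<Rightarrow> bool" where
  "stable_critical V E \<theta> \<longleftrightarrow>
     (\<forall>u\<in>V. (\<Sum>v\<in>V. adj E u v * sin (\<theta> u - \<theta> v)) = 0) \<and>
     (\<forall>x. 0 \<le> (\<Sum>u\<in>V. \<Sum>v\<in>V. adj E u v * cos (\<theta> u - \<theta> v) * (x u - x v)\<^sup>2))"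

lemma adj_sym: "adj E u v = adj E v u"
  by (simp add: adj_def insert_commute)

lemma adj_refl [simp]: "adj E u u = 0"
  by (simp add: adj_def)

lemma adj_nonneg [simp]: "0 \<le> adj E u v"
  by (simp add: adj_def)

lemma adj_le_1 [simp]: "adj E u v \<le> 1"
  by (simp add: adj_def)

lemma adj_square [simp]: "adj E u v * adj E u v = adj E u v"
  by (simp add: adj_def)

text \<open>The right side is twice the distance from 1 to a point of the ray through
  \<open>z\<close>. For an obtuse angle that distance is at least 1, and the chord is at most 2. For
  an acute angle the nearest point is \<open>c * z\<close>, and the difference of the squares is a
  square plus \<open>2 (1 - c) (1 + 2 c)\<close>.\<close>

lemma cmod_unit_minus_1_le_ray:
  fixes z :: complex
  assumes "cmod z = 1" "0 \<le> l"
  shows "cmod (z - 1) \<le> 2 * cmod (of_real l * z - 1)"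
proof -
  define c where "c = Re z"
  define s where "s = Im z"
  have cs: "c\<^sup>2 + s\<^sup>2 = 1" using assms(1) by (simp add: c_def s_def cmod_def)
  hence c1: "\<bar>c\<bar> \<le> 1" by (metis abs_square_le_1 add_increasing2 order_refl zero_le_power2 le_add_same_cancel1)
  have e1: "(cmod (z - 1))\<^sup>2 = 2 - 2 * c"
    using cs by (simp add: cmod_power2 flip: c_def s_def) (simp add: power2_eq_square algebra_simps)
  have e2: "(cmod (of_real l * z - 1))\<^sup>2 = l\<^sup>2 - 2 * l * c + 1"
  proof -
    have "(cmod (of_real l * z - 1))\<^sup>2 = (l * c - 1)\<^sup>2 + (l * s)\<^sup>2"
      by (simp add: cmod_power2 c_def s_def)
    also have "\<dots> = l\<^sup>2 * (c\<^sup>2 + s\<^sup>2) - 2 * l * c + 1" by (simp add: power2_eq_square algebra_simps)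
    finally show ?thesis using cs by simp
  qed
  have "2 - 2 * c \<le> 4 * (l\<^sup>2 - 2 * l * c + 1)"
  proof (cases "c \<le> 0")
    case True
    have "l * c \<le> 0" using assms True by (intro mult_nonneg_nonpos) auto
    moreover have "0 \<le> l\<^sup>2" by simp
    moreover have "4 * (l\<^sup>2 - 2 * l * c + 1) = 4 * l\<^sup>2 - 8 * (l * c) + 4" by (simp add: algebra_simps)
    ultimately show ?thesis using c1 by linarith
  next
    case False
    have "0 \<le> 4 * (l - c)\<^sup>2 + 2 * ((1 - c) * (1 + 2 * c))"
      using False c1 by (intro add_nonneg_nonneg mult_nonneg_nonneg) auto
    then show ?thesis by (simp add: power2_eq_square algebra_simps)
  qed
  then have "(cmod (z - 1))\<^sup>2 \<le> (2 * cmod (of_real l * z - 1))\<^sup>2"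
    by (simp add: e1 e2 power_mult_distrib)
  then show ?thesis by (rule power2_le_imp_le) simp
qed

lemma cmod_sum_power2_le_complex:
  fixes M :: "nat \<Rightarrow> nat \<Rightarrow> real" and z :: "nat \<Rightarrow> complex"
  assumes "\<And>y. (\<Sum>u\<in>V. (\<Sum>v\<in>V. M u v * y v)\<^sup>2) \<le> K * (\<Sum>v\<in>V. (y v)\<^sup>2)"
  shows "(\<Sum>u\<in>V. (cmod (\<Sum>v\<in>V. of_real (M u v) * z v))\<^sup>2) \<le> K * (\<Sum>v\<in>V. (cmod (z v))\<^sup>2)"
proof -
  have "(\<Sum>u\<in>V. (cmod (\<Sum>v\<in>V. of_real (M u v) * z v))\<^sup>2)
      = (\<Sum>u\<in>V. (\<Sum>v\<in>V. M u v * Re (z v))\<^sup>2) + (\<Sum>u\<in>V. (\<Sum>v\<in>V. M u v * Im (z v))\<^sup>2)"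
    by (simp add: cmod_power2 sum.distrib)
  also have "\<dots> \<le> K * (\<Sum>v\<in>V. (Re (z v))\<^sup>2) + K * (\<Sum>v\<in>V. (Im (z v))\<^sup>2)"
    by (intro add_mono assms)
  also have "\<dots> = K * (\<Sum>v\<in>V. (cmod (z v))\<^sup>2)"
    by (simp add: cmod_power2 sum.distrib distrib_left)
  finally show ?thesis .
qed

lemma abs_quadratic_form_le:
  fixes M :: "nat \<Rightarrow> nat \<Rightarrow> real"
  assumes "\<And>y. (\<Sum>u\<in>V. (\<Sum>v\<in>V. M u v * y v)\<^sup>2) \<le> K\<^sup>2 * (\<Sum>v\<in>V. (y v)\<^sup>2)" "0 \<le> K"
  shows "\<bar>\<Sum>u\<in>V. \<Sum>v\<in>V. M u v * (x u * x v)\<bar> \<le> K * (\<Sum>v\<in>V. (x v)\<^sup>2)"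
proof -
  have eq: "(\<Sum>u\<in>V. \<Sum>v\<in>V. M u v * (x u * x v)) = (\<Sum>u\<in>V. x u * (\<Sum>v\<in>V. M u v * x v))"
    by (simp add: sum_distrib_left mult_ac)
  have "(\<Sum>u\<in>V. x u * (\<Sum>v\<in>V. M u v * x v))\<^sup>2
      \<le> (\<Sum>v\<in>V. (x v)\<^sup>2) * (\<Sum>u\<in>V. (\<Sum>v\<in>V. M u v * x v)\<^sup>2)"
    by (rule Cauchy_Schwarz_ineq_sum)
  also have "\<dots> \<le> (\<Sum>v\<in>V. (x v)\<^sup>2) * (K\<^sup>2 * (\<Sum>v\<in>V. (x v)\<^sup>2))"
    by (intro mult_left_mono assms sum_nonneg) auto
  also have "\<dots> = (K * (\<Sum>v\<in>V. (x v)\<^sup>2))\<^sup>2" by (simp add: power2_eq_square mult_ac)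
  finally have "\<bar>\<Sum>u\<in>V. x u * (\<Sum>v\<in>V. M u v * x v)\<bar>\<^sup>2 \<le> (K * (\<Sum>v\<in>V. (x v)\<^sup>2))\<^sup>2"
    by simp
  then show ?thesis unfolding eq
    by (rule power2_le_imp_le) (intro mult_nonneg_nonneg sum_nonneg zero_le_power2 assms(2))
qed

lemma sum_cos_diff:
  "(\<Sum>u\<in>V. \<Sum>v\<in>V. cos (\<theta> u - \<theta> v)) = (\<Sum>u\<in>V. cos (\<theta> u))\<^sup>2 + (\<Sum>u\<in>V. sin (\<theta> u :: real))\<^sup>2"
  by (simp add: cos_diff sum.distrib power2_eq_square sum_product)

lemma abs_sum_cos_diff_le:
  fixes M :: "nat \<Rightarrow> nat \<Rightarrow> real"
  assumes "\<And>y. (\<Sum>u\<in>V. (\<Sum>v\<in>V. M u v * y v)\<^sup>2) \<le> K\<^sup>2 * (\<Sum>v\<in>V. (y v)\<^sup>2)" "0 \<le> K"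
  shows "\<bar>\<Sum>u\<in>V. \<Sum>v\<in>V. M u v * cos (\<theta> u - \<theta> v)\<bar> \<le> K * card V"
proof -
  have "(\<Sum>u\<in>V. \<Sum>v\<in>V. M u v * cos (\<theta> u - \<theta> v))
     = (\<Sum>u\<in>V. \<Sum>v\<in>V. M u v * (cos (\<theta> u) * cos (\<theta> v))) + (\<Sum>u\<in>V. \<Sum>v\<in>V. M u v * (sin (\<theta> u) * sin (\<theta> v)))"
    by (simp add: cos_diff sum.distrib distrib_left)
  also have "\<bar>\<dots>\<bar> \<le> K * (\<Sum>v\<in>V. (cos (\<theta> v))\<^sup>2) + K * (\<Sum>v\<in>V. (sin (\<theta> v))\<^sup>2)"
    by (intro abs_triangle_ineq[THEN order_trans] add_mono abs_quadratic_form_le assms)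
  also have "\<dots> = K * (\<Sum>v\<in>V. (cos (\<theta> v))\<^sup>2 + (sin (\<theta> v))\<^sup>2)"
    by (simp only: sum.distrib distrib_left)
  also have "\<dots> = K * card V" by simp
  finally show ?thesis .
qed

text \<open>The Hessian is tested on the vectors \<open>cos \<theta>\<close> and
  \<open>sin \<theta>\<close>; adding both inequalities gives \<open>W + W2 \<le> 2 * W1\<close>.
  Replacing \<open>A\<close> by \<open>p\<close>, \<open>W\<close> is \<open>p n^2\<close>,
  \<open>W1\<close> is \<open>p\<close> times the squared order parameter, and \<open>W2\<close> is
  \<open>p\<close> times a square, hence nonnegative. The four replacements cost at most
  \<open>4/10 * p n^2\<close>, which leaves 3/10 of \<open>n^2\<close> against the claimed
  1/4.\<close>

lemma order_parameter_ge:
  fixes n :: nat and p \<epsilon> :: real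
  assumes M: "\<And>y. (\<Sum>u<n. (\<Sum>v<n. (adj E u v - p) * y v)\<^sup>2) \<le> (\<epsilon> * (p * n))\<^sup>2 * (\<Sum>v<n. (y v)\<^sup>2)"
    and pos: "0 < n" "0 < p" "0 \<le> \<epsilon>" "\<epsilon> \<le> 1/10"
    and st: "stable_critical {..<n} E \<theta>"
  shows "(real n / 2)\<^sup>2 \<le> (\<Sum>u<n. cos (\<theta> u))\<^sup>2 + (\<Sum>u<n. sin (\<theta> u))\<^sup>2"
proof -
  let ?A = "adj E"
  define K where "K = \<epsilon> * (p * n)"
  have K0: "0 \<le> K" using pos by (simp add: K_def)
  note M' = M[folded K_def]
  define W where "W = (\<Sum>u<n. \<Sum>v<n. ?A u v)"
  define W1 where "W1 = (\<Sum>u<n. \<Sum>v<n. ?A u v * cos (\<theta> u - \<theta> v))"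
  define W2 where "W2 = (\<Sum>u<n. \<Sum>v<n. ?A u v * cos (2 * \<theta> u - 2 * \<theta> v))"
  have b: "(\<Sum>u<n. \<Sum>v<n. ?A u v * cos (\<phi> u - \<phi> v)) =
        (\<Sum>u<n. \<Sum>v<n. (?A u v - p) * cos (\<phi> u - \<phi> v)) + p * ((\<Sum>u<n. cos (\<phi> u))\<^sup>2 + (\<Sum>u<n. sin (\<phi> u))\<^sup>2)" for \<phi>
    by (simp add: sum_cos_diff[symmetric] sum_distrib_left left_diff_distrib sum_subtractf)
  have "0 \<le> (\<Sum>u<n. \<Sum>v<n. ?A u v * cos (\<theta> u - \<theta> v) * (cos (\<theta> u) - cos (\<theta> v))\<^sup>2)
         + (\<Sum>u<n. \<Sum>v<n. ?A u v * cos (\<theta> u - \<theta> v) * (sin (\<theta> u) - sin (\<theta> v))\<^sup>2)"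
    using st unfolding stable_critical_def by (intro add_nonneg_nonneg) auto
  also have "\<dots> = (\<Sum>u<n. \<Sum>v<n. 2 * (?A u v * cos (\<theta> u - \<theta> v)) - ?A u v - ?A u v * cos (2 * \<theta> u - 2 * \<theta> v))"
    unfolding sum.distrib[symmetric]
  proof (intro sum.cong refl)
    fix u v
    have "(cos (\<theta> u) - cos (\<theta> v))\<^sup>2 + (sin (\<theta> u) - sin (\<theta> v))\<^sup>2
       = ((cos (\<theta> u))\<^sup>2 + (sin (\<theta> u))\<^sup>2) + ((cos (\<theta> v))\<^sup>2 + (sin (\<theta> v))\<^sup>2) - 2 * cos (\<theta> u - \<theta> v)"
      unfolding cos_diff by (simp add: power2_eq_square algebra_simps)
    hence "(cos (\<theta> u) - cos (\<theta> v))\<^sup>2 + (sin (\<theta> u) - sin (\<theta> v))\<^sup>2 = 2 - 2 * cos (\<theta> u - \<theta> v)" by simp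
    moreover have "cos (2 * \<theta> u - 2 * \<theta> v) = 2 * (cos (\<theta> u - \<theta> v))\<^sup>2 - 1"
      using cos_double_cos[of "\<theta> u - \<theta> v"] by (simp add: algebra_simps)
    ultimately have "?A u v * cos (\<theta> u - \<theta> v) * ((cos (\<theta> u) - cos (\<theta> v))\<^sup>2 + (sin (\<theta> u) - sin (\<theta> v))\<^sup>2)
       = 2 * (?A u v * cos (\<theta> u - \<theta> v)) - ?A u v * (1 + cos (2 * \<theta> u - 2 * \<theta> v))"
      by (simp add: power2_eq_square right_diff_distrib mult_ac)
    then show "?A u v * cos (\<theta> u - \<theta> v) * (cos (\<theta> u) - cos (\<theta> v))\<^sup>2 + ?A u v * cos (\<theta> u - \<theta> v) * (sin (\<theta> u) - sin (\<theta> v))\<^sup>2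
       = 2 * (?A u v * cos (\<theta> u - \<theta> v)) - ?A u v - ?A u v * cos (2 * \<theta> u - 2 * \<theta> v)"
      by (simp add: distrib_left)
  qed
  also have "\<dots> = 2 * W1 - W - W2"
    by (simp add: W1_def W_def W2_def sum_subtractf sum_distrib_left)
  finally have "W + W2 \<le> 2 * W1" by simp
  moreover have "W2 \<ge> - (K * n)"
    using b[of "\<lambda>u. 2 * \<theta> u"] abs_sum_cos_diff_le[OF M' K0, of "\<lambda>u. 2 * \<theta> u"] pos
      mult_nonneg_nonneg[of p "(\<Sum>u<n. cos (2 * \<theta> u))\<^sup>2 + (\<Sum>u<n. sin (2 * \<theta> u))\<^sup>2"]
      sum_power2_ge_zero[of "\<Sum>u<n. cos (2 * \<theta> u)" "\<Sum>u<n. sin (2 * \<theta> u)"]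
    unfolding W2_def card_lessThan by linarith
  moreover have "W \<ge> p * (real n)\<^sup>2 - K * n"
    using b[of "\<lambda>u. 0"] abs_sum_cos_diff_le[OF M' K0, of "\<lambda>u. 0"]
    unfolding W_def by simp
  moreover have "W1 \<le> K * n + p * ((\<Sum>u<n. cos (\<theta> u))\<^sup>2 + (\<Sum>u<n. sin (\<theta> u))\<^sup>2)"
    using b[of \<theta>] abs_sum_cos_diff_le[OF M' K0, of \<theta>] unfolding W1_def by simp
  ultimately have "p * (real n)\<^sup>2 - 4 * (K * n) \<le> 2 * (p * ((\<Sum>u<n. cos (\<theta> u))\<^sup>2 + (\<Sum>u<n. sin (\<theta> u))\<^sup>2))"
    by linarith
  moreover have "K * n \<le> p * (real n)\<^sup>2 / 10"
    using pos mult_right_mono[of \<epsilon> "1/10" "p * real n * real n"] unfolding K_def by (simp add: power2_eq_square mult_ac)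
  moreover have "p * (real n / 2)\<^sup>2 = p * (real n)\<^sup>2 / 4" "0 \<le> p * (real n)\<^sup>2"
    using pos by (simp_all add: power_divide)
  ultimately have "p * (real n / 2)\<^sup>2 \<le> p * ((\<Sum>u<n. cos (\<theta> u))\<^sup>2 + (\<Sum>u<n. sin (\<theta> u))\<^sup>2)"
    by linarith
  then show ?thesis using pos by simp
qed

text \<open>The sum of the neighbours' phases is the local field at \<open>u\<close>. The
  equilibrium equation makes it parallel to \<open>cis (\<theta> u)\<close>, and the Hessian tested
  on the indicator of \<open>u\<close> makes it point forward rather than backward.\<close>

lemma stable_critical_aligned:
  assumes st: "stable_critical V E \<theta>" and V: "finite V" "u \<in> V"
  defines "h \<equiv> (\<Sum>v\<in>V. adj E u v * cos (\<theta> u - \<theta> v))"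
  shows "0 \<le> h" and "(\<Sum>v\<in>V. of_real (adj E u v) * cis (\<theta> v)) = of_real h * cis (\<theta> u)"
proof -
  define x :: "nat \<Rightarrow> real" where "x = (\<lambda>a. of_bool (a = u))"
  have "0 \<le> (\<Sum>a\<in>V. \<Sum>b\<in>V. adj E a b * cos (\<theta> a - \<theta> b) * (x a - x b)\<^sup>2)"
    using st unfolding stable_critical_def by blast
  also have "\<dots> = (\<Sum>a\<in>V. \<Sum>b\<in>V. adj E a b * cos (\<theta> a - \<theta> b) * x a + adj E a b * cos (\<theta> a - \<theta> b) * x b)"
    by (intro sum.cong refl) (auto simp: x_def)
  also have "\<dots> = (\<Sum>a\<in>V. \<Sum>b\<in>V. adj E a b * cos (\<theta> a - \<theta> b) * x a) + (\<Sum>a\<in>V. \<Sum>b\<in>V. adj E a b * cos (\<theta> a - \<theta> b) * x b)"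
    by (simp add: sum.distrib)
  also have "(\<Sum>a\<in>V. \<Sum>b\<in>V. adj E a b * cos (\<theta> a - \<theta> b) * x a) = (\<Sum>a\<in>V. if a = u then h else 0)"
    by (intro sum.cong refl) (auto simp: x_def h_def)
  also have "\<dots> = h" using V by simp
  also have "(\<Sum>a\<in>V. \<Sum>b\<in>V. adj E a b * cos (\<theta> a - \<theta> b) * x b) = (\<Sum>a\<in>V. \<Sum>b\<in>V. if b = u then adj E a u * cos (\<theta> a - \<theta> u) else 0)"
    by (intro sum.cong refl) (auto simp: x_def)
  also have "\<dots> = (\<Sum>a\<in>V. adj E a u * cos (\<theta> a - \<theta> u))" using V by simp
  also have "\<dots> = h" unfolding h_def
  proof (intro sum.cong refl)
    fix a show "adj E a u * cos (\<theta> a - \<theta> u) = adj E u a * cos (\<theta> u - \<theta> a)"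
      using adj_sym[of E a u] cos_minus[of "\<theta> a - \<theta> u"] by simp
  qed
  finally show "0 \<le> h" by simp
  have "(\<Sum>v\<in>V. of_real (adj E u v) * cis (\<theta> v)) = (\<Sum>v\<in>V. of_real (adj E u v) * cis (\<theta> v - \<theta> u)) * cis (\<theta> u)"
    by (simp add: sum_distrib_right cis_mult mult.assoc)
  also have "(\<Sum>v\<in>V. of_real (adj E u v) * cis (\<theta> v - \<theta> u)) = of_real h"
  proof (rule complex_eqI)
    have "(\<Sum>v\<in>V. adj E u v * sin (\<theta> v - \<theta> u)) = - (\<Sum>v\<in>V. adj E u v * sin (\<theta> u - \<theta> v))"
      unfolding sum_negf[symmetric] by (intro sum.cong refl) (metis minus_diff_eq mult_minus_right sin_minus)
    then show "Im (\<Sum>v\<in>V. of_real (adj E u v) * cis (\<theta> v - \<theta> u)) = Im (of_real h)"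
      using st V by (simp add: stable_critical_def)
    show "Re (\<Sum>v\<in>V. of_real (adj E u v) * cis (\<theta> v - \<theta> u)) = Re (of_real h)"
      by (simp add: h_def) (intro sum.cong refl, metis cos_minus minus_diff_eq)
  qed
  finally show "(\<Sum>v\<in>V. of_real (adj E u v) * cis (\<theta> v)) = of_real h * cis (\<theta> u)" .
qed

text \<open>The local field lies on the ray through \<open>cis (\<theta> u)\<close>, so its distance
  to any positive real \<open>R\<close> controls the distance from the phase to 1. Two choices of
  \<open>R\<close> are used later: the expected field \<open>p * S\<close> and the degree of
  \<open>u\<close>.\<close>

lemma stable_critical_deviation_le:
  assumes st: "stable_critical V E \<theta>" and V: "finite V" "u \<in> V" and R: "0 < R"
  shows "(cmod (cis (\<theta> u) - 1))\<^sup>2 \<le> 4 / R\<^sup>2 * (cmod ((\<Sum>v\<in>V. of_real (adj E u v) * cis (\<theta> v)) - of_real R))\<^sup>2"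
proof -
  define h where "h = (\<Sum>v\<in>V. adj E u v * cos (\<theta> u - \<theta> v))"
  note h = stable_critical_aligned[OF st V, folded h_def]
  have "cmod (cis (\<theta> u) - 1) \<le> 2 * cmod (of_real (h / R) * cis (\<theta> u) - 1)"
    by (rule cmod_unit_minus_1_le_ray) (use h(1) R in auto)
  also have "of_real (h / R) * cis (\<theta> u) - 1 = (of_real h * cis (\<theta> u) - of_real R) / of_real R"
    using R by (simp add: field_simps)
  finally have "(cmod (cis (\<theta> u) - 1))\<^sup>2 \<le> (2 * cmod ((of_real h * cis (\<theta> u) - of_real R) / of_real R))\<^sup>2"
    by (intro power_mono) auto
  then show ?thesis using R by (simp add: h(2) norm_divide power_mult_distrib power_divide)
qed

text \<open>The condition \<open>200 * \<epsilon>^2 < c^2\<close> is exactly what makes the final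
  estimate \<open>T \<le> 200 * \<epsilon>^2 / c^2 * T\<close> contractive. The 200 is 5 * 4 * 10:
  10 bounds the squared norm of \<open>A t\<close>, 4 comes from the squared factor 2 of the ray
  estimate, and 5 = 1 + 4 accounts for the exceptional vertices in \<open>L\<close>.\<close>

lemma sync_of_rotated_stable_critical:
  fixes n :: nat and p \<epsilon> c :: real and L :: "nat set"
  assumes M: "\<And>y. (\<Sum>u<n. (\<Sum>v<n. (adj E u v - p) * y v)\<^sup>2) \<le> (\<epsilon> * (p * n))\<^sup>2 * (\<Sum>v<n. (y v)\<^sup>2)"
    and pos: "0 < n" "0 < p" "0 < c" "200 * \<epsilon>\<^sup>2 < c\<^sup>2"
    and L: "L \<subseteq> {..<n}" "\<And>u. u < n \<Longrightarrow> u \<notin> L \<Longrightarrow> c * (p * n) \<le> (\<Sum>v<n. adj E u v)"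
      "\<And>u. u \<in> L \<Longrightarrow> 1 \<le> (\<Sum>v<n. adj E u v)"
      "\<And>u v. u \<in> L \<Longrightarrow> v \<in> L \<Longrightarrow> adj E u v = 0"
      "\<And>v. v < n \<Longrightarrow> (\<Sum>u\<in>L. adj E u v) \<le> 1"
    and st: "stable_critical {..<n} E \<theta>"
    and rot: "(\<Sum>u<n. sin (\<theta> u)) = 0" "real n / 2 \<le> (\<Sum>u<n. cos (\<theta> u))"
  shows "\<forall>u<n. cis (\<theta> u) = 1"
proof -
  let ?A = "adj E"
  define S where "S = (\<Sum>u<n. cos (\<theta> u))"
  define t where "t = (\<lambda>u. cis (\<theta> u) - 1)"
  define T where "T = (\<Sum>u<n. (cmod (t u))\<^sup>2)"
  define D where "D = (\<lambda>u. \<Sum>v<n. ?A u v)"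
  have T0: "0 \<le> T" by (simp add: T_def sum_nonneg)
  have sz: "(\<Sum>v<n. cis (\<theta> v)) = of_real S" by (rule complex_eqI) (simp_all add: S_def rot)
  have S0: "0 < S" using rot pos by (simp add: S_def)
  note Mc = cmod_sum_power2_le_complex[OF M]
  have t2: "(cmod (t u))\<^sup>2 = 2 - 2 * cos (\<theta> u)" for u
    using sin_cos_squared_add[of "\<theta> u"]
    by (simp add: t_def cmod_power2) (simp add: power2_eq_square algebra_simps)
  have TS: "T = 2 * (n - S)" by (simp add: T_def t2 sum_subtractf sum_distrib_left S_def)
  have st1: "(\<Sum>v<n. t v) = of_real (- T / 2)" unfolding TS
    by (simp add: t_def sum_subtractf sz)
  \<comment> \<open>A crude bound on \<open>T\<close> has to come before the contraction. The rank
    one part \<open>p\<close> of \<open>A\<close> maps \<open>t\<close> to a constant vector of size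
    \<open>p * T / 2\<close>, whose square is quadratic in \<open>T\<close>; it turns into a small
    multiple of \<open>T\<close> only when \<open>T\<close> is already at most of order
    \<open>\<epsilon>^2 * n\<close>.\<close>
  have "T \<le> (\<Sum>u<n. 4 / (p * S)\<^sup>2 * (cmod (\<Sum>v<n. of_real (?A u v - p) * cis (\<theta> v)))\<^sup>2)"
    unfolding T_def t_def
  proof (intro sum_mono)
    fix u assume "u \<in> {..<n}"
    have "(\<Sum>v<n. of_real (?A u v) * cis (\<theta> v)) - of_real (p * S) = (\<Sum>v<n. of_real (?A u v - p) * cis (\<theta> v))"
      by (simp add: left_diff_distrib sum_subtractf sz[symmetric] sum_distrib_left)
    then show "(cmod (cis (\<theta> u) - 1))\<^sup>2 \<le> 4 / (p * S)\<^sup>2 * (cmod (\<Sum>v<n. of_real (?A u v - p) * cis (\<theta> v)))\<^sup>2"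
      using stable_critical_deviation_le[OF st, of u "p * S"] \<open>u \<in> _\<close> S0 pos by simp
  qed
  also have "\<dots> \<le> 4 / (p * S)\<^sup>2 * ((\<epsilon> * (p * n))\<^sup>2 * n)"
    unfolding sum_distrib_left[symmetric] using Mc[of "\<lambda>v. cis (\<theta> v)"] by (intro mult_left_mono) simp_all
  also have "\<dots> = 4 * \<epsilon>\<^sup>2 * n * (n / S)\<^sup>2" using pos S0 by (simp add: field_simps power2_eq_square)
  also have "\<dots> \<le> 4 * \<epsilon>\<^sup>2 * n * 2\<^sup>2"
    using rot(2) S0 by (intro mult_left_mono power_mono) (auto simp: S_def[symmetric] field_simps)
  finally have Tb: "T \<le> 16 * \<epsilon>\<^sup>2 * n" by simp
  define At where "At = (\<lambda>u. \<Sum>v<n. of_real (?A u v) * t v)"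
  have Az: "(\<Sum>v<n. of_real (?A u v) * cis (\<theta> v)) - of_real (D u) = At u" for u
    by (simp add: At_def t_def D_def right_diff_distrib sum_subtractf)
  have dev: "(cmod (t u))\<^sup>2 \<le> 4 / (D u)\<^sup>2 * (cmod (At u))\<^sup>2" if "u < n" "0 < D u" for u
    using stable_critical_deviation_le[OF st, of u "D u"] that unfolding Az by (simp add: t_def)
  have "(\<Sum>u<n. (cmod (At u))\<^sup>2) \<le> (\<Sum>u<n. 2 * (cmod (\<Sum>v<n. of_real (?A u v - p) * t v))\<^sup>2 + p\<^sup>2 * T\<^sup>2 / 2)"
  proof (intro sum_mono)
    fix u
    have "At u = (\<Sum>v<n. of_real (?A u v - p) * t v) + of_real p * (\<Sum>v<n. t v)"
      by (simp add: At_def left_diff_distrib sum_subtractf sum_distrib_left)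
    then have "cmod (At u) \<le> cmod (\<Sum>v<n. of_real (?A u v - p) * t v) + p * T / 2"
      using norm_triangle_ineq[of "\<Sum>v<n. of_real (?A u v - p) * t v" "of_real p * (\<Sum>v<n. t v)"] pos T0
      unfolding st1 by (simp add: norm_mult)
    then have "(cmod (At u))\<^sup>2 \<le> (cmod (\<Sum>v<n. of_real (?A u v - p) * t v) + p * T / 2)\<^sup>2" by (intro power_mono) auto
    also have "\<dots> \<le> 2 * (cmod (\<Sum>v<n. of_real (?A u v - p) * t v))\<^sup>2 + 2 * (p * T / 2)\<^sup>2"
      using sum_squares_bound[of "cmod (\<Sum>v<n. of_real (?A u v - p) * t v)" "p * T / 2"]
      by (simp add: power2_sum)
    finally show "(cmod (At u))\<^sup>2 \<le> 2 * (cmod (\<Sum>v<n. of_real (?A u v - p) * t v))\<^sup>2 + p\<^sup>2 * T\<^sup>2 / 2"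
      by (simp add: power_mult_distrib power_divide mult.commute)
  qed
  also have "\<dots> = 2 * (\<Sum>u<n. (cmod (\<Sum>v<n. of_real (?A u v - p) * t v))\<^sup>2) + n * (p\<^sup>2 * T\<^sup>2 / 2)"
    by (simp add: sum.distrib sum_distrib_left)
  also have "\<dots> \<le> 2 * ((\<epsilon> * (p * n))\<^sup>2 * T) + n * (p\<^sup>2 * (16 * \<epsilon>\<^sup>2 * n * T) / 2)"
    using Mc[of t] T0 Tb unfolding T_def[symmetric]
    by (intro add_mono mult_left_mono divide_right_mono) (auto simp: power2_eq_square intro!: mult_right_mono)
  finally have Atb: "(\<Sum>u<n. (cmod (At u))\<^sup>2) \<le> 10 * (\<epsilon> * (p * n))\<^sup>2 * T"
    by (simp add: power2_eq_square algebra_simps)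
  define TB where "TB = (\<Sum>u\<in>{..<n} - L. (cmod (t u))\<^sup>2)"
  have cpn: "0 < c * (p * n)" using pos by simp
  have "TB \<le> (\<Sum>u\<in>{..<n} - L. 4 / (c * (p * n))\<^sup>2 * (cmod (At u))\<^sup>2)"
    unfolding TB_def
  proof (intro sum_mono)
    fix u assume u: "u \<in> {..<n} - L"
    then have Du: "c * (p * n) \<le> D u" using L(2) by (simp add: D_def)
    have "(cmod (t u))\<^sup>2 \<le> 4 / (D u)\<^sup>2 * (cmod (At u))\<^sup>2" using dev u Du cpn by auto
    also have "\<dots> \<le> 4 / (c * (p * n))\<^sup>2 * (cmod (At u))\<^sup>2"
      using Du cpn less_le_trans[OF cpn Du]
      by (intro mult_right_mono divide_left_mono power_mono mult_pos_pos[OF zero_less_power zero_less_power]) auto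
    finally show "(cmod (t u))\<^sup>2 \<le> 4 / (c * (p * n))\<^sup>2 * (cmod (At u))\<^sup>2" .
  qed
  also have "\<dots> \<le> 4 / (c * (p * n))\<^sup>2 * (\<Sum>u<n. (cmod (At u))\<^sup>2)"
    unfolding sum_distrib_left[symmetric] by (intro mult_left_mono sum_mono2) auto
  also have "\<dots> \<le> 4 / (c * (p * n))\<^sup>2 * (10 * (\<epsilon> * (p * n))\<^sup>2 * T)"
    by (intro mult_left_mono Atb) simp
  also have "\<dots> = 40 * \<epsilon>\<^sup>2 / c\<^sup>2 * T" using pos by (simp add: field_simps power2_eq_square)
  finally have TB: "TB \<le> 40 * \<epsilon>\<^sup>2 / c\<^sup>2 * T" .
  have finL: "finite L" using L(1) finite_subset by auto
  \<comment> \<open>A vertex of \<open>L\<close> is compared with the average of its neighbours,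
    whose number is at least 1. The neighbours lie outside \<open>L\<close>, and each of them has at
    most one neighbour in \<open>L\<close>, so the sum over \<open>L\<close> counts every outside
    vertex at most once.\<close>
  have "(\<Sum>u\<in>L. (cmod (t u))\<^sup>2) \<le> (\<Sum>u\<in>L. 4 * (\<Sum>v<n. ?A u v * (cmod (t v))\<^sup>2))"
  proof (intro sum_mono)
    fix u assume u: "u \<in> L"
    then have un: "u < n" and Du: "1 \<le> D u" using L by (auto simp: D_def)
    have "cmod (At u) \<le> (\<Sum>v<n. ?A u v * (?A u v * cmod (t v)))"
      unfolding At_def by (rule order_trans[OF norm_sum]) (simp add: norm_mult mult.assoc[symmetric])
    then have "(cmod (At u))\<^sup>2 \<le> (\<Sum>v<n. ?A u v * (?A u v * cmod (t v)))\<^sup>2" by (intro power_mono) auto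
    also have "\<dots> \<le> (\<Sum>v<n. (?A u v)\<^sup>2) * (\<Sum>v<n. (?A u v * cmod (t v))\<^sup>2)"
      by (rule Cauchy_Schwarz_ineq_sum)
    also have "\<dots> = D u * (\<Sum>v<n. ?A u v * (cmod (t v))\<^sup>2)"
      by (simp add: D_def power_mult_distrib) (simp add: power2_eq_square)
    finally have "4 / (D u)\<^sup>2 * (cmod (At u))\<^sup>2 \<le> 4 / (D u)\<^sup>2 * (D u * (\<Sum>v<n. ?A u v * (cmod (t v))\<^sup>2))"
      by (intro mult_left_mono) auto
    also have "\<dots> = 4 / D u * (\<Sum>v<n. ?A u v * (cmod (t v))\<^sup>2)" using Du by (simp add: field_simps power2_eq_square)
    also have "\<dots> \<le> 4 / 1 * (\<Sum>v<n. ?A u v * (cmod (t v))\<^sup>2)"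
      using Du by (intro mult_right_mono divide_left_mono sum_nonneg) auto
    finally show "(cmod (t u))\<^sup>2 \<le> 4 * (\<Sum>v<n. ?A u v * (cmod (t v))\<^sup>2)" using dev[OF un] Du by simp
  qed
  also have "\<dots> = 4 * (\<Sum>v<n. (\<Sum>u\<in>L. ?A u v) * (cmod (t v))\<^sup>2)"
    unfolding sum_distrib_left[symmetric] sum_distrib_right by (subst sum.swap) simp
  also have "(\<Sum>v<n. (\<Sum>u\<in>L. ?A u v) * (cmod (t v))\<^sup>2) \<le> (\<Sum>v<n. if v \<in> L then 0 else (cmod (t v))\<^sup>2)"
  proof (intro sum_mono)
    fix v assume v: "v \<in> {..<n}"
    show "(\<Sum>u\<in>L. ?A u v) * (cmod (t v))\<^sup>2 \<le> (if v \<in> L then 0 else (cmod (t v))\<^sup>2)"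
      using L(4)[of _ v] mult_right_mono[OF L(5)[of v], of "(cmod (t v))\<^sup>2"] v by auto
  qed
  also have "(\<Sum>v<n. if v \<in> L then 0 else (cmod (t v))\<^sup>2) = TB"
    unfolding TB_def by (rule sum.mono_neutral_cong_right) auto
  finally have TL: "(\<Sum>u\<in>L. (cmod (t u))\<^sup>2) \<le> 4 * TB" by simp
  have "T = TB + (\<Sum>u\<in>L. (cmod (t u))\<^sup>2)"
    unfolding T_def TB_def using L(1) by (intro sum.subset_diff) auto
  then have "T \<le> 5 * (40 * \<epsilon>\<^sup>2 / c\<^sup>2 * T)" using TL TB by linarith
  then have "T * (1 - 200 * \<epsilon>\<^sup>2 / c\<^sup>2) \<le> 0" by (simp add: algebra_simps)
  moreover have "0 < 1 - 200 * \<epsilon>\<^sup>2 / c\<^sup>2" using pos by simp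
  ultimately have "T = 0" using T0 by (metis mult_le_0_iff not_less order.antisym)
  then have "\<forall>u<n. t u = 0" unfolding T_def by (subst (asm) sum_nonneg_eq_0_iff) auto
  then show ?thesis by (simp add: t_def)
qed

lemma stable_critical_shift: "stable_critical V E (\<lambda>u. \<theta> u - a) = stable_critical V E \<theta>"
  by (simp add: stable_critical_def)

text \<open>Stability and synchronization are invariant under a common rotation, so subtracting the
  argument of the order parameter makes that parameter a positive real number.\<close>

lemma stable_critical_imp_synchronized:
  fixes n :: nat and p \<epsilon> c :: real and L :: "nat set"
  assumes M: "\<And>y. (\<Sum>u<n. (\<Sum>v<n. (adj E u v - p) * y v)\<^sup>2) \<le> (\<epsilon> * (p * n))\<^sup>2 * (\<Sum>v<n. (y v)\<^sup>2)"
    and pos: "0 < n" "0 < p" "0 < c" "200 * \<epsilon>\<^sup>2 < c\<^sup>2" "0 \<le> \<epsilon>" "\<epsilon> \<le> 1/10"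
    and L: "L \<subseteq> {..<n}" "\<And>u. u < n \<Longrightarrow> u \<notin> L \<Longrightarrow> c * (p * n) \<le> (\<Sum>v<n. adj E u v)"
      "\<And>u. u \<in> L \<Longrightarrow> 1 \<le> (\<Sum>v<n. adj E u v)"
      "\<And>u v. u \<in> L \<Longrightarrow> v \<in> L \<Longrightarrow> adj E u v = 0"
      "\<And>v. v < n \<Longrightarrow> (\<Sum>u\<in>L. adj E u v) \<le> 1"
    and st: "stable_critical {..<n} E \<theta>"
  shows "fully_synchronized {..<n} \<theta>"
proof -
  define Z where "Z = (\<Sum>u<n. cis (\<theta> u))"
  define a where "a = Arg Z"
  have "(real n / 2)\<^sup>2 \<le> (cmod Z)\<^sup>2"
    using order_parameter_ge[OF M pos(1,2,5,6) st] by (simp add: Z_def cmod_power2)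
  then have Zn: "real n / 2 \<le> cmod Z" by (rule power2_le_imp_le) simp
  have "(\<Sum>u<n. cis (\<theta> u - a)) = Z * cis (- a)"
    by (simp add: Z_def sum_distrib_right cis_mult)
  also have "Z = of_real (cmod Z) * cis a" using rcis_cmod_Arg[of Z] by (simp add: a_def rcis_def)
  also have "\<dots> * cis (- a) = of_real (cmod Z)" by (simp add: mult.assoc cis_mult)
  finally have eq: "(\<Sum>u<n. cis (\<theta> u - a)) = of_real (cmod Z)" .
  have "\<forall>u<n. cis (\<theta> u - a) = 1"
  proof (rule sync_of_rotated_stable_critical[OF M pos(1-4) L])
    show "stable_critical {..<n} E (\<lambda>u. \<theta> u - a)" using st by (simp add: stable_critical_shift)
    show "(\<Sum>u<n. sin (\<theta> u - a)) = 0" using arg_cong[OF eq, of Im] by simp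
    show "real n / 2 \<le> (\<Sum>u<n. cos (\<theta> u - a))" using arg_cong[OF eq, of Re] Zn by simp
  qed
  then have "cis (\<theta> u - \<theta> v) = 1" if "u < n" "v < n" for u v
    using that cis_divide[of "\<theta> u - a" "\<theta> v - a"] by simp
  then have "cos (\<theta> u - \<theta> v) = 1" if "u < n" "v < n" for u v
    using that by (metis cis.sel(1) one_complex.sel(1))
  then show ?thesis
    unfolding fully_synchronized_def cos_one_2pi_int
    by (metis lessThan_iff mult.commute mult.left_commute)
qed

section \<open>Definable predicates\<close>

text \<open>Polynomials are represented as functions of infinitely many real coordinates, so that
  parameters, unknowns and auxiliary variables share one space and no arities have to be
  tracked.\<close>

inductive_set polyfun :: "((nat \<Rightarrow> real) \<Rightarrow> real) set" where
  const: "(\<lambda>x. c) \<in> polyfun"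
| coord: "(\<lambda>x. x i) \<in> polyfun"
| add: "f \<in> polyfun \<Longrightarrow> g \<in> polyfun \<Longrightarrow> (\<lambda>x. f x + g x) \<in> polyfun"
| mult: "f \<in> polyfun \<Longrightarrow> g \<in> polyfun \<Longrightarrow> (\<lambda>x. f x * g x) \<in> polyfun"

lemma polyfun_minus: "f \<in> polyfun \<Longrightarrow> (\<lambda>x. - f x) \<in> polyfun"
  using polyfun.mult[OF polyfun.const[of "-1"], of f] by simp

lemma polyfun_diff: "f \<in> polyfun \<Longrightarrow> g \<in> polyfun \<Longrightarrow> (\<lambda>x. f x - g x) \<in> polyfun"
  using polyfun.add[OF _ polyfun_minus, of f g] by simp

lemma polyfun_power: "f \<in> polyfun \<Longrightarrow> (\<lambda>x. f x ^ k) \<in> polyfun"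
  by (induction k) (auto intro: polyfun.intros)

lemma polyfun_sum: "(\<And>i. i \<in> I \<Longrightarrow> f i \<in> polyfun) \<Longrightarrow> (\<lambda>x. \<Sum>i\<in>I. f i x) \<in> polyfun"
  by (induction I rule: infinite_finite_induct) (auto intro: polyfun.intros)

lemma polyfun_if: "f \<in> polyfun \<Longrightarrow> g \<in> polyfun \<Longrightarrow> (\<lambda>x. if b then f x else g x) \<in> polyfun"
  by (cases b) auto

lemmas polyfun_intros = polyfun.intros polyfun_minus polyfun_diff polyfun_power polyfun_sum

lemma polyfun_subst: "f \<in> polyfun \<Longrightarrow> g \<in> polyfun \<Longrightarrow> (\<lambda>x. f (x(i := g x))) \<in> polyfun"
proof (induction rule: polyfun.induct)
  case (coord j)
  then show ?case by (cases "i = j") (auto intro: polyfun.intros)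
qed (auto intro: polyfun.intros)

definition sgn_eq :: "((nat \<Rightarrow> real) \<Rightarrow> real) set \<Rightarrow> (nat \<Rightarrow> real) \<Rightarrow> (nat \<Rightarrow> real) \<Rightarrow> bool" where
  "sgn_eq G x x' \<longleftrightarrow> (\<forall>g\<in>G. sgn (g x) = sgn (g x'))"

text \<open>A semantic form of quantifier-free definability: the truth value depends only on the
  signs of finitely many polynomials. This is the same as being a Boolean combination of polynomial
  sign conditions.\<close>

definition definable :: "((nat \<Rightarrow> real) \<Rightarrow> bool) \<Rightarrow> bool" where
  "definable P \<longleftrightarrow> (\<exists>G. finite G \<and> G \<subseteq> polyfun \<and> (\<forall>x x'. sgn_eq G x x' \<longrightarrow> P x = P x'))"

lemma definable_less: assumes "f \<in> polyfun" "g \<in> polyfun" shows "definable (\<lambda>x. f x < g x)"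
  unfolding definable_def
proof (intro exI[of _ "{\<lambda>x. g x - f x}"] conjI allI impI)
  fix x x' assume "sgn_eq {\<lambda>x. g x - f x} x x'"
  then have "sgn (g x - f x) = sgn (g x' - f x')" by (simp add: sgn_eq_def)
  then show "(f x < g x) = (f x' < g x')" by (auto simp: sgn_if split: if_splits)
qed (use polyfun_diff[OF assms(2,1)] in simp_all)

lemma definable_eq: assumes "f \<in> polyfun" "g \<in> polyfun" shows "definable (\<lambda>x. f x = g x)"
  unfolding definable_def
proof (intro exI[of _ "{\<lambda>x. g x - f x}"] conjI allI impI)
  fix x x' assume "sgn_eq {\<lambda>x. g x - f x} x x'"
  then have "sgn (g x - f x) = sgn (g x' - f x')" by (simp add: sgn_eq_def)
  then show "(f x = g x) = (f x' = g x')" by (auto simp: sgn_if split: if_splits)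
qed (use polyfun_diff[OF assms(2,1)] in simp_all)

lemma definable_not: "definable P \<Longrightarrow> definable (\<lambda>x. \<not> P x)"
  unfolding definable_def by metis

lemma definable_conj: assumes "definable P" "definable Q" shows "definable (\<lambda>x. P x \<and> Q x)"
proof -
  obtain G H where "finite G" "G \<subseteq> polyfun" "\<And>x x'. sgn_eq G x x' \<Longrightarrow> P x = P x'"
    "finite H" "H \<subseteq> polyfun" "\<And>x x'. sgn_eq H x x' \<Longrightarrow> Q x = Q x'"
    using assms unfolding definable_def by metis
  moreover have "sgn_eq G x x' \<and> sgn_eq H x x'" if "sgn_eq (G \<union> H) x x'" for x x'
    using that by (auto simp: sgn_eq_def)
  ultimately show ?thesis unfolding definable_def
    by (intro exI[of _ "G \<union> H"] conjI allI impI) (blast+)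
qed

lemma definable_ball:
  "finite I \<Longrightarrow> (\<And>i. i \<in> I \<Longrightarrow> definable (P i)) \<Longrightarrow> definable (\<lambda>x. \<forall>i\<in>I. P i x)"
proof (induction I rule: finite_induct)
  case empty
  show ?case by (auto simp: definable_def)
next
  case (insert i I)
  then show ?case using definable_conj[of "P i" "\<lambda>x. \<forall>i\<in>I. P i x"] by simp
qed

lemma definable_subst: assumes "definable P" "g \<in> polyfun" shows "definable (\<lambda>x. P (x(i := g x)))"
proof -
  obtain G where G: "finite G" "G \<subseteq> polyfun" "\<And>x x'. sgn_eq G x x' \<Longrightarrow> P x = P x'"
    using assms unfolding definable_def by metis
  show ?thesis unfolding definable_def
  proof (intro exI[of _ "(\<lambda>f x. f (x(i := g x))) ` G"] conjI allI impI)
    show "(\<lambda>f x. f (x(i := g x))) ` G \<subseteq> polyfun" using G(2) polyfun_subst[OF _ assms(2)] by auto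
    fix x x' assume "sgn_eq ((\<lambda>f x. f (x(i := g x))) ` G) x x'"
    then show "P (x(i := g x)) = P (x'(i := g x'))" by (intro G(3)) (simp add: sgn_eq_def)
  qed (use G in auto)
qed

section \<open>Polynomials in one variable with parameters, and their sign diagrams\<close>

definition ppoly :: "nat \<Rightarrow> ((nat \<Rightarrow> real) \<Rightarrow> real poly) \<Rightarrow> bool" where
  "ppoly k p \<longleftrightarrow> (\<forall>x. degree (p x) \<le> k) \<and> (\<forall>l. (\<lambda>x. coeff (p x) l) \<in> polyfun)"

lemma ppoly_mono: "ppoly k p \<Longrightarrow> k \<le> l \<Longrightarrow> ppoly l p"
  unfolding ppoly_def by (meson le_trans)

lemma ppoly_add: "ppoly k p \<Longrightarrow> ppoly k q \<Longrightarrow> ppoly k (\<lambda>x. p x + q x)"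
  unfolding ppoly_def coeff_add by (intro conjI allI degree_add_le polyfun.add) simp_all

lemma ppoly_diff: "ppoly k p \<Longrightarrow> ppoly k q \<Longrightarrow> ppoly k (\<lambda>x. p x - q x)"
  unfolding ppoly_def coeff_diff by (intro conjI allI degree_diff_le polyfun_diff) simp_all

lemma ppoly_mult: "ppoly k p \<Longrightarrow> ppoly l q \<Longrightarrow> ppoly (k + l) (\<lambda>x. p x * q x)"
  unfolding ppoly_def coeff_mult
  by (intro conjI allI degree_mult_le[THEN order_trans] add_mono polyfun_sum polyfun.mult) simp_all

lemma ppoly_smult: "a \<in> polyfun \<Longrightarrow> ppoly k p \<Longrightarrow> ppoly k (\<lambda>x. smult (a x) (p x))"
  unfolding ppoly_def coeff_smult
  by (intro conjI allI degree_smult_le[THEN order_trans] polyfun.mult) simp_all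

lemma ppoly_const: "a \<in> polyfun \<Longrightarrow> ppoly k (\<lambda>x. [:a x:])"
proof -
  assume "a \<in> polyfun"
  moreover have "coeff [:a x:] l = (if l = 0 then a x else 0)" for x l by (cases l) auto
  ultimately show ?thesis unfolding ppoly_def by (auto intro: polyfun_if polyfun.const)
qed

lemma ppoly_X: "ppoly 1 (\<lambda>x. [:0, 1:])"
  unfolding ppoly_def by (auto intro: polyfun.const)

lemma ppoly_pderiv: "ppoly k p \<Longrightarrow> ppoly (k - 1) (\<lambda>x. pderiv (p x))"
  unfolding ppoly_def coeff_pderiv degree_pderiv
  by (intro conjI allI polyfun.mult polyfun.const) (auto intro: diff_le_mono)

lemma ppoly_monom: "a \<in> polyfun \<Longrightarrow> ppoly k (\<lambda>x. monom (a x) k)"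
  unfolding ppoly_def coeff_monom by (auto simp: degree_monom_le intro: polyfun_if polyfun.const)

lemma ppoly_truncate:
  assumes "ppoly k p" shows "ppoly r (\<lambda>x. \<Sum>l\<le>r. monom (coeff (p x) l) l)"
proof -
  have "coeff (\<Sum>l\<le>r. monom (coeff (p x) l) l) i = (if i \<le> r then coeff (p x) i else 0)" for x i
    by (simp add: coeff_sum)
  moreover have "degree (\<Sum>l\<le>r. monom (coeff (p x) l) l) \<le> r" for x
    by (rule degree_sum_le) (auto intro: degree_monom_le[THEN order_trans])
  ultimately show ?thesis using assms unfolding ppoly_def by (auto intro: polyfun_if polyfun.const)
qed

lemma polyfun_as_ppoly:
  "f \<in> polyfun \<Longrightarrow> \<exists>k p. ppoly k p \<and> (\<forall>x y. f (x(i := y)) = poly (p x) y)"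
proof (induction rule: polyfun.induct)
  case (const c)
  show ?case by (intro exI[of _ 0] exI[of _ "\<lambda>x. [:c:]"] conjI ppoly_const polyfun.const) simp
next
  case (coord j)
  show ?case
  proof (cases "i = j")
    case True
    then show ?thesis by (intro exI[of _ 1] exI[of _ "\<lambda>x. [:0,1:]"] conjI ppoly_X) auto
  next
    case False
    then show ?thesis by (intro exI[of _ 0] exI[of _ "\<lambda>x. [:x j:]"] conjI ppoly_const polyfun_intros) auto
  qed
next
  case (add f g)
  then obtain k p l q where "ppoly k p" "\<forall>x y. f (x(i := y)) = poly (p x) y"
    "ppoly l q" "\<forall>x y. g (x(i := y)) = poly (q x) y" by blast
  then show ?case
    by (intro exI[of _ "max k l"] exI[of _ "\<lambda>x. p x + q x"] conjI ppoly_add) (auto intro: ppoly_mono simp del: fun_upd_apply)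
next
  case (mult f g)
  then obtain k p l q where "ppoly k p" "\<forall>x y. f (x(i := y)) = poly (p x) y"
    "ppoly l q" "\<forall>x y. g (x(i := y)) = poly (q x) y" by blast
  then show ?case
    by (intro exI[of _ "k + l"] exI[of _ "\<lambda>x. p x * q x"] conjI ppoly_mult) (auto simp del: fun_upd_apply)
qed

text \<open>Each division step multiplies \<open>f\<close> by the square of the leading coefficient
  of \<open>g\<close>. The square keeps signs at the roots of \<open>g\<close> whatever the sign of
  that coefficient, and the coefficients remain polynomials in the parameters. The degree bound in
  \<open>ppoly\<close> is formal, so the conclusion is restricted to parameters where
  \<open>r\<close> is the true degree of \<open>g x\<close>.\<close>

lemma ppoly_pseudo_remainder:
  assumes "ppoly r g" "0 < r"
  shows "ppoly k f \<Longrightarrow> \<exists>R. ppoly (r - 1) R \<and>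
     (\<forall>x y. coeff (g x) r \<noteq> 0 \<longrightarrow> poly (g x) y = 0 \<longrightarrow> sgn (poly (R x) y) = sgn (poly (f x) y))"
proof (induction k arbitrary: f)
  case 0
  then show ?case by (intro exI[of _ f]) (auto intro: ppoly_mono)
next
  case (Suc k)
  show ?case
  proof (cases "Suc k < r")
    case True
    then show ?thesis using Suc.prems by (intro exI[of _ f]) (auto intro: ppoly_mono)
  next
    case False
    define c where "c = (\<lambda>x. coeff (g x) r)"
    have c: "c \<in> polyfun" using assms by (auto simp: ppoly_def c_def)
    define b where "b = (\<lambda>x. coeff (f x) (Suc k))"
    have b: "b \<in> polyfun" using Suc.prems by (auto simp: ppoly_def b_def)
    define q where "q = (\<lambda>x. smult (c x * c x) (f x) - monom (c x * b x) (Suc k - r) * g x)"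
    have q: "ppoly (Suc k) q" unfolding q_def
    proof (intro ppoly_diff ppoly_smult polyfun_intros b c Suc.prems)
      have "ppoly (Suc k - r + r) (\<lambda>x. monom (c x * b x) (Suc k - r) * g x)"
        by (intro ppoly_mult ppoly_monom assms polyfun_intros b c)
      then show "ppoly (Suc k) (\<lambda>x. monom (c x * b x) (Suc k - r) * g x)" using False by simp
    qed
    have "coeff (q x) (Suc k) = 0" for x
      using False by (simp add: q_def coeff_monom_mult c_def b_def)
    then have "degree (q x) \<le> k" for x
      using q unfolding ppoly_def by (metis le_SucE degree_0 le0 leading_coeff_0_iff)
    then have "ppoly k q" using q by (simp add: ppoly_def)
    from Suc.IH[OF this] obtain R where R: "ppoly (r - 1) R"
      "\<And>x y. coeff (g x) r \<noteq> 0 \<Longrightarrow> poly (g x) y = 0 \<Longrightarrow> sgn (poly (R x) y) = sgn (poly (q x) y)" by blast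
    have "sgn (poly (q x) y) = sgn (poly (f x) y)" if "coeff (g x) r \<noteq> 0" "poly (g x) y = 0" for x y
      using that by (simp add: q_def sgn_mult c_def)
    then show ?thesis using R by auto
  qed
qed

text \<open>An increasing bijection of the line carrying the sign pattern of each \<open>p\<close>
  to that of its partner \<open>q\<close> plays the role of equality of two sign tables. It
  transports points, hence witnesses of existential statements, directly.\<close>

definition matched :: "(real poly \<times> real poly) set \<Rightarrow> (real \<Rightarrow> real) \<Rightarrow> bool" where
  "matched Ps h \<longleftrightarrow> strict_mono h \<and> surj h \<and> (\<forall>(p, q)\<in>Ps. \<forall>y. sgn (poly p y) = sgn (poly q (h y)))"

text \<open>A piecewise linear homeomorphism of the line that moves \<open>a\<close> to
  \<open>b\<close> and is the identity outside the interval from \<open>l\<close> to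
  \<open>u\<close>. It repairs a bijection at one root without touching the rest; exchanging
  \<open>a\<close> and \<open>b\<close> inverts it.\<close>

definition bump :: "real \<Rightarrow> real \<Rightarrow> real \<Rightarrow> real \<Rightarrow> real \<Rightarrow> real" where
  "bump l u a b y = (if y \<le> l \<or> u \<le> y then y
     else if y \<le> a then l + (y - l) * ((b - l) / (a - l)) else u - (u - y) * ((u - b) / (u - a)))"

lemma bump_in:
  assumes "l < a" "a < u" "l < b" "b < u" "l < y" "y < u"
  shows "l < bump l u a b y" "bump l u a b y < u" "y \<le> a \<Longrightarrow> bump l u a b y \<le> b" "a < y \<Longrightarrow> b < bump l u a b y"
proof -
  have 1: "l < bump l u a b y" "bump l u a b y \<le> b" if "y \<le> a"
  proof -
    have "(y - l) * ((b - l) / (a - l)) = (b - l) * ((y - l) / (a - l))" by simp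
    also have "\<dots> \<le> (b - l) * 1" using assms that by (intro mult_left_mono) auto
    finally show "bump l u a b y \<le> b" using assms that by (simp add: bump_def)
    have "0 < (y - l) * ((b - l) / (a - l))" using assms by (intro mult_pos_pos divide_pos_pos) auto
    then show "l < bump l u a b y" using assms that by (simp add: bump_def)
  qed
  have 2: "bump l u a b y < u" "b < bump l u a b y" if "a < y"
  proof -
    have "(u - y) * ((u - b) / (u - a)) = (u - b) * ((u - y) / (u - a))" by simp
    also have "\<dots> < (u - b) * 1" using assms that by (intro mult_strict_left_mono) auto
    finally show "b < bump l u a b y" using assms that by (simp add: bump_def)
    have "0 < (u - y) * ((u - b) / (u - a))" using assms by (intro mult_pos_pos divide_pos_pos) auto
    then show "bump l u a b y < u" using assms that by (simp add: bump_def)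
  qed
  show "l < bump l u a b y" "bump l u a b y < u" "y \<le> a \<Longrightarrow> bump l u a b y \<le> b" "a < y \<Longrightarrow> b < bump l u a b y"
    using 1 2 assms by (cases "y \<le> a"; simp)+
qed

lemma bump_inverse:
  assumes "l < a" "a < u" "l < b" "b < u"
  shows "bump l u a b (bump l u b a y) = y"
proof (cases "l < y \<and> y < u")
  case True
  note b = bump_in[of l b u a y]
  show ?thesis
  proof (cases "y \<le> b")
    case True': True
    then have e: "bump l u b a y = l + (y - l) * ((a - l) / (b - l))" using True by (simp add: bump_def)
    have "bump l u a b (bump l u b a y) = l + (bump l u b a y - l) * ((b - l) / (a - l))"
      using b assms True True' by (simp add: bump_def[of l u a b])
    then show ?thesis using assms unfolding e by simp
  next
    case False
    then have e: "bump l u b a y = u - (u - y) * ((u - a) / (u - b))" using True by (simp add: bump_def)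
    have "bump l u a b (bump l u b a y) = u - (u - bump l u b a y) * ((u - b) / (u - a))"
      using b assms True False by (simp add: bump_def[of l u a b])
    then show ?thesis using assms unfolding e by simp
  qed
qed (auto simp: bump_def)

lemma bump_strict_mono:
  assumes "l < a" "a < u" "l < b" "b < u"
  shows "strict_mono (bump l u a b)"
proof (rule strict_monoI)
  fix x y :: real assume xy: "x < y"
  have out: "bump l u a b z = z" if "z \<le> l \<or> u \<le> z" for z using that by (simp add: bump_def)
  consider "x \<le> l \<or> u \<le> x \<or> y \<le> l \<or> u \<le> y" | "l < x" "y \<le> a" | "a < x" "y < u" | "l < x" "x \<le> a" "a < y" "y < u"
    by linarith
  then show "bump l u a b x < bump l u a b y"
  proof cases
    case 1
    have c: "(z \<le> l \<or> u \<le> z) \<and> bump l u a b z = z \<or> l < z \<and> z < u \<and> l < bump l u a b z \<and> bump l u a b z < u" for z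
      using out[of z] bump_in(1,2)[OF assms, of z] by (cases "z \<le> l \<or> u \<le> z") auto
    show ?thesis using 1 c[of x] c[of y] xy assms by (elim disjE conjE; linarith)
  next
    case 2
    then have "(x - l) * ((b - l) / (a - l)) < (y - l) * ((b - l) / (a - l))"
      using assms xy by (intro mult_strict_right_mono divide_pos_pos) auto
    then show ?thesis using 2 xy assms by (simp add: bump_def)
  next
    case 3
    then have "(u - y) * ((u - b) / (u - a)) < (u - x) * ((u - b) / (u - a))"
      using assms xy by (intro mult_strict_right_mono divide_pos_pos) auto
    then show ?thesis using 3 xy assms by (simp add: bump_def)
  next
    case 4
    then show ?thesis using bump_in(3)[OF assms, of x] bump_in(4)[OF assms, of y] by linarith
  qed
qed

lemma sgn_poly_eq_if_no_root:
  fixes q :: "real poly"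
  assumes "l < y" "y < u" "l < y'" "y' < u" "\<And>z. l < z \<Longrightarrow> z < u \<Longrightarrow> poly q z \<noteq> 0"
  shows "sgn (poly q y) = sgn (poly q y')"
proof -
  have *: "sgn (poly q y) = sgn (poly q y')" if y: "l < y" "y < y'" "y' < u" for y y'
  proof (rule ccontr)
    assume "sgn (poly q y) \<noteq> sgn (poly q y')"
    then have "poly q y < 0 \<and> 0 < poly q y' \<or> 0 < poly q y \<and> poly q y' < 0"
      using assms(5)[of y] assms(5)[of y'] y by (auto simp: sgn_if split: if_splits)
    then obtain z where "y < z" "z < y'" "poly q z = 0"
      using poly_IVT_pos[OF y(2), of q] poly_IVT_neg[OF y(2), of q] by blast
    then show False using assms(5)[of z] y by simp
  qed
  consider "y < y'" | "y' < y" | "y = y'" by linarith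
  then show ?thesis
  proof cases
    case 1
    then show ?thesis using *[of y y'] assms by simp
  next
    case 2
    then show ?thesis using *[of y' y] assms by simp
  qed simp
qed

text \<open>Positivity on a half line forces a positive leading coefficient of the derivative, which
  is then bounded below by a positive constant far out, so the polynomial grows at least linearly.
  This decides the sign at the unbounded ends of the sign diagram, where no marked point is
  available.\<close>

lemma poly_pos_if_deriv_pos_right:
  fixes g :: "real poly"
  assumes "\<And>y. c < y \<Longrightarrow> 0 < poly (pderiv g) y"
  shows "\<exists>b>c. 0 < poly g b"
proof -
  define q where "q = pderiv g"
  have lc: "0 < lead_coeff q"
  proof (rule ccontr)
    assume "\<not> 0 < lead_coeff q"
    moreover have "q \<noteq> 0" using assms[of "c + 1"] by (auto simp: q_def)
    ultimately have "0 < lead_coeff (- q)" by (simp add: order.strict_iff_order)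
    from poly_pinfty_gt_lc[OF this] obtain m where m: "\<forall>x\<ge>m. lead_coeff (- q) \<le> poly (- q) x" by blast
    then have "lead_coeff (- q) \<le> poly (- q) (max m (c + 1))" by simp
    moreover have "0 < poly q (max m (c + 1))" unfolding q_def by (rule assms) auto
    ultimately show False using \<open>0 < lead_coeff (- q)\<close> by simp
  qed
  from poly_pinfty_gt_lc[OF this] obtain m where m: "\<And>x. m \<le> x \<Longrightarrow> lead_coeff q \<le> poly q x" by blast
  define m' where "m' = max m (c + 1)"
  define b where "b = m' + (\<bar>poly g m'\<bar> + 1) / lead_coeff q"
  have b: "m' < b" using lc by (simp add: b_def)
  from poly_MVT[OF this, of g] obtain z where z: "m' < z" "poly g b - poly g m' = (b - m') * poly q z"
    unfolding q_def by blast
  have "(b - m') * lead_coeff q \<le> (b - m') * poly q z"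
    using b m[of z] z by (intro mult_left_mono) (auto simp: m'_def)
  moreover have "(b - m') * lead_coeff q = \<bar>poly g m'\<bar> + 1" using lc by (cases "q = 0") (simp_all add: b_def)
  ultimately have "0 < poly g b" using z by linarith
  then show ?thesis using b by (intro exI[of _ b]) (auto simp: m'_def)
qed

lemma poly_neg_if_deriv_pos_left:
  fixes g :: "real poly"
  assumes "\<And>y. y < c \<Longrightarrow> 0 < poly (pderiv g) y"
  shows "\<exists>b<c. poly g b < 0"
proof -
  define q where "q = - pcompose g [:0, -1:]"
  have "\<exists>b>-c. 0 < poly q b"
  proof (rule poly_pos_if_deriv_pos_right)
    fix y assume "- c < y"
    then show "0 < poly (pderiv q) y"
      using assms[of "- y"] by (simp add: q_def pderiv_minus pderiv_pcompose poly_pcompose pderiv_pCons)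
  qed
  then obtain b where "- c < b" "0 < poly q b" by blast
  then show ?thesis by (intro exI[of _ "- b"]) (simp add: q_def poly_pcompose)
qed

lemma poly_less_if_deriv_pos:
  fixes g :: "real poly"
  assumes "a < b" "\<And>y. a < y \<Longrightarrow> y < b \<Longrightarrow> 0 < poly (pderiv g) y"
  shows "poly g a < poly g b"
proof -
  obtain z where "a < z" "z < b" "poly g b - poly g a = (b - a) * poly (pderiv g) z"
    using poly_MVT[OF assms(1)] by blast
  moreover have "0 < (b - a) * poly (pderiv g) z" using assms calculation by (intro mult_pos_pos) auto
  ultimately show ?thesis by simp
qed

text \<open>The inductive situation for one new polynomial: the derivatives are already matched by
  \<open>h\<close>, and the signs of \<open>f\<close> and \<open>g\<close> agree at a finite set of
  marked points containing all critical points of \<open>f\<close>. Both polynomials are monotone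
  between corresponding marked points, so the signs there determine their roots.\<close>

locale sign_match =
  fixes h :: "real \<Rightarrow> real" and Z :: "real set" and f g :: "real poly"
  assumes h: "strict_mono h" "surj h" and Z: "finite Z"
    and der: "\<And>y. sgn (poly (pderiv f) y) = sgn (poly (pderiv g) (h y))"
    and derZ: "\<And>y. poly (pderiv f) y = 0 \<Longrightarrow> y \<in> Z"
    and Zsgn: "\<And>z. z \<in> Z \<Longrightarrow> sgn (poly f z) = sgn (poly g (h z))"
begin

lemma deriv_pos_segment:
  assumes "poly (pderiv f) y > 0" "\<And>z. z \<in> Z \<Longrightarrow> \<not> (min y w \<le> z \<and> z \<le> max y w)"
  shows "0 < poly (pderiv f) w" "0 < poly (pderiv g) (h w)"
proof -
  show 1: "0 < poly (pderiv f) w"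
  proof (rule ccontr)
    assume "\<not> 0 < poly (pderiv f) w"
    moreover have "poly (pderiv f) w \<noteq> 0" using assms(2)[of w] derZ[of w] by auto
    ultimately have w: "poly (pderiv f) w < 0" by simp
    with assms(1) consider "y < w" | "w < y" by (metis linorder_neqE order.asym)
    then have "\<exists>z. min y w \<le> z \<and> z \<le> max y w \<and> poly (pderiv f) z = 0"
    proof cases
      case 1
      then show ?thesis using poly_IVT_neg[OF 1 assms(1) w] by (metis less_imp_le max.absorb2 min.absorb1)
    next
      case 2
      then show ?thesis using poly_IVT_pos[OF 2 w assms(1)] by (metis less_imp_le max.absorb1 min.absorb2)
    qed
    then show False using derZ assms(2) by blast
  qed
  then show "0 < poly (pderiv g) (h w)" using der[of w] by (simp add: sgn_if split: if_splits)
qed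

lemma h_less_iff: "h x < h y \<longleftrightarrow> x < y"
  using h(1) by (simp add: strict_mono_less)

lemma f_nonzero: "f \<noteq> 0"
proof
  assume "f = 0"
  then have "y \<in> Z" for y using derZ[of y] by simp
  then have "Z = UNIV" by auto
  then show False using Z infinite_UNIV_char_0[where 'a=real] by simp
qed

lemma g_deriv_pos_segment:
  assumes "poly (pderiv f) a > 0"
    "\<And>w z. y = h w \<Longrightarrow> z \<in> Z \<Longrightarrow> min a w \<le> z \<Longrightarrow> z \<le> max a w \<Longrightarrow> False"
  shows "0 < poly (pderiv g) y"
proof -
  obtain w where w: "y = h w" using h(2) by (metis surjD)
  show ?thesis unfolding w using assms(2)[OF w] by (intro deriv_pos_segment(2)[OF assms(1)]) blast
qed

text \<open>On the interval between marked points around \<open>a\<close>, \<open>f\<close>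
  increases through 0, so it is negative at the left end and positive at the right end. The values
  of \<open>g\<close> at the corresponding ends have the same signs, and the intermediate value
  theorem gives the root. An end at infinity is replaced by a point far out.\<close>

lemma root_exists_pos:
  assumes a: "poly f a = 0" "poly (pderiv f) a > 0" "a \<notin> Z"
  shows "\<exists>b. poly g b = 0 \<and> (\<forall>z\<in>Z. (z < a \<longrightarrow> h z < b) \<and> (a < z \<longrightarrow> b < h z))"
proof -
  have "\<exists>b1<h a. poly g b1 < 0 \<and> (\<forall>z\<in>Z. z < a \<longrightarrow> h z \<le> b1)"
  proof (cases "{z\<in>Z. z < a} = {}")
    case True
    have "0 < poly (pderiv g) y" if "y < h a" for y
    proof (rule g_deriv_pos_segment[OF a(2)])
      fix w z assume w: "y = h w" "z \<in> Z" "min a w \<le> z" "z \<le> max a w"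
      then have "w < a" using that h_less_iff by simp
      then show False using w True a(3) by (cases "z = a") auto
    qed
    from poly_neg_if_deriv_pos_left[of "h a" g, OF this] show ?thesis using True by auto
  next
    case False
    define z1 where "z1 = Max {z\<in>Z. z < a}"
    have z1: "z1 \<in> Z" "z1 < a" "\<And>z. z \<in> Z \<Longrightarrow> z < a \<Longrightarrow> z \<le> z1"
      using Max_in[of "{z\<in>Z. z < a}"] False Z by (auto simp: z1_def)
    have "poly f z1 < poly f a"
    proof (rule poly_less_if_deriv_pos[OF z1(2)])
      fix y assume "z1 < y" "y < a"
      then show "0 < poly (pderiv f) y" using a z1(3) by (intro deriv_pos_segment(1)[OF a(2)]) force
    qed
    then have "poly g (h z1) < 0" using Zsgn[OF z1(1)] a(1) by (simp add: sgn_if split: if_splits)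
    then show ?thesis using z1 h_less_iff h(1) by (intro exI[of _ "h z1"]) (auto simp: strict_mono_less_eq)
  qed
  then obtain b1 where b1: "b1 < h a" "poly g b1 < 0" "\<And>z. z \<in> Z \<Longrightarrow> z < a \<Longrightarrow> h z \<le> b1" by blast
  have "\<exists>b2>h a. poly g b2 > 0 \<and> (\<forall>z\<in>Z. a < z \<longrightarrow> b2 \<le> h z)"
  proof (cases "{z\<in>Z. a < z} = {}")
    case True
    have "0 < poly (pderiv g) y" if "h a < y" for y
    proof (rule g_deriv_pos_segment[OF a(2)])
      fix w z assume w: "y = h w" "z \<in> Z" "min a w \<le> z" "z \<le> max a w"
      then have "a < w" using that h_less_iff by simp
      then show False using w True a(3) by (cases "z = a") auto
    qed
    from poly_pos_if_deriv_pos_right[of "h a" g, OF this] show ?thesis using True by auto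
  next
    case False
    define z1 where "z1 = Min {z\<in>Z. a < z}"
    have z1: "z1 \<in> Z" "a < z1" "\<And>z. z \<in> Z \<Longrightarrow> a < z \<Longrightarrow> z1 \<le> z"
      using Min_in[of "{z\<in>Z. a < z}"] False Z by (auto simp: z1_def)
    have "poly f a < poly f z1"
    proof (rule poly_less_if_deriv_pos[OF z1(2)])
      fix y assume "a < y" "y < z1"
      then show "0 < poly (pderiv f) y" using a z1(3) by (intro deriv_pos_segment(1)[OF a(2)]) force
    qed
    then have "poly g (h z1) > 0" using Zsgn[OF z1(1)] a(1) by (simp add: sgn_if split: if_splits)
    then show ?thesis using z1 h_less_iff h(1) by (intro exI[of _ "h z1"]) (auto simp: strict_mono_less_eq)
  qed
  then obtain b2 where b2: "h a < b2" "poly g b2 > 0" "\<And>z. z \<in> Z \<Longrightarrow> a < z \<Longrightarrow> b2 \<le> h z" by blast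
  obtain b where "b1 < b" "b < b2" "poly g b = 0"
    using poly_IVT_pos[of b1 b2 g] b1 b2 by auto
  then show ?thesis using b1(3) b2(3) by (intro exI[of _ b]) force
qed

text \<open>If \<open>f y\<close> is positive, the nearest point to the left of \<open>y\<close>
  that is marked or a root exists and has a nonnegative value, for otherwise a root would lie in
  between. There the signs of \<open>f\<close> and \<open>g\<close> already agree, and
  \<open>g\<close> increases strictly up to \<open>h y\<close>. A negative value is treated with the
  nearest such point to the right.\<close>

lemma sgn_eq_pos:
  assumes roots: "\<And>a. poly f a = 0 \<Longrightarrow> poly g (h a) = 0"
    and y: "y \<notin> Z" "poly (pderiv f) y > 0" "poly f y \<noteq> 0"
  shows "sgn (poly f y) = sgn (poly g (h y))"
proof -
  have finR: "finite {w. w \<in> Z \<or> poly f w = 0}"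
    using Z poly_roots_finite[OF f_nonzero] by (simp add: Collect_disj_eq)
  have W: "sgn (poly f w) = sgn (poly g (h w))" if "w \<in> Z \<or> poly f w = 0" for w
    using that Zsgn roots by auto
  show ?thesis
  proof (cases "poly f y > 0")
    case True
    define W where "W = {w. (w \<in> Z \<or> poly f w = 0) \<and> w < y}"
    have "finite W" unfolding W_def by (rule finite_subset[OF _ finR]) auto
    have "W \<noteq> {}"
    proof
      assume "W = {}"
      then have "0 < poly (pderiv f) w" if "w < y" for w
        using that y by (intro deriv_pos_segment(1)[OF y(2)]) (force simp: W_def)
      from poly_neg_if_deriv_pos_left[OF this, of y] obtain b where "b < y" "poly f b < 0" by blast
      then show False using poly_IVT_pos[of b y f] True \<open>W = {}\<close> by (auto simp: W_def)
    qed
    define w where "w = Max W"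
    have w: "w \<in> Z \<or> poly f w = 0" "w < y" using Max_in[OF \<open>finite W\<close> \<open>W \<noteq> {}\<close>] by (auto simp: w_def W_def)
    have wm: "v \<le> w" if "v \<in> Z \<or> poly f v = 0" "v < y" for v
      using Max_ge[OF \<open>finite W\<close>] that by (auto simp: w_def W_def)
    have "0 \<le> poly f w"
    proof (rule ccontr)
      assume "\<not> 0 \<le> poly f w"
      then show False using poly_IVT_pos[of w y f] True w(2) wm by force
    qed
    then have "0 \<le> poly g (h w)" using W[OF w(1)] by (simp add: sgn_if split: if_splits)
    also have "\<dots> < poly g (h y)"
    proof (rule poly_less_if_deriv_pos)
      fix v assume v: "h w < v" "v < h y"
      show "0 < poly (pderiv g) v"
      proof (rule g_deriv_pos_segment[OF y(2)])
        fix u z assume u: "v = h u" "z \<in> Z" "min y u \<le> z" "z \<le> max y u"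
        then have "w < u" "u < y" using v h_less_iff by simp_all
        then show False using u y(1) wm[of z] by (cases "z = y") auto
      qed
    qed (use w h_less_iff in auto)
    finally show ?thesis using True by simp
  next
    case False
    then have neg: "poly f y < 0" using y by simp
    define W where "W = {w. (w \<in> Z \<or> poly f w = 0) \<and> y < w}"
    have "finite W" unfolding W_def by (rule finite_subset[OF _ finR]) auto
    have "W \<noteq> {}"
    proof
      assume "W = {}"
      then have "0 < poly (pderiv f) w" if "y < w" for w
        using that y by (intro deriv_pos_segment(1)[OF y(2)]) (force simp: W_def)
      from poly_pos_if_deriv_pos_right[OF this, of y] obtain b where "y < b" "poly f b > 0" by blast
      then show False using poly_IVT_pos[of y b f] neg \<open>W = {}\<close> by (auto simp: W_def)
    qed
    define w where "w = Min W"
    have w: "w \<in> Z \<or> poly f w = 0" "y < w" using Min_in[OF \<open>finite W\<close> \<open>W \<noteq> {}\<close>] by (auto simp: w_def W_def)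
    have wm: "w \<le> v" if "v \<in> Z \<or> poly f v = 0" "y < v" for v
      using Min_le[OF \<open>finite W\<close>] that by (auto simp: w_def W_def)
    have "poly f w \<le> 0"
    proof (rule ccontr)
      assume "\<not> poly f w \<le> 0"
      then show False using poly_IVT_pos[of y w f] neg w(2) wm by force
    qed
    have "poly g (h y) < poly g (h w)"
    proof (rule poly_less_if_deriv_pos)
      fix v assume v: "h y < v" "v < h w"
      show "0 < poly (pderiv g) v"
      proof (rule g_deriv_pos_segment[OF y(2)])
        fix u z assume u: "v = h u" "z \<in> Z" "min y u \<le> z" "z \<le> max y u"
        then have "u < w" "y < u" using v h_less_iff by simp_all
        then show False using u y(1) wm[of z] by (cases "z = y") auto
      qed
    qed (use w h_less_iff in auto)
    also have "\<dots> \<le> 0" using W[OF w(1)] \<open>poly f w \<le> 0\<close> by (simp add: sgn_if split: if_splits)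
    finally show ?thesis using neg by simp
  qed
qed

lemma sign_match_minus: "sign_match h Z (- f) (- g)"
  by unfold_locales (use h Z der derZ Zsgn in \<open>auto simp: pderiv_minus sgn_minus\<close>)

lemma root_exists:
  assumes a: "poly f a = 0" "a \<notin> Z"
  shows "\<exists>b. poly g b = 0 \<and> (\<forall>z\<in>Z. (z < a \<longrightarrow> h z < b) \<and> (a < z \<longrightarrow> b < h z))"
proof (cases "poly (pderiv f) a > 0")
  case True
  then show ?thesis using root_exists_pos a by blast
next
  case False
  then have "poly (pderiv (- f)) a > 0" using a(2) derZ[of a] by (force simp: pderiv_minus)
  then show ?thesis using sign_match.root_exists_pos[OF sign_match_minus, of a] a by simp
qed

lemma sgn_eq_all:
  assumes roots: "\<And>a. poly f a = 0 \<Longrightarrow> poly g (h a) = 0"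
  shows "sgn (poly f y) = sgn (poly g (h y))"
proof (cases "y \<in> Z \<or> poly f y = 0")
  case True
  then show ?thesis using roots Zsgn by auto
next
  case F: False
  show ?thesis
  proof (cases "poly (pderiv f) y > 0")
    case True
    then show ?thesis using sgn_eq_pos[OF roots] F by blast
  next
    case False
    then have "poly (pderiv (- f)) y > 0" using F derZ[of y] by (force simp: pderiv_minus)
    then show ?thesis using sign_match.sgn_eq_pos[OF sign_match_minus, of y] F roots by (simp add: sgn_minus)
  qed
qed

end

lemma finite_avoid_segment:
  fixes a b :: real
  assumes "finite Z" "a \<le> b" "\<And>z. z \<in> Z \<Longrightarrow> \<not> (a \<le> z \<and> z \<le> b)"
  obtains l u where "l < a" "b < u" "\<And>z. z \<in> Z \<Longrightarrow> \<not> (l < z \<and> z < u)"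
proof
  define l where "l = Max (insert (a - 1) {z\<in>Z. z < a})"
  define u where "u = Min (insert (b + 1) {z\<in>Z. b < z})"
  show "l < a" unfolding l_def using assms(1) by (subst Max_less_iff) auto
  show "b < u" unfolding u_def using assms(1) by (subst Min_gr_iff) auto
  fix z assume z: "z \<in> Z"
  show "\<not> (l < z \<and> z < u)"
  proof (cases "z < a")
    case True
    then have "z \<le> l" unfolding l_def using z assms(1) by (intro Max_ge) auto
    then show ?thesis by simp
  next
    case False
    then have "b < z" using assms(3)[OF z] by auto
    then have "u \<le> z" unfolding u_def using z assms(1) by (intro Min_le) auto
    then show ?thesis by simp
  qed
qed

lemma matched_zero_iff:
  assumes "matched Ps h" "(p, q) \<in> Ps"
  shows "p = 0 \<longleftrightarrow> q = 0" "poly p y = 0 \<longleftrightarrow> poly q (h y) = 0"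
proof -
  have sg: "sgn (poly p y) = sgn (poly q (h y))" for y using assms by (auto simp: matched_def)
  then show 2: "poly p y = 0 \<longleftrightarrow> poly q (h y) = 0" for y by (metis sgn_0_0)
  have sj: "surj h" using assms by (simp add: matched_def)
  have "q = 0" if "p = 0"
  proof -
    have "poly q y = 0" for y using 2 that sj by (metis poly_0 surjD)
    then show ?thesis by (simp add: poly_eq_poly_eq_iff[symmetric] fun_eq_iff)
  qed
  moreover have "p = 0" if "q = 0"
    using 2 that by (simp add: poly_eq_poly_eq_iff[symmetric] fun_eq_iff)
  ultimately show "p = 0 \<longleftrightarrow> q = 0" by blast
qed

text \<open>The bijection \<open>h0\<close> has the correct signs at the roots of the old
  polynomials but may miss the new roots of \<open>g\<close>. These are corrected one at a time by a
  bump supported in an interval that contains no image of an old root, so the old signs survive. By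
  Rolle an old root, namely one of the derivative, separates any two roots of \<open>f\<close>, so a
  correction does not undo the earlier ones.\<close>

lemma matched_extend:
  assumes fin: "finite Ps" and m: "matched Ps h0" and der: "(pderiv f, pderiv g) \<in> Ps" "pderiv f \<noteq> 0"
    and roots: "\<And>p q r. (p, q) \<in> Ps \<Longrightarrow> p \<noteq> 0 \<Longrightarrow> poly p r = 0 \<Longrightarrow> sgn (poly f r) = sgn (poly g (h0 r))"
  shows "\<exists>h. matched (insert (f, g) Ps) h"
proof -
  define Z where "Z = (\<Union>(p, q)\<in>{(p, q)\<in>Ps. p \<noteq> 0}. {r. poly p r = 0})"
  have "finite {(p, q)\<in>Ps. p \<noteq> 0}" using fin by (rule rev_finite_subset) auto
  then have Z: "finite Z" unfolding Z_def by (rule finite_UN_I) (auto intro: poly_roots_finite)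
  have inZ: "(p, q) \<in> Ps \<Longrightarrow> p \<noteq> 0 \<Longrightarrow> poly p r = 0 \<Longrightarrow> r \<in> Z" for p q r unfolding Z_def by auto
  have Zsgn: "sgn (poly f r) = sgn (poly g (h0 r))" if "r \<in> Z" for r
    using that roots unfolding Z_def by auto
  have sm: "sign_match h Z f g" if "matched Ps h" "\<And>z. z \<in> Z \<Longrightarrow> h z = h0 z" for h
    using that der Z Zsgn inZ[OF der] unfolding sign_match_def matched_def by auto
  have f0: "f \<noteq> 0" using der(2) by auto
  define A where "A = {a. poly f a = 0} - Z"
  have "finite A" unfolding A_def using poly_roots_finite[OF f0] by simp
  have "\<exists>h. matched Ps h \<and> (\<forall>z\<in>Z. h z = h0 z) \<and> (\<forall>a\<in>R. poly g (h a) = 0)" if "finite R" "R \<subseteq> A" for R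
    using that
  proof (induction R rule: finite_induct)
    case empty
    then show ?case using m by blast
  next
    case (insert a R)
    then obtain h where mh: "matched Ps h" "\<And>z. z \<in> Z \<Longrightarrow> h z = h0 z" "\<And>a. a \<in> R \<Longrightarrow> poly g (h a) = 0"
      by auto
    have hm: "strict_mono h" and hs: "surj h" using mh(1) by (auto simp: matched_def)
    interpret sign_match h Z f g by (rule sm[OF mh(1,2)])
    have a: "poly f a = 0" "a \<notin> Z" using insert.prems by (auto simp: A_def)
    obtain b where b: "poly g b = 0" "\<And>z. z \<in> Z \<Longrightarrow> z < a \<Longrightarrow> h z < b" "\<And>z. z \<in> Z \<Longrightarrow> a < z \<Longrightarrow> b < h z"
      using root_exists[OF a] by blast
    have seg: "\<not> (min (h a) b \<le> z \<and> z \<le> max (h a) b)" if z: "z \<in> h ` Z" for z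
    proof -
      obtain w where w: "z = h w" "w \<in> Z" using z by auto
      then consider "w < a" | "a < w" using a(2) by (metis linorder_neqE)
      then show ?thesis
        using b(2,3)[OF w(2)] w(1) h_less_iff[of w a] h_less_iff[of a w] by cases auto
    qed
    have "min (h a) b \<le> max (h a) b" by simp
    then obtain l u where lu: "l < min (h a) b" "max (h a) b < u" "\<And>z. z \<in> h ` Z \<Longrightarrow> \<not> (l < z \<and> z < u)"
      using finite_avoid_segment[OF finite_imageI[OF Z] _ seg] by blast
    define T where "T = bump l u (h a) b"
    have prem: "l < h a" "h a < u" "l < b" "b < u" using lu by auto
    have Tm: "strict_mono T" unfolding T_def by (rule bump_strict_mono[OF prem])
    have Ts: "surj T" unfolding T_def surj_def using bump_inverse[OF prem] by metis
    have Tout: "T y = y" if "\<not> (l < y \<and> y < u)" for y using that by (auto simp: T_def bump_def)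
    have Tin: "l < T y" "T y < u" if "l < y" "y < u" for y using bump_in(1,2)[OF prem that] by (auto simp: T_def)
    have Ta: "T (h a) = b" using prem by (simp add: T_def bump_def)
    have sgnT: "sgn (poly q (T y)) = sgn (poly q y)" if pq: "(p, q) \<in> Ps" for p q y
    proof (cases "q = 0 \<or> \<not> (l < y \<and> y < u)")
      case True
      then show ?thesis using Tout by auto
    next
      case False
      have "poly q z \<noteq> 0" if "l < z" "z < u" for z
      proof
        assume "poly q z = 0"
        obtain w where w: "z = h w" using hs by (metis surjD)
        have "poly p w = 0" "p \<noteq> 0" using matched_zero_iff[OF mh(1) pq] False \<open>poly q z = 0\<close> w by auto
        then show False using inZ[OF pq] lu(3)[of z] w that by auto
      qed
      then show ?thesis using False Tin by (intro sgn_poly_eq_if_no_root[of l _ u]) auto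
    qed
    have "matched Ps (T \<circ> h)" unfolding matched_def
    proof (intro conjI)
      show "strict_mono (T \<circ> h)" using Tm hm by (simp add: strict_mono_def)
      show "surj (T \<circ> h)" using Ts hs by (rule comp_surj[rotated])
      show "\<forall>(p, q)\<in>Ps. \<forall>y. sgn (poly p y) = sgn (poly q ((T \<circ> h) y))"
        using mh(1) sgnT by (fastforce simp: matched_def)
    qed
    moreover have "(T \<circ> h) z = h0 z" if "z \<in> Z" for z using Tout lu(3)[of "h z"] mh(2) that by auto
    moreover have "poly g ((T \<circ> h) a') = 0" if a': "a' \<in> insert a R" for a'
    proof (cases "a' = a")
      case True
      then show ?thesis using Ta b(1) by simp
    next
      case False
      then have a'R: "a' \<in> R" using a' by simp
      then have fa': "poly f a' = 0" using insert.prems by (auto simp: A_def)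
      obtain z where z: "poly (pderiv f) z = 0" "min a a' < z" "z < max a a'"
      proof (cases "a < a'")
        case True
        then obtain z where "a < z" "z < a'" "poly f a' - poly f a = (a' - a) * poly (pderiv f) z"
          using poly_MVT by blast
        then show ?thesis using that[of z] a fa' True by auto
      next
        case F: False
        then have "a' < a" using False by simp
        then obtain z where "a' < z" "z < a" "poly f a - poly f a' = (a - a') * poly (pderiv f) z"
          using poly_MVT by blast
        then show ?thesis using that[of z] a fa' \<open>a' < a\<close> by auto
      qed
      then have "z \<in> Z" using derZ by simp
      then have "\<not> (l < h a' \<and> h a' < u)"
        using lu(3)[of "h z"] z prem h_less_iff[of z a] h_less_iff[of a z] h_less_iff[of z a'] h_less_iff[of a' z]
        by (auto simp: min_def max_def split: if_splits)
      then show ?thesis using Tout mh(3)[OF a'R] by simp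
    qed
    ultimately show ?case by blast
  qed
  from this[OF \<open>finite A\<close> order_refl] obtain h where mh: "matched Ps h" "\<And>z. z \<in> Z \<Longrightarrow> h z = h0 z"
    "\<And>a. a \<in> A \<Longrightarrow> poly g (h a) = 0" by blast
  interpret sign_match h Z f g by (rule sm[OF mh(1,2)])
  have "poly g (h a) = 0" if "poly f a = 0" for a
  proof (cases "a \<in> Z")
    case True
    then show ?thesis using Zsgn that by (metis sgn_0_0)
  next
    case False
    then show ?thesis using mh(3)[of a] that by (simp add: A_def)
  qed
  then have "sgn (poly f y) = sgn (poly g (h y))" for y by (rule sgn_eq_all)
  then have "matched (insert (f, g) Ps) h" using mh(1) by (simp add: matched_def)
  then show ?thesis by blast
qed

lemma matched_subset: "matched Ps h \<Longrightarrow> Qs \<subseteq> Ps \<Longrightarrow> matched Qs h"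
  unfolding matched_def by blast

section \<open>Quantifier elimination by induction on degrees\<close>

definition sign_stable :: "(nat \<times> ((nat \<Rightarrow> real) \<Rightarrow> real poly)) set \<Rightarrow> bool" where
  "sign_stable F \<longleftrightarrow> (\<exists>G. finite G \<and> G \<subseteq> polyfun \<and>
     (\<forall>x x'. sgn_eq G x x' \<longrightarrow> (\<exists>h. matched ((\<lambda>(k, p). (p x, p x')) ` F) h)))"

lemma truncate_eq: "degree p \<le> r \<Longrightarrow> (\<Sum>l\<le>r. monom (coeff p l) l) = p"
  by (rule poly_as_sum_of_monoms')

text \<open>Where the top coefficient of \<open>f\<close> vanishes, \<open>f\<close> equals its
  truncation \<open>f0\<close>. Elsewhere its sign diagram follows from its derivative and from its
  signs at the roots of the polynomials in \<open>F\<close> and of the derivative, and those signs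
  are the signs of pseudo-remainders. Apart from \<open>F\<close> itself, all auxiliary polynomials
  have formal degree at most \<open>k\<close>. Remainders are taken modulo every truncation, since
  true degrees vary with the parameters.\<close>

lemma sign_stable_step:
  assumes fin: "finite F" and F: "\<And>k' p. (k', p) \<in> F \<Longrightarrow> ppoly k' p \<and> k' \<le> Suc k"
    and f: "ppoly (Suc k) f"
    and IH: "\<And>H. finite H \<Longrightarrow> (\<And>k' p. (k', p) \<in> H \<Longrightarrow> ppoly k' p \<and> k' \<le> k) \<Longrightarrow> sign_stable (F \<union> H)"
  shows "sign_stable (insert (Suc k, f) F)"
proof -
  define f0 where "f0 = (\<lambda>x. \<Sum>l\<le>k. monom (coeff (f x) l) l)"
  have f0: "ppoly k f0" unfolding f0_def by (rule ppoly_truncate[OF f])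
  define f' where "f' = (\<lambda>x. pderiv (f x))"
  have f': "ppoly k f'" using ppoly_pderiv[OF f] by (simp add: f'_def)
  define F1 where "F1 = insert (k, f') F"
  have F1: "ppoly k' p \<and> k' \<le> Suc k" if "(k', p) \<in> F1" for k' p
    using that F f' by (auto simp: F1_def)
  have finF1: "finite F1" using fin by (simp add: F1_def)
  define tr where "tr = (\<lambda>p r (x::nat \<Rightarrow> real). \<Sum>l\<le>r. monom (coeff (p x) l) l :: real poly)"
  define RR where "RR = (\<lambda>p r. SOME R. ppoly (r - 1) R \<and>
     (\<forall>x y. coeff (tr p r x) r \<noteq> 0 \<longrightarrow> poly (tr p r x) y = 0 \<longrightarrow> sgn (poly (R x) y) = sgn (poly (f x) y)))"
  have RR: "ppoly (r - 1) (RR p r)"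
    "coeff (tr p r x) r \<noteq> 0 \<Longrightarrow> poly (tr p r x) y = 0 \<Longrightarrow> sgn (poly (RR p r x) y) = sgn (poly (f x) y)"
    if "0 < r" "(k', p) \<in> F1" for k' p r x y
  proof -
    have "ppoly r (tr p r)" unfolding tr_def using F1[OF that(2)] by (intro ppoly_truncate) auto
    from someI_ex[OF ppoly_pseudo_remainder[OF this that(1) f]]
    show "ppoly (r - 1) (RR p r)"
      "coeff (tr p r x) r \<noteq> 0 \<Longrightarrow> poly (tr p r x) y = 0 \<Longrightarrow> sgn (poly (RR p r x) y) = sgn (poly (f x) y)"
      unfolding RR_def by auto
  qed
  define H where "H = insert (k, f') ((\<lambda>((k', p), r). (r - 1, RR p r)) ` (F1 \<times> {1..Suc k}))"
  have "sign_stable (F \<union> {(k, f0)})" using f0 by (intro IH) auto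
  then obtain G0 where G0: "finite G0" "G0 \<subseteq> polyfun"
    "\<And>x x'. sgn_eq G0 x x' \<Longrightarrow> \<exists>h. matched ((\<lambda>(k, p). (p x, p x')) ` (F \<union> {(k, f0)})) h"
    unfolding sign_stable_def by blast
  have "sign_stable (F \<union> H)"
  proof (rule IH)
    show "finite H" unfolding H_def using finF1 by simp
    fix k' p assume "(k', p) \<in> H"
    then show "ppoly k' p \<and> k' \<le> k" using RR(1) f' by (auto simp: H_def)
  qed
  then obtain G1 where G1: "finite G1" "G1 \<subseteq> polyfun"
    "\<And>x x'. sgn_eq G1 x x' \<Longrightarrow> \<exists>h. matched ((\<lambda>(k, p). (p x, p x')) ` (F \<union> H)) h"
    unfolding sign_stable_def by blast
  \<comment> \<open>These coefficients are added to the test polynomials so that parameters with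
    equal signs give equal true degrees; the remainder modulo the same truncation is then valid at
    both \<open>x\<close> and \<open>x'\<close>.\<close>
  define C where "C = (\<lambda>((k', p), l). (\<lambda>x. coeff (p x) l)) ` (insert (Suc k, f) F1 \<times> {..Suc k})"
  have C: "finite C" "C \<subseteq> polyfun" unfolding C_def using finF1 F1 f by (auto simp: ppoly_def)
  show ?thesis unfolding sign_stable_def
  proof (intro exI[of _ "G0 \<union> G1 \<union> C"] conjI allI impI)
    fix x x' assume eq: "sgn_eq (G0 \<union> G1 \<union> C) x x'"
    have coeq: "coeff (p x) l = 0 \<longleftrightarrow> coeff (p x') l = 0" if p: "(k', p) \<in> insert (Suc k, f) F1" for k' p l
    proof (cases "l \<le> Suc k")
      case True
      then have "(\<lambda>x. coeff (p x) l) \<in> C" unfolding C_def using p by force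
      moreover have "\<forall>g\<in>C. sgn (g x) = sgn (g x')" using eq by (simp add: sgn_eq_def)
      ultimately have "sgn (coeff (p x) l) = sgn (coeff (p x') l)" by (rule bspec[rotated])
      then show ?thesis by (metis sgn_0_0)
    next
      case False
      have "ppoly k' p \<and> k' \<le> Suc k" using p F1 f by auto
      then have "degree (p y) < l" for y using False unfolding ppoly_def by (meson le_trans not_le)
      then show ?thesis by (simp add: coeff_eq_0)
    qed
    show "\<exists>h. matched ((\<lambda>(k, p). (p x, p x')) ` insert (Suc k, f) F) h"
    proof (cases "coeff (f x) (Suc k) = 0")
      case True
      have fe: "f0 y = f y" if "coeff (f y) (Suc k) = 0" for y
      proof -
        have "degree (f y) \<le> k"
          using f that unfolding ppoly_def by (metis degree_0 le0 le_SucE leading_coeff_0_iff)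
        then show ?thesis unfolding f0_def by (rule truncate_eq)
      qed
      have "coeff (f x') (Suc k) = 0" using True coeq[of "Suc k" f "Suc k"] by simp
      moreover have "sgn_eq G0 x x'" using eq by (auto simp: sgn_eq_def)
      ultimately show ?thesis using G0(3)[of x x'] fe[of x] fe[of x'] True by auto
    next
      case False
      then have F': "coeff (f x') (Suc k) \<noteq> 0" using coeq[of "Suc k" f "Suc k"] by simp
      have "sgn_eq G1 x x'" using eq by (auto simp: sgn_eq_def)
      from G1(3)[OF this] obtain h where h: "matched ((\<lambda>(k, p). (p x, p x')) ` (F \<union> H)) h" by blast
      have "F1 \<subseteq> F \<union> H" by (auto simp: F1_def H_def)
      then have h1: "matched ((\<lambda>(k, p). (p x, p x')) ` F1) h" using h by (rule matched_subset[rotated, OF image_mono])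
      have "\<exists>h. matched (insert (f x, f x') ((\<lambda>(k, p). (p x, p x')) ` F1)) h"
      proof (rule matched_extend[OF _ h1])
        show "(pderiv (f x), pderiv (f x')) \<in> (\<lambda>(k, p). (p x, p x')) ` F1"
          by (auto simp: F1_def f'_def image_iff)
        have "0 < degree (f x)" using False by (metis le_degree less_le_trans zero_less_Suc)
        then show "pderiv (f x) \<noteq> 0" by (simp add: pderiv_eq_0_iff)
        fix p q r assume "(p, q) \<in> (\<lambda>(k, p). (p x, p x')) ` F1" and p0: "p \<noteq> 0" and r: "poly p r = 0"
        then obtain k' P where P: "(k', P) \<in> F1" "p = P x" "q = P x'" by auto
        define e where "e = degree (P x)"
        have e0: "0 < e"
        proof (rule ccontr)
          assume "\<not> 0 < e"
          then obtain a where "P x = [:a:]" unfolding e_def using degree_eq_zeroE by auto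
          then show False using P p0 r by simp
        qed
        have de: "degree (P x') = e"
        proof -
          have pc: "coeff (P x) l = 0 \<longleftrightarrow> coeff (P x') l = 0" for l using coeq[of k' P l] P(1) by simp
          have "degree (P x') \<le> e"
          proof (intro degree_le allI impI)
            fix i assume "e < i"
            then have "coeff (P x) i = 0" by (simp add: e_def coeff_eq_0)
            then show "coeff (P x') i = 0" using pc[of i] by simp
          qed
          moreover have "e \<le> degree (P x')"
          proof (rule le_degree)
            have "coeff (P x) e \<noteq> 0" using p0 P(2) by (simp add: e_def)
            then show "coeff (P x') e \<noteq> 0" using pc[of e] by simp
          qed
          ultimately show ?thesis by simp
        qed
        have ek: "e \<le> Suc k" using F1[OF P(1)] unfolding e_def ppoly_def by (meson le_trans)
        have "tr P e x = P x" "tr P e x' = P x'" unfolding tr_def using de by (auto intro!: truncate_eq simp: e_def)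
        moreover have "coeff (P x) e \<noteq> 0" using p0 P(2) by (simp add: e_def)
        moreover have "coeff (P x') e \<noteq> 0" using coeq[of k' P e] P(1) calculation(3) by simp
        moreover have "poly (P x') (h r) = 0"
        proof -
          have "(P x, P x') \<in> (\<lambda>(k, p). (p x, p x')) ` F1" using P(1) by force
          then show ?thesis using matched_zero_iff(2)[OF h1] P(2) r by blast
        qed
        ultimately have "sgn (poly (RR P e x) r) = sgn (poly (f x) r)"
            "sgn (poly (RR P e x') (h r)) = sgn (poly (f x') (h r))"
          using RR(2)[OF e0 P(1)] r P(2) by auto
        moreover have "(e - 1, RR P e) \<in> H" unfolding H_def using P(1) e0 ek
          by (intro insertI2 image_eqI[of _ _ "((k', P), e)"]) auto
        then have "sgn (poly (RR P e x) r) = sgn (poly (RR P e x') (h r))"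
          using h by (force simp: matched_def)
        ultimately show "sgn (poly (f x) r) = sgn (poly (f x') (h r))" by simp
      qed (use finF1 in simp)
      then show ?thesis by (rule ex_forward, elim matched_subset) (auto simp: F1_def)
    qed
  qed (use G0 G1 C in auto)
qed

lemma sign_stable_0:
  assumes "finite F" "\<And>k' p. (k', p) \<in> F \<Longrightarrow> ppoly 0 p"
  shows "sign_stable F"
  unfolding sign_stable_def
proof (intro exI[of _ "(\<lambda>(k', p) x. coeff (p x) 0) ` F"] conjI allI impI)
  show "(\<lambda>(k', p) x. coeff (p x) 0) ` F \<subseteq> polyfun" using assms by (auto simp: ppoly_def)
  fix x x' assume eq: "sgn_eq ((\<lambda>(k', p) x. coeff (p x) 0) ` F) x x'"
  have "sgn (poly (p x) y) = sgn (poly (p x') y)" if "(k', p) \<in> F" for k' p y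
  proof -
    have "poly (p z) y = coeff (p z) 0" for z
    proof -
      have "degree (p z) = 0" using assms(2)[OF that] by (simp add: ppoly_def)
      then obtain a where "p z = [:a:]" by (rule degree_eq_zeroE)
      then show ?thesis by simp
    qed
    then show ?thesis using eq that by (force simp: sgn_eq_def)
  qed
  then have "matched ((\<lambda>(k, p). (p x, p x')) ` F) id"
    by (auto simp: matched_def strict_mono_def)
  then show "\<exists>h. matched ((\<lambda>(k, p). (p x, p x')) ` F) h" by blast
qed (use assms in auto)

text \<open>Inside the induction on the largest formal degree runs an induction on the number of
  polynomials attaining it. The inner one is stated for an arbitrary finite set \<open>H\<close> of
  lower polynomials, because removing one polynomial of top degree creates many lower ones.\<close>

lemma sign_stable_ppoly:
  "finite F \<Longrightarrow> (\<And>k' p. (k', p) \<in> F \<Longrightarrow> ppoly k' p \<and> k' \<le> k) \<Longrightarrow> sign_stable F"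
proof (induction k arbitrary: F)
  case 0
  then show ?case by (intro sign_stable_0) auto
next
  case (Suc k)
  define top where "top = {q \<in> F. fst q = Suc k}"
  have "finite H \<Longrightarrow> (\<And>k' p. (k', p) \<in> H \<Longrightarrow> ppoly k' p \<and> k' \<le> k) \<Longrightarrow> sign_stable (T \<union> H)"
    if "finite T" "\<And>k' p. (k', p) \<in> T \<Longrightarrow> ppoly k' p \<and> k' = Suc k" for T H
    using that
  proof (induction T arbitrary: H rule: finite_induct)
    case empty
    then show ?case using Suc.IH[of H] by simp
  next
    case (insert q T)
    obtain f where q: "q = (Suc k, f)" "ppoly (Suc k) f" using insert.prems(3)[of "fst q" "snd q"] by (cases q) auto
    have "sign_stable (insert (Suc k, f) (T \<union> H))"
    proof (rule sign_stable_step)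
      show "finite (T \<union> H)" using insert by simp
      show "ppoly k' p \<and> k' \<le> Suc k" if "(k', p) \<in> T \<union> H" for k' p
        using that insert.prems(2)[of k' p] insert.prems(3)[of k' p] by auto
      show "ppoly (Suc k) f" by (rule q(2))
      fix H' assume H': "finite H'" "\<And>k' p. (k', p) \<in> H' \<Longrightarrow> ppoly k' p \<and> k' \<le> k"
      have "sign_stable (T \<union> (H \<union> H'))"
      proof (rule insert.IH)
        show "finite (H \<union> H')" using insert.prems H' by simp
        show "ppoly k' p \<and> k' \<le> k" if "(k', p) \<in> H \<union> H'" for k' p
          using that insert.prems(2)[of k' p] H'(2)[of k' p] by blast
        show "ppoly k' p \<and> k' = Suc k" if "(k', p) \<in> T" for k' p
          using that insert.prems(3)[of k' p] by blast
      qed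
      then show "sign_stable (T \<union> H \<union> H')" by (simp add: Un_assoc)
    qed
    then show ?case using q by simp
  qed
  note step = this
  have "sign_stable (top \<union> (F - top))"
  proof (rule step)
    show "finite top" "finite (F - top)" using Suc.prems by (simp_all add: top_def)
    show "ppoly k' p \<and> k' \<le> k" if "(k', p) \<in> F - top" for k' p
      using that Suc.prems(2)[of k' p] by (auto simp: top_def)
    show "ppoly k' p \<and> k' = Suc k" if "(k', p) \<in> top" for k' p
      using that Suc.prems(2)[of k' p] by (auto simp: top_def)
  qed
  moreover have "top \<union> (F - top) = F" by (auto simp: top_def)
  ultimately show ?case by simp
qed

text \<open>If \<open>y\<close> is a witness at \<open>x\<close>, then its image under the matching
  bijection is a witness at every \<open>x'\<close> with the same signs of the test
  polynomials.\<close>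

theorem definable_ex:
  assumes "definable P" shows "definable (\<lambda>x. \<exists>y. P (x(i := y)))"
proof -
  obtain G where G: "finite G" "G \<subseteq> polyfun" "\<And>x x'. sgn_eq G x x' \<Longrightarrow> P x = P x'"
    using assms unfolding definable_def by metis
  have "\<forall>g\<in>G. \<exists>k p. ppoly k p \<and> (\<forall>x y. g (x(i := y)) = poly (p x) y)"
    using G(2) polyfun_as_ppoly by blast
  then obtain K Q where KQ: "\<And>g. g \<in> G \<Longrightarrow> ppoly (K g) (Q g)"
    "\<And>g x y. g \<in> G \<Longrightarrow> g (x(i := y)) = poly (Q g x) y" by metis
  have "sign_stable ((\<lambda>g. (K g, Q g)) ` G)"
    using G(1) KQ(1) by (intro sign_stable_ppoly[where k = "Max (K ` G)"]) auto
  then obtain G' where G': "finite G'" "G' \<subseteq> polyfun"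
    "\<And>x x'. sgn_eq G' x x' \<Longrightarrow> \<exists>h. matched ((\<lambda>(k, p). (p x, p x')) ` (\<lambda>g. (K g, Q g)) ` G) h"
    unfolding sign_stable_def by blast
  have imp: "\<exists>y. P (x'(i := y))" if eq: "sgn_eq G' x x'" and y: "P (x(i := y))" for x x' y
  proof -
    obtain h where "matched ((\<lambda>(k, p). (p x, p x')) ` (\<lambda>g. (K g, Q g)) ` G) h" using G'(3)[OF eq] by blast
    then have "sgn_eq G (x(i := y)) (x'(i := h y))"
      using KQ(2) by (auto simp: matched_def sgn_eq_def simp del: fun_upd_apply)
    then show ?thesis using G(3) y by blast
  qed
  have "sgn_eq G' x x' \<Longrightarrow> sgn_eq G' x' x" for x x' by (simp add: sgn_eq_def)
  then show ?thesis unfolding definable_def using G'(1,2) imp by (intro exI[of _ G'] conjI allI impI) blast+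
qed

section \<open>Bounded oscillation and definable selections\<close>

lemma definable_block_ex:
  "definable P \<Longrightarrow> definable (\<lambda>x. \<exists>v. (\<forall>i\<ge>M. v i = x i) \<and> P v)"
proof (induction M)
  case 0
  have "(\<exists>v. (\<forall>i\<ge>0. v i = x i) \<and> P v) = P x" for x :: "nat \<Rightarrow> real"
  proof
    assume "\<exists>v. (\<forall>i\<ge>0. v i = x i) \<and> P v"
    then obtain v where "\<forall>i. v i = x i" "P v" by auto
    then show "P x" by (metis ext)
  qed auto
  then show ?case using 0 by simp
next
  case (Suc M)
  have "(\<exists>v. (\<forall>i\<ge>Suc M. v i = x i) \<and> P v) = (\<exists>y v. (\<forall>i\<ge>M. v i = (x(M := y)) i) \<and> P v)" for x :: "nat \<Rightarrow> real"
  proof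
    assume "\<exists>v. (\<forall>i\<ge>Suc M. v i = x i) \<and> P v"
    then obtain v where "\<forall>i\<ge>Suc M. v i = x i" "P v" by auto
    then show "\<exists>y v. (\<forall>i\<ge>M. v i = (x(M := y)) i) \<and> P v" by (intro exI[of _ "v M"] exI[of _ v]) auto
  next
    assume "\<exists>y v. (\<forall>i\<ge>M. v i = (x(M := y)) i) \<and> P v"
    then obtain y v where "\<forall>i\<ge>M. v i = (x(M := y)) i" "P v" by blast
    then show "\<exists>v. (\<forall>i\<ge>Suc M. v i = x i) \<and> P v" by (intro exI[of _ v]) auto
  qed
  then show ?case using definable_ex[OF Suc.IH[OF Suc.prems], of M] by simp
qed

text \<open>Each sign change is charged to a root in the closed interval between two consecutive
  points. One root can serve two changes, when it is a common end of their intervals; recording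
  whether it is the upper end separates these, which gives the factor 2.\<close>

lemma card_poly_sign_changes_le:
  fixes q :: "real poly" and s :: "nat \<Rightarrow> real"
  assumes "\<And>j. j < k \<Longrightarrow> s (Suc j) \<le> s j"
  shows "card {j. j < k \<and> sgn (poly q (s j)) \<noteq> sgn (poly q (s (Suc j)))} \<le> 2 * degree q"
proof (cases "q = 0")
  case False
  define J where "J = {j. j < k \<and> sgn (poly q (s j)) \<noteq> sgn (poly q (s (Suc j)))}"
  have anti: "s j' \<le> s j" if "j \<le> j'" "j' \<le> k" for j j'
    using that
  proof (induction rule: dec_induct)
    case (step m)
    then show ?case using assms[of m] by simp
  qed simp
  have "\<exists>r. s (Suc j) \<le> r \<and> r \<le> s j \<and> poly q r = 0" if j: "j \<in> J" for j
  proof -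
    have lt: "s (Suc j) < s j" using assms[of j] j by (force simp: J_def order.order_iff_strict)
    show ?thesis
    proof (rule ccontr)
      assume "\<not> ?thesis"
      then have n: "\<And>r. s (Suc j) \<le> r \<Longrightarrow> r \<le> s j \<Longrightarrow> poly q r \<noteq> 0" by blast
      then have "poly q (s j) \<noteq> 0" "poly q (s (Suc j)) \<noteq> 0" using lt by auto
      then have "poly q (s (Suc j)) < 0 \<and> 0 < poly q (s j) \<or> 0 < poly q (s (Suc j)) \<and> poly q (s j) < 0"
        using j by (auto simp: J_def sgn_if split: if_splits)
      then obtain z where "s (Suc j) < z" "z < s j" "poly q z = 0"
        using poly_IVT_pos[OF lt, of q] poly_IVT_neg[OF lt, of q] by blast
      then show False using n[of z] by simp
    qed
  qed
  then obtain r where r: "\<And>j. j \<in> J \<Longrightarrow> s (Suc j) \<le> r j \<and> r j \<le> s j \<and> poly q (r j) = 0" by metis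
  have inj: "inj_on (\<lambda>j. (r j, r j = s j)) J"
  proof -
    have False if j: "j \<in> J" "j' \<in> J" "j < j'" "r j = r j'" "(r j = s j) = (r j' = s j')" for j j'
    proof -
      have "s j' \<le> s (Suc j)" using j by (intro anti) (auto simp: J_def)
      then have "r j' = s j'" "s j' = s (Suc j)" using r[OF j(1)] r[OF j(2)] j(4) by auto
      then have "s j = s (Suc j)" using j by simp
      then show False using j(1) by (simp add: J_def)
    qed
    then show ?thesis by (intro inj_onI) (metis linorder_neqE_nat prod.inject)
  qed
  have "card J = card ((\<lambda>j. (r j, r j = s j)) ` J)" using card_image[OF inj] by simp
  also have "\<dots> \<le> card ({x. poly q x = 0} \<times> (UNIV :: bool set))"
    using r poly_roots_finite[OF False] by (intro card_mono) auto
  also have "\<dots> \<le> 2 * degree q"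
    using card_poly_roots_bound[OF False] by (simp add: card_cartesian_product)
  finally show ?thesis unfolding J_def .
qed simp

text \<open>The number of changes is bounded through formal degrees, so \<open>N\<close> is
  independent of the parameters in \<open>x\<close>. This uniformity is what later permits
  integration over a threshold.\<close>

lemma definable_changes_bounded:
  assumes "definable P"
  shows "\<exists>N. \<forall>x k s. (\<forall>j<k. s (Suc j) \<le> s j) \<longrightarrow> card {j. j < k \<and> P (x(i := s j)) \<noteq> P (x(i := s (Suc j)))} \<le> N"
proof -
  obtain G where G: "finite G" "G \<subseteq> polyfun" "\<And>x x'. sgn_eq G x x' \<Longrightarrow> P x = P x'"
    using assms unfolding definable_def by metis
  have "\<forall>g\<in>G. \<exists>k p. ppoly k p \<and> (\<forall>x y. g (x(i := y)) = poly (p x) y)"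
    using G(2) polyfun_as_ppoly by blast
  then obtain K Q where KQ: "\<And>g. g \<in> G \<Longrightarrow> ppoly (K g) (Q g)"
    "\<And>g x y. g \<in> G \<Longrightarrow> g (x(i := y)) = poly (Q g x) y" by metis
  show ?thesis
  proof (intro exI[of _ "\<Sum>g\<in>G. 2 * K g"] allI impI)
    fix x k s assume s: "\<forall>j<k. s (Suc j) \<le> (s j :: real)"
    define J where "J = (\<lambda>g. {j. j < k \<and> sgn (poly (Q g x) (s j)) \<noteq> sgn (poly (Q g x) (s (Suc j)))})"
    have "{j. j < k \<and> P (x(i := s j)) \<noteq> P (x(i := s (Suc j)))} \<subseteq> (\<Union>g\<in>G. J g)"
    proof
      fix j assume j: "j \<in> {j. j < k \<and> P (x(i := s j)) \<noteq> P (x(i := s (Suc j)))}"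
      then have "\<not> sgn_eq G (x(i := s j)) (x(i := s (Suc j)))" using G(3) by blast
      then obtain g where "g \<in> G" "sgn (g (x(i := s j))) \<noteq> sgn (g (x(i := s (Suc j))))" unfolding sgn_eq_def by blast
      then show "j \<in> (\<Union>g\<in>G. J g)" using j KQ(2) by (auto simp: J_def simp del: fun_upd_apply)
    qed
    then have "card {j. j < k \<and> P (x(i := s j)) \<noteq> P (x(i := s (Suc j)))} \<le> card (\<Union>g\<in>G. J g)"
      using G(1) by (intro card_mono) (auto simp: J_def)
    also have "\<dots> \<le> (\<Sum>g\<in>G. card (J g))" by (rule card_UN_le[OF G(1)])
    also have "\<dots> \<le> (\<Sum>g\<in>G. 2 * K g)"
    proof (rule sum_mono)
      fix g assume "g \<in> G"
      then have "degree (Q g x) \<le> K g" using KQ(1) by (simp add: ppoly_def)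
      then show "card (J g) \<le> 2 * K g"
        unfolding J_def using card_poly_sign_changes_le[of k s "Q g x"] s by auto
    qed
    finally show "card {j. j < k \<and> P (x(i := s j)) \<noteq> P (x(i := s (Suc j)))} \<le> (\<Sum>g\<in>G. 2 * K g)" .
  qed
qed

text \<open>Coordinates below \<open>M\<close> are the unknowns; those from \<open>M\<close> on are
  parameters, fixed by \<open>b\<close>.\<close>

definition slice :: "nat \<Rightarrow> ((nat \<Rightarrow> real) \<Rightarrow> bool) \<Rightarrow> (nat \<Rightarrow> real) \<Rightarrow> (nat \<Rightarrow> real) set" where
  "slice M P b = {v. (\<forall>i\<ge>M. v i = b i) \<and> P v}"

definition argmin_pred :: "nat \<Rightarrow> ((nat \<Rightarrow> real) \<Rightarrow> real) \<Rightarrow> ((nat \<Rightarrow> real) \<Rightarrow> bool) \<Rightarrow> (nat \<Rightarrow> real) \<Rightarrow> bool" where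
  "argmin_pred M g P x \<longleftrightarrow> P x \<and> (\<forall>v. (\<forall>i\<ge>M. v i = x i) \<longrightarrow> P v \<longrightarrow> g x \<le> g v)"

definition indep_coord :: "nat \<Rightarrow> ((nat \<Rightarrow> real) \<Rightarrow> 'a) \<Rightarrow> bool" where
  "indep_coord e f \<longleftrightarrow> (\<forall>x c. f (x(e := c)) = f x)"

lemma indep_coord_argmin:
  assumes "indep_coord e P" "indep_coord e g" "M \<le> e"
  shows "indep_coord e (argmin_pred M g P)"
proof -
  have 1: "argmin_pred M g P (x(e := c))" if a: "argmin_pred M g P x" for x c
    unfolding argmin_pred_def
  proof (intro conjI allI impI)
    show "P (x(e := c))" using a assms by (simp add: argmin_pred_def indep_coord_def)
    fix v assume v: "\<forall>i\<ge>M. v i = (x(e := c)) i" "P v"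
    then have "g x \<le> g (v(e := x e))"
      using a assms unfolding argmin_pred_def indep_coord_def by (metis fun_upd_apply)
    then show "g (x(e := c)) \<le> g v" using assms by (simp add: indep_coord_def)
  qed
  show ?thesis unfolding indep_coord_def
  proof (intro allI)
    fix x c
    show "argmin_pred M g P (x(e := c)) = argmin_pred M g P x" using 1[of x c] 1[of "x(e := c)" "x e"] by auto
  qed
qed

text \<open>Elimination of a block of unknowns hides the point \<open>x\<close> except for its
  parameters. The value \<open>g x\<close> is therefore stored in a spare coordinate
  \<open>e\<close> beyond the block, where it remains visible under the quantifier.\<close>

lemma definable_argmin:
  assumes "definable P" "g \<in> polyfun" "indep_coord e P" "indep_coord e g" "M \<le> e"
  shows "definable (argmin_pred M g P)"
proof -
  define R where "R = (\<lambda>y. \<exists>v. (\<forall>i\<ge>M. v i = y i) \<and> (P v \<and> g v < v e))"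
  have "definable R" unfolding R_def
    by (intro definable_block_ex definable_conj definable_less assms polyfun.coord)
  then have "definable (\<lambda>x. P x \<and> \<not> R (x(e := g x)))"
    by (intro definable_conj definable_not assms definable_subst)
  also have "(\<lambda>x. P x \<and> \<not> R (x(e := g x))) = argmin_pred M g P"
  proof
    fix x
    have "R (x(e := g x)) \<longleftrightarrow> (\<exists>v. (\<forall>i\<ge>M. v i = x i) \<and> P v \<and> g v < g x)" (is "_ \<longleftrightarrow> ?R")
    proof
      assume "R (x(e := g x))"
      then obtain v where v: "\<forall>i\<ge>M. v i = (x(e := g x)) i" "P v" "g v < v e" unfolding R_def by blast
      have "g v < g x" using v assms(5) by auto
      then show ?R using v assms(3,4) unfolding indep_coord_def
        by (intro exI[of _ "v(e := x e)"]) auto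
    next
      assume ?R
      then obtain v where "\<forall>i\<ge>M. v i = x i" "P v" "g v < g x" by blast
      then show "R (x(e := g x))" unfolding R_def using assms(3,4) unfolding indep_coord_def
        by (intro exI[of _ "v(e := g x)"]) auto
    qed
    then show "(P x \<and> \<not> R (x(e := g x))) = argmin_pred M g P x"
      unfolding argmin_pred_def by (meson not_le)
  qed
  finally show ?thesis .
qed

lemma slice_argmin: "slice M (argmin_pred M g P) b = {v\<in>slice M P b. \<forall>w\<in>slice M P b. g v \<le> g w}"
  unfolding slice_def argmin_pred_def by auto

lemma continuous_polyfun: "f \<in> polyfun \<Longrightarrow> continuous_on UNIV f"
  by (induction rule: polyfun.induct) (auto intro!: continuous_intros continuous_on_product_coordinates)

lemma compact_slice_argmin:
  assumes "compact (slice M P b)" "g \<in> polyfun"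
  shows "compact (slice M (argmin_pred M g P) b)"
    and "slice M P b \<noteq> {} \<Longrightarrow> slice M (argmin_pred M g P) b \<noteq> {}"
proof -
  have c: "continuous_on (slice M P b) g" using continuous_polyfun[OF assms(2)] continuous_on_subset by blast
  have ne: "\<exists>v\<in>slice M P b. \<forall>w\<in>slice M P b. g v \<le> g w" if "slice M P b \<noteq> {}"
    using continuous_attains_inf[OF assms(1) that c] .
  then show "slice M P b \<noteq> {} \<Longrightarrow> slice M (argmin_pred M g P) b \<noteq> {}" unfolding slice_argmin by blast
  show "compact (slice M (argmin_pred M g P) b)"
  proof (cases "slice M P b = {}")
    case True
    then show ?thesis unfolding slice_argmin by simp
  next
    case False
    then obtain v where v: "v \<in> slice M P b" "\<forall>w\<in>slice M P b. g v \<le> g w" using ne by blast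
    then have "slice M (argmin_pred M g P) b = slice M P b \<inter> {w. g w \<le> g v}"
      unfolding slice_argmin by (auto intro: order_trans)
    moreover have "closed {w. g w \<le> g v}"
      by (intro closed_Collect_le continuous_polyfun[OF assms(2)] continuous_on_const)
    ultimately show ?thesis using compact_Int_closed[OF assms(1)] by simp
  qed
qed

text \<open>Minimizing the coordinates one after another selects the lexicographically least point
  of a compact slice, so that a choice function with a definable graph is obtained.\<close>

primrec lexmin :: "nat \<Rightarrow> ((nat \<Rightarrow> real) \<Rightarrow> bool) \<Rightarrow> nat \<Rightarrow> (nat \<Rightarrow> real) \<Rightarrow> bool" where
  "lexmin M P 0 = P"
| "lexmin M P (Suc j) = argmin_pred M (\<lambda>x. x j) (lexmin M P j)"

lemma lexmin_props:
  assumes "definable P" "indep_coord e P" "M \<le> e" "k \<le> M"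
  shows "definable (lexmin M P k) \<and> indep_coord e (lexmin M P k)"
  using assms(4)
proof (induction k)
  case (Suc k)
  have "indep_coord e (\<lambda>x. x k :: real)" using Suc.prems assms(3) by (auto simp: indep_coord_def)
  then show ?case using Suc assms by (auto intro!: definable_argmin[of _ _ e] indep_coord_argmin polyfun.coord)
qed (use assms in simp)

lemma lexmin_slice:
  assumes "compact (slice M P b)"
  shows "compact (slice M (lexmin M P k) b) \<and> (slice M P b \<noteq> {} \<longrightarrow> slice M (lexmin M P k) b \<noteq> {})
     \<and> slice M (lexmin M P k) b \<subseteq> slice M P b
     \<and> (\<forall>v\<in>slice M (lexmin M P k) b. \<forall>w\<in>slice M (lexmin M P k) b. \<forall>i<k. v i = w i)"
proof (induction k)
  case (Suc k)
  have "v i = w i" if "v \<in> slice M (lexmin M P (Suc k)) b" "w \<in> slice M (lexmin M P (Suc k)) b" "i < Suc k" for v w i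
    using that Suc unfolding lexmin.simps slice_argmin by (cases "i = k") (auto intro: order.antisym)
  moreover have "slice M (lexmin M P (Suc k)) b \<subseteq> slice M P b"
    using Suc unfolding lexmin.simps slice_argmin by auto
  moreover have "compact (slice M (lexmin M P (Suc k)) b)"
    "slice M P b \<noteq> {} \<Longrightarrow> slice M (lexmin M P (Suc k)) b \<noteq> {}"
    using compact_slice_argmin[of M "lexmin M P k" b "\<lambda>x. x k"] Suc by (auto intro: polyfun.coord)
  ultimately show ?case by blast
qed (use assms in auto)

definition level_point :: "nat \<Rightarrow> real \<Rightarrow> nat \<Rightarrow> real" where
  "level_point M s = (\<lambda>i. if i = M then s else 0)"

text \<open>The curve takes the lexicographically least among the minimizers of \<open>g\<close>.
  Its graph is then definable, and so is the predicate that coordinate \<open>i\<close> of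
  \<open>X s\<close> exceeds \<open>c\<close>, with \<open>s\<close> and \<open>c\<close> both as
  parameters. Hence the number of crossings of a threshold is bounded uniformly in the
  threshold.\<close>

theorem definable_selection:
  assumes P: "definable P" "indep_coord (Suc M) P" and g: "g \<in> polyfun" "indep_coord (Suc M) g"
    and comp: "\<And>s. compact (slice M P (level_point M s))"
  obtains X N where
    "\<And>s. slice M P (level_point M s) \<noteq> {} \<Longrightarrow> X s \<in> slice M P (level_point M s)"
    "\<And>s w. w \<in> slice M P (level_point M s) \<Longrightarrow> g (X s) \<le> g w"
    "\<And>i c s k. i < M \<Longrightarrow> (\<forall>j<k. s (Suc j) \<le> s j) \<Longrightarrow> (\<forall>j\<le>k. slice M P (level_point M (s j)) \<noteq> {})
       \<Longrightarrow> card {j. j < k \<and> (c < X (s j) i) \<noteq> (c < X (s (Suc j)) i)} \<le> N"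
proof -
  let ?lev = "level_point M"
  define P0 where "P0 = argmin_pred M g P"
  define P1 where "P1 = lexmin M P0 M"
  have P0: "definable P0" "indep_coord (Suc M) P0" unfolding P0_def
    by (intro definable_argmin[of P g "Suc M"] indep_coord_argmin assms; simp)+
  have P1: "definable P1" "indep_coord (Suc M) P1"
    unfolding P1_def using lexmin_props[OF P0, of M M] by auto
  have c0: "compact (slice M P0 (?lev s))" "slice M P (?lev s) \<noteq> {} \<Longrightarrow> slice M P0 (?lev s) \<noteq> {}" for s
    unfolding P0_def using compact_slice_argmin[OF comp g(1)] by auto
  have l: "slice M P0 (?lev s) \<noteq> {} \<Longrightarrow> slice M P1 (?lev s) \<noteq> {}"
    "slice M P1 (?lev s) \<subseteq> slice M P0 (?lev s)"
    "\<And>v w i. v \<in> slice M P1 (?lev s) \<Longrightarrow> w \<in> slice M P1 (?lev s) \<Longrightarrow> i < M \<Longrightarrow> v i = w i" for s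
    using lexmin_slice[OF c0(1)[of s], of M] unfolding P1_def by simp_all
  define X where "X = (\<lambda>s. SOME v. v \<in> slice M P1 (?lev s))"
  have X1: "X s \<in> slice M P1 (?lev s)" if "slice M P (?lev s) \<noteq> {}" for s
  proof -
    have "slice M P1 (?lev s) \<noteq> {}" using l(1)[OF c0(2)[OF that]] .
    then show ?thesis unfolding X_def by (simp add: some_in_eq)
  qed
  have X0: "X s \<in> slice M P0 (?lev s)" if "slice M P (?lev s) \<noteq> {}" for s
    using X1[OF that] l(2) by blast
  \<comment> \<open>Coordinate \<open>M\<close> carries the level \<open>s\<close> and coordinate
    \<open>Suc M\<close> the threshold. The selected point is unique in the coordinates below
    \<open>M\<close>, so the existential quantifier speaks about \<open>X s\<close>.\<close>
  define D where "D = (\<lambda>i x. \<exists>v. (\<forall>k\<ge>M. v k = x k) \<and> (P1 v \<and> v (Suc M) < v i))"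
  have "definable (D i)" for i unfolding D_def
    by (intro definable_block_ex definable_conj definable_less polyfun.coord P1)
  then have "\<forall>i. \<exists>N. \<forall>x k s. (\<forall>j<k. s (Suc j) \<le> s j) \<longrightarrow> card {j. j < k \<and> D i (x(M := s j)) \<noteq> D i (x(M := s (Suc j)))} \<le> N"
    by (intro allI definable_changes_bounded)
  from choice[OF this] obtain N where
    N: "\<And>i x k s. (\<forall>j<k. s (Suc j) \<le> s j) \<Longrightarrow> card {j. j < k \<and> D i (x(M := s j)) \<noteq> D i (x(M := s (Suc j)))} \<le> N i"
    by blast
  have D: "D i ((\<lambda>k. if k = Suc M then c else 0)(M := s)) \<longleftrightarrow> c < X s i"
    if i: "i < M" and ne: "slice M P (?lev s) \<noteq> {}" for i c s
  proof
    assume "D i ((\<lambda>k. if k = Suc M then c else 0)(M := s))"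
    then obtain v where v: "\<forall>k\<ge>M. v k = ((\<lambda>k. if k = Suc M then c else 0)(M := s)) k" "P1 v" "v (Suc M) < v i"
      unfolding D_def by blast
    have "v(Suc M := 0) \<in> slice M P1 (?lev s)"
      using v P1(2) by (auto simp: slice_def level_point_def indep_coord_def)
    then have "(v(Suc M := 0)) i = X s i" by (rule l(3)[OF _ X1[OF ne] i])
    then show "c < X s i" using v i by auto
  next
    assume "c < X s i"
    then show "D i ((\<lambda>k. if k = Suc M then c else 0)(M := s))"
      unfolding D_def using X1[OF ne] P1(2) i
      by (intro exI[of _ "(X s)(Suc M := c)"]) (auto simp: slice_def level_point_def indep_coord_def)
  qed
  show thesis
  proof (rule that[of X "\<Sum>i<M. N i"])
    show "X s \<in> slice M P (?lev s)" if "slice M P (?lev s) \<noteq> {}" for s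
      using X0[OF that] unfolding P0_def slice_argmin by blast
    show "g (X s) \<le> g w" if "w \<in> slice M P (?lev s)" for s w
      using X0[of s] that unfolding P0_def slice_argmin by blast
    fix i c s k assume a: "i < M" "\<forall>j<k. s (Suc j) \<le> s j" "\<forall>j\<le>k. slice M P (?lev (s j)) \<noteq> {}"
    define x where "x = (\<lambda>k. if k = Suc M then c else 0 :: real)"
    have "{j. j < k \<and> (c < X (s j) i) \<noteq> (c < X (s (Suc j)) i)} = {j. j < k \<and> D i (x(M := s j)) \<noteq> D i (x(M := s (Suc j)))}"
      unfolding x_def using D[OF a(1)] a(3) by (intro Collect_cong conj_cong refl) simp
    also have "card \<dots> \<le> N i" using N a(2) by blast
    also have "\<dots> \<le> (\<Sum>i<M. N i)" using a(1) by (intro member_le_sum) auto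
    finally show "card {j. j < k \<and> (c < X (s j) i) \<noteq> (c < X (s (Suc j)) i)} \<le> (\<Sum>i<M. N i)" .
  qed
qed

text \<open>This is the Banach indicatrix: the total variation is the integral over \<open>c\<close>
  of the number of crossings of the level \<open>c\<close>. Only levels in an interval of length 2
  are crossed.\<close>

lemma variation_le_of_crossings:
  fixes y :: "nat \<Rightarrow> real"
  assumes "\<And>j. j \<le> k \<Longrightarrow> \<bar>y j\<bar> \<le> 1"
    and N: "\<And>c. card {j. j < k \<and> (c < y j) \<noteq> (c < y (Suc j))} \<le> N"
  shows "(\<Sum>j<k. \<bar>y (Suc j) - y j\<bar>) \<le> 2 * real N"
proof -
  define I where "I = (\<lambda>j. {min (y j) (y (Suc j))..<max (y j) (y (Suc j))})"
  have I: "((\<lambda>c. if c \<in> I j then 1 else 0 :: real) has_integral \<bar>y (Suc j) - y j\<bar>) UNIV" for j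
  proof -
    have "((\<lambda>c. 1 :: real) has_integral measure lborel (I j)) (I j)"
      unfolding I_def by (intro has_integral_measure_lborel) auto
    moreover have "measure lborel (I j) = \<bar>y (Suc j) - y j\<bar>" by (auto simp: I_def min_def max_def)
    ultimately show ?thesis by (subst has_integral_restrict_UNIV) simp
  qed
  have 1: "((\<lambda>c. \<Sum>j<k. if c \<in> I j then 1 else 0 :: real) has_integral (\<Sum>j<k. \<bar>y (Suc j) - y j\<bar>)) UNIV"
    by (intro has_integral_sum I) auto
  have "((\<lambda>c. real N) has_integral (2 * real N)) {-1..1::real}"
    using has_integral_const_real[of "real N" "-1" 1] by simp
  then have 2: "((\<lambda>c. if c \<in> {-1..1::real} then real N else 0) has_integral (2 * real N)) UNIV"
    by (subst has_integral_restrict_UNIV) (simp add: mult.commute)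
  show ?thesis
  proof (rule has_integral_le[OF 1 2])
    fix c :: real
    have eq: "c \<in> I j \<longleftrightarrow> (c < y j) \<noteq> (c < y (Suc j))" for j by (auto simp: I_def)
    have "(\<Sum>j<k. if c \<in> I j then 1 else 0 :: real) = card {j. j < k \<and> (c < y j) \<noteq> (c < y (Suc j))}"
      unfolding eq by (simp add: sum.If_cases Int_def lessThan_def)
    also have "\<dots> \<le> (if c \<in> {-1..1} then real N else 0)"
    proof (cases "c \<in> {-1..1}")
      case True
      then show ?thesis using N[of c] by simp
    next
      case False
      have "{j. j < k \<and> (c < y j) \<noteq> (c < y (Suc j))} = {}"
      proof -
        have "(c < y j) = (c < y (Suc j))" if "j < k" for j
          using assms(1)[of j] assms(1)[of "Suc j"] that False by auto
        then show ?thesis by auto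
      qed
      then show ?thesis using False by (simp only: card.empty) simp
    qed
    finally show "(\<Sum>j<k. if c \<in> I j then 1 else 0 :: real) \<le> (if c \<in> {-1..1} then real N else 0)" .
  qed
qed

section \<open>Every trajectory converges\<close>

definition kgrad :: "nat \<Rightarrow> nat set set \<Rightarrow> (nat \<Rightarrow> real) \<Rightarrow> nat \<Rightarrow> real" where
  "kgrad n E \<theta> u = (\<Sum>v<n. adj E u v * sin (\<theta> u - \<theta> v))"

lemma abs_sin_diff_le: "\<bar>sin a - sin b\<bar> \<le> \<bar>a - b :: real\<bar>"
proof -
  have "norm (sin a - sin b) \<le> 1 * norm (a - b)"
    by (rule field_differentiable_bound[of UNIV sin cos]) (auto intro!: derivative_eq_intros)
  then show ?thesis by simp
qed

lemma kgrad_lipschitz: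
  assumes "\<And>v. v < n \<Longrightarrow> \<bar>\<phi> v - \<psi> v\<bar> \<le> K" "u < n"
  shows "\<bar>kgrad n E \<phi> u - kgrad n E \<psi> u\<bar> \<le> 2 * real n * K"
proof -
  have "\<bar>kgrad n E \<phi> u - kgrad n E \<psi> u\<bar> = \<bar>\<Sum>v<n. adj E u v * (sin (\<phi> u - \<phi> v) - sin (\<psi> u - \<psi> v))\<bar>"
    by (simp add: kgrad_def sum_subtractf right_diff_distrib)
  also have "\<dots> \<le> (\<Sum>v<n. \<bar>adj E u v * (sin (\<phi> u - \<phi> v) - sin (\<psi> u - \<psi> v))\<bar>)" by (rule sum_abs)
  also have "\<dots> \<le> (\<Sum>v<n. 2 * K)"
  proof (rule sum_mono)
    fix v assume "v \<in> {..<n}"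
    then have "\<bar>sin (\<phi> u - \<phi> v) - sin (\<psi> u - \<psi> v)\<bar> \<le> 2 * K"
      using abs_sin_diff_le[of "\<phi> u - \<phi> v" "\<psi> u - \<psi> v"] assms(1)[of u] assms(1)[of v] assms(2) by simp
    moreover have "\<bar>adj E u v * (sin (\<phi> u - \<phi> v) - sin (\<psi> u - \<psi> v))\<bar> \<le> 1 * \<bar>sin (\<phi> u - \<phi> v) - sin (\<psi> u - \<psi> v)\<bar>"
      unfolding abs_mult using adj_nonneg[of E u v] adj_le_1[of E u v] by (intro mult_right_mono) auto
    ultimately show "\<bar>adj E u v * (sin (\<phi> u - \<phi> v) - sin (\<psi> u - \<psi> v))\<bar> \<le> 2 * K" by simp
  qed
  finally show ?thesis by simp
qed

lemma sum_antisym_adj: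
  "(\<Sum>u<n. \<Sum>v<n. adj E u v * (sin (\<phi> u - \<phi> v) * (a u - a v))) = 2 * (\<Sum>u<n. kgrad n E \<phi> u * a u)"
proof -
  have "(\<Sum>u<n. \<Sum>v<n. adj E u v * (sin (\<phi> u - \<phi> v) * (a u - a v)))
      = (\<Sum>u<n. \<Sum>v<n. adj E u v * sin (\<phi> u - \<phi> v) * a u) - (\<Sum>u<n. \<Sum>v<n. adj E u v * sin (\<phi> u - \<phi> v) * a v)"
    by (simp add: sum_subtractf[symmetric] right_diff_distrib mult.assoc)
  also have "(\<Sum>u<n. \<Sum>v<n. adj E u v * sin (\<phi> u - \<phi> v) * a v) = (\<Sum>v<n. \<Sum>u<n. adj E u v * sin (\<phi> u - \<phi> v) * a v)"
    by (rule sum.swap)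
  also have "\<dots> = (\<Sum>v<n. \<Sum>u<n. - (adj E v u * sin (\<phi> v - \<phi> u) * a v))"
  proof (intro sum.cong refl)
    fix u v show "adj E u v * sin (\<phi> u - \<phi> v) * a v = - (adj E v u * sin (\<phi> v - \<phi> u) * a v)"
      using sin_minus[of "\<phi> u - \<phi> v"] adj_sym[of E u v] by simp
  qed
  also have "(\<Sum>u<n. \<Sum>v<n. adj E u v * sin (\<phi> u - \<phi> v) * a u) = (\<Sum>u<n. kgrad n E \<phi> u * a u)"
    by (simp add: kgrad_def sum_distrib_right)
  also have "(\<Sum>v<n. \<Sum>u<n. - (adj E v u * sin (\<phi> v - \<phi> u) * a v)) = - (\<Sum>u<n. kgrad n E \<phi> u * a u)"
    by (simp add: kgrad_def sum_distrib_right sum_negf)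
  finally show ?thesis by simp
qed

lemma one_minus_cos_diff_le: "1 - cos (a - b) \<le> 2 * (1 - cos a) + 2 * (1 - cos (b::real))"
proof -
  have "0 \<le> (cos a + cos b - 2)\<^sup>2 + (sin a + sin b)\<^sup>2" by simp
  also have "\<dots> = ((cos a)\<^sup>2 + (sin a)\<^sup>2) + ((cos b)\<^sup>2 + (sin b)\<^sup>2) + 2 * cos (a - b) - 4 * cos a - 4 * cos b + 4"
    unfolding cos_diff power2_eq_square by (simp only: algebra_simps)
  finally show ?thesis by simp
qed

text \<open>Distance on the circle measured in the coordinates \<open>(cos, sin)\<close>. Points of
  the definable curve are known only through these coordinates, so their angles may jump by
  multiples of \<open>2 * pi\<close> and a difference of angles would be meaningless.\<close>

definition chord :: "real \<Rightarrow> real \<Rightarrow> real" where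
  "chord a b = \<bar>cos a - cos b\<bar> + \<bar>sin a - sin b\<bar>"

lemma chord_bounds:
  shows "2 * (1 - cos (a - b)) \<le> (chord a b)\<^sup>2" "\<bar>sin (a - b)\<bar> \<le> chord a b" "1 - cos (a - b) \<le> chord a b"
proof -
  define \<kappa> where "\<kappa> = chord a b"
  have k0: "0 \<le> \<kappa>" by (simp add: \<kappa>_def chord_def)
  have "2 * (1 - cos (a - b)) = ((cos a)\<^sup>2 + (sin a)\<^sup>2) + ((cos b)\<^sup>2 + (sin b)\<^sup>2) - 2 * cos (a - b)" by simp
  also have "\<dots> = \<bar>cos a - cos b\<bar>\<^sup>2 + \<bar>sin a - sin b\<bar>\<^sup>2"
    unfolding cos_diff by (simp add: power2_eq_square algebra_simps)
  also have "\<dots> \<le> \<kappa>\<^sup>2" unfolding \<kappa>_def chord_def power2_sum by simp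
  finally have 1: "2 * (1 - cos (a - b)) \<le> \<kappa>\<^sup>2" .
  have c: "0 \<le> 1 - cos (a - b)" "1 - cos (a - b) \<le> 2" using cos_ge_minus_one[of "a - b"] by auto
  have "(sin (a - b))\<^sup>2 = (1 - cos (a - b)) * (1 + cos (a - b))"
    using sin_cos_squared_add[of "a - b"] by (simp add: power2_eq_square algebra_simps)
  also have "\<dots> \<le> (1 - cos (a - b)) * 2" using c by (intro mult_left_mono) auto
  finally have "\<bar>sin (a - b)\<bar>\<^sup>2 \<le> \<kappa>\<^sup>2" using 1 by simp
  then show "\<bar>sin (a - b)\<bar> \<le> chord a b" using k0 unfolding \<kappa>_def by (rule power2_le_imp_le)
  have "(1 - cos (a - b))\<^sup>2 \<le> (1 - cos (a - b)) * 2" unfolding power2_eq_square using c by (intro mult_left_mono) auto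
  then have "(1 - cos (a - b))\<^sup>2 \<le> \<kappa>\<^sup>2" using 1 by simp
  then show "1 - cos (a - b) \<le> chord a b" using k0 unfolding \<kappa>_def by (rule power2_le_imp_le)
  show "2 * (1 - cos (a - b)) \<le> (chord a b)\<^sup>2" using 1 by (simp add: \<kappa>_def)
qed

text \<open>A Taylor estimate in chordal terms: the linear part pairs the gradient with
  \<open>sin (\<delta> u)\<close> instead of \<open>\<delta> u\<close>, and the remainder
  \<open>R\<close> contains only products of two factors among \<open>sin \<delta>\<close> and
  \<open>1 - cos \<delta>\<close> or a term \<open>1 - cos (\<delta> u - \<delta> v)\<close>, all
  quadratic in the chords.\<close>

lemma energy_diff_le:
  fixes n :: nat and \<phi> \<psi> :: "nat \<Rightarrow> real"
  assumes G: "\<And>u. u < n \<Longrightarrow> \<bar>kgrad n E \<phi> u\<bar> \<le> G"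
  defines "D \<equiv> (\<Sum>u<n. chord (\<psi> u) (\<phi> u))"
  shows "\<bar>kuramoto_energy {..<n} E \<psi> - kuramoto_energy {..<n} E \<phi>\<bar> \<le> G * D + (real n + 1) * D\<^sup>2"
proof -
  let ?A = "adj E"
  define \<kappa> where "\<kappa> = (\<lambda>u. chord (\<psi> u) (\<phi> u))"
  define \<delta> where "\<delta> = (\<lambda>u. \<psi> u - \<phi> u)"
  have D: "D = (\<Sum>u<n. \<kappa> u)" by (simp add: D_def \<kappa>_def)
  have k0: "0 \<le> \<kappa> u" for u by (simp add: \<kappa>_def chord_def)
  have k: "2 * (1 - cos (\<delta> u)) \<le> (\<kappa> u)\<^sup>2" "\<bar>sin (\<delta> u)\<bar> \<le> \<kappa> u" "1 - cos (\<delta> u) \<le> \<kappa> u" for u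
    unfolding \<kappa>_def \<delta>_def by (rule chord_bounds)+
  have c: "0 \<le> 1 - cos (\<delta> u)" for u by simp
  define R where "R = (\<lambda>u v. cos (\<phi> u - \<phi> v) * (1 - cos (\<delta> u - \<delta> v))
      + sin (\<phi> u - \<phi> v) * (sin (\<delta> v) * (1 - cos (\<delta> u)) - sin (\<delta> u) * (1 - cos (\<delta> v))))"
  have pt: "cos (\<phi> u - \<phi> v) - cos (\<psi> u - \<psi> v) = sin (\<phi> u - \<phi> v) * (sin (\<delta> u) - sin (\<delta> v)) + R u v" for u v
  proof -
    have "cos (\<psi> u - \<psi> v) = cos ((\<phi> u - \<phi> v) + (\<delta> u - \<delta> v))" by (simp add: \<delta>_def)
    also have "\<dots> = cos (\<phi> u - \<phi> v) * cos (\<delta> u - \<delta> v) - sin (\<phi> u - \<phi> v) * sin (\<delta> u - \<delta> v)" by (rule cos_add)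
    finally show ?thesis unfolding R_def sin_diff[of "\<delta> u" "\<delta> v"] by (simp add: algebra_simps)
  qed
  have "kuramoto_energy {..<n} E \<psi> - kuramoto_energy {..<n} E \<phi>
      = (1/2) * (\<Sum>u<n. \<Sum>v<n. ?A u v * (cos (\<phi> u - \<phi> v) - cos (\<psi> u - \<psi> v)))"
    by (simp add: kuramoto_energy_def sum_subtractf[symmetric] right_diff_distrib algebra_simps diff_divide_distrib[symmetric])
  also have "\<dots> = (1/2) * (\<Sum>u<n. \<Sum>v<n. ?A u v * (sin (\<phi> u - \<phi> v) * (sin (\<delta> u) - sin (\<delta> v))))
      + (1/2) * (\<Sum>u<n. \<Sum>v<n. ?A u v * R u v)"
    unfolding pt by (simp add: distrib_left sum.distrib)
  also have "(1/2) * (\<Sum>u<n. \<Sum>v<n. ?A u v * (sin (\<phi> u - \<phi> v) * (sin (\<delta> u) - sin (\<delta> v))))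
      = (\<Sum>u<n. kgrad n E \<phi> u * sin (\<delta> u))"
    unfolding sum_antisym_adj by simp
  finally have eq: "kuramoto_energy {..<n} E \<psi> - kuramoto_energy {..<n} E \<phi>
      = (\<Sum>u<n. kgrad n E \<phi> u * sin (\<delta> u)) + (1/2) * (\<Sum>u<n. \<Sum>v<n. ?A u v * R u v)" .
  have "\<bar>\<Sum>u<n. kgrad n E \<phi> u * sin (\<delta> u)\<bar> \<le> (\<Sum>u<n. G * \<kappa> u)"
  proof (rule order_trans[OF sum_abs], rule sum_mono)
    fix u assume "u \<in> {..<n}"
    then have "\<bar>kgrad n E \<phi> u\<bar> \<le> G" using G by simp
    then show "\<bar>kgrad n E \<phi> u * sin (\<delta> u)\<bar> \<le> G * \<kappa> u"
      unfolding abs_mult using k(2)[of u] by (intro mult_mono) auto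
  qed
  then have 1: "\<bar>\<Sum>u<n. kgrad n E \<phi> u * sin (\<delta> u)\<bar> \<le> G * D" by (simp add: D sum_distrib_left)
  have Rb: "\<bar>?A u v * R u v\<bar> \<le> (\<kappa> u)\<^sup>2 + (\<kappa> v)\<^sup>2 + 2 * (\<kappa> u * \<kappa> v)" for u v
  proof -
    have a: "\<bar>cos (\<phi> u - \<phi> v) * (1 - cos (\<delta> u - \<delta> v))\<bar> \<le> (\<kappa> u)\<^sup>2 + (\<kappa> v)\<^sup>2"
    proof -
      have "\<bar>cos (\<phi> u - \<phi> v) * (1 - cos (\<delta> u - \<delta> v))\<bar> \<le> 1 * (1 - cos (\<delta> u - \<delta> v))"
        unfolding abs_mult by (intro mult_mono) auto
      then show ?thesis
        using order_trans[OF one_minus_cos_diff_le[of "\<delta> u" "\<delta> v"] add_mono[OF k(1)[of u] k(1)[of v]]]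
        by (simp only: mult_1 order_trans)
    qed
    have b: "\<bar>sin (\<delta> a) * (1 - cos (\<delta> b))\<bar> \<le> \<kappa> a * \<kappa> b" for a b
      unfolding abs_mult using k(2)[of a] k(3)[of b] c[of b] k0[of a] by (intro mult_mono) auto
    have "\<bar>sin (\<phi> u - \<phi> v) * (sin (\<delta> v) * (1 - cos (\<delta> u)) - sin (\<delta> u) * (1 - cos (\<delta> v)))\<bar>
        \<le> 1 * \<bar>sin (\<delta> v) * (1 - cos (\<delta> u)) - sin (\<delta> u) * (1 - cos (\<delta> v))\<bar>"
      unfolding abs_mult by (intro mult_right_mono) auto
    also have "\<dots> \<le> 2 * (\<kappa> u * \<kappa> v)" using b[of u v] b[of v u] by (simp add: mult.commute)
    finally have "\<bar>R u v\<bar> \<le> (\<kappa> u)\<^sup>2 + (\<kappa> v)\<^sup>2 + 2 * (\<kappa> u * \<kappa> v)" using a unfolding R_def by linarith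
    moreover have "\<bar>?A u v * R u v\<bar> \<le> 1 * \<bar>R u v\<bar>"
      unfolding abs_mult using adj_nonneg[of E u v] adj_le_1[of E u v] by (intro mult_right_mono) auto
    ultimately show ?thesis by simp
  qed
  have "\<bar>\<Sum>u<n. \<Sum>v<n. ?A u v * R u v\<bar> \<le> (\<Sum>u<n. \<Sum>v<n. (\<kappa> u)\<^sup>2 + (\<kappa> v)\<^sup>2 + 2 * (\<kappa> u * \<kappa> v))"
    by (intro order_trans[OF sum_abs] sum_mono Rb)
  also have "\<dots> = 2 * real n * (\<Sum>u<n. (\<kappa> u)\<^sup>2) + 2 * D\<^sup>2"
    by (simp add: sum.distrib D power2_eq_square sum_product sum_distrib_left mult_ac)
  also have "\<dots> \<le> 2 * real n * D\<^sup>2 + 2 * D\<^sup>2"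
  proof -
    have D0: "0 \<le> D" unfolding D by (intro sum_nonneg k0)
    have kD: "\<kappa> u \<le> D" if "u < n" for u unfolding D using that k0 by (intro member_le_sum) auto
    have "(\<Sum>u<n. (\<kappa> u)\<^sup>2) \<le> (\<Sum>u<n. \<kappa> u * D)"
      unfolding power2_eq_square using kD k0 by (intro sum_mono mult_left_mono) auto
    also have "\<dots> = D\<^sup>2" by (simp add: D sum_distrib_right power2_eq_square)
    finally show ?thesis by (intro add_right_mono mult_left_mono) auto
  qed
  finally have 2: "\<bar>(1/2) * (\<Sum>u<n. \<Sum>v<n. ?A u v * R u v)\<bar> \<le> (real n + 1) * D\<^sup>2"
    unfolding abs_mult by (simp add: algebra_simps)
  show ?thesis unfolding eq using 1 2 by linarith
qed

lemma has_real_derivative_mvt: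
  fixes f :: "real \<Rightarrow> real"
  assumes "\<And>t. 0 \<le> t \<Longrightarrow> (f has_real_derivative f' t) (at t within {0..})" "0 \<le> a" "a \<le> b"
  shows "\<exists>x\<in>{a..b}. f b - f a = f' x * (b - a)"
proof -
  have "\<exists>x\<in>{a..b}. f b - f a = (*) (f' x) (b - a)"
  proof (rule mvt_very_simple[OF assms(3)])
    fix x assume "a \<le> x" "x \<le> b"
    then have "(f has_real_derivative f' x) (at x within {a..b})"
      using assms by (intro has_field_derivative_subset[OF assms(1)]) auto
    then show "(f has_derivative (*) (f' x)) (at x within {a..b})" by (simp add: has_field_derivative_def)
  qed
  then show ?thesis .
qed

section \<open>The gradient flow observed at equally spaced times\<close>

locale kuramoto_trajectory =
  fixes n :: nat and E :: "nat set set" and \<theta> :: "real \<Rightarrow> nat \<Rightarrow> real"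
  assumes sol: "kuramoto_solution {..<n} E \<theta>" and n0: "0 < n"
begin

lemma deriv: "u < n \<Longrightarrow> 0 \<le> t \<Longrightarrow> ((\<lambda>s. \<theta> s u) has_real_derivative - kgrad n E (\<theta> t) u) (at t within {0..})"
  using sol by (simp add: kuramoto_solution_def kgrad_def)

lemma deriv_energy:
  assumes "0 \<le> t"
  shows "((\<lambda>s. kuramoto_energy {..<n} E (\<theta> s)) has_real_derivative - (\<Sum>u<n. (kgrad n E (\<theta> t) u)\<^sup>2)) (at t within {0..})"
proof -
  have "((\<lambda>s. kuramoto_energy {..<n} E (\<theta> s)) has_real_derivative
      (1/2) * (\<Sum>u<n. \<Sum>v<n. adj E u v * (sin (\<theta> t u - \<theta> t v) * (- kgrad n E (\<theta> t) u - - kgrad n E (\<theta> t) v)))) (at t within {0..})"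
    unfolding kuramoto_energy_def
  proof (intro DERIV_cmult DERIV_sum)
    fix u v assume "u \<in> {..<n}" "v \<in> {..<n}"
    then show "((\<lambda>s. 1 - cos (\<theta> s u - \<theta> s v)) has_real_derivative
       sin (\<theta> t u - \<theta> t v) * (- kgrad n E (\<theta> t) u - - kgrad n E (\<theta> t) v)) (at t within {0..})"
      using assms by (auto intro!: derivative_eq_intros deriv)
  qed
  then show ?thesis
    unfolding sum_antisym_adj
    by (simp add: power2_eq_square sum_negf)
qed

definition B :: "real \<Rightarrow> real" where "B t = (\<Sum>u<n. \<bar>kgrad n E (\<theta> t) u\<bar>)"

lemma B_nonneg: "0 \<le> B t" by (simp add: B_def sum_nonneg)

lemma kgrad_le_B: "u < n \<Longrightarrow> \<bar>kgrad n E (\<theta> t) u\<bar> \<le> B t"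
  unfolding B_def by (intro member_le_sum) auto

lemma continuous_B: "continuous_on {0..} B"
proof -
  have "continuous_on {0..} (\<lambda>s. \<theta> s u)" if "u < n" for u
    using deriv[OF that] by (auto simp: continuous_on_eq_continuous_within intro: DERIV_continuous)
  then show ?thesis unfolding B_def[abs_def] kgrad_def by (intro continuous_intros) auto
qed

text \<open>The time step is short enough that the gradient is nearly constant during one step: each
  of the \<open>n\<close> gradient components changes by at most \<open>2 * n * \<eta> * M\<close>
  when speeds are at most \<open>M\<close>, and \<open>n * 2 * n * \<eta>\<close> equals
  1/4.\<close>

definition \<eta> :: real where "\<eta> = 1 / (8 * (real n)\<^sup>2)"

lemma eta_pos: "0 < \<eta>" using n0 by (simp add: \<eta>_def)

text \<open>With \<open>M\<close> the maximum of \<open>B\<close> during the step, \<open>B\<close>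
  varies by at most \<open>M / 4\<close>. Hence \<open>M\<close> is at most 4/3 of the initial
  value, and \<open>B\<close> keeps at least 2/3 of that value.\<close>

lemma step:
  assumes t0: "0 \<le> t0" "t0 \<le> t" "t \<le> t0 + \<eta>"
  shows "u < n \<Longrightarrow> \<bar>\<theta> t u - \<theta> t0 u\<bar> \<le> 2 * \<eta> * B t0" and "B t0 / 2 \<le> B t"
proof -
  have "compact {t0..t0 + \<eta>}" "{t0..t0 + \<eta>} \<noteq> {}" "continuous_on {t0..t0 + \<eta>} B"
    using eta_pos t0 continuous_on_subset[OF continuous_B, of "{t0..t0 + \<eta>}"] by auto
  then obtain ts where ts: "ts \<in> {t0..t0 + \<eta>}" "\<And>t. t \<in> {t0..t0 + \<eta>} \<Longrightarrow> B t \<le> B ts"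
    using continuous_attains_sup[of "{t0..t0 + \<eta>}" B] by blast
  define M where "M = B ts"
  have M0: "0 \<le> M" by (simp add: M_def B_nonneg)
  have move: "\<bar>\<theta> t u - \<theta> t0 u\<bar> \<le> \<eta> * M" if "u < n" "t \<in> {t0..t0 + \<eta>}" for u t
  proof -
    have "\<exists>x\<in>{t0..t}. \<theta> t u - \<theta> t0 u = - kgrad n E (\<theta> x) u * (t - t0)"
      using has_real_derivative_mvt[OF deriv[OF that(1)], of t0 t] that t0 by auto
    then obtain x where x: "x \<in> {t0..t}" "\<theta> t u - \<theta> t0 u = - kgrad n E (\<theta> x) u * (t - t0)" by blast
    have "\<bar>kgrad n E (\<theta> x) u\<bar> \<le> M"
      using kgrad_le_B[OF that(1), of x] ts(2)[of x] x that by (auto simp: M_def)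
    then have "\<bar>\<theta> t u - \<theta> t0 u\<bar> \<le> M * \<eta>"
      unfolding x(2) abs_mult using that M0 by (intro mult_mono) auto
    then show ?thesis by (simp add: mult.commute)
  qed
  have Bdiff: "\<bar>B t - B t0\<bar> \<le> M / 4" if "t \<in> {t0..t0 + \<eta>}" for t
  proof -
    have "\<bar>B t - B t0\<bar> \<le> (\<Sum>u<n. \<bar>\<bar>kgrad n E (\<theta> t) u\<bar> - \<bar>kgrad n E (\<theta> t0) u\<bar>\<bar>)"
      unfolding B_def sum_subtractf[symmetric] by (rule sum_abs)
    also have "\<dots> \<le> (\<Sum>u<n. 2 * real n * (\<eta> * M))"
    proof (rule sum_mono)
      fix u assume "u \<in> {..<n}"
      then have "\<bar>kgrad n E (\<theta> t) u - kgrad n E (\<theta> t0) u\<bar> \<le> 2 * real n * (\<eta> * M)"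
        using move that by (intro kgrad_lipschitz) auto
      then show "\<bar>\<bar>kgrad n E (\<theta> t) u\<bar> - \<bar>kgrad n E (\<theta> t0) u\<bar>\<bar> \<le> 2 * real n * (\<eta> * M)"
        using abs_triangle_ineq3 order_trans by blast
    qed
    also have "\<dots> = M / 4" using n0 by (simp add: \<eta>_def field_simps power2_eq_square)
    finally show ?thesis .
  qed
  have Mb: "M \<le> 4 / 3 * B t0" using Bdiff[OF ts(1)] unfolding M_def by linarith
  have tI: "t \<in> {t0..t0 + \<eta>}" using t0 by simp
  show "B t0 / 2 \<le> B t" using Bdiff[OF tI] Mb B_nonneg[of t0] by linarith
  show "\<bar>\<theta> t u - \<theta> t0 u\<bar> \<le> 2 * \<eta> * B t0" if "u < n"
  proof -
    have "\<eta> * M \<le> \<eta> * (2 * B t0)" using Mb B_nonneg[of t0] eta_pos by (intro mult_left_mono) auto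
    then show ?thesis using move[OF that tI] by simp
  qed
qed

lemma energy_antimono:
  assumes "0 \<le> a" "a \<le> b"
  shows "kuramoto_energy {..<n} E (\<theta> b) \<le> kuramoto_energy {..<n} E (\<theta> a)"
proof -
  obtain x where "kuramoto_energy {..<n} E (\<theta> b) - kuramoto_energy {..<n} E (\<theta> a)
      = - (\<Sum>u<n. (kgrad n E (\<theta> x) u)\<^sup>2) * (b - a)"
    using has_real_derivative_mvt[OF deriv_energy assms] by blast
  moreover have "0 \<le> (\<Sum>u<n. (kgrad n E (\<theta> x) u)\<^sup>2) * (b - a)" using assms by (intro mult_nonneg_nonneg sum_nonneg) auto
  ultimately show ?thesis by simp
qed

lemma energy_drop:
  assumes "0 \<le> t0"
  shows "\<eta> * (B t0)\<^sup>2 / (4 * n) \<le> kuramoto_energy {..<n} E (\<theta> t0) - kuramoto_energy {..<n} E (\<theta> (t0 + \<eta>))"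
proof -
  obtain x where x: "x \<in> {t0..t0 + \<eta>}" "kuramoto_energy {..<n} E (\<theta> (t0 + \<eta>)) - kuramoto_energy {..<n} E (\<theta> t0)
      = - (\<Sum>u<n. (kgrad n E (\<theta> x) u)\<^sup>2) * \<eta>"
    using has_real_derivative_mvt[OF deriv_energy assms, of "t0 + \<eta>"] eta_pos by auto
  have "(B t0 / 2)\<^sup>2 \<le> (B x)\<^sup>2" using step(2)[OF assms, of x] x B_nonneg[of t0] by (intro power_mono) auto
  also have "\<dots> \<le> real n * (\<Sum>u<n. (kgrad n E (\<theta> x) u)\<^sup>2)"
    using Cauchy_Schwarz_ineq_sum[of "\<lambda>_. 1" "\<lambda>u. \<bar>kgrad n E (\<theta> x) u\<bar>" "{..<n}"] by (simp add: B_def)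
  finally have "(B t0)\<^sup>2 / (4 * n) \<le> (\<Sum>u<n. (kgrad n E (\<theta> x) u)\<^sup>2)"
    using n0 by (simp add: power_divide field_simps)
  then have "\<eta> * ((B t0)\<^sup>2 / (4 * n)) \<le> \<eta> * (\<Sum>u<n. (kgrad n E (\<theta> x) u)\<^sup>2)"
    using eta_pos by (intro mult_left_mono) auto
  then show ?thesis using x(2) by (simp add: mult.commute)
qed

text \<open>Displacement in one step is at most \<open>2 * \<eta>\<close> times the initial gradient
  size, so summability gives finite length. The limit is critical because the gradient sizes at the
  sampled times tend to 0.\<close>

lemma converges_if_summable:
  assumes "summable (\<lambda>j. B (real j * \<eta>))"
  shows "\<exists>\<phi>. (\<forall>u<n. ((\<lambda>t. \<theta> t u) \<longlongrightarrow> \<phi> u) at_top) \<and> (\<forall>u<n. kgrad n E \<phi> u = 0)"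
proof -
  define b where "b = (\<lambda>j. B (real j * \<eta>))"
  have b0: "b \<longlonglongrightarrow> 0" using summable_LIMSEQ_zero[OF assms] by (simp add: b_def)
  have "\<exists>l. (\<lambda>j. \<theta> (real j * \<eta>) u) \<longlonglongrightarrow> l" if u: "u < n" for u
  proof -
    have "summable (\<lambda>j. \<theta> (real (Suc j) * \<eta>) u - \<theta> (real j * \<eta>) u)"
    proof (rule summable_comparison_test'[where N = 0])
      show "summable (\<lambda>j. 2 * \<eta> * b j)" using assms by (intro summable_mult) (simp add: b_def)
      fix j :: nat
      show "norm (\<theta> (real (Suc j) * \<eta>) u - \<theta> (real j * \<eta>) u) \<le> 2 * \<eta> * b j"
        using step(1)[of "real j * \<eta>" "real (Suc j) * \<eta>" u] eta_pos u by (simp add: b_def algebra_simps)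
    qed
    then have "convergent (\<lambda>k. \<Sum>j<k. \<theta> (real (Suc j) * \<eta>) u - \<theta> (real j * \<eta>) u)"
      by (simp add: summable_iff_convergent)
    then have "convergent (\<lambda>k. \<theta> (real k * \<eta>) u - \<theta> 0 u)"
      by (subst (asm) sum_lessThan_telescope) simp
    then have "convergent (\<lambda>k. \<theta> (real k * \<eta>) u - \<theta> 0 u + \<theta> 0 u)"
      by (intro convergent_add convergent_const)
    then show ?thesis by (simp add: convergent_def)
  qed
  then obtain \<phi> where \<phi>: "\<And>u. u < n \<Longrightarrow> (\<lambda>j. \<theta> (real j * \<eta>) u) \<longlonglongrightarrow> \<phi> u" by metis
  have "((\<lambda>t. \<theta> t u) \<longlongrightarrow> \<phi> u) at_top" if u: "u < n" for u
  proof -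
    define J where "J = (\<lambda>t. nat \<lfloor>t / \<eta>\<rfloor>)"
    have J: "filterlim J sequentially at_top"
    proof -
      have "filterlim (\<lambda>t::real. t / \<eta>) at_top at_top"
        using filterlim_tendsto_pos_mult_at_top[OF tendsto_const[of "1/\<eta>"] _ filterlim_ident] eta_pos
        by (simp add: mult.commute divide_inverse)
      then have "filterlim (\<lambda>t. \<lfloor>t / \<eta>\<rfloor>) at_top at_top"
        by (rule filterlim_compose[OF filterlim_floor_sequentially])
      then show ?thesis unfolding J_def by (rule filterlim_compose[OF filterlim_nat_sequentially])
    qed
    have "((\<lambda>t. \<theta> (real (J t) * \<eta>) u) \<longlongrightarrow> \<phi> u) at_top"
      by (rule filterlim_compose[OF \<phi>[OF u] J])
    moreover have "((\<lambda>t. \<theta> t u - \<theta> (real (J t) * \<eta>) u) \<longlongrightarrow> 0) at_top"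
    proof (rule Lim_null_comparison)
      have "((\<lambda>t. 2 * \<eta> * b (J t)) \<longlongrightarrow> 2 * \<eta> * 0) at_top"
        by (intro tendsto_intros filterlim_compose[OF b0 J])
      then show "((\<lambda>t. 2 * \<eta> * b (J t)) \<longlongrightarrow> 0) at_top" by simp
      show "\<forall>\<^sub>F t in at_top. norm (\<theta> t u - \<theta> (real (J t) * \<eta>) u) \<le> 2 * \<eta> * b (J t)"
        using eventually_ge_at_top[of 0]
      proof eventually_elim
        case (elim t)
        have r: "real (J t) = of_int \<lfloor>t / \<eta>\<rfloor>" using elim eta_pos by (simp add: J_def)
        have "of_int \<lfloor>t / \<eta>\<rfloor> * \<eta> \<le> t / \<eta> * \<eta>" "t / \<eta> * \<eta> \<le> (of_int \<lfloor>t / \<eta>\<rfloor> + 1) * \<eta>"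
          using eta_pos by (intro mult_right_mono; linarith)+
        then have "real (J t) * \<eta> \<le> t" "t \<le> real (J t) * \<eta> + \<eta>"
          using eta_pos unfolding r by (simp_all add: distrib_right)
        then show ?case using step(1)[of "real (J t) * \<eta>" t u] eta_pos u by (simp add: b_def)
      qed
    qed
    ultimately show ?thesis by (rule Lim_transform)
  qed
  moreover have "kgrad n E \<phi> u = 0" if u: "u < n" for u
  proof -
    have "(\<lambda>j. kgrad n E (\<theta> (real j * \<eta>)) u) \<longlonglongrightarrow> kgrad n E \<phi> u"
      unfolding kgrad_def using \<phi> u by (intro tendsto_intros) auto
    moreover have "(\<lambda>j. kgrad n E (\<theta> (real j * \<eta>)) u) \<longlonglongrightarrow> 0"
      by (rule Lim_null_comparison[OF _ b0]) (use kgrad_le_B[OF u] in \<open>simp add: b_def\<close>)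
    ultimately show ?thesis by (rule LIMSEQ_unique)
  qed
  ultimately show ?thesis by blast
qed

end

section \<open>Energy levels as compact semialgebraic sets\<close>

definition energy_poly :: "nat \<Rightarrow> nat set set \<Rightarrow> (nat \<Rightarrow> real) \<Rightarrow> real" where
  "energy_poly n E x = (1/2) * (\<Sum>u<n. \<Sum>v<n. adj E u v * (1 - (x u * x v + x (n + u) * x (n + v))))"

definition grad2_poly :: "nat \<Rightarrow> nat set set \<Rightarrow> (nat \<Rightarrow> real) \<Rightarrow> real" where
  "grad2_poly n E x = (\<Sum>u<n. (\<Sum>v<n. adj E u v * (x (n + u) * x v - x u * x (n + v)))\<^sup>2)"

text \<open>Coordinates \<open>u\<close> and \<open>n + u\<close> hold the cosine and sine of the
  phase of \<open>u\<close>, and coordinate \<open>2 * n\<close> holds the energy value. Thus a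
  level set is a slice with \<open>2 * n\<close> unknowns and the level as its parameter.\<close>

definition level_pred :: "nat \<Rightarrow> nat set set \<Rightarrow> (nat \<Rightarrow> real) \<Rightarrow> bool" where
  "level_pred n E x \<longleftrightarrow> (\<forall>u\<in>{..<n}. (x u)\<^sup>2 + (x (n + u))\<^sup>2 = 1) \<and> energy_poly n E x = x (2 * n)"

definition circle_point :: "nat \<Rightarrow> (nat \<Rightarrow> real) \<Rightarrow> real \<Rightarrow> nat \<Rightarrow> real" where
  "circle_point n \<theta> s = (\<lambda>i. if i < n then cos (\<theta> i) else if i < 2 * n then sin (\<theta> (i - n)) else if i = 2 * n then s else 0)"

lemma polyfun_energy_poly: "energy_poly n E \<in> polyfun"
  unfolding energy_poly_def[abs_def] by (intro polyfun_sum polyfun_diff polyfun.add polyfun.mult polyfun.const polyfun.coord)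

lemma polyfun_grad2_poly: "grad2_poly n E \<in> polyfun"
  unfolding grad2_poly_def[abs_def]
  by (intro polyfun_sum polyfun_power polyfun_diff polyfun.mult polyfun.const polyfun.coord)

lemma definable_level_pred: "definable (level_pred n E)"
  unfolding level_pred_def[abs_def]
  by (intro definable_conj definable_ball definable_eq polyfun_energy_poly polyfun.add polyfun_power polyfun.const polyfun.coord) simp

lemma indep_level_pred: "indep_coord (Suc (2 * n)) (level_pred n E)"
  unfolding indep_coord_def level_pred_def energy_poly_def by (auto intro!: ball_cong)

lemma indep_grad2_poly: "indep_coord (Suc (2 * n)) (grad2_poly n E)"
  unfolding indep_coord_def grad2_poly_def by auto

lemma compact_box:
  fixes B :: "nat \<Rightarrow> real set"
  assumes "\<And>i. compact (B i)"
  shows "compact {v. \<forall>i. v i \<in> B i}"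
proof -
  have "compactin (product_topology (\<lambda>_. euclidean) UNIV) (PiE UNIV B)"
    unfolding compactin_PiE using assms by simp
  then have "compact (PiE UNIV B)"
    by (simp add: euclidean_product_topology)
  moreover have "PiE UNIV B = {v. \<forall>i. v i \<in> B i}" by (auto simp: PiE_def)
  ultimately show ?thesis by simp
qed

lemma compact_level: "compact (slice (2 * n) (level_pred n E) (level_point (2 * n) s))"
proof -
  define Bx where "Bx = (\<lambda>i. if i < 2 * n then {-1..1} else {level_point (2 * n) s i})"
  have "compact {v. \<forall>i. v i \<in> Bx i}" by (rule compact_box) (auto simp: Bx_def)
  moreover have "closed {v. level_pred n E v}"
  proof -
    have "closed {v. energy_poly n E v = v (2 * n)}"
      by (intro closed_Collect_eq continuous_polyfun polyfun_energy_poly polyfun.coord)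
    moreover have "closed (\<Inter>u\<in>{..<n}. {v. (v u)\<^sup>2 + (v (n + u))\<^sup>2 = (1::real)})"
      by (intro closed_INT ballI closed_Collect_eq continuous_polyfun polyfun.add polyfun_power polyfun.const polyfun.coord)
    moreover have "{v. level_pred n E v} = (\<Inter>u\<in>{..<n}. {v. (v u)\<^sup>2 + (v (n + u))\<^sup>2 = 1}) \<inter> {v. energy_poly n E v = v (2 * n)}"
      by (auto simp: level_pred_def)
    ultimately show ?thesis by (simp add: closed_Int)
  qed
  moreover have "slice (2 * n) (level_pred n E) (level_point (2 * n) s) = {v. \<forall>i. v i \<in> Bx i} \<inter> {v. level_pred n E v}"
  proof (intro equalityI subsetI)
    fix v assume v: "v \<in> slice (2 * n) (level_pred n E) (level_point (2 * n) s)"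
    have "v i \<in> Bx i" for i
    proof (cases "i < 2 * n")
      case True
      have "\<bar>v i\<bar> \<le> 1"
      proof -
        define u where "u = (if i < n then i else i - n)"
        have "u < n" using True by (auto simp: u_def)
        then have "(v u)\<^sup>2 + (v (n + u))\<^sup>2 = 1" using v by (auto simp: slice_def level_pred_def)
        then have "(v u)\<^sup>2 \<le> 1" "(v (n + u))\<^sup>2 \<le> 1"
          using zero_le_power2[of "v u"] zero_le_power2[of "v (n + u)"] by linarith+
        moreover have "i = u \<or> i = n + u" using True by (auto simp: u_def)
        ultimately have "(v i)\<^sup>2 \<le> 1" by auto
        then show ?thesis by (simp add: abs_square_le_1)
      qed
      then show ?thesis using True by (auto simp: Bx_def)
    next
      case False
      then show ?thesis using v by (auto simp: slice_def Bx_def)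
    qed
    then show "v \<in> {v. \<forall>i. v i \<in> Bx i} \<inter> {v. level_pred n E v}" using v by (simp add: slice_def)
  next
    fix v assume v: "v \<in> {v. \<forall>i. v i \<in> Bx i} \<inter> {v. level_pred n E v}"
    then have "v i = level_point (2 * n) s i" if "2 * n \<le> i" for i
      using that by (auto simp: Bx_def dest: spec[of _ i])
    then show "v \<in> slice (2 * n) (level_pred n E) (level_point (2 * n) s)" using v by (auto simp: slice_def)
  qed
  ultimately show ?thesis by (simp add: compact_Int_closed)
qed

lemma energy_poly_angles:
  assumes "\<And>u. u < n \<Longrightarrow> v u = cos (\<phi> u) \<and> v (n + u) = sin (\<phi> u)"
  shows "energy_poly n E v = kuramoto_energy {..<n} E \<phi>"
    and "grad2_poly n E v = (\<Sum>u<n. (kgrad n E \<phi> u)\<^sup>2)"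
  unfolding energy_poly_def kuramoto_energy_def grad2_poly_def kgrad_def using assms
  by (auto simp: cos_diff sin_diff intro!: sum.cong)

lemma circle_point_in_level:
  assumes "kuramoto_energy {..<n} E \<phi> = s"
  shows "circle_point n \<phi> s \<in> slice (2 * n) (level_pred n E) (level_point (2 * n) s)"
    and "grad2_poly n E (circle_point n \<phi> s) = (\<Sum>u<n. (kgrad n E \<phi> u)\<^sup>2)"
proof -
  have a: "circle_point n \<phi> s u = cos (\<phi> u) \<and> circle_point n \<phi> s (n + u) = sin (\<phi> u)" if "u < n" for u
    using that by (simp add: circle_point_def)
  show "grad2_poly n E (circle_point n \<phi> s) = (\<Sum>u<n. (kgrad n E \<phi> u)\<^sup>2)" by (rule energy_poly_angles(2)) (rule a)
  have "energy_poly n E (circle_point n \<phi> s) = s" using energy_poly_angles(1)[of n "circle_point n \<phi> s" \<phi> E] a assms by simp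
  then show "circle_point n \<phi> s \<in> slice (2 * n) (level_pred n E) (level_point (2 * n) s)"
    using a by (auto simp: slice_def level_pred_def level_point_def) (auto simp: circle_point_def)
qed

lemma level_has_angles:
  assumes v: "v \<in> slice (2 * n) (level_pred n E) (level_point (2 * n) s)"
  obtains \<phi> where "\<And>u. u < n \<Longrightarrow> v u = cos (\<phi> u) \<and> v (n + u) = sin (\<phi> u)" "kuramoto_energy {..<n} E \<phi> = s"
proof -
  have "\<exists>a. v u = cos a \<and> v (n + u) = sin a" if "u < n" for u
  proof -
    have "(v u)\<^sup>2 + (v (n + u))\<^sup>2 = 1" using v that by (auto simp: slice_def level_pred_def)
    then show ?thesis using sincos_total_2pi by metis
  qed
  then obtain \<phi> where \<phi>: "\<And>u. u < n \<Longrightarrow> v u = cos (\<phi> u) \<and> v (n + u) = sin (\<phi> u)" by metis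
  moreover have "kuramoto_energy {..<n} E \<phi> = s"
    using energy_poly_angles(1)[of n v \<phi> E] \<phi> v by (auto simp: slice_def level_pred_def level_point_def)
  ultimately show thesis using that by blast
qed

context kuramoto_trajectory begin

text \<open>The gradient norms along the trajectory are dominated by the increments of a definable curve
  that meets each energy level in a point of least gradient (the talweg); such a curve has finite length.\<close>

lemma summable_B: "summable (\<lambda>j. B (real j * \<eta>))"
proof -
  let ?S = "\<lambda>s. slice (2 * n) (level_pred n E) (level_point (2 * n) s)"
  let ?E = "kuramoto_energy {..<n} E"
  obtain X N where X: "\<And>s. ?S s \<noteq> {} \<Longrightarrow> X s \<in> ?S s" "\<And>s w. w \<in> ?S s \<Longrightarrow> grad2_poly n E (X s) \<le> grad2_poly n E w"
    "\<And>i c s k. i < 2 * n \<Longrightarrow> (\<forall>j<k. s (Suc j) \<le> s j) \<Longrightarrow> (\<forall>j\<le>k. ?S (s j) \<noteq> {})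
       \<Longrightarrow> card {j. j < k \<and> (c < X (s j) i) \<noteq> (c < X (s (Suc j)) i)} \<le> N"
    using definable_selection[OF definable_level_pred indep_level_pred polyfun_grad2_poly indep_grad2_poly compact_level]
    by blast
  define s where "s = (\<lambda>j. ?E (\<theta> (real j * \<eta>)))"
  define b where "b = (\<lambda>j. B (real j * \<eta>))"
  have ne: "?S (s j) \<noteq> {}" for j using circle_point_in_level(1)[of n E "\<theta> (real j * \<eta>)" "s j"] by (auto simp: s_def)
  have mono: "s (Suc j) \<le> s j" for j
    unfolding s_def using eta_pos by (intro energy_antimono) (auto simp: algebra_simps)
  have "\<exists>\<phi>. (\<forall>u<n. X (s j) u = cos (\<phi> u) \<and> X (s j) (n + u) = sin (\<phi> u)) \<and> ?E \<phi> = s j" for j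
    using level_has_angles[OF X(1)[OF ne[of j]]] by metis
  then obtain \<phi> where \<phi>: "\<And>j u. u < n \<Longrightarrow> X (s j) u = cos (\<phi> j u) \<and> X (s j) (n + u) = sin (\<phi> j u)"
    "\<And>j. ?E (\<phi> j) = s j" by metis
  define D where "D = (\<lambda>j. \<Sum>u<n. chord (\<phi> (Suc j) u) (\<phi> j u))"
  have D0: "0 \<le> D j" for j unfolding D_def by (intro sum_nonneg) (simp add: chord_def)
  have b0: "0 \<le> b j" for j by (simp add: b_def B_nonneg)
  have var: "(\<Sum>j<k. \<bar>X (s (Suc j)) i - X (s j) i\<bar>) \<le> 2 * real N" if "i < 2 * n" for i k
  proof (rule variation_le_of_crossings)
    show "\<bar>X (s j) i\<bar> \<le> 1" for j
      using \<phi>(1)[of i j] \<phi>(1)[of "i - n" j] that by (cases "i < n") auto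
    show "card {j. j < k \<and> (c < X (s j) i) \<noteq> (c < X (s (Suc j)) i)} \<le> N" for c
      using mono ne that by (intro X(3)) auto
  qed
  have sumD: "(\<Sum>j<k. D j) \<le> 4 * real n * real N" for k
  proof -
    have "(\<Sum>j<k. D j) = (\<Sum>u<n. \<Sum>j<k. chord (\<phi> (Suc j) u) (\<phi> j u))" unfolding D_def by (rule sum.swap)
    also have "\<dots> = (\<Sum>u<n. (\<Sum>j<k. \<bar>X (s (Suc j)) u - X (s j) u\<bar>) + (\<Sum>j<k. \<bar>X (s (Suc j)) (n + u) - X (s j) (n + u)\<bar>))"
      by (intro sum.cong refl) (simp add: \<phi>(1) chord_def sum.distrib)
    also have "\<dots> \<le> (\<Sum>u<n. 2 * real N + 2 * real N)" by (intro sum_mono add_mono var) auto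
    finally show ?thesis by simp
  qed
  \<comment> \<open>The summand 1 serves the steps with \<open>b j \<le> D j\<close>; the other
    summand comes from comparing energies in the remaining steps.\<close>
  define C where "C = 1 + 4 * real n * (real n + 2) / \<eta>"
  have C1: "1 \<le> C" unfolding C_def using eta_pos by simp
  have bD: "b j \<le> C * D j" for j
  proof (cases "b j \<le> D j")
    case True
    also have "D j \<le> C * D j" using mult_right_mono[OF C1 D0[of j]] by simp
    finally show ?thesis .
  next
    case False
    then have bpos: "0 < b j" using D0[of j] by simp
    have g2: "(\<Sum>u<n. (kgrad n E (\<theta> (real j * \<eta>)) u)\<^sup>2) \<le> (b j)\<^sup>2"
    proof -
      have "(\<Sum>u<n. (kgrad n E (\<theta> (real j * \<eta>)) u)\<^sup>2) \<le> (\<Sum>u<n. \<bar>kgrad n E (\<theta> (real j * \<eta>)) u\<bar> * b j)"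
      proof (rule sum_mono)
        fix u assume "u \<in> {..<n}"
        then have "\<bar>kgrad n E (\<theta> (real j * \<eta>)) u\<bar> * \<bar>kgrad n E (\<theta> (real j * \<eta>)) u\<bar> \<le> \<bar>kgrad n E (\<theta> (real j * \<eta>)) u\<bar> * b j"
          using kgrad_le_B by (intro mult_left_mono) (auto simp: b_def)
        then show "(kgrad n E (\<theta> (real j * \<eta>)) u)\<^sup>2 \<le> \<bar>kgrad n E (\<theta> (real j * \<eta>)) u\<bar> * b j"
          by (simp add: power2_eq_square)
      qed
      also have "\<dots> = (b j)\<^sup>2" by (simp add: b_def B_def sum_distrib_right power2_eq_square)
      finally show ?thesis .
    qed
    have G: "\<bar>kgrad n E (\<phi> j) u\<bar> \<le> b j" if "u < n" for u
    proof -
      have "(kgrad n E (\<phi> j) u)\<^sup>2 \<le> (\<Sum>u<n. (kgrad n E (\<phi> j) u)\<^sup>2)" using that by (intro member_le_sum) auto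
      also have "\<dots> = grad2_poly n E (X (s j))" using energy_poly_angles(2)[of n "X (s j)" "\<phi> j" E] \<phi>(1) by simp
      also have "\<dots> \<le> grad2_poly n E (circle_point n (\<theta> (real j * \<eta>)) (s j))"
        by (intro X(2) circle_point_in_level(1)) (simp add: s_def)
      also have "\<dots> = (\<Sum>u<n. (kgrad n E (\<theta> (real j * \<eta>)) u)\<^sup>2)"
        by (intro circle_point_in_level(2)) (simp add: s_def)
      also have "\<dots> \<le> (b j)\<^sup>2" by (rule g2)
      finally have "\<bar>kgrad n E (\<phi> j) u\<bar>\<^sup>2 \<le> (b j)\<^sup>2" by simp
      then show ?thesis using b0 by (rule power2_le_imp_le)
    qed
    \<comment> \<open>The same energy difference is estimated twice. Along the trajectory it is at
      least of order \<open>(b j)^2\<close>. Between the two points of the definable curve on the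
      same levels it is at most of order \<open>b j * D j\<close>, because the gradient at the curve
      point is the least on its level and so does not exceed \<open>b j\<close>.\<close>
    have "\<eta> * (b j)\<^sup>2 / (4 * n) \<le> s j - s (Suc j)"
      unfolding s_def b_def using energy_drop[of "real j * \<eta>"] eta_pos by (simp add: algebra_simps)
    also have "\<dots> \<le> \<bar>?E (\<phi> (Suc j)) - ?E (\<phi> j)\<bar>" using \<phi>(2) by simp
    also have "\<dots> \<le> b j * D j + (real n + 1) * (D j)\<^sup>2" unfolding D_def by (rule energy_diff_le[OF G])
    also have "\<dots> \<le> b j * D j + (real n + 1) * (b j * D j)"
      unfolding power2_eq_square using False D0[of j] by (intro add_left_mono mult_left_mono mult_right_mono) auto
    finally have "\<eta> * (b j)\<^sup>2 / (4 * n) \<le> (real n + 2) * (b j * D j)" by (simp add: algebra_simps)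
    then have "b j * (\<eta> * b j) \<le> b j * (4 * real n * (real n + 2) * D j)"
      using n0 by (simp add: field_simps power2_eq_square)
    then have "\<eta> * b j \<le> 4 * real n * (real n + 2) * D j" using bpos by simp
    then have "b j \<le> 4 * real n * (real n + 2) / \<eta> * D j" using eta_pos by (simp add: field_simps)
    then show ?thesis using D0[of j] by (simp add: C_def distrib_right)
  qed
  show ?thesis unfolding b_def[symmetric, THEN fun_cong, symmetric]
  proof (rule summableI_nonneg_bounded)
    show "0 \<le> B (real j * \<eta>)" for j by (rule B_nonneg)
    fix k
    have "(\<Sum>j<k. b j) \<le> (\<Sum>j<k. C * D j)" by (intro sum_mono bD)
    also have "\<dots> = C * (\<Sum>j<k. D j)" by (simp add: sum_distrib_left)
    also have "\<dots> \<le> C * (4 * real n * real N)" using sumD C1 by (intro mult_left_mono) auto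
    finally show "(\<Sum>j<k. B (real j * \<eta>)) \<le> C * (4 * real n * real N)" by (simp add: b_def)
  qed
qed

end

theorem kuramoto_trajectory_converges:
  assumes "kuramoto_solution {..<n} E \<theta>"
  shows "\<exists>\<phi>. (\<forall>u<n. ((\<lambda>t. \<theta> t u) \<longlongrightarrow> \<phi> u) at_top) \<and> (\<forall>u<n. kgrad n E \<phi> u = 0)"
proof (cases "n = 0")
  case False
  then interpret kuramoto_trajectory n E \<theta> using assms by unfold_locales auto
  show ?thesis by (rule converges_if_summable[OF summable_B])
qed simp

section \<open>Unstable equilibria attract only a null set\<close>

definition ip :: "nat \<Rightarrow> (nat \<Rightarrow> real) \<Rightarrow> (nat \<Rightarrow> real) \<Rightarrow> real" where
  "ip n x y = (\<Sum>u<n. x u * y u)"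

definition mv :: "nat \<Rightarrow> (nat \<Rightarrow> nat \<Rightarrow> real) \<Rightarrow> (nat \<Rightarrow> real) \<Rightarrow> nat \<Rightarrow> real" where
  "mv n h d u = (\<Sum>v<n. h u v * d v)"

lemma ip_nonneg: "0 \<le> ip n x x"
  by (simp add: ip_def sum_nonneg)

lemma ip_commute: "ip n x y = ip n y x"
  by (simp add: ip_def mult.commute)

lemma ip_eq_0_iff: "ip n x x = 0 \<longleftrightarrow> (\<forall>u<n. x u = 0)"
  unfolding ip_def by (subst sum_nonneg_eq_0_iff) auto

lemma ip_mv_sym:
  assumes "\<And>u v. h u v = h v u"
  shows "ip n x (mv n h y) = ip n (mv n h x) y"
proof -
  have "ip n x (mv n h y) = (\<Sum>u<n. \<Sum>v<n. x u * (h u v * y v))" by (simp add: ip_def mv_def sum_distrib_left)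
  also have "\<dots> = (\<Sum>v<n. \<Sum>u<n. x u * (h u v * y v))" by (rule sum.swap)
  also have "\<dots> = ip n (mv n h x) y"
    unfolding ip_def mv_def sum_distrib_right
    by (intro sum.cong refl) (metis assms mult.assoc mult.commute)
  finally show ?thesis .
qed

lemma Cauchy_Schwarz_ip: "(ip n x y)\<^sup>2 \<le> ip n x x * ip n y y"
  using Cauchy_Schwarz_ineq_sum[of x y "{..<n}"] by (simp add: ip_def power2_eq_square)

text \<open>Bessel's inequality for the \<open>u\<close>-th unit vector bounds the sum of the
  squares \<open>(e i u)^2\<close> over \<open>i\<close> by 1. Summing over \<open>u\<close> counts
  each vector with its norm 1.\<close>

lemma bessel_dimension:
  fixes e :: "nat \<Rightarrow> nat \<Rightarrow> real"
  assumes "\<And>i j. i < m \<Longrightarrow> j < m \<Longrightarrow> ip n (e i) (e j) = of_bool (i = j)"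
  shows "m \<le> n"
proof -
  have "(\<Sum>i<m. (e i u)\<^sup>2) \<le> 1" if u: "u < n" for u
  proof -
    define S where "S = (\<Sum>i<m. (e i u)\<^sup>2)"
    define f where "f = (\<lambda>w. \<Sum>i<m. e i u * e i w)"
    have 1: "(\<Sum>w<n. (f w)\<^sup>2) = S"
    proof -
      have "(\<Sum>w<n. (f w)\<^sup>2) = (\<Sum>w<n. \<Sum>i<m. \<Sum>j<m. (e i u * e j u) * (e i w * e j w))"
        by (simp add: f_def power2_eq_square sum_product mult_ac)
      also have "\<dots> = (\<Sum>i<m. \<Sum>w<n. \<Sum>j<m. (e i u * e j u) * (e i w * e j w))"
        by (rule sum.swap)
      also have "\<dots> = (\<Sum>i<m. \<Sum>j<m. \<Sum>w<n. (e i u * e j u) * (e i w * e j w))"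
        by (intro sum.cong refl sum.swap)
      also have "\<dots> = (\<Sum>i<m. \<Sum>j<m. (e i u * e j u) * of_bool (i = j))"
        using assms by (intro sum.cong refl) (simp add: sum_distrib_left[symmetric] ip_def)
      also have "\<dots> = (\<Sum>i<m. \<Sum>j<m. if i = j then e i u * e i u else 0)"
        by (intro sum.cong refl) auto
      also have "\<dots> = S" by (simp add: S_def power2_eq_square)
      finally show ?thesis .
    qed
    have 2: "f u = S" by (simp add: f_def S_def power2_eq_square)
    have "0 \<le> (\<Sum>w<n. (of_bool (w = u) - f w)\<^sup>2)" by (simp add: sum_nonneg)
    also have "\<dots> = (\<Sum>w<n. (if w = u then 1 - 2 * f u else 0) + (f w)\<^sup>2)"
      by (intro sum.cong refl) (auto simp: power2_diff)
    also have "\<dots> = 1 - 2 * S + S" using u by (simp add: sum.distrib 1 2)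
    finally show ?thesis by (simp add: S_def)
  qed
  then have "(\<Sum>u<n. \<Sum>i<m. (e i u)\<^sup>2) \<le> (\<Sum>u<n. 1)" by (intro sum_mono) auto
  moreover have "(\<Sum>u<n. \<Sum>i<m. (e i u)\<^sup>2) = (\<Sum>i<m. ip n (e i) (e i))"
    unfolding ip_def by (subst sum.swap) (simp add: power2_eq_square)
  ultimately show ?thesis using assms by simp
qed

text \<open>A bad shift \<open>c\<close> is one for which \<open>- c\<close> is an eigenvalue of
  \<open>h\<close>. Among \<open>n + 1\<close> distinct candidates not all can be bad, since
  eigenvectors of a symmetric matrix for distinct eigenvalues are orthogonal.\<close>

lemma exists_nondegenerate_shift:
  assumes sym: "\<And>u v. h u v = h v u" and l: "0 < l"
  shows "\<exists>c. 0 < c \<and> c < l \<and> (\<forall>d. (\<forall>u<n. mv n h d u + c * d u = 0) \<longrightarrow> (\<forall>u<n. d u = 0))"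
proof (rule ccontr)
  assume neg: "\<not> ?thesis"
  define c where "c = (\<lambda>i. l * ((real i + 1) / (real n + 3)))"
  have c: "0 < c i" "c i < l" if "i < Suc n" for i
    using that l mult_strict_left_mono[of "(real i + 1) / (real n + 3)" 1 l] by (auto simp: c_def)
  have "\<exists>d. (\<forall>u<n. mv n h d u + c i * d u = 0) \<and> ip n d d \<noteq> 0" if "i < Suc n" for i
    using neg c[OF that] unfolding ip_eq_0_iff by blast
  then obtain d where d: "\<And>i u. i < Suc n \<Longrightarrow> u < n \<Longrightarrow> mv n h (d i) u + c i * d i u = 0"
    "\<And>i. i < Suc n \<Longrightarrow> ip n (d i) (d i) \<noteq> 0" by metis
  have orth: "ip n (d i) (d j) = 0" if ij: "i < Suc n" "j < Suc n" "i \<noteq> j" for i j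
  proof -
    have mvd: "mv n h (d i) u = - c i * d i u" if "i < Suc n" "u < n" for i u using d(1)[OF that] by linarith
    have "ip n (d i) (mv n h (d j)) = - c j * ip n (d i) (d j)"
      unfolding ip_def sum_distrib_left using mvd[OF ij(2)] by (intro sum.cong refl) simp
    moreover have "ip n (mv n h (d i)) (d j) = - c i * ip n (d i) (d j)"
      unfolding ip_def sum_distrib_left using mvd[OF ij(1)] by (intro sum.cong refl) simp
    ultimately have "(c i - c j) * ip n (d i) (d j) = 0" using ip_mv_sym[where h = h and n = n and x = "d i" and y = "d j", OF sym] by (simp add: algebra_simps)
    moreover have "c i \<noteq> c j" using ij l by (simp add: c_def field_simps)
    ultimately show ?thesis by simp
  qed
  define e where "e = (\<lambda>i u. d i u / sqrt (ip n (d i) (d i)))"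
  have ipe: "ip n (e i) (e j) = ip n (d i) (d j) / (sqrt (ip n (d i) (d i)) * sqrt (ip n (d j) (d j)))" for i j
    by (simp add: e_def ip_def sum_divide_distrib)
  have "Suc n \<le> n"
  proof (rule bessel_dimension[of _ n e])
    fix i j assume ij: "i < Suc n" "j < Suc n"
    show "ip n (e i) (e j) = of_bool (i = j)"
      using orth[OF ij] d(2)[OF ij(1)] ip_nonneg[of n "d i"] unfolding ipe by (cases "i = j") auto
  qed
  then show False by simp
qed

text \<open>The squared norm of the image attains a positive minimum on the unit sphere, and scaling
  does the rest. Vectors are functions on all naturals, so the sphere is taken with coordinates from
  \<open>n\<close> on equal to 0 to be compact.\<close>

lemma coercive_of_injective:
  assumes inj: "\<And>d. (\<forall>u<n. mv n k d u = 0) \<Longrightarrow> (\<forall>u<n. d u = 0)"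
  shows "\<exists>m>0. \<forall>d. m * ip n d d \<le> ip n (mv n k d) (mv n k d)"
proof (cases "n = 0")
  case True
  then show ?thesis by (intro exI[of _ 1]) (simp add: ip_def)
next
  case False
  define S where "S = {d. (\<forall>i. d i \<in> (if i < n then {-1..1} else {0})) \<and> ip n d d = 1}"
  have ipf: "(\<lambda>d. ip n d d) \<in> polyfun" unfolding ip_def by (intro polyfun_sum polyfun.mult polyfun.coord)
  have mvf: "(\<lambda>d. ip n (mv n k d) (mv n k d)) \<in> polyfun"
    unfolding ip_def mv_def by (intro polyfun_sum polyfun.mult polyfun.coord polyfun.const)
  have "compact S"
  proof -
    have "S = {d. \<forall>i. d i \<in> (if i < n then {-1..1} else {0})} \<inter> {d. ip n d d = 1}" by (auto simp: S_def)
    moreover have "compact {d. \<forall>i. d i \<in> (if i < n then {-1..1} else {0::real})}" by (rule compact_box) auto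
    moreover have "closed {d. ip n d d = 1}"
      by (intro closed_Collect_eq continuous_polyfun[OF ipf] continuous_on_const)
    ultimately show ?thesis by (simp add: compact_Int_closed)
  qed
  moreover have "(\<lambda>i. if i = 0 then 1 else 0) \<in> S"
  proof -
    have "ip n (\<lambda>i. if i = 0 then 1 else 0) (\<lambda>i. if i = 0 then 1 else 0) = (\<Sum>u<n. if u = 0 then 1 else 0)"
      unfolding ip_def by (intro sum.cong refl) auto
    then show ?thesis using False by (auto simp: S_def)
  qed
  ultimately obtain d0 where d0: "d0 \<in> S" "\<And>d. d \<in> S \<Longrightarrow> ip n (mv n k d0) (mv n k d0) \<le> ip n (mv n k d) (mv n k d)"
    using continuous_attains_inf[of S "\<lambda>d. ip n (mv n k d) (mv n k d)"] continuous_on_subset[OF continuous_polyfun[OF mvf], of S] by blast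
  define m where "m = ip n (mv n k d0) (mv n k d0)"
  have "m \<noteq> 0"
  proof
    assume "m = 0"
    then have "\<forall>u<n. d0 u = 0" unfolding m_def ip_eq_0_iff by (rule inj)
    then have "ip n d0 d0 = 0" by (simp add: ip_eq_0_iff)
    then show False using d0(1) by (simp add: S_def)
  qed
  then have m0: "0 < m" using ip_nonneg[of n "mv n k d0"] by (simp add: m_def)
  have "m * ip n d d \<le> ip n (mv n k d) (mv n k d)" for d
  proof (cases "ip n d d = 0")
    case True
    then show ?thesis using ip_nonneg[of n "mv n k d"] by simp
  next
    case F: False
    define r where "r = sqrt (ip n d d)"
    have r: "0 < r" "r * r = ip n d d" using F ip_nonneg[of n d] by (auto simp: r_def)
    define d1 where "d1 = (\<lambda>i. if i < n then d i / r else 0)"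
    have i1: "ip n d1 d1 = 1"
    proof -
      have "ip n d1 d1 = (\<Sum>u<n. d u * d u / (r * r))" unfolding ip_def by (intro sum.cong refl) (simp add: d1_def)
      also have "\<dots> = ip n d d / (r * r)" by (simp add: ip_def sum_divide_distrib)
      finally show ?thesis using r F by simp
    qed
    have "d1 i \<in> {-1..1}" if "i < n" for i
    proof -
      have "d1 i * d1 i \<le> ip n d1 d1" unfolding ip_def using that by (intro member_le_sum) auto
      then have "\<bar>d1 i\<bar> \<le> 1" unfolding i1 by (simp add: abs_square_le_1[symmetric] power2_eq_square)
      then show ?thesis by auto
    qed
    then have "d1 \<in> S" using i1 by (auto simp: S_def d1_def)
    then have "m \<le> ip n (mv n k d1) (mv n k d1)" unfolding m_def by (rule d0(2))
    also have "\<dots> = ip n (mv n k d) (mv n k d) / (r * r)"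
    proof -
      have "mv n k d1 u = mv n k d u / r" for u unfolding mv_def sum_divide_distrib by (intro sum.cong refl) (simp add: d1_def)
      then show ?thesis by (simp add: ip_def sum_divide_distrib)
    qed
    finally show ?thesis using pos_le_divide_eq[of "r * r"] r mult_pos_pos[OF r(1) r(1)] by simp
  qed
  then show ?thesis using m0 by blast
qed

section \<open>Expanding cones at an unstable equilibrium\<close>

definition hess :: "nat \<Rightarrow> nat set set \<Rightarrow> (nat \<Rightarrow> real) \<Rightarrow> nat \<Rightarrow> nat \<Rightarrow> real" where
  "hess n E p u v = (if u = v then (\<Sum>w<n. adj E u w * cos (p u - p w)) else 0) - adj E u v * cos (p u - p v)"

lemma hess_sym: "hess n E p u v = hess n E p v u"
  using adj_sym[of E u v] cos_minus[of "p u - p v"] by (simp add: hess_def)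

lemma mv_hess: "u < n \<Longrightarrow> mv n (hess n E p) d u = (\<Sum>v<n. adj E u v * cos (p u - p v) * (d u - d v))"
proof -
  assume u: "u < n"
  have "mv n (hess n E p) d u = (\<Sum>v<n. (if u = v then (\<Sum>w<n. adj E u w * cos (p u - p w)) * d u else 0) - adj E u v * cos (p u - p v) * d v)"
    unfolding mv_def hess_def by (intro sum.cong refl) (auto simp: left_diff_distrib)
  also have "\<dots> = (\<Sum>w<n. adj E u w * cos (p u - p w)) * d u - (\<Sum>v<n. adj E u v * cos (p u - p v) * d v)"
    using u by (simp add: sum_subtractf)
  finally show ?thesis by (simp add: sum_distrib_right sum_subtractf right_diff_distrib)
qed

lemma ip_hess: "2 * ip n x (mv n (hess n E p) x) = (\<Sum>u<n. \<Sum>v<n. adj E u v * cos (p u - p v) * (x u - x v)\<^sup>2)"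
proof -
  define c where "c = (\<lambda>u v. adj E u v * cos (p u - p v))"
  have cs: "c u v = c v u" for u v using adj_sym[of E u v] cos_minus[of "p u - p v"] by (simp add: c_def)
  have 1: "ip n x (mv n (hess n E p) x) = (\<Sum>u<n. \<Sum>v<n. c u v * (x u * (x u - x v)))"
    unfolding ip_def c_def using mv_hess[of _ n E p x] by (intro sum.cong refl) (simp add: sum_distrib_left mult_ac)
  also have "\<dots> = (\<Sum>v<n. \<Sum>u<n. c u v * (x u * (x u - x v)))" by (rule sum.swap)
  also have "\<dots> = (\<Sum>u<n. \<Sum>v<n. c u v * (x v * (x v - x u)))"
    by (intro sum.cong refl) (metis cs)
  finally have 2: "ip n x (mv n (hess n E p) x) = (\<Sum>u<n. \<Sum>v<n. c u v * (x v * (x v - x u)))" .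
  have "2 * ip n x (mv n (hess n E p) x) = (\<Sum>u<n. \<Sum>v<n. c u v * (x u * (x u - x v)) + c u v * (x v * (x v - x u)))"
    using 1 2 by (simp add: sum.distrib)
  also have "\<dots> = (\<Sum>u<n. \<Sum>v<n. c u v * (x u - x v)\<^sup>2)"
    by (intro sum.cong refl) (simp add: power2_eq_square algebra_simps)
  finally show ?thesis by (simp add: c_def)
qed

lemma sin_diff_linearize:
  fixes a b c r :: real
  assumes "\<bar>a - c\<bar> \<le> r" "\<bar>b - c\<bar> \<le> r"
  shows "\<bar>sin a - sin b - cos c * (a - b)\<bar> \<le> r * \<bar>a - b\<bar>"
proof -
  have "norm (sin a - sin b - cos c * (a - b)) \<le> r * norm (a - b)"
  proof -
    have "norm ((sin a - cos c * a) - (sin b - cos c * b)) \<le> r * norm (a - b)"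
    proof (rule field_differentiable_bound[of "{c - r..c + r}" "\<lambda>x. sin x - cos c * x" "\<lambda>x. cos x - cos c"])
      fix z assume "z \<in> {c - r..c + r}"
      have "\<bar>sin (z + pi / 2) - sin (c + pi / 2)\<bar> \<le> \<bar>z + pi / 2 - (c + pi / 2)\<bar>" by (rule abs_sin_diff_le)
      moreover have "\<bar>z - c\<bar> \<le> r" using \<open>z \<in> _\<close> by (auto simp: abs_le_iff)
      ultimately show "norm (cos z - cos c) \<le> r" by (simp add: sin_add)
    qed (use assms in \<open>auto intro!: derivative_eq_intros simp: abs_le_iff\<close>)
    then show ?thesis by (simp add: algebra_simps)
  qed
  then show ?thesis by simp
qed

text \<open>A positive initial value of the form would grow at least like
  \<open>exp (2 * c * t)\<close>, against its bound \<open>K\<close> along bounded curves. The time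
  \<open>T\<close> is chosen so that even the linear lower bound for the exponential reaches
  \<open>Q 0 + K\<close>.\<close>

lemma quadratic_form_growth:
  fixes d d' :: "real \<Rightarrow> nat \<Rightarrow> real"
  assumes sym: "\<And>u v. k u v = k v u" and c: "0 < c"
    and der: "\<And>u t. u < n \<Longrightarrow> 0 \<le> t \<Longrightarrow> ((\<lambda>s. d s u) has_real_derivative d' t u) (at t within {0..})"
    and bd: "\<And>u t. u < n \<Longrightarrow> 0 \<le> t \<Longrightarrow> \<bar>d t u\<bar> \<le> R"
    and growth: "\<And>t. 0 \<le> t \<Longrightarrow> c * ip n (d t) (mv n k (d t)) \<le> ip n (d' t) (mv n k (d t))"
  shows "ip n (d 0) (mv n k (d 0)) \<le> 0"
proof (rule ccontr)
  assume neg: "\<not> ?thesis"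
  define Q where "Q = (\<lambda>t. ip n (d t) (mv n k (d t)))"
  have Q0: "0 < Q 0" using neg by (simp add: Q_def)
  define K where "K = (\<Sum>u<n. \<Sum>v<n. R * (\<bar>k u v\<bar> * R))"
  have QK: "Q t \<le> K" if "0 \<le> t" for t
  proof -
    have "Q t = (\<Sum>u<n. \<Sum>v<n. d t u * (k u v * d t v))" by (simp add: Q_def ip_def mv_def sum_distrib_left)
    also have "\<dots> \<le> K" unfolding K_def
    proof (intro sum_mono)
      fix u v assume uv: "u \<in> {..<n}" "v \<in> {..<n}"
      have "d t u * (k u v * d t v) \<le> \<bar>d t u\<bar> * (\<bar>k u v\<bar> * \<bar>d t v\<bar>)" by (metis abs_ge_self abs_mult)
      also have "\<dots> \<le> R * (\<bar>k u v\<bar> * R)" using bd[of u t] bd[of v t] uv that by (intro mult_mono mult_left_mono) auto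
      finally show "d t u * (k u v * d t v) \<le> R * (\<bar>k u v\<bar> * R)" .
    qed
    finally show ?thesis .
  qed
  have derQ: "(Q has_real_derivative 2 * ip n (d' t) (mv n k (d t))) (at t within {0..})" if "0 \<le> t" for t
  proof -
    have "(Q has_real_derivative (\<Sum>u<n. (d' t u * mv n k (d t) u + (\<Sum>v<n. k u v * d' t v) * d t u))) (at t within {0..})"
      unfolding Q_def ip_def mv_def using that
      by (intro DERIV_sum DERIV_mult DERIV_cmult der) auto
    moreover have "(\<Sum>u<n. (d' t u * mv n k (d t) u + (\<Sum>v<n. k u v * d' t v) * d t u)) = 2 * ip n (d' t) (mv n k (d t))"
      using ip_mv_sym[where h = k and n = n and x = "d' t" and y = "d t", OF sym] by (simp add: sum.distrib ip_def mv_def)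
    ultimately show ?thesis by simp
  qed
  define F where "F = (\<lambda>t. Q t * exp (- 2 * c * t))"
  have derF: "(F has_real_derivative (2 * ip n (d' t) (mv n k (d t)) - 2 * c * Q t) * exp (- 2 * c * t)) (at t within {0..})" if "0 \<le> t" for t
    unfolding F_def using derQ[OF that] by (auto intro!: derivative_eq_intros simp: algebra_simps)
  define T where "T = K / (2 * c * Q 0)"
  have T0: "0 \<le> T" using QK[of 0] Q0 c by (simp add: T_def)
  obtain x where x: "x \<in> {0..T}" "F T - F 0 = (2 * ip n (d' x) (mv n k (d x)) - 2 * c * Q x) * exp (- 2 * c * x) * (T - 0)"
    using has_real_derivative_mvt[OF derF _ T0] by auto
  have "0 \<le> (2 * ip n (d' x) (mv n k (d x)) - 2 * c * Q x) * exp (- 2 * c * x) * (T - 0)"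
    using growth[of x] x T0 by (intro mult_nonneg_nonneg) (auto simp: Q_def)
  then have "Q 0 \<le> Q T * exp (- 2 * c * T)" using x(2) by (simp add: F_def)
  then have "Q 0 * exp (2 * c * T) \<le> Q T * (exp (- 2 * c * T) * exp (2 * c * T))"
    using mult_right_mono[of "Q 0" "Q T * exp (- 2 * c * T)" "exp (2 * c * T)"] by (simp add: mult.assoc)
  also have "exp (- 2 * c * T) * exp (2 * c * T) = 1" by (simp add: exp_add[symmetric])
  finally have "Q 0 * exp (2 * c * T) \<le> K" using QK[OF T0] by simp
  moreover have "Q 0 * (1 + 2 * c * T) \<le> Q 0 * exp (2 * c * T)"
    using Q0 by (intro mult_left_mono exp_ge_add_one_self) auto
  moreover have "Q 0 * (1 + 2 * c * T) = Q 0 + K" using Q0 c by (simp add: T_def field_simps)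
  ultimately show False using Q0 by linarith
qed

text \<open>The form of this matrix is positive exactly on the directions that the linearized flow
  expands at a rate above \<open>c\<close>. The shift makes room for nonlinear errors and, for a
  suitable \<open>c\<close>, makes the matrix invertible.\<close>

definition shifted :: "nat \<Rightarrow> nat set set \<Rightarrow> (nat \<Rightarrow> real) \<Rightarrow> real \<Rightarrow> nat \<Rightarrow> nat \<Rightarrow> real" where
  "shifted n E p c u v = - hess n E p u v - (if u = v then c else 0)"

lemma shifted_sym: "shifted n E p c u v = shifted n E p c v u"
  using hess_sym[of n E p u v] by (simp add: shifted_def)

lemma mv_shifted: "u < n \<Longrightarrow> mv n (shifted n E p c) d u = - mv n (hess n E p) d u - c * d u"
proof -
  assume u: "u < n"
  have "mv n (shifted n E p c) d u = (\<Sum>v<n. - (hess n E p u v * d v) - (if u = v then c * d u else 0))"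
    unfolding mv_def shifted_def by (intro sum.cong refl) (auto simp: left_diff_distrib)
  also have "\<dots> = - mv n (hess n E p) d u - c * d u"
    using u by (simp add: sum_subtractf sum_negf mv_def)
  finally show ?thesis .
qed

text \<open>With \<open>K\<close> the shifted matrix applied to the difference \<open>d\<close>, the
  velocity of \<open>d\<close> is \<open>K + c * d + e\<close>. If the norm of \<open>e\<close> is
  at most that of \<open>K\<close>, the pairing of the velocity with \<open>K\<close> is at least
  \<open>c\<close> times the quadratic form, so the form cannot start positive. The linearization
  error is at most \<open>4 * r * n * S\<close> in each coordinate; summing its square gives
  \<open>16 * n^3 * r^2 * S^2\<close>, which coercivity dominates.\<close>

lemma cone_condition:
  assumes sol: "kuramoto_solution {..<n} E \<theta>" "kuramoto_solution {..<n} E \<theta>'"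
    and near: "\<And>t u. 0 \<le> t \<Longrightarrow> u < n \<Longrightarrow> \<bar>\<theta> t u - p u\<bar> \<le> r" "\<And>t u. 0 \<le> t \<Longrightarrow> u < n \<Longrightarrow> \<bar>\<theta>' t u - p u\<bar> \<le> r"
    and c: "0 < c" and r: "0 < r" "16 * (real n)^3 * r\<^sup>2 \<le> m"
    and co: "\<And>d. m * ip n d d \<le> ip n (mv n (shifted n E p c) d) (mv n (shifted n E p c) d)"
  shows "ip n (\<lambda>u. \<theta> 0 u - \<theta>' 0 u) (mv n (shifted n E p c) (\<lambda>u. \<theta> 0 u - \<theta>' 0 u)) \<le> 0"
proof -
  define d where "d = (\<lambda>t u. \<theta> t u - \<theta>' t u)"
  define d' where "d' = (\<lambda>t u. - kgrad n E (\<theta> t) u - - kgrad n E (\<theta>' t) u)"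
  let ?k = "shifted n E p c"
  have "ip n (d 0) (mv n ?k (d 0)) \<le> 0"
  proof (rule quadratic_form_growth[where k = ?k and d = d and d' = d' and R = "2 * r" and c = c])
    show "?k u v = ?k v u" for u v by (rule shifted_sym)
    show "((\<lambda>s. d s u) has_real_derivative d' t u) (at t within {0..})" if "u < n" "0 \<le> t" for u t
      unfolding d_def d'_def using sol that
      by (intro DERIV_diff) (auto simp: kuramoto_solution_def kgrad_def)
    show "\<bar>d t u\<bar> \<le> 2 * r" if "u < n" "0 \<le> t" for u t
      using near(1)[OF that(2,1)] near(2)[OF that(2,1)] unfolding d_def by linarith
    fix t :: real assume t: "0 \<le> t"
    define S where "S = sqrt (ip n (d t) (d t))"
    have S0: "0 \<le> S" "S * S = ip n (d t) (d t)" using ip_nonneg[of n "d t"] by (auto simp: S_def)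
    have dS: "\<bar>d t u\<bar> \<le> S" if "u < n" for u
    proof -
      have "d t u * d t u \<le> ip n (d t) (d t)" unfolding ip_def using that by (intro member_le_sum) auto
      then have "\<bar>d t u\<bar>\<^sup>2 \<le> S\<^sup>2" using S0 by (simp add: power2_eq_square)
      then show ?thesis using S0(1) by (rule power2_le_imp_le)
    qed
    define e where "e = (\<lambda>u. d' t u + mv n (hess n E p) (d t) u)"
    have eb: "\<bar>e u\<bar> \<le> 4 * r * n * S" if u: "u < n" for u
    proof -
      have eu: "e u = - (\<Sum>v<n. adj E u v * (sin (\<theta> t u - \<theta> t v) - sin (\<theta>' t u - \<theta>' t v)
          - cos (p u - p v) * ((\<theta> t u - \<theta> t v) - (\<theta>' t u - \<theta>' t v))))"
        unfolding e_def d'_def mv_hess[OF u] kgrad_def d_def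
        by (simp add: right_diff_distrib sum_subtractf mult.assoc[symmetric])
      have "\<bar>e u\<bar> \<le> (\<Sum>v<n. 2 * r * (2 * S))"
        unfolding eu abs_minus_cancel
      proof (rule order_trans[OF sum_abs], rule sum_mono)
        fix v assume "v \<in> {..<n}"
        then have v: "v < n" by simp
        have "\<bar>(\<theta> t u - \<theta> t v) - (p u - p v)\<bar> \<le> 2 * r" "\<bar>(\<theta>' t u - \<theta>' t v) - (p u - p v)\<bar> \<le> 2 * r"
          using near[OF t u] near[OF t v] by linarith+
        then have "\<bar>sin (\<theta> t u - \<theta> t v) - sin (\<theta>' t u - \<theta>' t v) - cos (p u - p v) * ((\<theta> t u - \<theta> t v) - (\<theta>' t u - \<theta>' t v))\<bar>
            \<le> 2 * r * \<bar>(\<theta> t u - \<theta> t v) - (\<theta>' t u - \<theta>' t v)\<bar>"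
          by (rule sin_diff_linearize)
        also have "\<dots> \<le> 2 * r * (2 * S)"
          using dS[OF u] dS[OF v] r unfolding d_def by (intro mult_left_mono) linarith+
        finally have 1: "\<bar>sin (\<theta> t u - \<theta> t v) - sin (\<theta>' t u - \<theta>' t v) - cos (p u - p v) * ((\<theta> t u - \<theta> t v) - (\<theta>' t u - \<theta>' t v))\<bar> \<le> 2 * r * (2 * S)" .
        have "\<bar>adj E u v\<bar> \<le> 1" using adj_nonneg[of E u v] adj_le_1[of E u v] by simp
        then show "\<bar>adj E u v * (sin (\<theta> t u - \<theta> t v) - sin (\<theta>' t u - \<theta>' t v) - cos (p u - p v) * ((\<theta> t u - \<theta> t v) - (\<theta>' t u - \<theta>' t v)))\<bar> \<le> 2 * r * (2 * S)"
          unfolding abs_mult using mult_mono[OF _ 1, of "\<bar>adj E u v\<bar>" 1] by simp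
      qed
      then show ?thesis by (simp add: algebra_simps)
    qed
    define K where "K = mv n ?k (d t)"
    have "ip n e e \<le> (\<Sum>u<n. (4 * r * n * S)\<^sup>2)"
      unfolding ip_def
    proof (rule sum_mono)
      fix u assume "u \<in> {..<n}"
      then have "\<bar>e u\<bar> * \<bar>e u\<bar> \<le> (4 * r * n * S) * (4 * r * n * S)" using eb[of u] r(1) S0(1) by (intro mult_mono) auto
      then show "e u * e u \<le> (4 * r * n * S)\<^sup>2" by (simp add: power2_eq_square)
    qed
    also have "\<dots> = 16 * (real n)^3 * r\<^sup>2 * (S * S)" by (simp add: power2_eq_square power3_eq_cube mult_ac)
    also have "\<dots> \<le> m * (S * S)" using r by (intro mult_right_mono) auto
    also have "\<dots> \<le> ip n K K" unfolding S0 K_def by (rule co)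
    finally have eK: "ip n e e \<le> ip n K K" .
    have "(ip n e K)\<^sup>2 \<le> ip n e e * ip n K K" by (rule Cauchy_Schwarz_ip)
    also have "\<dots> \<le> ip n K K * ip n K K" using eK ip_nonneg by (intro mult_right_mono) auto
    finally have "\<bar>ip n e K\<bar>\<^sup>2 \<le> (ip n K K)\<^sup>2" by (simp add: power2_eq_square)
    then have "\<bar>ip n e K\<bar> \<le> ip n K K" using ip_nonneg by (rule power2_le_imp_le)
    moreover have "ip n (d' t) K = ip n K K + c * ip n (d t) K + ip n e K"
    proof -
      have "d' t u = K u + c * d t u + e u" if "u < n" for u
        using mv_shifted[OF that, of E p c "d t"] by (simp add: K_def e_def)
      then have "ip n (d' t) K = (\<Sum>u<n. (K u + c * d t u + e u) * K u)" by (simp add: ip_def)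
      then show ?thesis by (simp add: ip_def distrib_right sum.distrib sum_distrib_left mult.assoc)
    qed
    ultimately show "c * ip n (d t) (mv n ?k (d t)) \<le> ip n (d' t) (mv n ?k (d t))"
      unfolding K_def[symmetric] by linarith
  qed (rule c)
  then show ?thesis by (simp add: d_def)
qed

text \<open>Writing \<open>d = d j * w + e\<close>, the form is \<open>q * (d j)^2\<close> plus
  terms of order \<open>d j * e\<close> and \<open>e^2\<close>. If it is nonpositive,
  \<open>d j\<close> is bounded by a multiple of \<open>e\<close>, the projection of
  \<open>d\<close> along \<open>w\<close>. So a set whose differences all avoid the positive cone is
  a Lipschitz graph over a hyperplane.\<close>

lemma quadratic_cone_graph:
  assumes sym: "\<And>u v. k u v = k v u" and w: "0 < ip n w (mv n k w)" "w j = 1"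
  shows "\<exists>C\<ge>0. \<forall>d. ip n d (mv n k d) \<le> 0 \<longrightarrow> \<bar>d j\<bar> \<le> C * (\<Sum>u<n. \<bar>d u - d j * w u\<bar>)"
proof -
  define B1 where "B1 = (\<Sum>u<n. \<bar>mv n k w u\<bar>)"
  define B2 where "B2 = (\<Sum>u<n. \<Sum>v<n. \<bar>k u v\<bar>)"
  define q where "q = ip n w (mv n k w)"
  define C where "C = 1 + (2 * B1 + B2) / q"
  have q: "0 < q" using w by (simp add: q_def)
  have B: "0 \<le> B1" "0 \<le> B2" by (auto simp: B1_def B2_def sum_nonneg)
  have C1: "1 \<le> C" using q B by (simp add: C_def)
  have "\<bar>d j\<bar> \<le> C * (\<Sum>u<n. \<bar>d u - d j * w u\<bar>)" if Qd: "ip n d (mv n k d) \<le> 0" for d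
  proof -
    define e where "e = (\<lambda>u. d u - d j * w u)"
    define m where "m = (\<Sum>u<n. \<bar>e u\<bar>)"
    have m0: "0 \<le> m" by (simp add: m_def sum_nonneg)
    have em: "\<bar>e u\<bar> \<le> m" if "u < n" for u unfolding m_def using that by (intro member_le_sum) auto
    have dd: "d = (\<lambda>u. d j * w u + e u)" by (simp add: e_def)
    have mvd: "mv n k d u = d j * mv n k w u + mv n k e u" for u
      unfolding mv_def by (subst dd) (simp add: distrib_left sum.distrib sum_distrib_left mult_ac)
    have "ip n d (mv n k d) = (\<Sum>u<n. (d j * w u + e u) * (d j * mv n k w u + mv n k e u))"
      unfolding ip_def by (intro sum.cong refl) (simp only: mvd, simp add: e_def)
    also have "\<dots> = d j * d j * q + d j * ip n w (mv n k e) + d j * ip n e (mv n k w) + ip n e (mv n k e)"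
      unfolding q_def ip_def by (simp add: algebra_simps sum.distrib sum_distrib_left)
    also have "ip n w (mv n k e) = ip n e (mv n k w)" using ip_mv_sym[where h = k and x = w and y = e, OF sym] ip_commute by simp
    finally have eq: "d j * d j * q + 2 * (d j * ip n e (mv n k w)) + ip n e (mv n k e) \<le> 0" using Qd by simp
    have i1: "\<bar>ip n e (mv n k w)\<bar> \<le> m * B1"
    proof -
      have "\<bar>ip n e (mv n k w)\<bar> \<le> (\<Sum>u<n. \<bar>e u\<bar> * \<bar>mv n k w u\<bar>)"
        unfolding ip_def by (rule order_trans[OF sum_abs]) (simp add: abs_mult)
      also have "\<dots> \<le> (\<Sum>u<n. m * \<bar>mv n k w u\<bar>)" using em by (intro sum_mono mult_right_mono) auto
      finally show ?thesis by (simp add: B1_def sum_distrib_left)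
    qed
    have i2: "\<bar>ip n e (mv n k e)\<bar> \<le> m * m * B2"
    proof -
      have "\<bar>ip n e (mv n k e)\<bar> \<le> (\<Sum>u<n. \<Sum>v<n. \<bar>e u * (k u v * e v)\<bar>)"
        unfolding ip_def mv_def sum_distrib_left by (rule order_trans[OF sum_abs]) (intro sum_mono sum_abs)
      also have "\<dots> \<le> (\<Sum>u<n. \<Sum>v<n. m * m * \<bar>k u v\<bar>)"
      proof (intro sum_mono)
        fix u v assume uv: "u \<in> {..<n}" "v \<in> {..<n}"
        have "\<bar>e u\<bar> * \<bar>e v\<bar> * \<bar>k u v\<bar> \<le> m * m * \<bar>k u v\<bar>"
          using em[of u] em[of v] uv m0 by (intro mult_right_mono mult_mono) auto
        then show "\<bar>e u * (k u v * e v)\<bar> \<le> m * m * \<bar>k u v\<bar>" by (simp add: abs_mult mult_ac)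
      qed
      finally show ?thesis by (simp add: B2_def sum_distrib_left)
    qed
    show "\<bar>d j\<bar> \<le> C * (\<Sum>u<n. \<bar>d u - d j * w u\<bar>)"
    proof (cases "\<bar>d j\<bar> \<le> m")
      case True
      also have "m \<le> C * m" using mult_right_mono[OF C1 m0] by simp
      finally show ?thesis by (simp add: m_def e_def)
    next
      case False
      then have dpos: "0 < \<bar>d j\<bar>" using m0 by linarith
      have "\<bar>d j * ip n e (mv n k w)\<bar> \<le> \<bar>d j\<bar> * (m * B1)" unfolding abs_mult using i1 by (intro mult_left_mono) auto
      moreover have "m * m * B2 \<le> \<bar>d j\<bar> * m * B2" using False m0 B by (intro mult_right_mono) auto
      ultimately have "\<bar>d j\<bar> * \<bar>d j\<bar> * q \<le> 2 * (\<bar>d j\<bar> * (m * B1)) + \<bar>d j\<bar> * m * B2"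
        using eq i2 abs_mult_self_eq[of "d j"] by linarith
      then have "\<bar>d j\<bar> * (\<bar>d j\<bar> * q) \<le> \<bar>d j\<bar> * ((2 * B1 + B2) * m)" by (simp add: algebra_simps)
      then have "\<bar>d j\<bar> * q \<le> (2 * B1 + B2) * m" using dpos by simp
      then have "\<bar>d j\<bar> \<le> (2 * B1 + B2) * m / q" using q by (simp add: pos_le_divide_eq)
      also have "\<dots> \<le> C * m" using m0 by (simp add: C_def distrib_right)
      finally show ?thesis by (simp add: m_def e_def)
    qed
  qed
  then show ?thesis using C1 by (intro exI[of _ C]) auto
qed

text \<open>A Lipschitz form of the centre-stable manifold: initial states of trajectories that
  never leave a neighbourhood of the equilibrium lie on a graph transversal to \<open>w\<close>. The
  shift \<open>c\<close> is taken below the expansion rate \<open>l\<close> of the unstable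
  direction \<open>x\<close>, so that \<open>x\<close> stays inside the positive cone.\<close>

lemma unstable_point_graph:
  assumes x: "(\<Sum>u<n. \<Sum>v<n. adj E u v * cos (p u - p v) * (x u - x v)\<^sup>2) < 0"
  shows "\<exists>r>0. \<exists>j<n. \<exists>w. \<exists>C\<ge>0. w j = 1 \<and> (\<forall>\<theta> \<theta>'. kuramoto_solution {..<n} E \<theta> \<longrightarrow> kuramoto_solution {..<n} E \<theta>' \<longrightarrow>
     (\<forall>t\<ge>0. \<forall>u<n. \<bar>\<theta> t u - p u\<bar> \<le> r) \<longrightarrow> (\<forall>t\<ge>0. \<forall>u<n. \<bar>\<theta>' t u - p u\<bar> \<le> r) \<longrightarrow>
     \<bar>\<theta> 0 j - \<theta>' 0 j\<bar> \<le> C * (\<Sum>u<n. \<bar>(\<theta> 0 u - \<theta>' 0 u) - (\<theta> 0 j - \<theta>' 0 j) * w u\<bar>))"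
proof -
  let ?h = "hess n E p"
  have hx: "ip n x (mv n ?h x) < 0" using x ip_hess[of n x E p] by linarith
  have xx: "0 < ip n x x"
  proof (rule ccontr)
    assume "\<not> 0 < ip n x x"
    then have "\<forall>u<n. x u = 0" using ip_nonneg[of n x] ip_eq_0_iff[of n x] by simp
    then have "ip n x (mv n ?h x) = 0" by (simp add: ip_def)
    then show False using hx by simp
  qed
  define l where "l = - ip n x (mv n ?h x) / ip n x x"
  have l: "0 < l" "l * ip n x x = - ip n x (mv n ?h x)" using hx xx by (auto simp: l_def divide_less_0_iff)
  obtain c where c: "0 < c" "c < l" "\<And>d. (\<forall>u<n. mv n ?h d u + c * d u = 0) \<Longrightarrow> (\<forall>u<n. d u = 0)"
    using exists_nondegenerate_shift[of ?h, OF hess_sym l(1), of n] by blast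
  let ?k = "shifted n E p c"
  have "\<exists>m>0. \<forall>d. m * ip n d d \<le> ip n (mv n ?k d) (mv n ?k d)"
  proof (rule coercive_of_injective)
    fix d assume "\<forall>u<n. mv n ?k d u = 0"
    then have "mv n ?h d u + c * d u = 0" if "u < n" for u using mv_shifted[OF that, of E p c d] that by simp
    then show "\<forall>u<n. d u = 0" using c(3) by blast
  qed
  then obtain m where m: "0 < m" "\<And>d. m * ip n d d \<le> ip n (mv n ?k d) (mv n ?k d)" by blast
  obtain j where j: "j < n" "x j \<noteq> 0" using xx ip_eq_0_iff[of n x] by auto
  define w where "w = (\<lambda>u. x u / x j)"
  have wj: "w j = 1" using j by (simp add: w_def)
  have "ip n w (mv n ?k w) = ip n x (mv n ?k x) / (x j * x j)"
  proof -
    have "mv n ?k w u = mv n ?k x u / x j" for u unfolding mv_def w_def by (simp add: sum_divide_distrib)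
    then show ?thesis unfolding ip_def by (simp add: w_def sum_divide_distrib)
  qed
  moreover have "ip n x (mv n ?k x) = (l - c) * ip n x x"
  proof -
    have "ip n x (mv n ?k x) = (\<Sum>u<n. x u * (- mv n ?h x u - c * x u))"
      unfolding ip_def using mv_shifted by (intro sum.cong refl) simp
    also have "\<dots> = - ip n x (mv n ?h x) - c * ip n x x"
      by (simp add: ip_def right_diff_distrib sum_subtractf sum_negf sum_distrib_left mult_ac)
    finally show ?thesis using l by (simp add: algebra_simps)
  qed
  moreover have "0 < x j * x j" using j by (simp add: zero_less_mult_iff linorder_neq_iff disj_commute)
  ultimately have "0 < ip n w (mv n ?k w)" using c xx by simp
  from quadratic_cone_graph[of ?k, OF shifted_sym this wj] obtain C where
    C: "0 \<le> C" "\<And>d. ip n d (mv n ?k d) \<le> 0 \<Longrightarrow> \<bar>d j\<bar> \<le> C * (\<Sum>u<n. \<bar>d u - d j * w u\<bar>)" by blast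
  define r where "r = sqrt (m / (16 * (real n)^3))"
  have n0: "0 < real n" using j by simp
  have r: "0 < r" "16 * (real n)^3 * r\<^sup>2 \<le> m" using m n0 by (auto simp: r_def)
  show ?thesis
  proof (rule exI[of _ r], rule conjI[OF r(1)], rule exI[of _ j], rule conjI[OF j(1)], rule exI[of _ w],
      rule exI[of _ C], rule conjI[OF C(1)], rule conjI[OF wj], intro allI impI)
    fix \<theta> \<theta>' assume s: "kuramoto_solution {..<n} E \<theta>" "kuramoto_solution {..<n} E \<theta>'"
      and nr: "\<forall>t\<ge>0. \<forall>u<n. \<bar>\<theta> t u - p u\<bar> \<le> r" "\<forall>t\<ge>0. \<forall>u<n. \<bar>\<theta>' t u - p u\<bar> \<le> r"
    have "ip n (\<lambda>u. \<theta> 0 u - \<theta>' 0 u) (mv n ?k (\<lambda>u. \<theta> 0 u - \<theta>' 0 u)) \<le> 0"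
      by (rule cone_condition[OF s _ _ c(1) r m(2)]) (use nr in auto)
    from C(2)[OF this] show "\<bar>\<theta> 0 j - \<theta>' 0 j\<bar> \<le> C * (\<Sum>u<n. \<bar>(\<theta> 0 u - \<theta>' 0 u) - (\<theta> 0 j - \<theta>' 0 j) * w u\<bar>)" by simp
  qed
qed

lemma solution_shift:
  assumes "kuramoto_solution V E \<theta>" "0 \<le> T"
  shows "kuramoto_solution V E (\<lambda>t. \<theta> (T + t))"
  unfolding kuramoto_solution_def
proof (intro ballI allI impI)
  fix u t assume u: "u \<in> V" and t: "0 \<le> (t::real)"
  have "((\<lambda>s. \<theta> s u) has_real_derivative - (\<Sum>v\<in>V. adj E u v * sin (\<theta> (T + t) u - \<theta> (T + t) v))) (at (T + t) within {0..})"
    using assms u t by (simp add: kuramoto_solution_def)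
  then have "((\<lambda>s. \<theta> s u) has_real_derivative - (\<Sum>v\<in>V. adj E u v * sin (\<theta> (T + t) u - \<theta> (T + t) v))) (at (T + t) within (+) T ` {0..})"
    using assms(2) by (elim has_field_derivative_subset) auto
  then have "((\<lambda>s. \<theta> s u) \<circ> (\<lambda>s. T + s) has_real_derivative - (\<Sum>v\<in>V. adj E u v * sin (\<theta> (T + t) u - \<theta> (T + t) v)) * 1) (at t within {0..})"
    by (rule DERIV_image_chain) (auto intro!: derivative_eq_intros)
  then show "((\<lambda>s. \<theta> (T + s) u) has_real_derivative - (\<Sum>v\<in>V. adj E u v * sin (\<theta> (T + t) u - \<theta> (T + t) v))) (at t within {0..})"
    by (simp add: o_def)
qed

text \<open>The squared distance of two solutions satisfies \<open>D' \<ge> - 4 n D\<close>, so it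
  shrinks at most exponentially. This carries the graph from the time when the trajectory has come
  close to its limit back to time 0.\<close>

lemma backward_lipschitz:
  assumes sol: "kuramoto_solution {..<n} E \<theta>" "kuramoto_solution {..<n} E \<theta>'" and T: "0 \<le> T"
    and m: "\<And>v. v < n \<Longrightarrow> \<bar>\<theta> T v - \<theta>' T v\<bar> \<le> m" and u: "u < n"
  shows "\<bar>\<theta> 0 u - \<theta>' 0 u\<bar> \<le> (exp (2 * real n * T) * real n) * m"
proof -
  define d where "d = (\<lambda>t u. \<theta> t u - \<theta>' t u)"
  define g where "g = (\<lambda>t u. - kgrad n E (\<theta> t) u - - kgrad n E (\<theta>' t) u)"
  have der: "((\<lambda>s. d s u) has_real_derivative g t u) (at t within {0..})" if "u < n" "0 \<le> t" for u t
    unfolding d_def g_def using sol that by (intro DERIV_diff) (auto simp: kuramoto_solution_def kgrad_def)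
  define D where "D = (\<lambda>t. ip n (d t) (d t))"
  have derD: "(D has_real_derivative (\<Sum>u<n. g t u * d t u + g t u * d t u)) (at t within {0..})" if "0 \<le> t" for t
    unfolding D_def ip_def using that by (intro DERIV_sum DERIV_mult der) auto
  have low: "- (4 * n) * D t \<le> (\<Sum>u<n. g t u * d t u + g t u * d t u)" for t
  proof -
    have gb: "\<bar>g t u\<bar> \<le> n * \<bar>d t u\<bar> + (\<Sum>v<n. \<bar>d t v\<bar>)" for u
    proof -
      have "g t u = (\<Sum>v<n. adj E u v * (sin (\<theta>' t u - \<theta>' t v) - sin (\<theta> t u - \<theta> t v)))"
        by (simp add: g_def kgrad_def right_diff_distrib sum_subtractf)
      also have "\<bar>\<dots>\<bar> \<le> (\<Sum>v<n. \<bar>d t u\<bar> + \<bar>d t v\<bar>)"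
      proof (rule order_trans[OF sum_abs], rule sum_mono)
        fix v
        have 1: "\<bar>sin (\<theta>' t u - \<theta>' t v) - sin (\<theta> t u - \<theta> t v)\<bar> \<le> \<bar>d t u\<bar> + \<bar>d t v\<bar>"
          using abs_sin_diff_le[of "\<theta>' t u - \<theta>' t v" "\<theta> t u - \<theta> t v"] unfolding d_def by linarith
        have "\<bar>adj E u v\<bar> \<le> 1" using adj_nonneg[of E u v] adj_le_1[of E u v] by simp
        then show "\<bar>adj E u v * (sin (\<theta>' t u - \<theta>' t v) - sin (\<theta> t u - \<theta> t v))\<bar> \<le> \<bar>d t u\<bar> + \<bar>d t v\<bar>"
          unfolding abs_mult using mult_mono[OF _ 1, of "\<bar>adj E u v\<bar>" 1] by simp
      qed
      finally show ?thesis by (simp add: sum.distrib)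
    qed
    have "- (\<Sum>u<n. g t u * d t u) \<le> (\<Sum>u<n. (n * \<bar>d t u\<bar> + (\<Sum>v<n. \<bar>d t v\<bar>)) * \<bar>d t u\<bar>)"
      unfolding sum_negf[symmetric]
    proof (rule sum_mono)
      fix u
      have "- (g t u * d t u) \<le> \<bar>g t u\<bar> * \<bar>d t u\<bar>" by (metis abs_ge_minus_self abs_mult)
      also have "\<dots> \<le> (n * \<bar>d t u\<bar> + (\<Sum>v<n. \<bar>d t v\<bar>)) * \<bar>d t u\<bar>" using gb by (intro mult_right_mono) auto
      finally show "- (g t u * d t u) \<le> (n * \<bar>d t u\<bar> + (\<Sum>v<n. \<bar>d t v\<bar>)) * \<bar>d t u\<bar>" .
    qed
    also have "\<dots> = n * D t + (\<Sum>v<n. \<bar>d t v\<bar>)\<^sup>2"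
      by (simp add: D_def ip_def distrib_right sum.distrib sum_distrib_left power2_eq_square mult.assoc)
    also have "(\<Sum>v<n. \<bar>d t v\<bar>)\<^sup>2 \<le> n * D t"
      using Cauchy_Schwarz_ineq_sum[of "\<lambda>_. 1" "\<lambda>u. \<bar>d t u\<bar>" "{..<n}"] by (simp add: D_def ip_def power2_eq_square)
    finally have "- (\<Sum>u<n. g t u * d t u) \<le> n * D t + n * D t" by simp
    moreover have "(\<Sum>u<n. g t u * d t u + g t u * d t u) = 2 * (\<Sum>u<n. g t u * d t u)" by (simp only: sum.distrib mult_2)
    ultimately show ?thesis by (simp add: mult.assoc)
  qed
  define F where "F = (\<lambda>t. D t * exp (4 * real n * t))"
  have derF: "(F has_real_derivative ((\<Sum>u<n. g t u * d t u + g t u * d t u) + 4 * real n * D t) * exp (4 * real n * t)) (at t within {0..})" if "0 \<le> t" for t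
    unfolding F_def using derD[OF that] by (auto intro!: derivative_eq_intros simp: algebra_simps)
  obtain x where x: "F T - F 0 = ((\<Sum>u<n. g x u * d x u + g x u * d x u) + 4 * real n * D x) * exp (4 * real n * x) * (T - 0)"
    using has_real_derivative_mvt[OF derF _ T] by auto
  have "0 \<le> ((\<Sum>u<n. g x u * d x u + g x u * d x u) + 4 * real n * D x) * exp (4 * real n * x) * (T - 0)"
    using low[of x] T by (intro mult_nonneg_nonneg) auto
  then have "D 0 \<le> D T * exp (4 * real n * T)" using x by (simp add: F_def)
  also have "D T \<le> n * (m * m)"
  proof -
    have "D T \<le> (\<Sum>u<n. m * m)" unfolding D_def ip_def
    proof (rule sum_mono)
      fix v assume "v \<in> {..<n}"
      then have "\<bar>d T v\<bar> \<le> m" using m by (simp add: d_def)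
      then have "\<bar>d T v\<bar> * \<bar>d T v\<bar> \<le> m * m" by (intro mult_mono) auto
      then show "d T v * d T v \<le> m * m" by simp
    qed
    then show ?thesis by simp
  qed
  finally have "D 0 \<le> n * (m * m) * exp (4 * real n * T)" by simp
  moreover have "d 0 u * d 0 u \<le> D 0" unfolding D_def ip_def using u by (intro member_le_sum) auto
  ultimately have "(d 0 u)\<^sup>2 \<le> n * (m * m) * exp (4 * real n * T)" by (simp add: power2_eq_square)
  also have "\<dots> \<le> n * (n * (m * m) * exp (4 * real n * T))"
  proof -
    have "1 * (n * (m * m) * exp (4 * real n * T)) \<le> real n * (n * (m * m) * exp (4 * real n * T))"
      using u by (intro mult_right_mono) auto
    then show ?thesis by simp
  qed
  also have "\<dots> = (exp (2 * real n * T) * real n * m)\<^sup>2"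
    by (simp add: power2_eq_square mult_ac exp_add[symmetric])
  finally have "\<bar>d 0 u\<bar>\<^sup>2 \<le> (exp (2 * real n * T) * real n * m)\<^sup>2" by simp
  moreover have "0 \<le> m" using m[OF u] by linarith
  ultimately have "\<bar>d 0 u\<bar> \<le> exp (2 * real n * T) * real n * m" by (intro power2_le_imp_le[of "\<bar>d 0 u\<bar>"]) auto
  then show ?thesis by (simp add: d_def)
qed

section \<open>Null sets on the torus\<close>

lemma emeasure_uniform_interval_le:
  assumes "0 \<le> \<rho>"
  shows "emeasure (uniform_measure lborel {0..<2*pi}) {a - \<rho>..a + \<rho>} \<le> ennreal \<rho>"
proof -
  have l: "emeasure lborel {0..<2*pi} = ennreal (2 * pi)" by simp
  have "emeasure (uniform_measure lborel {0..<2*pi}) {a - \<rho>..a + \<rho>}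
      = emeasure lborel ({0..<2*pi} \<inter> {a - \<rho>..a + \<rho>}) / emeasure lborel {0..<2*pi}"
    by (intro emeasure_uniform_measure) auto
  also have "\<dots> \<le> emeasure lborel {a - \<rho>..a + \<rho>} / emeasure lborel {0..<2*pi}"
    by (intro divide_right_mono_ennreal emeasure_mono) auto
  also have "\<dots> = ennreal (2 * \<rho>) / ennreal (2 * pi)" using assms by (simp add: l)
  also have "\<dots> = ennreal (2 * \<rho> / (2 * pi))" using assms by (intro divide_ennreal) auto
  also have "\<dots> \<le> ennreal \<rho>"
    using assms pi_ge_two mult_left_mono[of 1 pi \<rho>] by (intro ennreal_leI) (simp add: field_simps)
  finally show ?thesis .
qed

lemma emeasure_torus_box_le:
  assumes "0 \<le> \<rho>"
  shows "emeasure (torus_uniform {..<n}) (PiE {..<n} (\<lambda>u. {a u - \<rho>..a u + \<rho>})) \<le> ennreal (\<rho> ^ n)"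
proof -
  have ps: "prob_space (uniform_measure lborel {0..<2*pi})"
    by (rule prob_space_uniform_measure) auto
  interpret product_prob_space "\<lambda>_::nat. uniform_measure lborel {0..<2*pi}"
    unfolding product_prob_space_def product_prob_space_axioms_def product_sigma_finite_def
    by (intro conjI allI ps prob_space_imp_sigma_finite[OF ps])
  have "emeasure (torus_uniform {..<n}) (PiE {..<n} (\<lambda>u. {a u - \<rho>..a u + \<rho>}))
      = (\<Prod>u<n. emeasure (uniform_measure lborel {0..<2*pi}) {a u - \<rho>..a u + \<rho>})"
    unfolding torus_uniform_def by (rule emeasure_PiM) auto
  also have "\<dots> \<le> (\<Prod>u<n. ennreal \<rho>)"
  proof (induction n)
    case (Suc n)
    then show ?case unfolding prod.lessThan_Suc
      by (intro mult_mono emeasure_uniform_interval_le[OF assms]) auto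
  qed simp
  also have "\<dots> = ennreal (\<rho> ^ n)" using assms by (simp add: ennreal_power)
  finally show ?thesis .
qed

lemma sets_torus_box: "PiE {..<n} (\<lambda>u. {a u - \<rho>..a u + \<rho>::real}) \<in> sets (torus_uniform {..<n})"
  unfolding torus_uniform_def by (intro sets_PiM_I_finite) auto

text \<open>A Lipschitz graph over a hyperplane is covered by \<open>O(M\<^sup>n\<^sup>-\<^sup>1)\<close> sets of diameter \<open>O(1/M)\<close>,
  and so is any Lipschitz image of it.\<close>

lemma lipschitz_graph_null:
  fixes T :: "(nat \<Rightarrow> real) set" and \<sigma> :: "(nat \<Rightarrow> real) \<Rightarrow> nat \<Rightarrow> real"
  assumes j: "j < n" "w j = 1" and C: "0 \<le> C"
    and graph: "\<And>x y. x \<in> T \<Longrightarrow> y \<in> T \<Longrightarrow> \<bar>\<sigma> x j - \<sigma> y j\<bar> \<le> C * (\<Sum>u<n. \<bar>(\<sigma> x u - \<sigma> y u) - (\<sigma> x j - \<sigma> y j) * w u\<bar>)"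
    and bd: "\<And>x u. x \<in> T \<Longrightarrow> u < n \<Longrightarrow> \<bar>\<sigma> x u\<bar> \<le> R"
    and \<Lambda>: "0 \<le> \<Lambda>" and lip: "\<And>x y m u. x \<in> T \<Longrightarrow> y \<in> T \<Longrightarrow> (\<And>v. v < n \<Longrightarrow> \<bar>\<sigma> x v - \<sigma> y v\<bar> \<le> m) \<Longrightarrow> u < n \<Longrightarrow> \<bar>x u - y u\<bar> \<le> \<Lambda> * m"
  shows "\<exists>N\<in>null_sets (torus_uniform {..<n}). T \<inter> space (torus_uniform {..<n}) \<subseteq> N"
proof -
  define W where "W = (\<Sum>u<n. \<bar>w u\<bar>)"
  have wW: "\<bar>w u\<bar> \<le> W" if "u < n" for u unfolding W_def using that by (intro member_le_sum) auto
  have W0: "0 \<le> W" by (simp add: W_def sum_nonneg)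
  \<comment> \<open>Projection along \<open>w\<close> onto the hyperplane where coordinate
    \<open>j\<close> vanishes; \<open>w j = 1\<close> gives \<open>q x j = 0\<close>.\<close>
  define q where "q = (\<lambda>x u. \<sigma> x u - \<sigma> x j * w u)"
  define R' where "R' = \<bar>R\<bar> + \<bar>R\<bar> * W"
  have R'0: "0 \<le> R'" using W0 by (simp add: R'_def)
  have qb: "\<bar>q x u\<bar> \<le> R'" if "x \<in> T" "u < n" for x u
  proof -
    have "\<bar>\<sigma> x j * w u\<bar> \<le> \<bar>R\<bar> * W"
      unfolding abs_mult using bd[OF that(1) j(1)] wW[OF that(2)] by (intro mult_mono) auto
    then show ?thesis using bd[OF that] unfolding q_def R'_def by linarith
  qed
  define K where "K = nat \<lceil>2 * R'\<rceil>"
  define C2 where "C2 = 1 + W * (C * n)"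
  have C20: "0 \<le> C2" using W0 C by (simp add: C2_def)
  define I where "I = {..<n} - {j}"
  have cardI: "card I = n - 1" using j by (simp add: I_def)
  \<comment> \<open>The cell of the projected point in a grid of mesh \<open>1 / M\<close>; adding
    \<open>R'\<close> makes the coordinates nonnegative. Coordinate \<open>j\<close> is left out,
    which saves one factor \<open>M\<close> in the number of cells.\<close>
  define idx where "idx = (\<lambda>M x. \<lambda>u\<in>I. nat \<lfloor>(q x u + R') * real M\<rfloor>)"
  define rep where "rep = (\<lambda>M f. SOME x. x \<in> T \<and> idx M x = f)"
  define \<rho> where "\<rho> = (\<lambda>M. \<Lambda> * (C2 / real M))"
  define U where "U = (\<lambda>M. \<Union>f\<in>(PiE I (\<lambda>_. {..K * M})). PiE {..<n} (\<lambda>u. {rep M f u - \<rho> M..rep M f u + \<rho> M}))"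
  have finP: "finite (PiE I (\<lambda>_. {..K * M}))" for M by (intro finite_PiE) (auto simp: I_def)
  have close: "\<bar>x u - y u\<bar> \<le> \<rho> M" if xy: "x \<in> T" "y \<in> T" "idx M x = idx M y" "0 < M" "u < n" for x y M u
  proof -
    have qd: "\<bar>q x v - q y v\<bar> \<le> 1 / M" if v: "v < n" for v
    proof (cases "v = j")
      case True
      then show ?thesis using j by (simp add: q_def)
    next
      case False
      then have vI: "v \<in> I" using v by (simp add: I_def)
      have "nat \<lfloor>(q x v + R') * real M\<rfloor> = nat \<lfloor>(q y v + R') * real M\<rfloor>"
        using fun_cong[OF xy(3), of v] vI by (simp add: idx_def)
      moreover have "0 \<le> (q x v + R') * real M" "0 \<le> (q y v + R') * real M"
        using qb[OF xy(1) v] qb[OF xy(2) v] by (intro mult_nonneg_nonneg; simp)+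
      ultimately have "\<lfloor>(q x v + R') * real M\<rfloor> = \<lfloor>(q y v + R') * real M\<rfloor>" by (simp add: eq_nat_nat_iff)
      then have "\<bar>(q x v + R') * real M - (q y v + R') * real M\<bar> \<le> 1" by linarith
      then have "\<bar>q x v - q y v\<bar> * real M \<le> 1" by (simp add: abs_mult[of _ "real M", simplified] left_diff_distrib[symmetric])
      then show ?thesis using xy(4) by (simp add: pos_le_divide_eq)
    qed
    have "\<bar>\<sigma> x j - \<sigma> y j\<bar> \<le> C * (\<Sum>u<n. \<bar>(\<sigma> x u - \<sigma> y u) - (\<sigma> x j - \<sigma> y j) * w u\<bar>)" by (rule graph[OF xy(1,2)])
    also have "\<dots> = C * (\<Sum>u<n. \<bar>q x u - q y u\<bar>)"
      by (intro arg_cong[of _ _ "\<lambda>s. C * s"] sum.cong refl arg_cong[of _ _ abs]) (simp add: q_def algebra_simps)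
    also have "\<dots> \<le> C * (\<Sum>u<n. 1 / M)" using qd C by (intro mult_left_mono sum_mono) auto
    finally have sj: "\<bar>\<sigma> x j - \<sigma> y j\<bar> \<le> C * n / M" by simp
    have "\<bar>\<sigma> x v - \<sigma> y v\<bar> \<le> C2 / M" if v: "v < n" for v
    proof -
      have "\<sigma> x v - \<sigma> y v = (q x v - q y v) + (\<sigma> x j - \<sigma> y j) * w v" by (simp add: q_def algebra_simps)
      moreover have "\<bar>(\<sigma> x j - \<sigma> y j) * w v\<bar> \<le> (C * n / M) * W"
        unfolding abs_mult using sj wW[OF v] C by (intro mult_mono) auto
      ultimately have "\<bar>\<sigma> x v - \<sigma> y v\<bar> \<le> 1 / M + (C * n / M) * W" using qd[OF v] by linarith
      also have "\<dots> = C2 / M" by (simp add: C2_def add_divide_distrib mult_ac)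
      finally show ?thesis .
    qed
    then show ?thesis unfolding \<rho>_def using lip[OF xy(1,2)] xy(5) by blast
  qed
  have cover: "T \<inter> space (torus_uniform {..<n}) \<subseteq> U M" if M: "0 < M" for M
  proof
    fix x assume x: "x \<in> T \<inter> space (torus_uniform {..<n})"
    then have xT: "x \<in> T" and xe: "x \<in> extensional {..<n}" by (auto simp: torus_uniform_def space_PiM PiE_def)
    have f: "idx M x \<in> PiE I (\<lambda>_. {..K * M})"
    proof (rule PiE_I)
      fix u assume u: "u \<in> I"
      then have "u < n" by (simp add: I_def)
      have "(q x u + R') * real M \<le> (2 * R') * real M" using qb[OF xT \<open>u < n\<close>] by (intro mult_right_mono) auto
      also have "\<dots> \<le> real K * real M" unfolding K_def by (intro mult_right_mono real_nat_ceiling_ge) auto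
      finally have "(q x u + R') * real M \<le> real (K * M)" by simp
      then have "nat \<lfloor>(q x u + R') * real M\<rfloor> \<le> K * M" by linarith
      then show "idx M x u \<in> {..K * M}" using u by (simp add: idx_def)
    qed (simp add: idx_def)
    have r: "rep M (idx M x) \<in> T" "idx M (rep M (idx M x)) = idx M x"
      using someI[of "\<lambda>y. y \<in> T \<and> idx M y = idx M x" x] xT unfolding rep_def by auto
    have "x \<in> PiE {..<n} (\<lambda>u. {rep M (idx M x) u - \<rho> M..rep M (idx M x) u + \<rho> M})"
    proof (rule PiE_I)
      fix u assume "u \<in> {..<n}"
      then have "\<bar>rep M (idx M x) u - x u\<bar> \<le> \<rho> M" using close[OF r(1) xT r(2) M] by simp
      then show "x u \<in> {rep M (idx M x) u - \<rho> M..rep M (idx M x) u + \<rho> M}" by (auto simp: abs_le_iff)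
    qed (use xe in \<open>simp add: extensional_def\<close>)
    then show "x \<in> U M" unfolding U_def using f by blast
  qed
  have Us: "U M \<in> sets (torus_uniform {..<n})" for M
    unfolding U_def using finP by (intro sets.finite_UN sets_torus_box) auto
  \<comment> \<open>There are at most \<open>((K + 1) * M)^(n - 1)\<close> cells, each contributing
    a box of measure at most \<open>(\<Lambda> * C2 / M)^n\<close>; the product is
    \<open>C3 / M\<close>.\<close>
  define C3 where "C3 = (real K + 1) ^ (n - 1) * (\<Lambda> * C2) ^ n"
  have C30: "0 \<le> C3" using \<Lambda> C20 by (simp add: C3_def)
  have Um: "emeasure (torus_uniform {..<n}) (U M) \<le> ennreal (C3 / M)" if M: "0 < M" for M
  proof -
    have r0: "0 \<le> \<rho> M" using \<Lambda> C20 by (simp add: \<rho>_def)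
    have "emeasure (torus_uniform {..<n}) (U M) \<le>
        (\<Sum>f\<in>PiE I (\<lambda>_. {..K * M}). emeasure (torus_uniform {..<n}) (PiE {..<n} (\<lambda>u. {rep M f u - \<rho> M..rep M f u + \<rho> M})))"
      unfolding U_def using finP by (intro emeasure_subadditive_finite) (auto intro: sets_torus_box)
    also have "\<dots> \<le> (\<Sum>f\<in>PiE I (\<lambda>_. {..K * M}). ennreal (\<rho> M ^ n))"
      by (intro sum_mono emeasure_torus_box_le r0)
    also have "\<dots> = ennreal (real ((K * M + 1) ^ (n - 1)) * \<rho> M ^ n)"
    proof -
      have "card (PiE I (\<lambda>_. {..K * M})) = (K * M + 1) ^ (n - 1)"
        using j by (subst card_PiE) (auto simp: I_def cardI[unfolded I_def])
      then show ?thesis using r0 by (simp add: ennreal_mult' ennreal_of_nat_eq_real_of_nat del: of_nat_power)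
    qed
    also have "\<dots> \<le> ennreal (C3 / M)"
    proof (rule ennreal_leI)
      have "real ((K * M + 1) ^ (n - 1)) * \<rho> M ^ n \<le> ((real K + 1) * M) ^ (n - 1) * \<rho> M ^ n"
        using r0 M by (intro mult_right_mono) (auto intro!: power_mono simp: algebra_simps)
      also have "\<dots> = (real K + 1) ^ (n - 1) * (\<Lambda> * C2) ^ n * (real M ^ (n - 1) / real M ^ n)"
        by (simp add: \<rho>_def power_mult_distrib power_divide mult_ac)
      also have "real M ^ (n - 1) / real M ^ n = 1 / M"
        using j M by (cases n) auto
      finally show "real ((K * M + 1) ^ (n - 1)) * \<rho> M ^ n \<le> C3 / M" by (simp add: C3_def)
    qed
    finally show ?thesis .
  qed
  define N where "N = (\<Inter>M. U (Suc M))"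
  have Ns: "N \<in> sets (torus_uniform {..<n})" unfolding N_def using Us by (intro sets.countable_INT) auto
  have "emeasure (torus_uniform {..<n}) N \<le> ennreal (C3 / Suc M)" for M
  proof -
    have "emeasure (torus_uniform {..<n}) N \<le> emeasure (torus_uniform {..<n}) (U (Suc M))"
      by (intro emeasure_mono Us) (auto simp: N_def)
    also have "\<dots> \<le> ennreal (C3 / Suc M)" using Um[of "Suc M"] by simp
    finally show ?thesis .
  qed
  moreover have "(\<lambda>M. ennreal (C3 / Suc M)) \<longlonglongrightarrow> ennreal 0"
    by (intro tendsto_ennrealI) (use LIMSEQ_Suc[OF lim_const_over_n[of C3]] in simp)
  ultimately have "emeasure (torus_uniform {..<n}) N \<le> ennreal 0"
    by (intro LIMSEQ_le_const) auto
  then have "N \<in> null_sets (torus_uniform {..<n})" using Ns by (intro null_setsI) auto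
  moreover have "T \<inter> space (torus_uniform {..<n}) \<subseteq> N" using cover unfolding N_def by blast
  ultimately show ?thesis by blast
qed

text \<open>Initial states of solutions that stay within \<open>r\<close> of \<open>q\<close> from
  time \<open>N\<close> on. Restricting \<open>q\<close> and \<open>r\<close> to rational values
  leaves countably many such sets.\<close>

definition trapped :: "nat \<Rightarrow> nat set set \<Rightarrow> (nat \<Rightarrow> real) \<Rightarrow> real \<Rightarrow> nat \<Rightarrow> (nat \<Rightarrow> real) set" where
  "trapped n E q r N = {x. \<exists>\<theta>. kuramoto_solution {..<n} E \<theta> \<and> (\<forall>u<n. \<theta> 0 u = x u) \<and>
      (\<forall>t\<ge>0. \<forall>u<n. \<bar>\<theta> (real N + t) u - q u\<bar> \<le> r)}"

lemma trapped_null: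
  assumes j: "j < n" "w j = 1" and C: "0 \<le> C"
    and graph: "\<And>\<theta> \<theta>'. kuramoto_solution {..<n} E \<theta> \<Longrightarrow> kuramoto_solution {..<n} E \<theta>' \<Longrightarrow>
     (\<forall>t\<ge>0. \<forall>u<n. \<bar>\<theta> t u - q u\<bar> \<le> r) \<Longrightarrow> (\<forall>t\<ge>0. \<forall>u<n. \<bar>\<theta>' t u - q u\<bar> \<le> r) \<Longrightarrow>
     \<bar>\<theta> 0 j - \<theta>' 0 j\<bar> \<le> C * (\<Sum>u<n. \<bar>(\<theta> 0 u - \<theta>' 0 u) - (\<theta> 0 j - \<theta>' 0 j) * w u\<bar>)"
  shows "\<exists>N0\<in>null_sets (torus_uniform {..<n}). trapped n E q r N \<inter> space (torus_uniform {..<n}) \<subseteq> N0"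
proof -
  have "\<forall>x\<in>trapped n E q r N. \<exists>\<theta>. kuramoto_solution {..<n} E \<theta> \<and> (\<forall>u<n. \<theta> 0 u = x u) \<and>
      (\<forall>t\<ge>0. \<forall>u<n. \<bar>\<theta> (real N + t) u - q u\<bar> \<le> r)" by (auto simp: trapped_def)
  then obtain \<Theta> where \<Theta>: "\<And>x. x \<in> trapped n E q r N \<Longrightarrow> kuramoto_solution {..<n} E (\<Theta> x)"
    "\<And>x u. x \<in> trapped n E q r N \<Longrightarrow> u < n \<Longrightarrow> \<Theta> x 0 u = x u"
    "\<And>x t u. x \<in> trapped n E q r N \<Longrightarrow> 0 \<le> t \<Longrightarrow> u < n \<Longrightarrow> \<bar>\<Theta> x (real N + t) u - q u\<bar> \<le> r" by metis
  show ?thesis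
  proof (rule lipschitz_graph_null[where j = j and w = w and C = C and n = n and \<sigma> = "\<lambda>x. \<Theta> x (real N)" and R = "\<bar>r\<bar> + (\<Sum>u<n. \<bar>q u\<bar>)" and \<Lambda> = "exp (2 * real n * real N) * real n", OF j C])
    fix x y assume xy: "x \<in> trapped n E q r N" "y \<in> trapped n E q r N"
    show "\<bar>\<Theta> x (real N) j - \<Theta> y (real N) j\<bar> \<le> C * (\<Sum>u<n. \<bar>(\<Theta> x (real N) u - \<Theta> y (real N) u) - (\<Theta> x (real N) j - \<Theta> y (real N) j) * w u\<bar>)"
      using graph[OF solution_shift[OF \<Theta>(1)[OF xy(1)], of "real N"] solution_shift[OF \<Theta>(1)[OF xy(2)], of "real N"]] \<Theta>(3) xy by simp
    fix m u assume m: "\<And>v. v < n \<Longrightarrow> \<bar>\<Theta> x (real N) v - \<Theta> y (real N) v\<bar> \<le> m" and u: "u < n"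
    show "\<bar>x u - y u\<bar> \<le> exp (2 * real n * real N) * real n * m"
      using backward_lipschitz[OF \<Theta>(1)[OF xy(1)] \<Theta>(1)[OF xy(2)] _ m u] \<Theta>(2)[OF xy(1) u] \<Theta>(2)[OF xy(2) u] by simp
  next
    fix x u assume x: "x \<in> trapped n E q r N" and u: "u < n"
    have "\<bar>\<Theta> x (real N) u - q u\<bar> \<le> r" using \<Theta>(3)[OF x, of 0 u] u by simp
    moreover have "\<bar>q u\<bar> \<le> (\<Sum>u<n. \<bar>q u\<bar>)" using u by (intro member_le_sum) auto
    ultimately show "\<bar>\<Theta> x (real N) u\<bar> \<le> \<bar>r\<bar> + (\<Sum>u<n. \<bar>q u\<bar>)" by linarith
  qed simp
qed

text \<open>A trajectory that does not synchronize has a limit that is critical but not stable,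
  hence it is trapped near a point with an expanding direction. A union over all such limits would
  be uncountable, so each limit is replaced by a rational centre and radius that inherit the graph
  property.\<close>

theorem globally_synchronizing_if_no_spurious_equilibria:
  assumes "\<And>\<phi>. stable_critical {..<n} E \<phi> \<Longrightarrow> fully_synchronized {..<n} \<phi>"
  shows "globally_synchronizing {..<n} E"
proof -
  define Ix where "Ix = {(q, r, N) \<in> (PiE {..<n} (\<lambda>_. \<rat>)) \<times> (\<rat> :: real set) \<times> (UNIV :: nat set).
     \<exists>N0\<in>null_sets (torus_uniform {..<n}). trapped n E q r N \<inter> space (torus_uniform {..<n}) \<subseteq> N0}"
  have "countable (PiE {..<n} (\<lambda>_. \<rat> :: real set) \<times> (\<rat> :: real set) \<times> (UNIV :: nat set))"
    by (intro countable_SIGMA countable_PiE countable_rat) auto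
  then have cI: "countable Ix" unfolding Ix_def by (rule countable_subset[rotated]) auto
  have "\<forall>z\<in>Ix. \<exists>N0\<in>null_sets (torus_uniform {..<n}). trapped n E (fst z) (fst (snd z)) (snd (snd z)) \<inter> space (torus_uniform {..<n}) \<subseteq> N0"
    by (auto simp: Ix_def)
  then obtain Z where Z: "\<And>z. z \<in> Ix \<Longrightarrow> Z z \<in> null_sets (torus_uniform {..<n})"
    "\<And>z. z \<in> Ix \<Longrightarrow> trapped n E (fst z) (fst (snd z)) (snd (snd z)) \<inter> space (torus_uniform {..<n}) \<subseteq> Z z" by metis
  have null: "(\<Union>z\<in>Ix. Z z) \<in> null_sets (torus_uniform {..<n})" by (rule null_sets_UN'[OF cI Z(1)])
  show ?thesis unfolding globally_synchronizing_def
  proof (rule AE_I'[OF null], rule subsetI)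
    fix \<theta>0 assume "\<theta>0 \<in> {\<theta>0 \<in> space (torus_uniform {..<n}).
      \<not> (\<forall>\<theta>. kuramoto_solution {..<n} E \<theta> \<and> (\<forall>u\<in>{..<n}. \<theta> 0 u = \<theta>0 u) \<longrightarrow> converges_to_sync {..<n} \<theta>)}"
    then obtain \<theta> where sp: "\<theta>0 \<in> space (torus_uniform {..<n})" and sol: "kuramoto_solution {..<n} E \<theta>"
      and init: "\<forall>u\<in>{..<n}. \<theta> 0 u = \<theta>0 u" and ns: "\<not> converges_to_sync {..<n} \<theta>" by blast
    obtain \<phi> where \<phi>: "\<forall>u<n. ((\<lambda>t. \<theta> t u) \<longlongrightarrow> \<phi> u) at_top" "\<forall>u<n. kgrad n E \<phi> u = 0"
      using kuramoto_trajectory_converges[OF sol] by blast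
    have "\<not> fully_synchronized {..<n} \<phi>" using ns \<phi>(1) by (auto simp: converges_to_sync_def)
    then have "\<not> stable_critical {..<n} E \<phi>" using assms by blast
    then obtain x where "(\<Sum>u<n. \<Sum>v<n. adj E u v * cos (\<phi> u - \<phi> v) * (x u - x v)\<^sup>2) < 0"
      using \<phi>(2) unfolding stable_critical_def kgrad_def by (auto simp: not_le)
    from unstable_point_graph[OF this] obtain r j w C where r: "0 < r" and j: "j < n" "w j = 1" and C: "0 \<le> C"
      and gr: "\<And>\<theta> \<theta>'. kuramoto_solution {..<n} E \<theta> \<Longrightarrow> kuramoto_solution {..<n} E \<theta>' \<Longrightarrow>
        (\<forall>t\<ge>0. \<forall>u<n. \<bar>\<theta> t u - \<phi> u\<bar> \<le> r) \<Longrightarrow> (\<forall>t\<ge>0. \<forall>u<n. \<bar>\<theta>' t u - \<phi> u\<bar> \<le> r) \<Longrightarrow>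
        \<bar>\<theta> 0 j - \<theta>' 0 j\<bar> \<le> C * (\<Sum>u<n. \<bar>(\<theta> 0 u - \<theta>' 0 u) - (\<theta> 0 j - \<theta>' 0 j) * w u\<bar>)"
      by blast
    \<comment> \<open>The trajectory is eventually within \<open>r / 8\<close> of its limit and the
      rational centre is within \<open>r / 8\<close> of it too, so the distance to the centre is
      below \<open>r / 4 < \<rho>\<close>. Conversely \<open>\<rho> + r / 8 < r\<close> keeps the
      trapped solutions in the ball where the graph estimate holds.\<close>
    obtain \<rho> where \<rho>: "\<rho> \<in> \<rat>" "r / 4 < \<rho>" "\<rho> < r / 2" using Rats_dense_in_real[of "r / 4" "r / 2"] r by auto
    have "\<exists>q\<in>\<rat>. \<phi> u - r / 8 < q \<and> q < \<phi> u + r / 8" for u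
      using Rats_dense_in_real[of "\<phi> u - r / 8" "\<phi> u + r / 8"] r by auto
    then obtain q0 where q0: "\<And>u. q0 u \<in> \<rat>" "\<And>u. \<phi> u - r / 8 < q0 u" "\<And>u. q0 u < \<phi> u + r / 8" by metis
    define q where "q = restrict q0 {..<n}"
    have q: "q \<in> PiE {..<n} (\<lambda>_. \<rat>)" using q0(1) by (auto simp: q_def)
    have q\<phi>: "\<bar>q u - \<phi> u\<bar> < r / 8" if "u < n" for u
      using q0(2,3)[of u] that unfolding q_def restrict_def abs_less_iff by simp
    have "\<forall>\<^sub>F t in at_top. \<forall>u\<in>{..<n}. \<bar>\<theta> t u - \<phi> u\<bar> < r / 8"
    proof (rule eventually_ball_finite, simp, rule ballI)
      fix u assume "u \<in> {..<n}"
      then have "((\<lambda>t. \<theta> t u) \<longlongrightarrow> \<phi> u) at_top" using \<phi>(1) by simp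
      from tendstoD[OF this, of "r / 8"] show "\<forall>\<^sub>F t in at_top. \<bar>\<theta> t u - \<phi> u\<bar> < r / 8" using r by (simp add: dist_real_def)
    qed
    then obtain T where T: "\<And>t u. T \<le> t \<Longrightarrow> u < n \<Longrightarrow> \<bar>\<theta> t u - \<phi> u\<bar> < r / 8"
      unfolding eventually_at_top_linorder by auto
    define N where "N = nat \<lceil>T\<rceil>"
    have TN: "T \<le> real N" unfolding N_def by (rule real_nat_ceiling_ge)
    have "\<theta>0 \<in> trapped n E q \<rho> N" unfolding trapped_def
    proof (intro CollectI exI[of _ \<theta>] conjI sol allI impI)
      show "\<theta> 0 u = \<theta>0 u" if "u < n" for u using init that by simp
      show "\<bar>\<theta> (real N + t) u - q u\<bar> \<le> \<rho>" if "0 \<le> t" "u < n" for t u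
        using T[of "real N + t" u] q\<phi>[OF that(2)] TN that \<rho> by linarith
    qed
    moreover have "(q, \<rho>, N) \<in> Ix"
    proof -
      have "\<exists>N0\<in>null_sets (torus_uniform {..<n}). trapped n E q \<rho> N \<inter> space (torus_uniform {..<n}) \<subseteq> N0"
      proof (rule trapped_null[where j = j and w = w and C = C, OF j C])
        fix \<theta>1 \<theta>2 assume s: "kuramoto_solution {..<n} E \<theta>1" "kuramoto_solution {..<n} E \<theta>2"
          and nr: "\<forall>t\<ge>0. \<forall>u<n. \<bar>\<theta>1 t u - q u\<bar> \<le> \<rho>" "\<forall>t\<ge>0. \<forall>u<n. \<bar>\<theta>2 t u - q u\<bar> \<le> \<rho>"
        have "\<bar>a - \<phi> u\<bar> \<le> r" if "\<bar>a - q u\<bar> \<le> \<rho>" "u < n" for a u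
          using that q\<phi>[OF that(2)] \<rho> r by linarith
        then show "\<bar>\<theta>1 0 j - \<theta>2 0 j\<bar> \<le> C * (\<Sum>u<n. \<bar>(\<theta>1 0 u - \<theta>2 0 u) - (\<theta>1 0 j - \<theta>2 0 j) * w u\<bar>)"
          using nr by (intro gr s) auto
      qed
      then show ?thesis using q \<rho>(1) by (simp add: Ix_def)
    qed
    ultimately show "\<theta>0 \<in> (\<Union>z\<in>Ix. Z z)" using Z(2)[of "(q, \<rho>, N)"] sp by fastforce
  qed
qed

section \<open>Uniformly random orderings\<close>

abbreviation perms :: "'a set \<Rightarrow> 'a list set" where "perms \<equiv> permutations_of_set"

definition avg :: "'a set \<Rightarrow> ('a list \<Rightarrow> real) \<Rightarrow> real" where
  "avg A f = (\<Sum>xs\<in>perms A. f xs) / fact (card A)"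

definition ins :: "'a \<Rightarrow> nat \<Rightarrow> 'a list \<Rightarrow> 'a list" where
  "ins y i ys = take i ys @ y # drop i ys"

lemma set_ins: "set (ins y i ys) = insert y (set ys)"
proof -
  have "set ys = set (take i ys) \<union> set (drop i ys)" by (metis append_take_drop_id set_append)
  then show ?thesis by (auto simp: ins_def)
qed

lemma distinct_ins: "distinct (ins y i ys) \<longleftrightarrow> distinct ys \<and> y \<notin> set ys"
proof -
  have "mset (ins y i ys) = mset (y # ys)" unfolding ins_def
    by (metis append_take_drop_id mset_append mset.simps(2) union_mset_add_mset_right)
  then have "distinct (ins y i ys) = distinct (y # ys)" by (rule mset_eq_imp_distinct_iff)
  then show ?thesis by auto
qed

text \<open>A uniform ordering of \<open>A\<close> is a uniform ordering of \<open>A - {y}\<close>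
  together with an independent uniform position for \<open>y\<close>. This recursion takes the place
  of conditioning in the computations below.\<close>

lemma bij_betw_ins:
  assumes "finite A" "y \<in> A"
  shows "bij_betw (\<lambda>(i, ys). ins y i ys) ({..<card A} \<times> perms (A - {y})) (perms A)"
proof (rule bij_betw_byWitness[where f' = "\<lambda>xs. (length (takeWhile (\<lambda>x. x \<noteq> y) xs), filter (\<lambda>x. x \<noteq> y) xs)"])
  show "\<forall>a\<in>{..<card A} \<times> perms (A - {y}). (\<lambda>xs. (length (takeWhile (\<lambda>x. x \<noteq> y) xs), filter (\<lambda>x. x \<noteq> y) xs)) ((\<lambda>(i, ys). ins y i ys) a) = a"
  proof
    fix a assume "a \<in> {..<card A} \<times> perms (A - {y})"
    then obtain i ys where a: "a = (i, ys)" and i: "i \<in> {..<card A}" and ys: "ys \<in> perms (A - {y})" by auto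
    have yn: "y \<notin> set ys" and len: "length ys = card A - 1"
      using permutations_of_setD[OF ys] length_finite_permutations_of_set[OF ys] assms by auto
    have "x \<noteq> y" if "x \<in> set (take i ys)" for x using that yn in_set_takeD by fastforce
    then have "takeWhile (\<lambda>x. x \<noteq> y) (ins y i ys) = take i ys" unfolding ins_def by (subst takeWhile_append2) auto
    moreover have "filter (\<lambda>x. x \<noteq> y) (ins y i ys) = ys"
    proof -
      have "filter (\<lambda>x. x \<noteq> y) (ins y i ys) = filter (\<lambda>x. x \<noteq> y) (take i ys @ drop i ys)"
        by (simp only: ins_def filter_append filter.simps) simp
      also have "\<dots> = ys" unfolding append_take_drop_id using yn by (intro filter_True) auto
      finally show ?thesis .
    qed
    ultimately show "(\<lambda>xs. (length (takeWhile (\<lambda>x. x \<noteq> y) xs), filter (\<lambda>x. x \<noteq> y) xs)) ((\<lambda>(i, ys). ins y i ys) a) = a"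
      using i len by (auto simp: a)
  qed
  show "\<forall>xs\<in>perms A. (\<lambda>(i, ys). ins y i ys) (length (takeWhile (\<lambda>x. x \<noteq> y) xs), filter (\<lambda>x. x \<noteq> y) xs) = xs"
  proof
    fix xs assume xs: "xs \<in> perms A"
    then have "y \<in> set xs" "distinct xs" using assms by (auto simp: permutations_of_setD)
    then obtain as bs where ab: "xs = as @ y # bs" "y \<notin> set as" by (metis split_list_first)
    then have yb: "y \<notin> set bs" using \<open>distinct xs\<close> by auto
    have "takeWhile (\<lambda>x. x \<noteq> y) xs = as" unfolding ab(1) using ab(2) by (subst takeWhile_append2) auto
    moreover have "filter (\<lambda>x. x \<noteq> y) xs = as @ bs"
      unfolding ab(1) using ab(2) yb by (simp, metis (mono_tags, lifting) filter_True)
    ultimately show "(\<lambda>(i, ys). ins y i ys) (length (takeWhile (\<lambda>x. x \<noteq> y) xs), filter (\<lambda>x. x \<noteq> y) xs) = xs"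
      by (simp add: ins_def ab(1))
  qed
  show "(\<lambda>(i, ys). ins y i ys) ` ({..<card A} \<times> perms (A - {y})) \<subseteq> perms A"
  proof (rule image_subsetI)
    fix z assume "z \<in> {..<card A} \<times> perms (A - {y})"
    then obtain i ys where z: "z = (i, ys)" "ys \<in> perms (A - {y})" by auto
    then have "set ys = A - {y}" "distinct ys" by (simp_all add: permutations_of_setD)
    then have "ins y i ys \<in> perms A"
      using assms(2) by (intro permutations_of_setI) (simp_all add: set_ins distinct_ins insert_absorb)
    then show "(\<lambda>(i, ys). ins y i ys) z \<in> perms A" by (simp add: z)
  qed
  show "(\<lambda>xs. (length (takeWhile (\<lambda>x. x \<noteq> y) xs), filter (\<lambda>x. x \<noteq> y) xs)) ` perms A \<subseteq> {..<card A} \<times> perms (A - {y})"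
  proof (rule image_subsetI, rule SigmaI)
    fix xs assume xs: "xs \<in> perms A"
    have "length xs = card A" using length_finite_permutations_of_set[OF xs] .
    moreover have "length (takeWhile (\<lambda>x. x \<noteq> y) xs) < length xs"
    proof -
      have "y \<in> set xs" using permutations_of_setD(1)[OF xs] assms by simp
      then obtain as bs where ab: "xs = as @ y # bs" "y \<notin> set as" by (metis split_list_first)
      have "takeWhile (\<lambda>x. x \<noteq> y) xs = as" unfolding ab(1) using ab(2) by (subst takeWhile_append2) auto
      then show ?thesis by (simp add: ab(1))
    qed
    ultimately show "length (takeWhile (\<lambda>x. x \<noteq> y) xs) \<in> {..<card A}" by simp
    show "filter (\<lambda>x. x \<noteq> y) xs \<in> perms (A - {y})"
      using permutations_of_setD[OF xs] by (auto simp: permutations_of_set_def)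
  qed
qed

lemma set_take_ins:
  assumes "i \<le> length ys"
  shows "set (take m (ins y i ys)) = (if i < m then insert y (set (take (m - 1) ys)) else set (take m ys))"
proof (cases "i < m")
  case True
  then have e: "m - length (take i ys) = Suc (m - 1 - i)" using assms by simp
  have "take m (ins y i ys) = take i ys @ y # take (m - 1 - i) (drop i ys)"
    unfolding ins_def take_append e using True by simp
  moreover have "take i ys @ take (m - 1 - i) (drop i ys) = take (m - 1) ys"
    using True take_add[of i "m - 1 - i" ys] by simp
  ultimately show ?thesis using True by (metis Un_insert_right list.simps(15) set_append)
next
  case False
  then show ?thesis using assms by (simp add: ins_def)
qed

lemma avg_ins:
  assumes "finite A" "y \<in> A"
  shows "avg A f = (\<Sum>i<card A. avg (A - {y}) (\<lambda>ys. f (ins y i ys))) / card A"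
proof -
  have "card A = Suc (card (A - {y}))" by (rule card.remove[OF assms])
  then have fa: "fact (card A) = real (card A) * fact (card (A - {y}))" by simp
  have "(\<Sum>xs\<in>perms A. f xs) = (\<Sum>(i, ys)\<in>{..<card A} \<times> perms (A - {y}). f (ins y i ys))"
    using sum.reindex_bij_betw[OF bij_betw_ins[OF assms], of f] by (simp add: case_prod_unfold)
  also have "\<dots> = (\<Sum>i<card A. \<Sum>ys\<in>perms (A - {y}). f (ins y i ys))"
    by (simp add: sum.cartesian_product)
  finally show ?thesis unfolding avg_def fa by (simp add: sum_divide_distrib[symmetric] mult.commute)
qed

lemma perms_length: "finite A \<Longrightarrow> y \<in> A \<Longrightarrow> ys \<in> perms (A - {y}) \<Longrightarrow> i < card A \<Longrightarrow> i \<le> length ys"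
  using length_finite_permutations_of_set[of ys "A - {y}"] by simp

lemma avg_cong: "(\<And>xs. xs \<in> perms A \<Longrightarrow> f xs = g xs) \<Longrightarrow> avg A f = avg A g"
  unfolding avg_def by (intro arg_cong2[of _ _ _ _ "(/)"] sum.cong refl)

lemma avg_mono: "(\<And>xs. xs \<in> perms A \<Longrightarrow> f xs \<le> g xs) \<Longrightarrow> avg A f \<le> avg A g"
  unfolding avg_def by (intro divide_right_mono sum_mono) auto

lemma avg_const: "finite A \<Longrightarrow> avg A (\<lambda>_. c) = c"
  unfolding avg_def by simp

lemma avg_sum: "avg A (\<lambda>xs. \<Sum>i\<in>I. f i xs) = (\<Sum>i\<in>I. avg A (f i))"
  unfolding avg_def by (subst sum.swap) (simp add: sum_divide_distrib)

lemma avg_cmult: "avg A (\<lambda>xs. c * f xs) = c * avg A f"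
  unfolding avg_def by (simp add: sum_distrib_left)

lemma avg_nonneg: "(\<And>xs. xs \<in> perms A \<Longrightarrow> 0 \<le> f xs) \<Longrightarrow> 0 \<le> avg A f"
  unfolding avg_def by (intro divide_nonneg_pos sum_nonneg) auto

lemma avg_split_position:
  assumes "finite A" "y \<in> A" "m \<le> card A"
    and f1: "\<And>i ys. i < m \<Longrightarrow> ys \<in> perms (A - {y}) \<Longrightarrow> f (ins y i ys) = g ys"
    and f2: "\<And>i ys. m \<le> i \<Longrightarrow> i < card A \<Longrightarrow> ys \<in> perms (A - {y}) \<Longrightarrow> f (ins y i ys) = h ys"
  shows "avg A f = (real m * avg (A - {y}) g + real (card A - m) * avg (A - {y}) h) / card A"
proof -
  have "(\<Sum>i<card A. avg (A - {y}) (\<lambda>ys. f (ins y i ys))) = (\<Sum>i<card A. if i < m then avg (A - {y}) g else avg (A - {y}) h)"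
  proof (intro sum.cong refl)
    fix i assume "i \<in> {..<card A}"
    then show "avg (A - {y}) (\<lambda>ys. f (ins y i ys)) = (if i < m then avg (A - {y}) g else avg (A - {y}) h)"
      using f1[of i] f2[of i] by (auto intro!: avg_cong)
  qed
  also have "\<dots> = real m * avg (A - {y}) g + real (card A - m) * avg (A - {y}) h"
  proof -
    have "{..<card A} \<inter> {i. i < m} = {..<m}" "{..<card A} \<inter> - {i. i < m} = {m..<card A}" using assms(3) by auto
    then show ?thesis by (simp add: sum.If_cases)
  qed
  finally show ?thesis using avg_ins[OF assms(1,2)] by metis
qed

text \<open>The hypergeometric probability, obtained by placing the elements of \<open>T\<close> one
  at a time. An element outside the prefix leaves the prefix length \<open>m\<close> unchanged,
  whereas in the companion formula for containment it uses up one of the \<open>m\<close>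
  places.\<close>

lemma avg_avoid:
  assumes "finite T"
  shows "finite A \<Longrightarrow> T \<subseteq> A \<Longrightarrow> m \<le> card A \<Longrightarrow>
    avg A (\<lambda>xs. of_bool (T \<inter> set (take m xs) = {})) = (\<Prod>j<card T. (real (card A) - m - j) / (real (card A) - j))"
  using assms
proof (induction T arbitrary: A rule: finite_induct)
  case empty
  then show ?case by (simp add: avg_const)
next
  case (insert y T)
  have yA: "y \<in> A" and TA: "T \<subseteq> A - {y}" using insert by auto
  have cA: "card (A - {y}) = card A - 1" "0 < card A" using yA insert.prems(1) by (auto simp: card_gt_0_iff)
  have rA: "real (card (A - {y})) = real (card A) - 1" using cA by (simp add: of_nat_diff)
  have cT: "card (insert y T) = Suc (card T)" using insert.hyps by simp
  have fA: "finite (A - {y})" using insert.prems(1) by simp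
  have "avg A (\<lambda>xs. of_bool (insert y T \<inter> set (take m xs) = {}))
     = (real m * avg (A - {y}) (\<lambda>_. 0) + real (card A - m) * avg (A - {y}) (\<lambda>ys. of_bool (T \<inter> set (take m ys) = {}))) / card A"
  proof (rule avg_split_position[OF insert.prems(1) yA insert.prems(3)])
    fix i ys assume i: "i < m" "ys \<in> perms (A - {y})"
    then have "i \<le> length ys" using insert.prems by (intro perms_length[OF insert.prems(1) yA]) auto
    then show "of_bool (insert y T \<inter> set (take m (ins y i ys)) = {}) = (0::real)" using i set_take_ins[of i ys m y] by simp
  next
    fix i ys assume i: "m \<le> i" "i < card A" "ys \<in> perms (A - {y})"
    have "y \<notin> set (take m ys)" using permutations_of_setD(1)[OF i(3)] in_set_takeD by fastforce
    moreover have "i \<le> length ys" using i by (intro perms_length[OF insert.prems(1) yA]) auto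
    ultimately show "of_bool (insert y T \<inter> set (take m (ins y i ys)) = {}) = (of_bool (T \<inter> set (take m ys) = {}) :: real)"
      using i set_take_ins[of i ys m y] by simp
  qed
  also have "\<dots> = (real (card A) - m) / card A * avg (A - {y}) (\<lambda>ys. of_bool (T \<inter> set (take m ys) = {}))"
    using insert.prems(3) by (simp add: avg_def of_nat_diff)
  also have "\<dots> = (real (card A) - m) / card A * (\<Prod>j<card T. (real (card A) - 1 - m - j) / (real (card A) - 1 - j))"
  proof (cases "m = card A")
    case False
    then have "m \<le> card (A - {y})" using insert.prems(3) cA by simp
    show ?thesis unfolding insert.IH[OF fA TA \<open>m \<le> card (A - {y})\<close>] rA ..
  qed simp
  also have "\<dots> = (\<Prod>j<card (insert y T). (real (card A) - m - j) / (real (card A) - j))"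
    unfolding cT prod.lessThan_Suc_shift by (simp add: algebra_simps)
  finally show ?case .
qed

lemma avg_contain:
  assumes "finite T"
  shows "finite A \<Longrightarrow> T \<subseteq> A \<Longrightarrow> m \<le> card A \<Longrightarrow>
    avg A (\<lambda>xs. of_bool (T \<subseteq> set (take m xs))) = (\<Prod>j<card T. (real m - j) / (real (card A) - j))"
  using assms
proof (induction T arbitrary: A m rule: finite_induct)
  case empty
  then show ?case by (simp add: avg_const)
next
  case (insert y T)
  have yA: "y \<in> A" and TA: "T \<subseteq> A - {y}" using insert by auto
  have cA: "card (A - {y}) = card A - 1" "0 < card A" using yA insert.prems(1) by (auto simp: card_gt_0_iff)
  have rA: "real (card (A - {y})) = real (card A) - 1" using cA by (simp add: of_nat_diff)
  have cT: "card (insert y T) = Suc (card T)" using insert.hyps by simp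
  have fA: "finite (A - {y})" using insert.prems(1) by simp
  have "avg A (\<lambda>xs. of_bool (insert y T \<subseteq> set (take m xs)))
     = (real m * avg (A - {y}) (\<lambda>ys. of_bool (T \<subseteq> set (take (m - 1) ys))) + real (card A - m) * avg (A - {y}) (\<lambda>_. 0)) / card A"
  proof (rule avg_split_position[OF insert.prems(1) yA insert.prems(3)])
    fix i ys assume i: "i < m" "ys \<in> perms (A - {y})"
    then have "i \<le> length ys" using insert.prems by (intro perms_length[OF insert.prems(1) yA]) auto
    then show "of_bool (insert y T \<subseteq> set (take m (ins y i ys))) = (of_bool (T \<subseteq> set (take (m - 1) ys)) :: real)"
      using i set_take_ins[of i ys m y] insert.hyps by auto
  next
    fix i ys assume i: "m \<le> i" "i < card A" "ys \<in> perms (A - {y})"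
    have "y \<notin> set (take m ys)" using permutations_of_setD(1)[OF i(3)] in_set_takeD by fastforce
    moreover have "i \<le> length ys" using i by (intro perms_length[OF insert.prems(1) yA]) auto
    ultimately show "of_bool (insert y T \<subseteq> set (take m (ins y i ys))) = (0::real)"
      using i set_take_ins[of i ys m y] by simp
  qed
  also have "\<dots> = real m / card A * avg (A - {y}) (\<lambda>ys. of_bool (T \<subseteq> set (take (m - 1) ys)))"
    by (simp add: avg_def)
  also have "\<dots> = real m / card A * (\<Prod>j<card T. (real m - 1 - j) / (real (card A) - 1 - j))"
  proof (cases "m = 0")
    case False
    then have m1: "m - 1 \<le> card (A - {y})" "real (m - 1) = real m - 1" using insert.prems(3) cA by auto
    show ?thesis unfolding insert.IH[OF fA TA m1(1)] rA m1(2) ..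
  qed simp
  also have "\<dots> = (\<Prod>j<card (insert y T). (real m - j) / (real (card A) - j))"
    unfolding cT prod.lessThan_Suc_shift by (simp add: algebra_simps)
  finally show ?case .
qed

text \<open>Sampling without replacement compared with sampling with replacement, factor by factor.
  For \<open>t > a\<close> the factor with \<open>j = a\<close> is 0, so negative factors after it
  do no harm.\<close>

lemma falling_ratio_le:
  fixes a N t :: nat
  assumes "a \<le> N" "t \<le> N"
  shows "(\<Prod>j<t. (real a - j) / (real N - j)) \<le> (real a / N) ^ t"
proof (cases "t \<le> a")
  case True
  have "(\<Prod>j<t. (real a - j) / (real N - j)) \<le> (\<Prod>j<t. real a / N)"
  proof (intro prod_mono conjI)
    fix j assume "j \<in> {..<t}"
    then have j: "real j < a" "real j < N" using True assms by auto
    then show "0 \<le> (real a - j) / (real N - j)" by simp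
    have "real j * a \<le> real j * N" using assms by (intro mult_left_mono) auto
    then show "(real a - j) / (real N - j) \<le> real a / N" using j by (simp add: field_simps)
  qed
  then show ?thesis by simp
next
  case False
  then have z: "(\<Prod>j<t. (real a - j) / (real N - j)) = 0" by (intro prod_zero) (auto intro!: bexI[of _ a])
  show ?thesis unfolding z by simp
qed

lemma avg_avoid_le:
  assumes "finite A" "T \<subseteq> A" "m \<le> card A"
  shows "avg A (\<lambda>xs. of_bool (T \<inter> set (take m xs) = {})) \<le> (1 - real m / card A) ^ card T"
proof (cases "card A = 0")
  case True
  then have "A = {}" using assms by simp
  then show ?thesis using assms by (simp add: avg_def)
next
  case False
  have fT: "finite T" "card T \<le> card A" using assms finite_subset card_mono by auto
  have "avg A (\<lambda>xs. of_bool (T \<inter> set (take m xs) = {})) = (\<Prod>j<card T. (real (card A - m) - j) / (real (card A) - j))"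
    using avg_avoid[OF fT(1) assms] assms by (simp add: of_nat_diff)
  also have "\<dots> \<le> (real (card A - m) / card A) ^ card T" using fT by (intro falling_ratio_le) auto
  also have "real (card A - m) / card A = 1 - real m / card A" using assms False by (simp add: of_nat_diff diff_divide_distrib)
  finally show ?thesis .
qed

lemma avg_contain_le:
  assumes "finite A" "T \<subseteq> A" "m \<le> card A"
  shows "avg A (\<lambda>xs. of_bool (T \<subseteq> set (take m xs))) \<le> (real m / card A) ^ card T"
proof -
  have fT: "finite T" "card T \<le> card A" using assms finite_subset card_mono by auto
  show ?thesis using avg_contain[OF fT(1) assms] falling_ratio_le[OF assms(3) fT(2)] by simp
qed

section \<open>Exponential moments and tail bounds for prefixes of a random ordering\<close>

lemma prod_one_plus_indicator:
  fixes a :: "'a \<Rightarrow> real"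
  assumes "finite A"
  shows "(\<Prod>e\<in>A. 1 + a e * of_bool (P e)) = (\<Sum>T\<in>Pow A. (\<Prod>e\<in>T. a e) * of_bool (\<forall>e\<in>T. P e))"
proof -
  have "(\<Prod>e\<in>A. 1 + a e * of_bool (P e)) = (\<Sum>T\<in>Pow A. (\<Prod>e\<in>T. a e * of_bool (P e)))"
    using prod_add[OF assms, of "\<lambda>e. a e * of_bool (P e)" "\<lambda>_. 1"] by (simp add: add.commute)
  also have "\<dots> = (\<Sum>T\<in>Pow A. (\<Prod>e\<in>T. a e) * of_bool (\<forall>e\<in>T. P e))"
  proof (intro sum.cong refl)
    fix T assume "T \<in> Pow A"
    then have "finite T" using assms finite_subset by auto
    then have "(\<Prod>e\<in>T. of_bool (P e)) = (of_bool (\<forall>e\<in>T. P e) :: real)" by (induction T rule: finite_induct) auto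
    then show "(\<Prod>e\<in>T. a e * of_bool (P e)) = (\<Prod>e\<in>T. a e) * of_bool (\<forall>e\<in>T. P e)" by (simp only: prod.distrib)
  qed
  finally show ?thesis .
qed

text \<open>Expanding the product over subsets leaves only joint probabilities with nonnegative
  coefficients. Since these are at most those of independent events of probability \<open>q\<close>,
  the average is at most the independent value.\<close>

lemma avg_prod_le:
  fixes a :: "'a \<Rightarrow> real"
  assumes A: "finite A" and a: "\<And>e. e \<in> A \<Longrightarrow> 0 \<le> a e"
    and T: "\<And>T. T \<subseteq> A \<Longrightarrow> avg A (\<lambda>xs. of_bool (\<forall>e\<in>T. P xs e)) \<le> q ^ card T"
  shows "avg A (\<lambda>xs. \<Prod>e\<in>A. 1 + a e * of_bool (P xs e)) \<le> (\<Prod>e\<in>A. 1 + q * a e)"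
proof -
  have "avg A (\<lambda>xs. \<Prod>e\<in>A. 1 + a e * of_bool (P xs e)) = (\<Sum>T\<in>Pow A. (\<Prod>e\<in>T. a e) * avg A (\<lambda>xs. of_bool (\<forall>e\<in>T. P xs e)))"
    unfolding prod_one_plus_indicator[OF A] by (simp add: avg_sum avg_cmult)
  also have "\<dots> \<le> (\<Sum>T\<in>Pow A. (\<Prod>e\<in>T. a e) * q ^ card T)"
    by (intro sum_mono mult_left_mono prod_nonneg T) (auto intro: a)
  also have "\<dots> = (\<Sum>T\<in>Pow A. (\<Prod>e\<in>T. q * a e))"
    by (intro sum.cong refl) (simp add: prod.distrib)
  also have "\<dots> = (\<Prod>e\<in>A. 1 + q * a e)"
    using prod_add[OF A, of "\<lambda>e. q * a e" "\<lambda>_. 1"] by (simp add: add.commute)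
  finally show ?thesis .
qed

definition wt :: "'a set \<Rightarrow> ('a \<Rightarrow> real) \<Rightarrow> nat \<Rightarrow> 'a list \<Rightarrow> real" where
  "wt A c m xs = (\<Sum>e\<in>A. c e * of_bool (e \<in> set (take m xs)))"

lemma mgf_upper:
  assumes A: "finite A" "m \<le> card A" and c: "\<And>e. e \<in> A \<Longrightarrow> 0 \<le> c e" and l: "0 \<le> l"
  shows "avg A (\<lambda>xs. exp (l * wt A c m xs)) \<le> exp (real m / card A * (\<Sum>e\<in>A. exp (l * c e) - 1))"
proof -
  let ?p = "real m / card A"
  have "avg A (\<lambda>xs. exp (l * wt A c m xs)) = avg A (\<lambda>xs. \<Prod>e\<in>A. 1 + (exp (l * c e) - 1) * of_bool (e \<in> set (take m xs)))"
  proof (rule avg_cong)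
    fix xs
    have "exp (l * wt A c m xs) = (\<Prod>e\<in>A. exp (l * (c e * of_bool (e \<in> set (take m xs)))))"
      unfolding wt_def sum_distrib_left by (rule exp_sum[OF A(1)])
    also have "\<dots> = (\<Prod>e\<in>A. 1 + (exp (l * c e) - 1) * of_bool (e \<in> set (take m xs)))"
      by (intro prod.cong refl) auto
    finally show "exp (l * wt A c m xs) = (\<Prod>e\<in>A. 1 + (exp (l * c e) - 1) * of_bool (e \<in> set (take m xs)))" .
  qed
  also have "\<dots> \<le> (\<Prod>e\<in>A. 1 + ?p * (exp (l * c e) - 1))"
  proof (rule avg_prod_le[OF A(1)])
    show "0 \<le> exp (l * c e) - 1" if "e \<in> A" for e using c[OF that] l by simp
    show "avg A (\<lambda>xs. of_bool (\<forall>e\<in>T. e \<in> set (take m xs))) \<le> ?p ^ card T" if "T \<subseteq> A" for T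
      using avg_contain_le[OF A(1) that A(2)] by (simp add: subset_iff Ball_def)
  qed
  also have "\<dots> \<le> (\<Prod>e\<in>A. exp (?p * (exp (l * c e) - 1)))"
    using c l by (intro prod_mono conjI exp_ge_add_one_self) (auto intro!: add_nonneg_nonneg mult_nonneg_nonneg)
  also have "\<dots> = exp (?p * (\<Sum>e\<in>A. exp (l * c e) - 1))" by (simp add: exp_sum[OF A(1), symmetric] sum_distrib_left)
  finally show ?thesis .
qed

text \<open>With a negative exponent the expansion in inclusion events would have negative
  coefficients. Factoring out \<open>exp (- l * c e)\<close> rewrites each factor through the event
  that \<open>e\<close> is missing, with coefficient \<open>exp (l * c e) - 1 \<ge> 0\<close>, and
  joint avoidance probabilities are bounded as well.\<close>

lemma mgf_lower:
  assumes A: "finite A" "m \<le> card A" and c: "\<And>e. e \<in> A \<Longrightarrow> 0 \<le> c e" and l: "0 \<le> l"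
  shows "avg A (\<lambda>xs. exp (- l * wt A c m xs)) \<le> exp (- (real m / card A * (\<Sum>e\<in>A. 1 - exp (- l * c e))))"
proof -
  let ?p = "real m / card A"
  have p1: "?p \<le> 1" "0 \<le> ?p" using A by (auto simp: divide_le_eq_1)
  have e1: "exp (- l * c e) * (exp (l * c e) - 1) = 1 - exp (- l * c e)" for e
    by (simp add: right_diff_distrib exp_add[symmetric])
  have "avg A (\<lambda>xs. exp (- l * wt A c m xs)) = avg A (\<lambda>xs. (\<Prod>e\<in>A. exp (- l * c e)) * (\<Prod>e\<in>A. 1 + (exp (l * c e) - 1) * of_bool (e \<notin> set (take m xs))))"
  proof (rule avg_cong)
    fix xs
    have "exp (- l * wt A c m xs) = (\<Prod>e\<in>A. exp (- l * (c e * of_bool (e \<in> set (take m xs)))))"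
      unfolding wt_def sum_distrib_left by (rule exp_sum[OF A(1)])
    also have "\<dots> = (\<Prod>e\<in>A. exp (- l * c e) * (1 + (exp (l * c e) - 1) * of_bool (e \<notin> set (take m xs))))"
      using e1 by (intro prod.cong refl) (auto simp: distrib_left)
    finally show "exp (- l * wt A c m xs) = (\<Prod>e\<in>A. exp (- l * c e)) * (\<Prod>e\<in>A. 1 + (exp (l * c e) - 1) * of_bool (e \<notin> set (take m xs)))"
      by (simp add: prod.distrib)
  qed
  also have "\<dots> = (\<Prod>e\<in>A. exp (- l * c e)) * avg A (\<lambda>xs. \<Prod>e\<in>A. 1 + (exp (l * c e) - 1) * of_bool (e \<notin> set (take m xs)))"
    by (rule avg_cmult)
  also have "\<dots> \<le> (\<Prod>e\<in>A. exp (- l * c e)) * (\<Prod>e\<in>A. 1 + (1 - ?p) * (exp (l * c e) - 1))"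
  proof (rule mult_left_mono[OF avg_prod_le[OF A(1)]])
    show "0 \<le> exp (l * c e) - 1" if "e \<in> A" for e using c[OF that] l by simp
    show "avg A (\<lambda>xs. of_bool (\<forall>e\<in>T. e \<notin> set (take m xs))) \<le> (1 - ?p) ^ card T" if "T \<subseteq> A" for T
    proof -
      have "(\<forall>e\<in>T. e \<notin> set (take m xs)) = (T \<inter> set (take m xs) = {})" for xs by auto
      then show ?thesis using avg_avoid_le[OF A(1) that A(2)] by simp
    qed
  qed (simp add: prod_nonneg)
  also have "\<dots> = (\<Prod>e\<in>A. 1 - ?p * (1 - exp (- l * c e)))"
    unfolding prod.distrib[symmetric]
  proof (intro prod.cong refl)
    fix e
    have "exp (- l * c e) * (1 + (1 - ?p) * (exp (l * c e) - 1)) = exp (- l * c e) + (1 - ?p) * (exp (- l * c e) * (exp (l * c e) - 1))"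
      by (simp add: distrib_left mult_ac)
    then show "exp (- l * c e) * (1 + (1 - ?p) * (exp (l * c e) - 1)) = 1 - ?p * (1 - exp (- l * c e))"
      unfolding e1 by (simp add: algebra_simps)
  qed
  also have "\<dots> \<le> (\<Prod>e\<in>A. exp (- (?p * (1 - exp (- l * c e)))))"
  proof (intro prod_mono conjI)
    fix e assume e: "e \<in> A"
    have "0 \<le> 1 - exp (- l * c e)" "1 - exp (- l * c e) \<le> 1" using c[OF e] l by auto
    then have "?p * (1 - exp (- l * c e)) \<le> 1" using p1 by (intro mult_le_one) auto
    then show "0 \<le> 1 - ?p * (1 - exp (- l * c e))" by simp
    show "1 - ?p * (1 - exp (- l * c e)) \<le> exp (- (?p * (1 - exp (- l * c e))))"
      using exp_ge_add_one_self[of "- (?p * (1 - exp (- l * c e)))"] by simp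
  qed
  also have "\<dots> = exp (- (?p * (\<Sum>e\<in>A. 1 - exp (- l * c e))))"
    by (simp add: exp_sum[OF A(1), symmetric] sum_distrib_left sum_negf)
  finally show ?thesis .
qed

definition pr :: "'a set \<Rightarrow> ('a list \<Rightarrow> bool) \<Rightarrow> real" where
  "pr A Q = avg A (\<lambda>xs. of_bool (Q xs))"

lemma pr_mono: "(\<And>xs. xs \<in> perms A \<Longrightarrow> Q xs \<Longrightarrow> Q' xs) \<Longrightarrow> pr A Q \<le> pr A Q'"
  unfolding pr_def by (rule avg_mono) auto

lemma pr_nonneg: "0 \<le> pr A Q" unfolding pr_def by (rule avg_nonneg) simp

lemma pr_union: "finite I \<Longrightarrow> pr A (\<lambda>xs. \<exists>i\<in>I. Q i xs) \<le> (\<Sum>i\<in>I. pr A (Q i))"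
proof -
  assume I: "finite I"
  have "pr A (\<lambda>xs. \<exists>i\<in>I. Q i xs) \<le> avg A (\<lambda>xs. \<Sum>i\<in>I. of_bool (Q i xs))"
    unfolding pr_def
  proof (rule avg_mono)
    fix xs
    show "of_bool (\<exists>i\<in>I. Q i xs) \<le> (\<Sum>i\<in>I. of_bool (Q i xs) :: real)"
    proof (cases "\<exists>i\<in>I. Q i xs")
      case True
      then obtain i where "i \<in> I" "Q i xs" by blast
      then have "1 \<le> (\<Sum>i\<in>I. of_bool (Q i xs) :: real)"
        using member_le_sum[of i I "\<lambda>i. of_bool (Q i xs) :: real"] I by simp
      then show ?thesis using True by simp
    qed (simp add: sum_nonneg)
  qed
  then show ?thesis by (simp add: avg_sum pr_def)
qed

lemma pr_or: "pr A (\<lambda>xs. Q xs \<or> Q' xs) \<le> pr A Q + pr A Q'"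
proof -
  have "pr A (\<lambda>xs. Q xs \<or> Q' xs) \<le> avg A (\<lambda>xs. of_bool (Q xs) + of_bool (Q' xs))"
    unfolding pr_def by (rule avg_mono) auto
  also have "\<dots> = pr A Q + pr A Q'"
    unfolding pr_def avg_def by (simp add: sum.distrib add_divide_distrib)
  finally show ?thesis .
qed

lemma pr_markov:
  assumes "\<And>xs. 0 \<le> f xs" "\<And>xs. xs \<in> perms A \<Longrightarrow> Q xs \<Longrightarrow> 1 \<le> f xs"
  shows "pr A Q \<le> avg A f"
  unfolding pr_def using assms by (intro avg_mono) (auto simp: of_bool_def)

lemma tail_upper:
  assumes A: "finite A" "m \<le> card A" and c: "\<And>e. e \<in> A \<Longrightarrow> 0 \<le> c e" and l: "0 \<le> l"
  shows "pr A (\<lambda>xs. x \<le> wt A c m xs) \<le> exp (real m / card A * (\<Sum>e\<in>A. exp (l * c e) - 1) - l * x)"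
proof -
  have "pr A (\<lambda>xs. x \<le> wt A c m xs) \<le> avg A (\<lambda>xs. exp (- l * x) * exp (l * wt A c m xs))"
  proof (rule pr_markov)
    fix xs assume "x \<le> wt A c m xs"
    then have "l * x \<le> l * wt A c m xs" using l by (rule mult_left_mono)
    then show "1 \<le> exp (- l * x) * exp (l * wt A c m xs)" by (simp add: exp_add[symmetric])
  qed simp
  also have "\<dots> \<le> exp (- l * x) * exp (real m / card A * (\<Sum>e\<in>A. exp (l * c e) - 1))"
    unfolding avg_cmult using mgf_upper[OF A c l] by (intro mult_left_mono) auto
  finally show ?thesis by (simp add: exp_add[symmetric])
qed

lemma tail_lower:
  assumes A: "finite A" "m \<le> card A" and c: "\<And>e. e \<in> A \<Longrightarrow> 0 \<le> c e" and l: "0 \<le> l"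
  shows "pr A (\<lambda>xs. wt A c m xs \<le> x) \<le> exp (l * x - real m / card A * (\<Sum>e\<in>A. 1 - exp (- l * c e)))"
proof -
  have "pr A (\<lambda>xs. wt A c m xs \<le> x) \<le> avg A (\<lambda>xs. exp (l * x) * exp (- l * wt A c m xs))"
  proof (rule pr_markov)
    fix xs assume "wt A c m xs \<le> x"
    then have "l * wt A c m xs \<le> l * x" using l by (rule mult_left_mono)
    then show "1 \<le> exp (l * x) * exp (- l * wt A c m xs)" by (simp add: exp_add[symmetric])
  qed simp
  also have "\<dots> \<le> exp (l * x) * exp (- (real m / card A * (\<Sum>e\<in>A. 1 - exp (- l * c e))))"
    unfolding avg_cmult using mgf_lower[OF A c l] by (intro mult_left_mono) auto
  finally show ?thesis by (simp add: exp_add[symmetric])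
qed

text \<open>Removing an element that is placed early shifts every prefix by at most one place.\<close>

lemma pr_placed_early:
  assumes "finite A" "y \<in> A" "M \<le> card A"
    and Q: "\<And>i ys. i < M \<Longrightarrow> ys \<in> perms (A - {y}) \<Longrightarrow> Q (ins y i ys) \<Longrightarrow> Q' ys"
  shows "pr A (\<lambda>xs. y \<in> set (take M xs) \<and> Q xs) \<le> real M / card A * pr (A - {y}) Q'"
proof -
  have "pr A (\<lambda>xs. y \<in> set (take M xs) \<and> Q xs) = (\<Sum>i<card A. avg (A - {y}) (\<lambda>ys. of_bool (y \<in> set (take M (ins y i ys)) \<and> Q (ins y i ys)))) / card A"
    unfolding pr_def by (rule avg_ins[OF assms(1,2)])
  also have "\<dots> \<le> (\<Sum>i<card A. if i < M then pr (A - {y}) Q' else 0) / card A"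
  proof (intro divide_right_mono sum_mono)
    fix i assume "i \<in> {..<card A}"
    then have i: "i < card A" by simp
    show "avg (A - {y}) (\<lambda>ys. of_bool (y \<in> set (take M (ins y i ys)) \<and> Q (ins y i ys))) \<le> (if i < M then pr (A - {y}) Q' else 0)"
    proof (cases "i < M")
      case True
      then show ?thesis unfolding pr_def using Q[of i] by (auto intro!: avg_mono)
    next
      case False
      have "avg (A - {y}) (\<lambda>ys. of_bool (y \<in> set (take M (ins y i ys)) \<and> Q (ins y i ys))) = avg (A - {y}) (\<lambda>_. 0)"
      proof (rule avg_cong)
        fix ys assume ys: "ys \<in> perms (A - {y})"
        have "y \<notin> set (take M ys)" using permutations_of_setD(1)[OF ys] in_set_takeD by fastforce
        then show "of_bool (y \<in> set (take M (ins y i ys)) \<and> Q (ins y i ys)) = (0::real)"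
          using set_take_ins[OF perms_length[OF assms(1,2) ys i], of M y] False by simp
      qed
      then show ?thesis using False by (simp add: avg_def)
    qed
  qed simp
  also have "(\<Sum>i<card A. if i < M then pr (A - {y}) Q' else 0) = real M * pr (A - {y}) Q'"
  proof -
    have "{..<card A} \<inter> {i. i < M} = {..<M}" using assms(3) by auto
    then show ?thesis by (simp add: sum.If_cases)
  qed
  finally show ?thesis by simp
qed

section \<open>Edge counts in the random graph process\<close>

lemma exp_minus_1_le: "exp x - 1 - x \<le> x\<^sup>2 * exp x" if "0 \<le> x" for x :: real
proof -
  have "1 - x \<le> exp (- x)" using exp_ge_add_one_self[of "- x"] by simp
  then have "(1 - x) * exp x \<le> exp (- x) * exp x" by (intro mult_right_mono) auto
  then have 1: "exp x - 1 \<le> x * exp x" by (simp add: exp_add[symmetric] left_diff_distrib)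
  then have "x * (exp x - 1) \<le> x * (x * exp x)" using that by (intro mult_left_mono) auto
  then show ?thesis using 1 by (simp add: power2_eq_square algebra_simps)
qed

lemma one_minus_exp_ge: "x - x\<^sup>2 \<le> 1 - exp (- x)" if "0 \<le> x" for x :: real
proof -
  have "1 + x \<le> exp x" by (rule exp_ge_add_one_self)
  then have "exp (- x) \<le> inverse (1 + x)" using that by (simp add: exp_minus le_imp_inverse_le)
  also have "\<dots> \<le> 1 - x + x\<^sup>2"
  proof -
    have "1 \<le> (1 - x + x\<^sup>2) * (1 + x)" using that by (simp add: power2_eq_square algebra_simps)
    then show ?thesis using that by (simp add: inverse_eq_divide pos_divide_le_eq)
  qed
  finally show ?thesis by simp
qed

text \<open>Weights at most 2 satisfy \<open>(c e)^2 \<le> 2 * c e\<close>, so the second order term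
  is bounded by the mean. The parameter \<open>l\<close> remains free: small vertex sets need a
  large value and large sets a small one.\<close>

lemma weight_tails:
  assumes A: "finite A" "m \<le> card A" and c: "\<And>e. e \<in> A \<Longrightarrow> 0 \<le> c e" "\<And>e. e \<in> A \<Longrightarrow> c e \<le> 2" and l: "0 \<le> l"
  defines "\<mu> \<equiv> real m / card A * (\<Sum>e\<in>A. c e)"
  shows "pr A (\<lambda>xs. \<mu> + a \<le> wt A c m xs) \<le> exp (2 * \<mu> * (l\<^sup>2 * exp (2 * l)) - l * a)"
    and "pr A (\<lambda>xs. wt A c m xs \<le> \<mu> - a) \<le> exp (2 * \<mu> * (l\<^sup>2 * exp (2 * l)) - l * a)"
proof -
  let ?p = "real m / card A"
  have p0: "0 \<le> ?p" by simp
  have mu0: "0 \<le> \<mu>" unfolding \<mu>_def using c by (intro mult_nonneg_nonneg sum_nonneg) auto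
  have sq: "(c e)\<^sup>2 \<le> 2 * c e" if "e \<in> A" for e
    using mult_right_mono[OF c(2)[OF that] c(1)[OF that]] by (simp add: power2_eq_square)
  have "?p * (\<Sum>e\<in>A. exp (l * c e) - 1) \<le> ?p * (\<Sum>e\<in>A. l * c e + 2 * (l\<^sup>2 * exp (2 * l)) * c e)"
  proof (intro mult_left_mono sum_mono p0)
    fix e assume e: "e \<in> A"
    have "exp (l * c e) - 1 - l * c e \<le> (l * c e)\<^sup>2 * exp (l * c e)" using l c[OF e] by (intro exp_minus_1_le) auto
    also have "\<dots> = l\<^sup>2 * (c e)\<^sup>2 * exp (l * c e)" by (simp add: power_mult_distrib)
    also have "\<dots> \<le> l\<^sup>2 * (2 * c e) * exp (2 * l)"
      using sq[OF e] c[OF e] l mult_left_mono[OF c(2)[OF e] l] by (intro mult_mono mult_left_mono) auto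
    finally show "exp (l * c e) - 1 \<le> l * c e + 2 * (l\<^sup>2 * exp (2 * l)) * c e" by (simp add: algebra_simps)
  qed
  also have "\<dots> = ?p * (l * (\<Sum>e\<in>A. c e) + 2 * (l\<^sup>2 * exp (2 * l)) * (\<Sum>e\<in>A. c e))"
    by (simp only: sum.distrib sum_distrib_left)
  also have "\<dots> = l * \<mu> + 2 * \<mu> * (l\<^sup>2 * exp (2 * l))"
    unfolding \<mu>_def by (simp only: distrib_left mult_ac)
  finally have u: "?p * (\<Sum>e\<in>A. exp (l * c e) - 1) \<le> l * \<mu> + 2 * \<mu> * (l\<^sup>2 * exp (2 * l))" .
  show "pr A (\<lambda>xs. \<mu> + a \<le> wt A c m xs) \<le> exp (2 * \<mu> * (l\<^sup>2 * exp (2 * l)) - l * a)"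
    by (rule order_trans[OF tail_upper[OF A c(1) l]]) (use u in \<open>simp_all add: distrib_left\<close>)
  have "l * \<mu> - 2 * \<mu> * l\<^sup>2 = ?p * (l * (\<Sum>e\<in>A. c e) - 2 * l\<^sup>2 * (\<Sum>e\<in>A. c e))"
    unfolding \<mu>_def by (simp only: right_diff_distrib mult_ac)
  also have "\<dots> = ?p * (\<Sum>e\<in>A. l * c e - 2 * l\<^sup>2 * c e)"
    by (simp only: sum_subtractf sum_distrib_left)
  also have "\<dots> \<le> ?p * (\<Sum>e\<in>A. 1 - exp (- l * c e))"
  proof (intro mult_left_mono sum_mono p0)
    fix e assume e: "e \<in> A"
    have "l * c e - (l * c e)\<^sup>2 \<le> 1 - exp (- (l * c e))" using l c[OF e] by (intro one_minus_exp_ge) auto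
    moreover have "(l * c e)\<^sup>2 \<le> l\<^sup>2 * (2 * c e)" unfolding power_mult_distrib using sq[OF e] by (intro mult_left_mono) auto
    ultimately show "l * c e - 2 * l\<^sup>2 * c e \<le> 1 - exp (- l * c e)" by (simp add: algebra_simps)
  qed
  finally have v: "l * \<mu> - 2 * \<mu> * l\<^sup>2 \<le> ?p * (\<Sum>e\<in>A. 1 - exp (- l * c e))" .
  have "2 * \<mu> * (l\<^sup>2 * 1) \<le> 2 * \<mu> * (l\<^sup>2 * exp (2 * l))" using mu0 l by (intro mult_left_mono) auto
  then show "pr A (\<lambda>xs. wt A c m xs \<le> \<mu> - a) \<le> exp (2 * \<mu> * (l\<^sup>2 * exp (2 * l)) - l * a)"
    by (intro order_trans[OF tail_lower[OF A c(1) l]]) (use v in \<open>simp_all add: right_diff_distrib\<close>)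
qed

lemma all_edges_alt: "all_edges n = {X. X \<subseteq> {..<n} \<and> card X = 2}"
  unfolding all_edges_def card_2_iff
proof (intro Collect_cong iffI)
  fix e assume "\<exists>u v. u < n \<and> v < n \<and> u \<noteq> v \<and> e = {u, v}"
  then obtain u v where "u < n" "v < n" "u \<noteq> v" "e = {u, v}" by blast
  then show "e \<subseteq> {..<n} \<and> (\<exists>x y. e = {x, y} \<and> x \<noteq> y)" by blast
next
  fix e assume "e \<subseteq> {..<n} \<and> (\<exists>x y. e = {x, y} \<and> x \<noteq> y)"
  then obtain x y where "e \<subseteq> {..<n}" "e = {x, y}" "x \<noteq> y" by blast
  moreover from this have "x < n" "y < n" by auto
  ultimately show "\<exists>u v. u < n \<and> v < n \<and> u \<noteq> v \<and> e = {u, v}" by blast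
qed

lemma finite_all_edges [simp]: "finite (all_edges n)"
  unfolding all_edges_alt by simp

lemma card_all_edges: "card (all_edges n) = n choose 2"
  unfolding all_edges_alt using n_subsets[of "{..<n}" 2] by simp

lemma real_card_all_edges: "real (card (all_edges n)) = real n * (real n - 1) / 2"
  unfolding card_all_edges by (induction n) (auto simp: numeral_2_eq_2 field_simps)

definition pairs :: "nat set \<Rightarrow> nat set \<Rightarrow> (nat \<times> nat) set" where
  "pairs S T = {(u, v). u \<in> S \<and> v \<in> T \<and> u \<noteq> v}"

text \<open>The multiplicity 0, 1 or 2 with which an unordered edge occurs among ordered pairs in
  \<open>S\<close> times \<open>T\<close>. It turns the bilinear edge count into a weighted count
  over edges with weights at most 2, even when \<open>S\<close> and \<open>T\<close>
  overlap.\<close>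

definition pcount :: "nat set \<Rightarrow> nat set \<Rightarrow> nat set \<Rightarrow> real" where
  "pcount S T e = card {z \<in> pairs S T. {fst z, snd z} = e}"

definition ecount :: "nat set set \<Rightarrow> nat set \<Rightarrow> nat set \<Rightarrow> real" where
  "ecount G S T = (\<Sum>u\<in>S. \<Sum>v\<in>T. adj G u v)"

lemma finite_pairs: "finite S \<Longrightarrow> finite T \<Longrightarrow> finite (pairs S T)"
  by (rule finite_subset[of _ "S \<times> T"]) (auto simp: pairs_def)

lemma sum_pcount:
  assumes "S \<subseteq> {..<n}" "T \<subseteq> {..<n}"
  shows "(\<Sum>e\<in>all_edges n. pcount S T e * f e) = (\<Sum>z\<in>pairs S T. f {fst z, snd z})"
proof -
  have fin: "finite (pairs S T)" using assms finite_subset by (intro finite_pairs) blast+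
  have sub: "(\<lambda>z. {fst z, snd z}) ` pairs S T \<subseteq> all_edges n"
    using assms by (auto simp: all_edges_alt pairs_def card_insert_if)
  have "(\<Sum>z\<in>pairs S T. f {fst z, snd z}) = (\<Sum>e\<in>all_edges n. \<Sum>z\<in>{z\<in>pairs S T. {fst z, snd z} = e}. f {fst z, snd z})"
    by (rule sum.group[OF fin finite_all_edges sub, symmetric])
  also have "\<dots> = (\<Sum>e\<in>all_edges n. pcount S T e * f e)"
    unfolding pcount_def by (intro sum.cong refl) (simp add: mult.commute)
  finally show ?thesis by simp
qed

lemma pcount_bounds: "0 \<le> pcount S T e" "pcount S T e \<le> 2"
proof -
  show "0 \<le> pcount S T e" by (simp add: pcount_def)
  have "card {z \<in> pairs S T. {fst z, snd z} = e} \<le> 2"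
  proof (cases "{z \<in> pairs S T. {fst z, snd z} = e} = {}")
    case False
    then obtain a b where "(a, b) \<in> pairs S T" "{a, b} = e" by auto
    then have "{z \<in> pairs S T. {fst z, snd z} = e} \<subseteq> {(a, b), (b, a)}"
    proof (intro subsetI)
      fix z assume "z \<in> {z \<in> pairs S T. {fst z, snd z} = e}"
      then have "{fst z, snd z} = {a, b}" using \<open>{a, b} = e\<close> by simp
      then have "fst z = a \<and> snd z = b \<or> fst z = b \<and> snd z = a" by (simp add: doubleton_eq_iff)
      then show "z \<in> {(a, b), (b, a)}" by (cases z) auto
    qed
    then have "card {z \<in> pairs S T. {fst z, snd z} = e} \<le> card {(a, b), (b, a)}" by (intro card_mono) auto
    also have "\<dots> \<le> 2" by (cases "a = b") simp_all
    finally show ?thesis .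
  next
    case True
    show ?thesis unfolding True by simp
  qed
  then show "pcount S T e \<le> 2" by (simp add: pcount_def)
qed

lemma ecount_eq_wt:
  assumes "S \<subseteq> {..<n}" "T \<subseteq> {..<n}"
  shows "ecount (Gnm xs m) S T = wt (all_edges n) (pcount S T) m xs"
proof -
  have fin: "finite S" "finite T" using assms finite_subset by blast+
  have "wt (all_edges n) (pcount S T) m xs = (\<Sum>z\<in>pairs S T. of_bool ({fst z, snd z} \<in> Gnm xs m))"
    unfolding wt_def sum_pcount[OF assms] Gnm_def ..
  also have "\<dots> = (\<Sum>z\<in>S \<times> T. adj (Gnm xs m) (fst z) (snd z))"
    using fin by (intro sum.mono_neutral_cong_left) (auto simp: pairs_def adj_def)
  also have "\<dots> = ecount (Gnm xs m) S T" unfolding ecount_def by (simp add: sum.cartesian_product case_prod_unfold)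
  finally show ?thesis by simp
qed

lemma sum_pcount_bounds:
  assumes "S \<subseteq> {..<n}" "T \<subseteq> {..<n}"
  shows "(\<Sum>e\<in>all_edges n. pcount S T e) \<le> real (card S) * card T"
    and "real (card S) * card T - card S \<le> (\<Sum>e\<in>all_edges n. pcount S T e)"
proof -
  have fin: "finite S" "finite T" using assms finite_subset by blast+
  have eq: "(\<Sum>e\<in>all_edges n. pcount S T e) = card (pairs S T)"
    using sum_pcount[OF assms, of "\<lambda>_. 1"] by simp
  have "card (pairs S T) \<le> card (S \<times> T)" using fin by (intro card_mono) (auto simp: pairs_def)
  then show "(\<Sum>e\<in>all_edges n. pcount S T e) \<le> real (card S) * card T"
    unfolding eq by (simp add: card_cartesian_product flip: of_nat_mult)
  have "S \<times> T \<subseteq> pairs S T \<union> (\<lambda>u. (u, u)) ` S" by (auto simp: pairs_def)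
  then have "card (S \<times> T) \<le> card (pairs S T \<union> (\<lambda>u. (u, u)) ` S)" using fin finite_pairs by (intro card_mono) auto
  also have "\<dots> \<le> card (pairs S T) + card ((\<lambda>u. (u, u)) ` S)" by (rule card_Un_le)
  also have "card ((\<lambda>u. (u, u)) ` S) \<le> card S" using fin by (intro card_image_le) auto
  finally have "card S * card T \<le> card (pairs S T) + card S" by (simp add: card_cartesian_product)
  then have "real (card S * card T) \<le> real (card (pairs S T) + card S)" by (rule of_nat_mono)
  then show "real (card S) * card T - card S \<le> (\<Sum>e\<in>all_edges n. pcount S T e)" unfolding eq by simp
qed

definition dens :: "nat \<Rightarrow> nat \<Rightarrow> real" where "dens n m = real m / card (all_edges n)"

lemma dens_nonneg: "0 \<le> dens n m" by (simp add: dens_def)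

text \<open>The mean of the edge count falls short of \<open>p * card S * card T\<close> by the
  diagonal pairs, at most \<open>p * card S\<close>. The condition \<open>2 / b \<le> n\<close> lets
  half of the allowed deviation absorb this; the other half is left for the tail bound.\<close>

lemma ecount_deviation:
  assumes ST: "S \<subseteq> {..<n}" "T \<subseteq> {..<n}" "card S \<le> t" "card T \<le> t" and m: "m \<le> card (all_edges n)"
    and b: "0 < b" "2 / b \<le> real n" and l: "0 \<le> l"
  shows "pr (all_edges n) (\<lambda>xs. b * (dens n m * n) * t < \<bar>ecount (Gnm xs m) S T - dens n m * (real (card S) * card T)\<bar>)
     \<le> 2 * exp (- (dens n m * n) * t * (l * b / 2 - 2 * (real t / n) * (l\<^sup>2 * exp (2 * l))))"
proof -
  let ?A = "all_edges n"
  define p where "p = dens n m"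
  define M where "M = (\<Sum>e\<in>?A. pcount S T e)"
  have p0: "0 \<le> p" by (simp add: p_def dens_nonneg)
  have n0: "0 < real n" using b by (smt (verit) divide_pos_pos)
  have M: "M \<le> real (card S) * card T" "real (card S) * card T - card S \<le> M"
    unfolding M_def by (rule sum_pcount_bounds[OF ST(1,2)])+
  have M0: "0 \<le> M" unfolding M_def by (intro sum_nonneg pcount_bounds)
  have Mt: "p * M \<le> (p * n) * t * (real t / n)"
  proof -
    have "M \<le> real t * real t" using M(1) ST(3,4) mult_mono[of "real (card S)" t "real (card T)" t] by simp
    then have "p * M \<le> p * (real t * real t)" using p0 by (rule mult_left_mono)
    then show ?thesis using n0 by simp
  qed
  have a0: "p * card S \<le> b * (p * n) * t / 2"
  proof -
    have "p * card S \<le> p * real t" using ST(3) p0 by (intro mult_left_mono) auto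
    also have "\<dots> \<le> p * real t * (b * n / 2)"
    proof -
      have "1 \<le> b * n / 2" using b by (simp add: divide_le_eq mult.commute)
      then have "p * real t * 1 \<le> p * real t * (b * n / 2)" using p0 by (intro mult_left_mono) auto
      then show ?thesis by simp
    qed
    finally show ?thesis by (simp add: mult_ac)
  qed
  define a where "a = b * (p * n) * t"
  have an: "0 \<le> a" using p0 b by (simp add: a_def)
  have ex: "exp (2 * (p * M) * (l\<^sup>2 * exp (2 * l)) - l * (a / 2))
      \<le> exp (- (p * n) * t * (l * b / 2 - 2 * (real t / n) * (l\<^sup>2 * exp (2 * l))))"
  proof -
    have "2 * (p * M) * (l\<^sup>2 * exp (2 * l)) \<le> 2 * ((p * n) * t * (real t / n)) * (l\<^sup>2 * exp (2 * l))"
      using Mt by (intro mult_right_mono mult_left_mono) auto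
    then show ?thesis using n0 by (simp add: a_def algebra_simps)
  qed
  have "pr ?A (\<lambda>xs. a < \<bar>ecount (Gnm xs m) S T - p * (real (card S) * card T)\<bar>)
      \<le> pr ?A (\<lambda>xs. p * M + a / 2 \<le> wt ?A (pcount S T) m xs \<or> wt ?A (pcount S T) m xs \<le> p * M - a / 2)"
  proof (rule pr_mono)
    fix xs assume "a < \<bar>ecount (Gnm xs m) S T - p * (real (card S) * card T)\<bar>"
    moreover have "p * M \<le> p * (real (card S) * card T)" using M(1) p0 by (rule mult_left_mono)
    moreover have "p * (real (card S) * card T) - p * card S \<le> p * M"
      using mult_left_mono[OF M(2) p0] by (simp add: right_diff_distrib)
    ultimately show "p * M + a / 2 \<le> wt ?A (pcount S T) m xs \<or> wt ?A (pcount S T) m xs \<le> p * M - a / 2"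
      using a0 an unfolding ecount_eq_wt[OF ST(1,2)] a_def[symmetric] by linarith
  qed
  also have "\<dots> \<le> pr ?A (\<lambda>xs. p * M + a / 2 \<le> wt ?A (pcount S T) m xs) + pr ?A (\<lambda>xs. wt ?A (pcount S T) m xs \<le> p * M - a / 2)"
    by (rule pr_or)
  also have "\<dots> \<le> 2 * exp (2 * (p * M) * (l\<^sup>2 * exp (2 * l)) - l * (a / 2))"
    using weight_tails[where c = "pcount S T" and a = "a / 2", OF finite_all_edges m pcount_bounds(1) pcount_bounds(2) l]
    unfolding M_def[symmetric] dens_def[symmetric] p_def[symmetric] by simp
  also have "\<dots> \<le> 2 * exp (- (p * n) * t * (l * b / 2 - 2 * (real t / n) * (l\<^sup>2 * exp (2 * l))))" using ex by simp
  finally show ?thesis by (simp add: a_def p_def)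
qed

section \<open>From discrepancy to the operator norm\<close>

definition bit :: "nat \<Rightarrow> real \<Rightarrow> nat" where
  "bit k x = nat (\<lfloor>2 ^ k * x\<rfloor> mod 2)"

lemma bit_cases: "bit k x = 0 \<or> bit k x = 1"
  unfolding bit_def by (cases "\<lfloor>2 ^ k * x\<rfloor> mod 2 = 0") auto

lemma floor_double: "\<lfloor>2 * (y::real)\<rfloor> = 2 * \<lfloor>y\<rfloor> + \<lfloor>2 * y\<rfloor> mod 2"
proof -
  have "\<lfloor>2 * y\<rfloor> div 2 = \<lfloor>y\<rfloor>"
    using floor_divide_real_eq_div[of 2 "2 * y"] by simp
  then show ?thesis by (metis mult_div_mod_eq)
qed

lemma binary_truncation:
  assumes "0 \<le> x" "x < 1"
  shows "(\<Sum>k=1..K. real (bit k x) / 2 ^ k) = \<lfloor>2 ^ K * x\<rfloor> / 2 ^ K"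
proof (induction K)
  case 0
  then show ?case using assms by (simp add: floor_eq_iff)
next
  case (Suc K)
  have "\<lfloor>2 ^ Suc K * x\<rfloor> = 2 * \<lfloor>2 ^ K * x\<rfloor> + \<lfloor>2 ^ Suc K * x\<rfloor> mod 2"
    using floor_double[of "2 ^ K * x"] by (simp add: mult.assoc)
  then have "real_of_int \<lfloor>2 ^ Suc K * x\<rfloor> = 2 * \<lfloor>2 ^ K * x\<rfloor> + real (bit (Suc K) x)"
    unfolding bit_def by (metis (no_types, opaque_lifting) of_int_add of_int_mult of_int_numeral of_nat_nat pos_mod_sign zero_less_numeral)
  then show ?case using Suc by (simp add: field_simps)
qed

text \<open>Levels \<open>k\<close> and \<open>l\<close> are the binary digits of the two vectors.
  For levels at distance at most \<open>r\<close> the discrepancy bound is split by the inequality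
  of arithmetic and geometric means, each level having at most \<open>2 * r + 1\<close> partners.
  For farther levels the bound by \<open>D\<close> sums geometrically to a factor
  \<open>2^(-r)\<close>. The number \<open>K\<close> of digits does not enter, so no logarithm is
  lost.\<close>

lemma bilinear_level_bound:
  fixes f :: "nat \<Rightarrow> nat \<Rightarrow> real" and s t :: "nat \<Rightarrow> real"
  assumes s: "\<And>k. 0 \<le> s k" and t: "\<And>k. 0 \<le> t k"
    and f1: "\<And>k l. \<bar>f k l\<bar> \<le> a * sqrt (s k * t l)"
    and f2: "\<And>k l. \<bar>f k l\<bar> \<le> D * s k" "\<And>k l. \<bar>f k l\<bar> \<le> D * t l"
    and aD: "0 \<le> a" "0 \<le> D"
    and S: "(\<Sum>k=1..K. s k / 4 ^ k) \<le> 1" and T: "(\<Sum>k=1..K. t k / 4 ^ k) \<le> 1"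
  shows "(\<Sum>k=1..K. \<Sum>l=1..K. \<bar>f k l\<bar> / (2 ^ k * 2 ^ l)) \<le> (2 * real r + 1) * a + 2 * D / 2 ^ r"
proof -
  define g where "g = (\<lambda>k l. if l \<le> k + r \<and> k \<le> l + r then a / 2 * (s k / 4 ^ k) + a / 2 * (t l / 4 ^ l) else 0)"
  have near: "\<bar>f k l\<bar> / (2 ^ k * 2 ^ l) \<le> a / 2 * (s k / 4 ^ k) + a / 2 * (t l / 4 ^ l)" for k l
  proof -
    have e: "sqrt (s k * t l) / (2 ^ k * 2 ^ l) = sqrt (s k / 4 ^ k * (t l / 4 ^ l))"
    proof -
      have "sqrt (4 ^ k) = (2::real) ^ k" for k by (simp add: real_sqrt_power)
      then show ?thesis by (simp add: real_sqrt_divide real_sqrt_mult)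
    qed
    have "\<bar>f k l\<bar> / (2 ^ k * 2 ^ l) \<le> a * sqrt (s k * t l) / (2 ^ k * 2 ^ l)" using f1 by (intro divide_right_mono) auto
    also have "\<dots> = a * sqrt (s k / 4 ^ k * (t l / 4 ^ l))" using e by (metis times_divide_eq_right)
    also have "\<dots> \<le> a * ((s k / 4 ^ k + t l / 4 ^ l) / 2)"
      using s[of k] t[of l] aD by (intro mult_left_mono arith_geo_mean_sqrt) auto
    finally show ?thesis by (simp add: field_simps)
  qed
  have geo: "(\<Sum>l\<in>L. 1 / (2::real) ^ l) \<le> 2 * (1 / 2 ^ q)" if "L \<subseteq> {q..K}" for L q
  proof -
    have "(\<Sum>l\<in>L. 1 / (2::real) ^ l) \<le> (\<Sum>l\<in>{q..K}. 1 / (2::real) ^ l)" using that by (intro sum_mono2) auto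
    also have "\<dots> \<le> 2 * (1 / 2 ^ q)"
    proof (cases "q \<le> K")
      case True
      have "(\<Sum>l\<in>{q..K}. 1 / (2::real) ^ l) = 2 * (1 / 2 ^ q) - 1 / 2 ^ K"
        using True by (induction K rule: dec_induct) simp_all
      then show ?thesis by simp
    qed simp
    finally show ?thesis .
  qed
  have far1: "(\<Sum>l\<in>{l\<in>{1..K}. k + r < l}. \<bar>f k l\<bar> / (2 ^ k * 2 ^ l)) \<le> D / 2 ^ r * (s k / 4 ^ k)" for k
  proof -
    have "(\<Sum>l\<in>{l\<in>{1..K}. k + r < l}. \<bar>f k l\<bar> / (2 ^ k * 2 ^ l)) \<le> (\<Sum>l\<in>{l\<in>{1..K}. k + r < l}. D * s k / 2 ^ k * (1 / 2 ^ l))"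
      using f2(1) by (intro sum_mono) (auto simp: field_simps)
    also have "\<dots> = D * s k / 2 ^ k * (\<Sum>l\<in>{l\<in>{1..K}. k + r < l}. 1 / 2 ^ l)" by (simp add: sum_distrib_left)
    also have "\<dots> \<le> D * s k / 2 ^ k * (2 * (1 / 2 ^ (k + r + 1)))"
      using aD s[of k] by (intro mult_left_mono geo) auto
    also have "\<dots> = D / 2 ^ r * (s k / 4 ^ k)"
      using power_mult_distrib[of 2 "2::real" k] by (simp add: power_add)
    finally show ?thesis .
  qed
  have far2: "(\<Sum>k\<in>{k\<in>{1..K}. l + r < k}. \<bar>f k l\<bar> / (2 ^ k * 2 ^ l)) \<le> D / 2 ^ r * (t l / 4 ^ l)" for l
  proof -
    have "(\<Sum>k\<in>{k\<in>{1..K}. l + r < k}. \<bar>f k l\<bar> / (2 ^ k * 2 ^ l)) \<le> (\<Sum>k\<in>{k\<in>{1..K}. l + r < k}. D * t l / 2 ^ l * (1 / 2 ^ k))"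
      using f2(2) by (intro sum_mono) (auto simp: field_simps)
    also have "\<dots> = D * t l / 2 ^ l * (\<Sum>k\<in>{k\<in>{1..K}. l + r < k}. 1 / 2 ^ k)" by (simp add: sum_distrib_left)
    also have "\<dots> \<le> D * t l / 2 ^ l * (2 * (1 / 2 ^ (l + r + 1)))"
      using aD t[of l] by (intro mult_left_mono geo) auto
    also have "\<dots> = D / 2 ^ r * (t l / 4 ^ l)"
      using power_mult_distrib[of 2 "2::real" l] by (simp add: power_add)
    finally show ?thesis .
  qed
  have split: "\<bar>f k l\<bar> / (2 ^ k * 2 ^ l) \<le> g k l + (if k + r < l then \<bar>f k l\<bar> / (2 ^ k * 2 ^ l) else 0)
      + (if l + r < k then \<bar>f k l\<bar> / (2 ^ k * 2 ^ l) else 0)" for k l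
    using near[of k l] by (auto simp: g_def)
  have "(\<Sum>k=1..K. \<Sum>l=1..K. \<bar>f k l\<bar> / (2 ^ k * 2 ^ l)) \<le> (\<Sum>k=1..K. \<Sum>l=1..K. g k l)
     + (\<Sum>k=1..K. \<Sum>l=1..K. if k + r < l then \<bar>f k l\<bar> / (2 ^ k * 2 ^ l) else 0)
     + (\<Sum>k=1..K. \<Sum>l=1..K. if l + r < k then \<bar>f k l\<bar> / (2 ^ k * 2 ^ l) else 0)"
    unfolding sum.distrib[symmetric] by (intro sum_mono split)
  moreover have "(\<Sum>k=1..K. \<Sum>l=1..K. if k + r < l then \<bar>f k l\<bar> / (2 ^ k * 2 ^ l) else 0) \<le> D / 2 ^ r"
  proof -
    have "(\<Sum>k=1..K. \<Sum>l=1..K. if k + r < l then \<bar>f k l\<bar> / (2 ^ k * 2 ^ l) else 0)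
        = (\<Sum>k=1..K. \<Sum>l\<in>{l\<in>{1..K}. k + r < l}. \<bar>f k l\<bar> / (2 ^ k * 2 ^ l))"
      by (intro sum.cong refl sum.inter_filter[symmetric]) auto
    also have "\<dots> \<le> (\<Sum>k=1..K. D / 2 ^ r * (s k / 4 ^ k))" by (intro sum_mono far1)
    also have "\<dots> = D / 2 ^ r * (\<Sum>k=1..K. s k / 4 ^ k)" by (simp add: sum_distrib_left)
    also have "\<dots> \<le> D / 2 ^ r * 1" using aD by (intro mult_left_mono S) auto
    finally show ?thesis by simp
  qed
  moreover have "(\<Sum>k=1..K. \<Sum>l=1..K. if l + r < k then \<bar>f k l\<bar> / (2 ^ k * 2 ^ l) else 0) \<le> D / 2 ^ r"
  proof -
    have "(\<Sum>k=1..K. \<Sum>l=1..K. if l + r < k then \<bar>f k l\<bar> / (2 ^ k * 2 ^ l) else 0)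
        = (\<Sum>l=1..K. \<Sum>k=1..K. if l + r < k then \<bar>f k l\<bar> / (2 ^ k * 2 ^ l) else 0)" by (rule sum.swap)
    also have "\<dots> = (\<Sum>l=1..K. \<Sum>k\<in>{k\<in>{1..K}. l + r < k}. \<bar>f k l\<bar> / (2 ^ k * 2 ^ l))"
      by (intro sum.cong refl sum.inter_filter[symmetric]) auto
    also have "\<dots> \<le> (\<Sum>l=1..K. D / 2 ^ r * (t l / 4 ^ l))" by (intro sum_mono far2)
    also have "\<dots> = D / 2 ^ r * (\<Sum>l=1..K. t l / 4 ^ l)" by (simp add: sum_distrib_left)
    also have "\<dots> \<le> D / 2 ^ r * 1" using aD by (intro mult_left_mono T) auto
    finally show ?thesis by simp
  qed
  moreover have "(\<Sum>k=1..K. \<Sum>l=1..K. g k l) \<le> (2 * real r + 1) * a"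
  proof -
    have cnt: "real (card {l\<in>{1..K}. l \<le> k + r \<and> k \<le> l + r}) \<le> 2 * real r + 1" for k
    proof -
      have "{l\<in>{1..K}. l \<le> k + r \<and> k \<le> l + r} \<subseteq> {k - r..k + r}" by auto
      then have "card {l\<in>{1..K}. l \<le> k + r \<and> k \<le> l + r} \<le> card {k - r..k + r}" by (intro card_mono) auto
      then show ?thesis by simp
    qed
    have "(\<Sum>k=1..K. \<Sum>l=1..K. g k l) = (\<Sum>k=1..K. \<Sum>l=1..K. if l \<le> k + r \<and> k \<le> l + r then a / 2 * (s k / 4 ^ k) else 0)
        + (\<Sum>k=1..K. \<Sum>l=1..K. if l \<le> k + r \<and> k \<le> l + r then a / 2 * (t l / 4 ^ l) else 0)"
      unfolding g_def sum.distrib[symmetric] by (intro sum.cong refl) auto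
    also have "(\<Sum>k=1..K. \<Sum>l=1..K. if l \<le> k + r \<and> k \<le> l + r then a / 2 * (s k / 4 ^ k) else 0) \<le> (2 * real r + 1) * (a / 2)"
    proof -
      have "(\<Sum>k=1..K. \<Sum>l=1..K. if l \<le> k + r \<and> k \<le> l + r then a / 2 * (s k / 4 ^ k) else 0)
          = (\<Sum>k=1..K. real (card {l\<in>{1..K}. l \<le> k + r \<and> k \<le> l + r}) * (a / 2 * (s k / 4 ^ k)))"
        by (intro sum.cong refl) (simp add: sum.inter_filter[symmetric])
      also have "\<dots> \<le> (\<Sum>k=1..K. (2 * real r + 1) * (a / 2 * (s k / 4 ^ k)))"
        using aD s cnt by (intro sum_mono mult_right_mono) auto
      also have "\<dots> = (2 * real r + 1) * (a / 2) * (\<Sum>k=1..K. s k / 4 ^ k)" by (simp add: sum_distrib_left mult.assoc)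
      also have "\<dots> \<le> (2 * real r + 1) * (a / 2) * 1" using aD by (intro mult_left_mono S) auto
      finally show ?thesis by simp
    qed
    also have "(\<Sum>k=1..K. \<Sum>l=1..K. if l \<le> k + r \<and> k \<le> l + r then a / 2 * (t l / 4 ^ l) else 0) \<le> (2 * real r + 1) * (a / 2)"
    proof -
      have "(\<Sum>k=1..K. \<Sum>l=1..K. if l \<le> k + r \<and> k \<le> l + r then a / 2 * (t l / 4 ^ l) else 0)
          = (\<Sum>l=1..K. \<Sum>k=1..K. if k \<le> l + r \<and> l \<le> k + r then a / 2 * (t l / 4 ^ l) else 0)"
        by (subst sum.swap) (intro sum.cong refl, auto)
      also have "\<dots> = (\<Sum>l=1..K. real (card {k\<in>{1..K}. k \<le> l + r \<and> l \<le> k + r}) * (a / 2 * (t l / 4 ^ l)))"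
        by (intro sum.cong refl) (simp add: sum.inter_filter[symmetric])
      also have "\<dots> \<le> (\<Sum>l=1..K. (2 * real r + 1) * (a / 2 * (t l / 4 ^ l)))"
        using aD t cnt by (intro sum_mono mult_right_mono) auto
      also have "\<dots> = (2 * real r + 1) * (a / 2) * (\<Sum>l=1..K. t l / 4 ^ l)" by (simp add: sum_distrib_left mult.assoc)
      also have "\<dots> \<le> (2 * real r + 1) * (a / 2) * 1" using aD by (intro mult_left_mono T) auto
      finally show ?thesis by simp
    qed
    finally show ?thesis by (simp add: mult.commute)
  qed
  ultimately show ?thesis by linarith
qed

text \<open>Truncating the binary expansions at \<open>K\<close> digits turns the form into a
  combination of sums over digit sets, where the hypotheses on sets apply. The bound is uniform in
  \<open>K\<close>, and the truncations converge to the vectors.\<close>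

lemma bilinear_nonneg_bound:
  fixes x y :: "nat \<Rightarrow> real" and P :: "nat \<Rightarrow> nat \<Rightarrow> real" and a D :: real
  assumes V: "finite V"
    and B1: "\<And>S T. S \<subseteq> V \<Longrightarrow> T \<subseteq> V \<Longrightarrow> \<bar>\<Sum>u\<in>S. \<Sum>v\<in>T. P u v\<bar> \<le> a * sqrt (real (card S) * card T)"
    and B2: "\<And>S T. S \<subseteq> V \<Longrightarrow> T \<subseteq> V \<Longrightarrow> \<bar>\<Sum>u\<in>S. \<Sum>v\<in>T. P u v\<bar> \<le> D * card S"
      "\<And>S T. S \<subseteq> V \<Longrightarrow> T \<subseteq> V \<Longrightarrow> \<bar>\<Sum>u\<in>S. \<Sum>v\<in>T. P u v\<bar> \<le> D * card T"
    and aD: "0 \<le> a" "0 \<le> D"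
    and x: "\<And>u. u \<in> V \<Longrightarrow> 0 \<le> x u" "\<And>u. u \<in> V \<Longrightarrow> x u < 1" "(\<Sum>u\<in>V. (x u)\<^sup>2) \<le> 1"
    and y: "\<And>u. u \<in> V \<Longrightarrow> 0 \<le> y u" "\<And>u. u \<in> V \<Longrightarrow> y u < 1" "(\<Sum>u\<in>V. (y u)\<^sup>2) \<le> 1"
  shows "\<bar>\<Sum>u\<in>V. \<Sum>v\<in>V. P u v * (x u * y v)\<bar> \<le> (2 * real r + 1) * a + 2 * D / 2 ^ r"
proof -
  define R where "R = (2 * real r + 1) * a + 2 * D / 2 ^ r"
  define tr where "tr = (\<lambda>K (z::real). real_of_int \<lfloor>2 ^ K * z\<rfloor> / 2 ^ K)"
  define X where "X = (\<lambda>(z::nat \<Rightarrow> real) k. {u\<in>V. bit k (z u) = 1})"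
  have trX: "tr K (z u) = (\<Sum>k=1..K. of_bool (u \<in> X z k) / 2 ^ k)" if "u \<in> V" "0 \<le> z u" "z u < 1" for z :: "nat \<Rightarrow> real" and u K
  proof -
    have "real (bit k (z u)) = of_bool (u \<in> X z k)" for k using bit_cases[of k "z u"] that by (auto simp: X_def)
    then show ?thesis using binary_truncation[OF that(2,3), of K] by (simp add: tr_def)
  qed
  \<comment> \<open>For nonnegative terms the sum of squares is at most the square of the sum.
    Applied to the digits of \<open>z u\<close>, this compares the weighted sizes of the digit sets
    with the squared norm of \<open>z\<close>.\<close>
  have norm: "(\<Sum>k=1..K. real (card (X z k)) / 4 ^ k) \<le> 1"
    if z: "\<And>u. u \<in> V \<Longrightarrow> 0 \<le> z u" "\<And>u. u \<in> V \<Longrightarrow> z u < 1" "(\<Sum>u\<in>V. (z u)\<^sup>2) \<le> 1" for z :: "nat \<Rightarrow> real" and K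
  proof -
    have "(\<Sum>k=1..K. real (card (X z k)) / 4 ^ k) = (\<Sum>k=1..K. \<Sum>u\<in>V. of_bool (u \<in> X z k) / 4 ^ k)"
    proof (intro sum.cong refl)
      fix k
      have "(\<Sum>u\<in>V. of_bool (u \<in> X z k) / (4::real) ^ k) = (\<Sum>u\<in>V. of_bool (u \<in> X z k)) / 4 ^ k" by (simp add: sum_divide_distrib)
      also have "(\<Sum>u\<in>V. of_bool (u \<in> X z k)) = real (card (X z k))"
        using V by (simp add: X_def sum.inter_filter[symmetric] of_bool_def Int_def)
      finally show "real (card (X z k)) / 4 ^ k = (\<Sum>u\<in>V. of_bool (u \<in> X z k) / 4 ^ k)" by simp
    qed
    also have "\<dots> = (\<Sum>u\<in>V. \<Sum>k=1..K. of_bool (u \<in> X z k) / 4 ^ k)" by (rule sum.swap)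
    also have "\<dots> \<le> (\<Sum>u\<in>V. (z u)\<^sup>2)"
    proof (rule sum_mono)
      fix u assume u: "u \<in> V"
      define w where "w = (\<lambda>k. of_bool (u \<in> X z k) / (2::real) ^ k)"
      have w0: "0 \<le> w k" for k by (simp add: w_def)
      have tz: "(\<Sum>k=1..K. w k) = tr K (z u)" using trX[of u z K, OF u z(1)[OF u] z(2)[OF u]] by (simp add: w_def)
      have tzz: "tr K (z u) \<le> z u" unfolding tr_def by (simp add: divide_le_eq mult.commute)
      have "(\<Sum>k=1..K. of_bool (u \<in> X z k) / (4::real) ^ k) = (\<Sum>k=1..K. w k * w k)"
        using power_mult_distrib[of 2 "2::real"] by (intro sum.cong refl) (auto simp: w_def)
      also have "\<dots> \<le> (\<Sum>k=1..K. w k * (\<Sum>k=1..K. w k))"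
        using w0 by (intro sum_mono mult_left_mono member_le_sum) auto
      also have "\<dots> = (tr K (z u))\<^sup>2" by (simp only: sum_distrib_right[symmetric] tz power2_eq_square)
      also have "\<dots> \<le> (z u)\<^sup>2"
        using tzz tz sum_nonneg[of "{1..K}" w] w0 by (intro power_mono) auto
      finally show "(\<Sum>k=1..K. of_bool (u \<in> X z k) / (4::real) ^ k) \<le> (z u)\<^sup>2" .
    qed
    finally show ?thesis using z(3) by simp
  qed
  have XV: "X z k \<subseteq> V" for z k by (auto simp: X_def)
  have trunc: "\<bar>\<Sum>u\<in>V. \<Sum>v\<in>V. P u v * (tr K (x u) * tr K (y v))\<bar> \<le> R" for K
  proof -
    define f where "f = (\<lambda>k l. \<Sum>u\<in>X x k. \<Sum>v\<in>X y l. P u v)"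
    have "(\<Sum>u\<in>V. \<Sum>v\<in>V. P u v * (tr K (x u) * tr K (y v)))
        = (\<Sum>u\<in>V. \<Sum>v\<in>V. \<Sum>k=1..K. \<Sum>l=1..K. P u v * of_bool (u \<in> X x k) * of_bool (v \<in> X y l) / (2 ^ k * 2 ^ l))"
    proof (intro sum.cong refl)
      fix u v assume uv: "u \<in> V" "v \<in> V"
      show "P u v * (tr K (x u) * tr K (y v)) = (\<Sum>k=1..K. \<Sum>l=1..K. P u v * of_bool (u \<in> X x k) * of_bool (v \<in> X y l) / (2 ^ k * 2 ^ l))"
      proof -
        have "P u v * (tr K (x u) * tr K (y v)) = P u v * (\<Sum>k=1..K. \<Sum>l=1..K. (of_bool (u \<in> X x k) / 2 ^ k) * (of_bool (v \<in> X y l) / 2 ^ l))"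
          using trX[of u x K, OF uv(1) x(1)[OF uv(1)] x(2)[OF uv(1)]] trX[of v y K, OF uv(2) y(1)[OF uv(2)] y(2)[OF uv(2)]]
          by (simp only: sum_product)
        also have "\<dots> = (\<Sum>k=1..K. \<Sum>l=1..K. P u v * ((of_bool (u \<in> X x k) / 2 ^ k) * (of_bool (v \<in> X y l) / 2 ^ l)))"
          by (simp only: sum_distrib_left)
        finally show ?thesis by (simp only: times_divide_eq_left times_divide_eq_right divide_divide_eq_left mult_ac)
      qed
    qed
    also have "\<dots> = (\<Sum>u\<in>V. \<Sum>k=1..K. \<Sum>v\<in>V. \<Sum>l=1..K. P u v * of_bool (u \<in> X x k) * of_bool (v \<in> X y l) / (2 ^ k * 2 ^ l))"
      by (intro sum.cong refl sum.swap)
    also have "\<dots> = (\<Sum>k=1..K. \<Sum>u\<in>V. \<Sum>v\<in>V. \<Sum>l=1..K. P u v * of_bool (u \<in> X x k) * of_bool (v \<in> X y l) / (2 ^ k * 2 ^ l))"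
      by (rule sum.swap)
    also have "\<dots> = (\<Sum>k=1..K. \<Sum>u\<in>V. \<Sum>l=1..K. \<Sum>v\<in>V. P u v * of_bool (u \<in> X x k) * of_bool (v \<in> X y l) / (2 ^ k * 2 ^ l))"
      by (intro sum.cong refl sum.swap)
    also have "\<dots> = (\<Sum>k=1..K. \<Sum>l=1..K. \<Sum>u\<in>V. \<Sum>v\<in>V. P u v * of_bool (u \<in> X x k) * of_bool (v \<in> X y l) / (2 ^ k * 2 ^ l))"
      by (intro sum.cong refl sum.swap)
    also have "\<dots> = (\<Sum>k=1..K. \<Sum>l=1..K. f k l / (2 ^ k * 2 ^ l))"
    proof (intro sum.cong refl)
      fix k l
      have "(\<Sum>u\<in>V. \<Sum>v\<in>V. P u v * of_bool (u \<in> X x k) * of_bool (v \<in> X y l)) = f k l"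
      proof -
        have "(\<Sum>v\<in>V. P u v * of_bool (u \<in> X x k) * of_bool (v \<in> X y l)) = (if u \<in> X x k then \<Sum>v\<in>X y l. P u v else 0)" for u
        proof (cases "u \<in> X x k")
          case True
          have "(\<Sum>v\<in>V. P u v * of_bool (v \<in> X y l)) = (\<Sum>v\<in>X y l. P u v)"
            using V XV[of y l] by (intro sum.mono_neutral_cong_right) auto
          then show ?thesis using True by simp
        qed simp
        moreover have "(\<Sum>u\<in>V. if u \<in> X x k then \<Sum>v\<in>X y l. P u v else 0) = f k l"
          unfolding f_def using V XV[of x k] by (intro sum.mono_neutral_cong_right) auto
        ultimately show ?thesis by simp
      qed
      then show "(\<Sum>u\<in>V. \<Sum>v\<in>V. P u v * of_bool (u \<in> X x k) * of_bool (v \<in> X y l) / (2 ^ k * 2 ^ l)) = f k l / (2 ^ k * 2 ^ l)"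
        by (simp add: sum_divide_distrib[symmetric])
    qed
    finally have "\<bar>\<Sum>u\<in>V. \<Sum>v\<in>V. P u v * (tr K (x u) * tr K (y v))\<bar> \<le> (\<Sum>k=1..K. \<Sum>l=1..K. \<bar>f k l\<bar> / (2 ^ k * 2 ^ l))"
      by (simp only:) (intro order_trans[OF sum_abs] sum_mono, simp add: order_trans[OF sum_abs] abs_mult)
    also have "\<dots> \<le> R" unfolding R_def
      by (rule bilinear_level_bound[where s = "\<lambda>k. real (card (X x k))" and t = "\<lambda>k. real (card (X y k))"])
        (use B1 B2 XV aD norm[OF x] norm[OF y] in \<open>auto simp: f_def\<close>)
    finally show ?thesis .
  qed
  have lim: "(\<lambda>K. tr K z) \<longlonglongrightarrow> z" for z
  proof (rule tendsto_sandwich[of "\<lambda>K. z - (1/2) ^ K" _ _ "\<lambda>_. z"])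
    have "z - (1/2) ^ K \<le> tr K z" for K
    proof -
      have "2 ^ K * z - 1 \<le> real_of_int \<lfloor>2 ^ K * z\<rfloor>" by linarith
      then have "(2 ^ K * z - 1) / 2 ^ K \<le> tr K z" unfolding tr_def by (intro divide_right_mono) auto
      then show ?thesis by (simp add: diff_divide_distrib power_one_over)
    qed
    then show "\<forall>\<^sub>F K in sequentially. z - (1/2) ^ K \<le> tr K z" by simp
    have "tr K z \<le> z" for K unfolding tr_def by (simp add: divide_le_eq mult.commute)
    then show "\<forall>\<^sub>F K in sequentially. tr K z \<le> z" by simp
    have "(\<lambda>K. z - (1/2) ^ K) \<longlonglongrightarrow> z - 0" by (intro tendsto_diff tendsto_const LIMSEQ_realpow_zero) auto
    then show "(\<lambda>K. z - (1/2) ^ K) \<longlonglongrightarrow> z" by simp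
  qed simp
  have "(\<lambda>K. \<bar>\<Sum>u\<in>V. \<Sum>v\<in>V. P u v * (tr K (x u) * tr K (y v))\<bar>) \<longlonglongrightarrow> \<bar>\<Sum>u\<in>V. \<Sum>v\<in>V. P u v * (x u * y v)\<bar>"
    by (intro tendsto_rabs tendsto_sum tendsto_mult tendsto_const lim)
  then show ?thesis unfolding R_def[symmetric] using trunc by (intro LIMSEQ_le_const2) auto
qed

text \<open>The 16 is 4 * 4. One factor 4 comes from scaling both vectors to norm 1/2, so that
  entries are strictly below 1 and have a binary expansion after the point. The other comes from the
  four combinations of positive and negative parts.\<close>

lemma operator_norm_bound:
  fixes P :: "nat \<Rightarrow> nat \<Rightarrow> real" and a D R :: real
  assumes V: "finite V"
    and B1: "\<And>S T. S \<subseteq> V \<Longrightarrow> T \<subseteq> V \<Longrightarrow> \<bar>\<Sum>u\<in>S. \<Sum>v\<in>T. P u v\<bar> \<le> a * sqrt (real (card S) * card T)"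
    and B2: "\<And>S T. S \<subseteq> V \<Longrightarrow> T \<subseteq> V \<Longrightarrow> \<bar>\<Sum>u\<in>S. \<Sum>v\<in>T. P u v\<bar> \<le> D * card S"
      "\<And>S T. S \<subseteq> V \<Longrightarrow> T \<subseteq> V \<Longrightarrow> \<bar>\<Sum>u\<in>S. \<Sum>v\<in>T. P u v\<bar> \<le> D * card T"
    and aD: "0 \<le> a" "0 \<le> D" and R: "16 * ((2 * real r + 1) * a + 2 * D / 2 ^ r) \<le> R"
  shows "(\<Sum>u\<in>V. (\<Sum>v\<in>V. P u v * y v)\<^sup>2) \<le> R\<^sup>2 * (\<Sum>v\<in>V. (y v)\<^sup>2)"
proof -
  define R0 where "R0 = (2 * real r + 1) * a + 2 * D / 2 ^ r"
  have R0: "0 \<le> R0" using aD by (simp add: R0_def)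
  define nrm where "nrm = (\<lambda>x. sqrt (\<Sum>u\<in>V. (x u)\<^sup>2))"
  have nn: "0 \<le> nrm x" "(nrm x)\<^sup>2 = (\<Sum>u\<in>V. (x u)\<^sup>2)" for x by (auto simp: nrm_def sum_nonneg)
  define Q where "Q = (\<lambda>x y. \<Sum>u\<in>V. \<Sum>v\<in>V. P u v * (x u * y v))"
  have pos: "\<bar>Q x y\<bar> \<le> 4 * R0 * nrm x * nrm y" if x: "\<And>u. u \<in> V \<Longrightarrow> 0 \<le> x u" and y: "\<And>u. u \<in> V \<Longrightarrow> 0 \<le> y u" for x y
  proof (cases "nrm x = 0 \<or> nrm y = 0")
    case True
    have z: "\<forall>u\<in>V. z u = 0" if "nrm z = 0" for z
    proof -
      have "(\<Sum>u\<in>V. (z u)\<^sup>2) = 0" using that nn(2)[of z] by simp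
      then show ?thesis using V by (subst (asm) sum_nonneg_eq_0_iff) auto
    qed
    have "Q x y = 0" unfolding Q_def using True z[of x] z[of y] by (intro sum.neutral ballI) auto
    then show ?thesis using R0 nn by simp
  next
    case False
    define x' where "x' = (\<lambda>u. x u / (2 * nrm x))"
    define y' where "y' = (\<lambda>u. y u / (2 * nrm y))"
    have np: "0 < nrm x" "0 < nrm y" using False nn(1)[of x] nn(1)[of y] by auto
    have half: "(\<Sum>u\<in>V. (z u / (2 * nrm z))\<^sup>2) \<le> 1" "\<And>u. u \<in> V \<Longrightarrow> z u / (2 * nrm z) < 1" if "0 < nrm z" for z
    proof -
      have "(\<Sum>u\<in>V. (z u / (2 * nrm z))\<^sup>2) = (nrm z)\<^sup>2 / (2 * nrm z)\<^sup>2"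
        unfolding nn(2) by (simp add: power_divide sum_divide_distrib[symmetric])
      then show "(\<Sum>u\<in>V. (z u / (2 * nrm z))\<^sup>2) \<le> 1" using that by (simp add: power_mult_distrib)
      fix u assume u: "u \<in> V"
      have "(z u)\<^sup>2 \<le> (nrm z)\<^sup>2" unfolding nn(2) using u V by (intro member_le_sum) auto
      then have "z u \<le> nrm z" using nn(1) by (rule power2_le_imp_le)
      then show "z u / (2 * nrm z) < 1" using that by simp
    qed
    have "\<bar>\<Sum>u\<in>V. \<Sum>v\<in>V. P u v * (x' u * y' v)\<bar> \<le> R0" unfolding R0_def
      by (rule bilinear_nonneg_bound[OF V B1 B2 aD]) (use x y np half in \<open>auto simp: x'_def y'_def\<close>)
    moreover have "(\<Sum>u\<in>V. \<Sum>v\<in>V. P u v * (x' u * y' v)) = Q x y / (4 * nrm x * nrm y)"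
      unfolding Q_def x'_def y'_def by (simp add: sum_divide_distrib mult_ac)
    ultimately have "\<bar>Q x y\<bar> / (4 * nrm x * nrm y) \<le> R0" using np by (simp add: abs_mult)
    then show ?thesis using np by (simp add: pos_divide_le_eq mult_ac)
  qed
  have gen: "\<bar>Q x y\<bar> \<le> 16 * R0 * nrm x * nrm y" for x y
  proof -
    define px where "px = (\<lambda>u. max (x u) 0)"
    define nx where "nx = (\<lambda>u. max (- x u) 0)"
    define py where "py = (\<lambda>u. max (y u) 0)"
    define ny where "ny = (\<lambda>u. max (- y u) 0)"
    have le: "nrm px \<le> nrm x" "nrm nx \<le> nrm x" "nrm py \<le> nrm y" "nrm ny \<le> nrm y"
      unfolding nrm_def px_def nx_def py_def ny_def by (intro real_sqrt_le_mono sum_mono; simp add: max_def)+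
    have xe: "x u = px u - nx u" and ye: "y u = py u - ny u" for u by (auto simp: px_def nx_def py_def ny_def)
    have "Q x y = Q px py - Q px ny - Q nx py + Q nx ny"
      unfolding Q_def sum_subtractf[symmetric] sum.distrib[symmetric] xe ye by (intro sum.cong refl) (simp add: algebra_simps)
    moreover have "\<bar>Q a b\<bar> \<le> 4 * R0 * nrm x * nrm y"
      if "\<And>u. u \<in> V \<Longrightarrow> 0 \<le> a u" "\<And>u. u \<in> V \<Longrightarrow> 0 \<le> b u" "nrm a \<le> nrm x" "nrm b \<le> nrm y" for a b
    proof -
      have "\<bar>Q a b\<bar> \<le> 4 * R0 * nrm a * nrm b" by (rule pos[OF that(1,2)])
      also have "\<dots> \<le> 4 * R0 * nrm x * nrm y" using that(3,4) R0 nn by (intro mult_mono) auto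
      finally show ?thesis .
    qed
    note this[of px py] this[of px ny] this[of nx py] this[of nx ny]
    ultimately show ?thesis using le unfolding px_def nx_def py_def ny_def by simp
  qed
  define z where "z = (\<lambda>u. \<Sum>v\<in>V. P u v * y v)"
  have "Q z y = (nrm z)\<^sup>2"
    unfolding nn(2) Q_def by (intro sum.cong refl) (simp add: z_def sum_distrib_left power2_eq_square mult_ac)
  then have "nrm z * nrm z \<le> nrm z * (16 * R0 * nrm y)" using gen[of z y] by (simp add: power2_eq_square mult_ac)
  then have "nrm z \<le> 16 * R0 * nrm y" using nn(1)[of z] nn(1)[of y] R0 by (cases "nrm z = 0") auto
  also have "\<dots> \<le> R * nrm y" using R nn(1)[of y] by (intro mult_right_mono) (auto simp: R0_def)
  finally have "(nrm z)\<^sup>2 \<le> (R * nrm y)\<^sup>2" using nn(1) by (intro power_mono) auto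
  then show ?thesis unfolding power_mult_distrib nn(2) by (simp add: z_def)
qed

text \<open>The tolerance is proportional to the larger of the two cardinalities, the quantity that
  the union bound over pairs of sets can afford. The geometric mean needed for the operator norm is
  recovered later with the help of the degree bound.\<close>

definition disc_bad :: "real \<Rightarrow> nat \<Rightarrow> nat \<Rightarrow> nat set list \<Rightarrow> bool" where
  "disc_bad b n m xs \<longleftrightarrow> (\<exists>S\<in>Pow {..<n}. \<exists>T\<in>Pow {..<n}.
     b * (dens n m * n) * max (card S) (card T) < \<bar>ecount (Gnm xs m) S T - dens n m * (real (card S) * card T)\<bar>)"

lemma sum_Pow_power: "finite V \<Longrightarrow> (\<Sum>S\<in>Pow V. (x::real) ^ card S) = (1 + x) ^ card V"
  using prod_add[of V "\<lambda>_. x" "\<lambda>_. 1"] by (simp add: add.commute)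

text \<open>Two regimes for the larger cardinality \<open>t\<close>. Up to \<open>t0 * n\<close>,
  the large parameter \<open>l2 = 30 / b\<close> gives failure probability \<open>n^(-6 t)\<close>,
  where 6 is 4/5 times \<open>l2 * b / 4 = 15/2\<close>; this beats the number of sets of that size.
  Above it, the small parameter \<open>l1\<close> gives an exponent of order \<open>n ln n\<close>,
  which beats all \<open>4^n\<close> pairs. Both \<open>t0\<close> and \<open>l1\<close> are chosen
  so that the second order term takes at most half of the linear one.\<close>

lemma pair_term_bound:
  fixes b :: real
  assumes b: "0 < b" "b \<le> 1"
  defines "l2 \<equiv> 30 / b"
  defines "t0 \<equiv> b / (8 * l2 * exp (2 * l2))"
  defines "l1 \<equiv> b / (8 * exp 2)"
  defines "\<gamma> \<equiv> t0 * (l1 * b / 4)"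
  assumes n: "2 \<le> n" "2 / b \<le> real n" "real n * ln 4 + 4 * ln n \<le> \<gamma> * (4/5 * ln n) * n"
    and d: "4/5 * ln (real n) \<le> dens n m * n" and m: "m \<le> card (all_edges n)"
    and ST: "S \<subseteq> {..<n}" "T \<subseteq> {..<n}"
  shows "pr (all_edges n) (\<lambda>xs. b * (dens n m * n) * max (card S) (card T) < \<bar>ecount (Gnm xs m) S T - dens n m * (real (card S) * card T)\<bar>)
     \<le> 2 * ((1 / real n ^ 3) ^ card S * (1 / real n ^ 3) ^ card T) + 2 * exp (- (real n * ln 4 + 4 * ln n))"
proof -
  define D where "D = dens n m * n"
  define t where "t = max (card S) (card T)"
  have l20: "0 < l2" using b by (simp add: l2_def)
  have t00: "0 < t0" using b l20 by (simp add: t0_def)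
  have l10: "0 < l1" "l1 \<le> 1"
    using b exp_ge_add_one_self[of 2] by (auto simp: l1_def divide_le_eq)
  have ln0: "0 < ln (real n)" using n by simp
  have D0: "0 < D" using d ln0 by (simp add: D_def)
  have tn: "real t \<le> n"
  proof -
    have "card S \<le> n" "card T \<le> n" using card_mono[OF _ ST(1)] card_mono[OF _ ST(2)] by auto
    then show ?thesis by (simp add: t_def)
  qed
  note dev = ecount_deviation[OF ST, of t m b, folded D_def]
  have cS: "card S \<le> t" "card T \<le> t" by (auto simp: t_def)
  let ?E = "\<lambda>xs. b * D * t < \<bar>ecount (Gnm xs m) S T - dens n m * (real (card S) * card T)\<bar>"
  show ?thesis unfolding D_def[symmetric] t_def[symmetric]
  proof (cases "real t \<le> t0 * n")
    case True
    have "l2 * b / 4 \<le> l2 * b / 2 - 2 * (real t / n) * (l2\<^sup>2 * exp (2 * l2))"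
    proof -
      have "2 * (real t / n) * (l2\<^sup>2 * exp (2 * l2)) \<le> 2 * t0 * (l2\<^sup>2 * exp (2 * l2))"
        using True n by (intro mult_right_mono mult_left_mono) (auto simp: divide_le_eq)
      also have "\<dots> = l2 * b / 4" using l20 by (simp add: t0_def power2_eq_square)
      finally show ?thesis by linarith
    qed
    moreover have "l2 * b / 4 = 15/2" using b by (simp add: l2_def)
    ultimately have br: "15/2 \<le> l2 * b / 2 - 2 * (real t / n) * (l2\<^sup>2 * exp (2 * l2))" by simp
    have "pr (all_edges n) ?E \<le> 2 * exp (- D * t * (l2 * b / 2 - 2 * (real t / n) * (l2\<^sup>2 * exp (2 * l2))))"
      using dev[OF cS m b(1) n(2), of l2] l20 by simp
    also have "\<dots> \<le> 2 * exp (- (6 * real t * ln n))"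
    proof -
      have "6 * real t * ln n = (4/5 * ln n) * t * (15/2)" by simp
      also have "\<dots> \<le> D * t * (l2 * b / 2 - 2 * (real t / n) * (l2\<^sup>2 * exp (2 * l2)))"
        using d br ln0 D0 by (intro mult_mono mult_right_mono) (auto simp: D_def)
      finally show ?thesis by simp
    qed
    also have "exp (- (6 * real t * ln n)) = (1 / real n ^ 3) ^ (2 * t)"
    proof -
      have "exp (6 * real t * ln n) = exp (real (6 * t) * ln n)" by simp
      also have "\<dots> = exp (ln n) ^ (6 * t)" by (rule exp_of_nat_mult)
      also have "\<dots> = (real n ^ 3) ^ (2 * t)" using n by (simp add: power_mult[symmetric])
      finally have e: "exp (6 * real t * ln n) = (real n ^ 3) ^ (2 * t)" .
      show ?thesis by (simp only: exp_minus of_nat_mult of_nat_numeral e power_one_over inverse_eq_divide)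
    qed
    also have "\<dots> \<le> (1 / real n ^ 3) ^ (card S + card T)"
      using n cS by (intro power_decreasing) (auto simp: divide_le_eq)
    finally show "pr (all_edges n) ?E \<le> 2 * ((1 / real n ^ 3) ^ card S * (1 / real n ^ 3) ^ card T) + 2 * exp (- (real n * ln 4 + 4 * ln n))"
      by (simp add: power_add add_increasing2)
  next
    case False
    have "l1 * b / 4 \<le> l1 * b / 2 - 2 * (real t / n) * (l1\<^sup>2 * exp (2 * l1))"
    proof -
      have "2 * (real t / n) * (l1\<^sup>2 * exp (2 * l1)) \<le> 2 * 1 * (l1\<^sup>2 * exp 2)"
        using tn n l10 by (intro mult_mono mult_left_mono) (auto simp: divide_le_eq)
      also have "\<dots> = l1 * b / 4" by (simp add: l1_def power2_eq_square)
      finally show ?thesis by linarith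
    qed
    then have "D * t * (l1 * b / 4) \<le> D * t * (l1 * b / 2 - 2 * (real t / n) * (l1\<^sup>2 * exp (2 * l1)))"
      using D0 by (intro mult_left_mono) auto
    moreover have "(4/5 * ln n) * (t0 * n) * (l1 * b / 4) \<le> D * t * (l1 * b / 4)"
      using False d ln0 D0 t00 l10 b by (intro mult_right_mono mult_mono) (auto simp: D_def)
    moreover have "(4/5 * ln n) * (t0 * n) * (l1 * b / 4) = \<gamma> * (4/5 * ln n) * n" by (simp add: \<gamma>_def)
    ultimately have ex: "real n * ln 4 + 4 * ln n \<le> D * t * (l1 * b / 2 - 2 * (real t / n) * (l1\<^sup>2 * exp (2 * l1)))"
      using n(3) by linarith
    have "pr (all_edges n) ?E \<le> 2 * exp (- D * t * (l1 * b / 2 - 2 * (real t / n) * (l1\<^sup>2 * exp (2 * l1))))"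
      using dev[OF cS m b(1) n(2), of l1] l10 by simp
    also have "\<dots> \<le> 2 * exp (- (real n * ln 4 + 4 * ln n))" using ex by simp
    finally show "pr (all_edges n) ?E \<le> 2 * ((1 / real n ^ 3) ^ card S * (1 / real n ^ 3) ^ card T) + 2 * exp (- (real n * ln 4 + 4 * ln n))"
      by (simp add: add_increasing)
  qed
qed

lemma power_minus_1_le:
  fixes x :: real
  assumes "0 \<le> x" "n * x \<le> 1"
  shows "(1 + x) ^ n - 1 \<le> 2 * (n * x)"
proof -
  have "(1 + x) ^ n \<le> exp x ^ n" using assms by (intro power_mono exp_ge_add_one_self) auto
  also have "\<dots> = exp (n * x)" by (simp add: exp_of_nat_mult)
  also have "\<dots> \<le> 1 + n * x + (n * x)\<^sup>2" using assms by (intro exp_bound) auto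
  also have "(n * x)\<^sup>2 \<le> n * x" unfolding power2_eq_square using assms mult_left_mono[of "n * x" 1 "n * x"] by simp
  finally show ?thesis by linarith
qed

lemma eventually_ln_ge: "\<forall>\<^sub>F n :: nat in sequentially. C \<le> ln (real n)"
  using filterlim_compose[OF ln_at_top filterlim_real_sequentially] by (simp add: filterlim_at_top)

text \<open>Pairs with an empty set have no deviation and are left out. Hence the generating sum
  over sets is \<open>(1 + x)^n - 1\<close>, which is at most \<open>2 / n^2\<close> for
  \<open>x = n^(-3)\<close>. Twice its square is \<open>8 / n^4\<close>, and the pairs with a large
  set add \<open>2 / n^4\<close>.\<close>

lemma disc_bad_prob:
  assumes b: "0 < b" "b \<le> 1"
  shows "\<forall>\<^sub>F n in sequentially. \<forall>m. m \<le> card (all_edges n) \<longrightarrow> 4/5 * ln (real n) \<le> dens n m * n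
     \<longrightarrow> pr (all_edges n) (disc_bad b n m) \<le> 10 / real n ^ 4"
proof -
  define l2 where "l2 = 30 / b"
  define t0 where "t0 = b / (8 * l2 * exp (2 * l2))"
  define l1 where "l1 = b / (8 * exp 2)"
  define \<gamma> where "\<gamma> = t0 * (l1 * b / 4)"
  have g0: "0 < \<gamma>" using b by (simp add: \<gamma>_def t0_def l2_def l1_def)
  have "\<forall>\<^sub>F n in sequentially. 2 / b \<le> real n"
    using filterlim_real_sequentially by (simp add: filterlim_at_top)
  then show ?thesis using eventually_ln_ge[of "(ln 4 + 4) / (\<gamma> * (4/5))"] eventually_ge_at_top[of 2]
  proof eventually_elim
    case (elim n)
    have ln0: "0 < ln (real n)" using elim by simp
    have n3: "real n * ln 4 + 4 * ln n \<le> \<gamma> * (4/5 * ln n) * n"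
    proof -
      have "ln (real n) \<le> n" using ln_bound[of "real n"] elim by simp
      then have "real n * ln 4 + 4 * ln n \<le> n * (ln 4 + 4)" by (simp add: algebra_simps)
      also have "\<dots> \<le> n * (\<gamma> * (4/5) * ln n)"
        using elim(2) g0 by (intro mult_left_mono) (auto simp: divide_le_eq mult_ac)
      finally show ?thesis by (simp add: mult_ac)
    qed
    show ?case
    proof (intro allI impI)
      fix m assume m: "m \<le> card (all_edges n)" and d: "4/5 * ln (real n) \<le> dens n m * n"
      define x where "x = 1 / real n ^ 3"
      define y where "y = exp (- (real n * ln 4 + 4 * ln n))"
      let ?V = "{..<n}"
      let ?P = "Pow ?V - {{}}"
      let ?B = "\<lambda>S T xs. b * (dens n m * n) * max (card S) (card T) < \<bar>ecount (Gnm xs m) S T - dens n m * (real (card S) * card T)\<bar>"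
      have "pr (all_edges n) (disc_bad b n m) \<le> pr (all_edges n) (\<lambda>xs. \<exists>z\<in>?P \<times> ?P. ?B (fst z) (snd z) xs)"
      proof (rule pr_mono)
        fix xs assume "disc_bad b n m xs"
        then obtain S T where ST: "S \<subseteq> ?V" "T \<subseteq> ?V" "?B S T xs" unfolding disc_bad_def by blast
        have "S \<noteq> {} \<and> T \<noteq> {}"
        proof (rule ccontr)
          assume "\<not> (S \<noteq> {} \<and> T \<noteq> {})"
          then have z: "ecount (Gnm xs m) S T - dens n m * (real (card S) * card T) = 0" by (auto simp: ecount_def)
          have "0 \<le> b * (dens n m * n) * max (card S) (card T)" using b dens_nonneg[of n m] by simp
          then show False using ST(3) unfolding z by simp
        qed
        then show "\<exists>z\<in>?P \<times> ?P. ?B (fst z) (snd z) xs" using ST by (intro bexI[of _ "(S, T)"]) auto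
      qed
      also have "\<dots> \<le> (\<Sum>z\<in>?P \<times> ?P. pr (all_edges n) (?B (fst z) (snd z)))" by (intro pr_union) auto
      also have "\<dots> \<le> (\<Sum>z\<in>?P \<times> ?P. 2 * (x ^ card (fst z) * x ^ card (snd z)) + 2 * y)"
        unfolding x_def y_def
        by (intro sum_mono pair_term_bound[OF b, folded l2_def t0_def l1_def, folded l1_def t0_def \<gamma>_def] elim n3 d m) auto
      also have "\<dots> = 2 * (\<Sum>z\<in>?P \<times> ?P. x ^ card (fst z) * x ^ card (snd z)) + card (?P \<times> ?P) * (2 * y)"
        by (simp add: sum.distrib sum_distrib_left)
      also have "(\<Sum>z\<in>?P \<times> ?P. x ^ card (fst z) * x ^ card (snd z)) = (\<Sum>S\<in>?P. x ^ card S) * (\<Sum>S\<in>?P. x ^ card S)"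
        unfolding sum_product by (simp add: sum.cartesian_product case_prod_unfold)
      also have "(\<Sum>S\<in>?P. x ^ card S) = (1 + x) ^ n - 1"
      proof -
        have "(\<Sum>S\<in>Pow ?V. x ^ card S) = (\<Sum>S\<in>?P. x ^ card S) + (\<Sum>S\<in>{{}}. x ^ card S)"
          using sum.subset_diff[of "{{}}" "Pow ?V" "\<lambda>S. x ^ card S"] by simp
        then show ?thesis using sum_Pow_power[of ?V x] by simp
      qed
      also have "2 * (((1 + x) ^ n - 1) * ((1 + x) ^ n - 1)) \<le> 2 * ((2 * (n * x)) * (2 * (n * x)))"
      proof -
        have x0: "0 \<le> x" by (simp add: x_def)
        have nx: "n * x = 1 / real n ^ 2" using elim by (simp add: x_def power2_eq_square power3_eq_cube)
        then have "n * x \<le> 1" using elim by (simp add: divide_le_eq)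
        then have "(1 + x) ^ n - 1 \<le> 2 * (n * x)" using x0 by (intro power_minus_1_le) auto
        moreover have "0 \<le> (1 + x) ^ n - 1" using x0 by (simp add: one_le_power)
        ultimately show ?thesis by (intro mult_left_mono mult_mono) auto
      qed
      also have "card (?P \<times> ?P) * (2 * y) \<le> 4 ^ n * (2 * y)"
      proof -
        have "card ?P \<le> 2 ^ n" using card_mono[of "Pow ?V" ?P] by (simp add: card_Pow)
        then have "card (?P \<times> ?P) \<le> 2 ^ n * 2 ^ n" by (simp add: card_cartesian_product mult_le_mono)
        also have "\<dots> = 4 ^ n" using power_mult_distrib[of 2 "2::nat" n] by simp
        finally have "real (card (?P \<times> ?P)) \<le> 4 ^ n" by (metis of_nat_le_iff of_nat_numeral of_nat_power)
        then show ?thesis by (intro mult_right_mono) (auto simp: y_def)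
      qed
      also have "4 ^ n * (2 * y) = 2 / real n ^ 4"
      proof -
        have "exp (real n * ln 4 + 4 * ln n) = exp (real n * ln 4) * exp (real (4::nat) * ln n)" by (simp add: exp_add)
        also have "\<dots> = 4 ^ n * real n ^ 4" using elim by (simp only: exp_of_nat_mult) simp
        finally have "y = inverse (4 ^ n * real n ^ 4)" by (simp only: y_def exp_minus)
        then show ?thesis using elim by (simp add: field_simps)
      qed
      also have "2 * ((2 * (n * x)) * (2 * (n * x))) = 8 / real n ^ 4"
        using elim by (simp add: x_def field_simps power2_eq_square power4_eq_xxxx power3_eq_cube)
      finally show "pr (all_edges n) (disc_bad b n m) \<le> 10 / real n ^ 4" by simp
    qed
  qed
qed

section \<open>Degree bounds and the resulting spectral estimate\<close>

definition deg :: "nat \<Rightarrow> nat set set \<Rightarrow> nat \<Rightarrow> real" where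
  "deg n G u = (\<Sum>v<n. adj G u v)"

lemma deg_eq_wt: "u < n \<Longrightarrow> deg n (Gnm xs m) u = wt (all_edges n) (pcount {u} {..<n}) m xs"
  using ecount_eq_wt[of "{u}" n "{..<n}" xs m] by (simp add: ecount_def deg_def)

lemma deg_mean:
  assumes "u < n"
  shows "dens n m * (\<Sum>e\<in>all_edges n. pcount {u} {..<n} e) \<le> dens n m * n"
    and "2 \<le> n \<Longrightarrow> dens n m * n / 2 \<le> dens n m * (\<Sum>e\<in>all_edges n. pcount {u} {..<n} e)"
proof -
  have s: "(\<Sum>e\<in>all_edges n. pcount {u} {..<n} e) \<le> n" "real n - 1 \<le> (\<Sum>e\<in>all_edges n. pcount {u} {..<n} e)"
    using sum_pcount_bounds[of "{u}" n "{..<n}"] assms by auto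
  show "dens n m * (\<Sum>e\<in>all_edges n. pcount {u} {..<n} e) \<le> dens n m * n" by (intro mult_left_mono s dens_nonneg)
  assume "2 \<le> n"
  then have "real n / 2 \<le> (\<Sum>e\<in>all_edges n. pcount {u} {..<n} e)" using s(2) by simp
  from mult_left_mono[OF this dens_nonneg[of n m]]
  show "dens n m * n / 2 \<le> dens n m * (\<Sum>e\<in>all_edges n. pcount {u} {..<n} e)" by simp
qed

lemma exp_neg_ln_le:
  assumes "2 \<le> n" "k * ln (real n) \<le> x"
  shows "exp (- x) \<le> 1 / real n powr k"
proof -
  have "exp (- x) \<le> exp (- (k * ln n))" using assms by simp
  also have "\<dots> = 1 / real n powr k" using assms by (simp add: powr_def exp_minus inverse_eq_divide)
  finally show ?thesis .
qed

text \<open>With \<open>l = 1\<close> the second order term is at most \<open>18 * d\<close>, so a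
  deviation of \<open>39 * d\<close> leaves an exponent beyond \<open>5 * d\<close>, and
  \<open>5 * (4/5) = 4\<close> is the required power of \<open>n\<close>.\<close>

lemma deg_upper_prob:
  assumes "u < n" "2 \<le> n" "m \<le> card (all_edges n)" "4/5 * ln (real n) \<le> dens n m * n"
  shows "pr (all_edges n) (\<lambda>xs. 40 * (dens n m * n) < deg n (Gnm xs m) u) \<le> 1 / real n ^ 4"
proof -
  define d where "d = dens n m * n"
  define \<mu> where "\<mu> = dens n m * (\<Sum>e\<in>all_edges n. pcount {u} {..<n} e)"
  have mu: "\<mu> \<le> d" using deg_mean(1)[OF assms(1)] by (simp add: \<mu>_def d_def)
  have mu0: "0 \<le> \<mu>" unfolding \<mu>_def by (intro mult_nonneg_nonneg dens_nonneg sum_nonneg pcount_bounds)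
  have "pr (all_edges n) (\<lambda>xs. 40 * d < deg n (Gnm xs m) u) \<le> pr (all_edges n) (\<lambda>xs. \<mu> + 39 * d \<le> wt (all_edges n) (pcount {u} {..<n}) m xs)"
    using mu by (intro pr_mono) (simp add: deg_eq_wt[OF assms(1)])
  also have "\<dots> \<le> exp (2 * \<mu> * (1\<^sup>2 * exp (2 * 1)) - 1 * (39 * d))"
    using weight_tails(1)[where c = "pcount {u} {..<n}" and l = 1 and a = "39 * d", OF finite_all_edges assms(3) pcount_bounds(1) pcount_bounds(2)]
    unfolding dens_def[symmetric] \<mu>_def[symmetric] by simp
  also have "\<dots> \<le> exp (- (5 * d))"
  proof -
    have "exp (2::real) = exp 1 * exp 1" by (simp add: exp_add[symmetric])
    also have "\<dots> \<le> 3 * 3" using exp_le by (intro mult_mono) auto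
    finally have "2 * \<mu> * exp 2 \<le> 2 * d * 9" using mu mu0 by (intro mult_mono) auto
    moreover have "0 \<le> d" using mu mu0 by simp
    ultimately have "2 * \<mu> * (1\<^sup>2 * exp (2 * 1)) - 1 * (39 * d) \<le> - (5 * d)" by simp
    then show ?thesis by simp
  qed
  also have "\<dots> \<le> 1 / real n powr 4" using assms by (intro exp_neg_ln_le) (auto simp: d_def)
  finally show ?thesis using assms(2) by (simp add: d_def powr_numeral)
qed

text \<open>The mean is only known to be at least \<open>d / 2\<close>, which leaves a deviation of
  \<open>d / 4\<close>. With \<open>l = 1/32\<close> the exponent is at least
  \<open>d / 500\<close>, so a mean degree of \<open>2000 * ln n\<close> is required; this explains
  the factor 1000 in the upper threshold for the number of edges.\<close>

lemma deg_lower_prob: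
  assumes "u < n" "2 \<le> n" "m \<le> card (all_edges n)" "2000 * ln (real n) \<le> dens n m * n"
  shows "pr (all_edges n) (\<lambda>xs. deg n (Gnm xs m) u \<le> dens n m * n / 4) \<le> 1 / real n ^ 4"
proof -
  define d where "d = dens n m * n"
  define \<mu> where "\<mu> = dens n m * (\<Sum>e\<in>all_edges n. pcount {u} {..<n} e)"
  have mu: "\<mu> \<le> d" "d / 2 \<le> \<mu>" using deg_mean[OF assms(1)] assms(2) by (auto simp: \<mu>_def d_def)
  have d0: "0 \<le> d" unfolding d_def by (simp add: dens_nonneg)
  have "pr (all_edges n) (\<lambda>xs. deg n (Gnm xs m) u \<le> d / 4) \<le> pr (all_edges n) (\<lambda>xs. wt (all_edges n) (pcount {u} {..<n}) m xs \<le> \<mu> - d / 4)"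
    using mu by (intro pr_mono) (simp add: deg_eq_wt[OF assms(1)])
  also have "\<dots> \<le> exp (2 * \<mu> * ((1/32)\<^sup>2 * exp (2 * (1/32))) - 1/32 * (d / 4))"
    using weight_tails(2)[where c = "pcount {u} {..<n}" and l = "1/32" and a = "d / 4", OF finite_all_edges assms(3) pcount_bounds(1) pcount_bounds(2)]
    unfolding dens_def[symmetric] \<mu>_def[symmetric] by simp
  also have "\<dots> \<le> exp (- (d / 500))"
  proof -
    have "exp (1/16::real) \<le> 1 + 1/16 + (1/16)\<^sup>2" by (rule exp_bound) auto
    then have "exp (1/16::real) \<le> 5/4" by (simp add: power2_eq_square)
    then have "2 * \<mu> * ((1/32)\<^sup>2 * exp (2 * (1/32))) \<le> 2 * d * ((1/32)\<^sup>2 * (5/4))" using mu d0 by (intro mult_mono mult_left_mono) auto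
    also have "\<dots> \<le> 1/32 * (d / 4) - d / 500" using d0 by (simp add: power2_eq_square)
    finally show ?thesis by simp
  qed
  also have "\<dots> \<le> 1 / real n powr 4" using assms by (intro exp_neg_ln_le) (auto simp: d_def)
  finally show ?thesis using assms(2) by (simp add: d_def powr_numeral)
qed

text \<open>One bound on a block sum is proportional to the larger cardinality, by discrepancy, and
  another to the smaller one, by degrees. Multiplying them yields the geometric mean with the small
  constant \<open>sqrt (41 * b)\<close>. Here 41 = 40 + 1 adds the contribution of the constant part
  \<open>p\<close>.\<close>

lemma operator_norm_of_discrepancy:
  assumes good: "\<not> disc_bad b n m xs" and dg: "\<And>u. u < n \<Longrightarrow> deg n (Gnm xs m) u \<le> 40 * (dens n m * n)"
    and b: "0 < b" and r: "16 * ((2 * real r + 1) * sqrt (41 * b) + 82 / 2 ^ r) \<le> \<epsilon>"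
  shows "(\<Sum>u<n. (\<Sum>v<n. (adj (Gnm xs m) u v - dens n m) * y v)\<^sup>2) \<le> (\<epsilon> * (dens n m * n))\<^sup>2 * (\<Sum>v<n. (y v)\<^sup>2)"
proof -
  define d where "d = dens n m * n"
  define P where "P = (\<lambda>u v. adj (Gnm xs m) u v - dens n m)"
  have d0: "0 \<le> d" by (simp add: d_def dens_nonneg)
  have sumP: "(\<Sum>u\<in>S. \<Sum>v\<in>T. P u v) = ecount (Gnm xs m) S T - dens n m * (real (card S) * card T)" for S T
    by (simp add: P_def ecount_def sum_subtractf)
  have fin: "finite S" "card S \<le> n" if "S \<subseteq> {..<n}" for S using that finite_subset card_mono[OF _ that] by auto
  have ec0: "0 \<le> ecount (Gnm xs m) S T" for S T unfolding ecount_def by (intro sum_nonneg) auto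
  have ec1: "ecount (Gnm xs m) S T \<le> 40 * d * card S" if "S \<subseteq> {..<n}" "T \<subseteq> {..<n}" for S T
  proof -
    have "ecount (Gnm xs m) S T \<le> (\<Sum>u\<in>S. deg n (Gnm xs m) u)"
      unfolding ecount_def deg_def using that by (intro sum_mono sum_mono2) auto
    also have "\<dots> \<le> (\<Sum>u\<in>S. 40 * d)" using that dg by (intro sum_mono) (auto simp: d_def)
    finally show ?thesis by (simp add: mult.commute)
  qed
  have ecs: "ecount (Gnm xs m) S T = ecount (Gnm xs m) T S" for S T
    unfolding ecount_def by (subst sum.swap) (intro sum.cong refl adj_sym)
  have c2: "\<bar>\<Sum>u\<in>S. \<Sum>v\<in>T. P u v\<bar> \<le> 41 * d * card S" if ST: "S \<subseteq> {..<n}" "T \<subseteq> {..<n}" for S T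
  proof -
    have "dens n m * (real (card S) * card T) \<le> dens n m * (real (card S) * n)"
      using fin[OF ST(2)] dens_nonneg[of n m] by (intro mult_left_mono) auto
    then have 1: "dens n m * (real (card S) * card T) \<le> d * card S" by (simp add: d_def mult_ac)
    have 2: "0 \<le> dens n m * (real (card S) * card T)" using dens_nonneg[of n m] by simp
    have 3: "0 \<le> d * card S" using d0 by simp
    have "\<bar>\<Sum>u\<in>S. \<Sum>v\<in>T. P u v\<bar> \<le> 40 * d * card S + d * card S"
      unfolding sumP using ec1[OF ST] ec0[of S T] 1 2 3 by linarith
    then show ?thesis by (simp add: algebra_simps)
  qed
  have c2': "\<bar>\<Sum>u\<in>S. \<Sum>v\<in>T. P u v\<bar> \<le> 41 * d * card T" if ST: "S \<subseteq> {..<n}" "T \<subseteq> {..<n}" for S T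
    using c2[OF ST(2,1)] unfolding sumP ecs[of T S] by (simp add: mult.commute)
  have c1: "\<bar>\<Sum>u\<in>S. \<Sum>v\<in>T. P u v\<bar> \<le> sqrt (41 * b) * d * sqrt (real (card S) * card T)" if ST: "S \<subseteq> {..<n}" "T \<subseteq> {..<n}" for S T
  proof -
    define z where "z = \<bar>\<Sum>u\<in>S. \<Sum>v\<in>T. P u v\<bar>"
    have a1: "z \<le> b * d * max (card S) (card T)"
      using good ST unfolding disc_bad_def z_def sumP d_def by (auto simp: not_less)
    have a2: "z \<le> 41 * d * min (card S) (card T)"
      using c2[OF ST] c2'[OF ST] unfolding z_def by (cases "card S \<le> card T") auto
    have z0: "0 \<le> z" by (simp add: z_def)
    have "z * z \<le> (b * d * max (card S) (card T)) * (41 * d * min (card S) (card T))"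
      using a1 a2 z0 b d0 by (intro mult_mono) auto
    also have "\<dots> = (41 * b) * (d * d) * (real (card S) * card T)" by (cases "card S \<le> card T") auto
    also have "\<dots> = (sqrt (41 * b) * d * sqrt (real (card S) * card T))\<^sup>2"
      using b by (simp add: power_mult_distrib) (simp add: power2_eq_square)
    finally have "z\<^sup>2 \<le> (sqrt (41 * b) * d * sqrt (real (card S) * card T))\<^sup>2" by (simp add: power2_eq_square)
    then show ?thesis unfolding z_def[symmetric] using b d0 by (intro power2_le_imp_le[of z]) auto
  qed
  have "16 * ((2 * real r + 1) * (sqrt (41 * b) * d) + 2 * (41 * d) / 2 ^ r) = 16 * ((2 * real r + 1) * sqrt (41 * b) + 82 / 2 ^ r) * d"
    by (simp add: algebra_simps)
  also have "\<dots> \<le> \<epsilon> * d" using r d0 by (intro mult_right_mono)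
  finally show ?thesis
    unfolding d_def[symmetric] using operator_norm_bound[of "{..<n}" P "sqrt (41 * b) * d" "41 * d" r "\<epsilon> * d" y] c1 c2 c2' b d0
    by (simp add: P_def)
qed

section \<open>Vertices of low degree\<close>

definition cnt :: "'a set \<Rightarrow> nat \<Rightarrow> 'a list \<Rightarrow> real" where
  "cnt S m xs = card (S \<inter> set (take m xs))"

lemma cnt_ins:
  assumes "finite S" "y \<notin> S" "i \<le> length ys"
  shows "cnt S (m - 1) ys \<le> cnt S m (ins y i ys)"
proof -
  have "set (take (m - 1) ys) \<subseteq> set (take m ys)" by (rule set_take_subset_set_take) simp
  then have "set (take (m - 1) ys) \<subseteq> set (take m (ins y i ys))" unfolding set_take_ins[OF assms(3)] by auto
  then show ?thesis unfolding cnt_def using assms(1) by (intro of_nat_mono card_mono) auto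
qed

text \<open>The elements of \<open>R\<close> are removed one at a time. Each lies early with
  probability at most \<open>M / (card A - card R)\<close>, and its removal shifts the counted
  prefix by at most one place, whence \<open>m - card R\<close>. This decouples the connecting edges
  from the edges that determine the degrees.\<close>

lemma pr_contain_and_few:
  assumes "finite R"
  shows "finite A \<Longrightarrow> R \<subseteq> A \<Longrightarrow> S \<subseteq> A \<Longrightarrow> R \<inter> S = {} \<Longrightarrow> M + card R \<le> card A \<Longrightarrow> 0 < card A - card R \<Longrightarrow>
    pr A (\<lambda>xs. R \<subseteq> set (take M xs) \<and> cnt S m xs \<le> x)
      \<le> (real M / real (card A - card R)) ^ card R * pr (A - R) (\<lambda>ys. cnt S (m - card R) ys \<le> x)"
  using assms
proof (induction R arbitrary: A m rule: finite_induct)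
  case empty
  then show ?case by simp
next
  case (insert y R)
  have finS: "finite S" using insert.prems finite_subset by blast
  have yA: "y \<in> A" and yS: "y \<notin> S" using insert.prems by auto
  have cA: "card (A - {y}) = card A - 1" using yA insert.prems by simp
  have cR: "card (insert y R) = card R + 1" using insert.hyps by simp
  define q where "q = real M / real (card A - card (insert y R))"
  have q0: "0 \<le> q" by (simp add: q_def)
  have "pr A (\<lambda>xs. insert y R \<subseteq> set (take M xs) \<and> cnt S m xs \<le> x)
      \<le> pr A (\<lambda>xs. y \<in> set (take M xs) \<and> (R \<subseteq> set (take M xs) \<and> cnt S m xs \<le> x))"
    by (intro pr_mono) auto
  also have "\<dots> \<le> real M / card A * pr (A - {y}) (\<lambda>ys. R \<subseteq> set (take M ys) \<and> cnt S (m - 1) ys \<le> x)"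
  proof (rule pr_placed_early)
    show "finite A" "y \<in> A" "M \<le> card A" using insert.prems yA by auto
    fix i ys assume i: "i < M" and ys: "ys \<in> perms (A - {y})" and Q: "R \<subseteq> set (take M (ins y i ys)) \<and> cnt S m (ins y i ys) \<le> x"
    have il: "i \<le> length ys" using perms_length[of A y ys i] insert.prems yA ys i by simp
    have "R \<subseteq> insert y (set (take (M - 1) ys))" using Q i unfolding set_take_ins[OF il] by simp
    then have "R \<subseteq> set (take (M - 1) ys)" using insert.hyps by auto
    also have "\<dots> \<subseteq> set (take M ys)" by (rule set_take_subset_set_take) simp
    finally show "R \<subseteq> set (take M ys) \<and> cnt S (m - 1) ys \<le> x" using Q cnt_ins[OF finS yS il, of m] by auto
  qed
  also have "\<dots> \<le> q * (q ^ card R * pr (A - insert y R) (\<lambda>ys. cnt S (m - card (insert y R)) ys \<le> x))"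
  proof (intro mult_mono)
    show "real M / card A \<le> q" unfolding q_def using insert.prems by (intro divide_left_mono) auto
    have "pr (A - {y}) (\<lambda>ys. R \<subseteq> set (take M ys) \<and> cnt S (m - 1) ys \<le> x)
      \<le> (real M / real (card (A - {y}) - card R)) ^ card R * pr (A - {y} - R) (\<lambda>ys. cnt S (m - 1 - card R) ys \<le> x)"
      using insert.prems insert.hyps by (intro insert.IH) (auto simp: cA)
    also have "real M / real (card (A - {y}) - card R) = q" unfolding q_def cA cR by (simp add: diff_diff_eq add.commute)
    also have "A - {y} - R = A - insert y R" by auto
    also have "m - 1 - card R = m - card (insert y R)" unfolding cR by simp
    finally show "pr (A - {y}) (\<lambda>ys. R \<subseteq> set (take M ys) \<and> cnt S (m - 1) ys \<le> x)
      \<le> q ^ card R * pr (A - insert y R) (\<lambda>ys. cnt S (m - card (insert y R)) ys \<le> x)" .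
  qed (use q0 in \<open>auto intro: pr_nonneg\<close>)
  finally show ?case unfolding q_def[symmetric] by (simp add: cR mult.assoc)
qed

lemma pr_few:
  assumes A: "finite A" "m \<le> card A" "S \<subseteq> A" and l: "0 \<le> l"
  shows "pr A (\<lambda>xs. cnt S m xs \<le> x) \<le> exp (l * x - real m / card A * (card S * (1 - exp (- l))))"
proof -
  have finS: "finite S" using A finite_subset by blast
  have "cnt S m xs = wt A (\<lambda>e. of_bool (e \<in> S)) m xs" for xs
  proof -
    have "wt A (\<lambda>e. of_bool (e \<in> S)) m xs = (\<Sum>e\<in>S \<inter> set (take m xs). 1)"
      unfolding wt_def using A by (intro sum.mono_neutral_cong_right) auto
    then show ?thesis by (simp add: cnt_def)
  qed
  moreover have "(\<Sum>e\<in>A. 1 - exp (- l * of_bool (e \<in> S))) = card S * (1 - exp (- l))"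
  proof -
    have "(\<Sum>e\<in>A. 1 - exp (- l * of_bool (e \<in> S))) = (\<Sum>e\<in>S. 1 - exp (- l))"
      using A by (intro sum.mono_neutral_cong_right) auto
    then show ?thesis by simp
  qed
  ultimately show ?thesis using tail_lower[of A m "\<lambda>e. of_bool (e \<in> S)" l x] A l by simp
qed

text \<open>The process becomes connected at about \<open>1/2 n ln n\<close> edges, between the following two thresholds.
  Beyond the second one all degrees are comparable to their mean.\<close>

definition m_low :: "nat \<Rightarrow> nat" where "m_low n = nat \<lceil>2/5 * (real n * ln n)\<rceil>"

definition m_high :: "nat \<Rightarrow> nat" where "m_high n = nat \<lceil>1000 * (real n * ln n)\<rceil>"

lemma m_low_bounds:
  assumes "1 \<le> n"
  shows "2/5 * (real n * ln n) \<le> m_low n" "m_low n \<le> 2/5 * (real n * ln n) + 1"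
proof -
  have "0 \<le> 2/5 * (real n * ln n)" using assms by simp
  then show "2/5 * (real n * ln n) \<le> m_low n" "m_low n \<le> 2/5 * (real n * ln n) + 1"
    unfolding m_low_def by linarith+
qed

lemma m_high_bounds:
  assumes "1 \<le> n"
  shows "1000 * (real n * ln n) \<le> m_high n" "m_high n \<le> 1000 * (real n * ln n) + 1"
proof -
  have "0 \<le> 1000 * (real n * ln n)" using assms by simp
  then show "1000 * (real n * ln n) \<le> m_high n" "m_high n \<le> 1000 * (real n * ln n) + 1"
    unfolding m_high_def by linarith+
qed

lemma eventually_sizes:
  "\<forall>\<^sub>F n in sequentially. m_high n + 2 < card (all_edges n) \<and> m_low n + 2 < card (all_edges n) \<and> 2 \<le> m_low n \<and> m_low n \<le> m_high n"
proof -
  have "\<forall>\<^sub>F n::nat in sequentially. 1000 * (real n * ln n) + 3 < real n * (real n - 1) / 2" by real_asymp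
  moreover have "\<forall>\<^sub>F n::nat in sequentially. 2 \<le> 2/5 * (real n * ln n)" by real_asymp
  moreover have "\<forall>\<^sub>F n::nat in sequentially. 2/5 * (real n * ln n) + 1 \<le> 1000 * (real n * ln n)" by real_asymp
  ultimately show ?thesis using eventually_ge_at_top[of 1]
  proof eventually_elim
    case (elim n)
    note b = m_low_bounds[OF elim(4)] m_high_bounds[OF elim(4)]
    have "real (m_high n) + 2 < card (all_edges n)" unfolding real_card_all_edges using b elim by linarith
    moreover have "real (m_low n) \<le> real (m_high n)" "2 \<le> real (m_low n)" using b elim by linarith+
    ultimately show ?case by linarith
  qed
qed

text \<open>Two stars have nearly \<open>2 * n\<close> edges, of which about
  \<open>8/5 * ln n\<close> are expected among the first \<open>m_low n\<close>. The tail bound with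
  \<open>l = ln 10\<close> has exponent \<open>9/10 * 8/5 = 1.44\<close> times \<open>ln n\<close>,
  minus at most \<open>3/50 * ln n\<close> for the threshold, which exceeds 13/10. The set
  \<open>A\<close> and the number \<open>r\<close> allow for up to two edges removed
  beforehand.\<close>

lemma few_close_exponent:
  "\<forall>\<^sub>F n in sequentially. \<forall>A r S. A \<subseteq> all_edges n \<longrightarrow> card (all_edges n) \<le> card A + 2 \<longrightarrow> r \<le> 2 \<longrightarrow> S \<subseteq> A \<longrightarrow> 2 * real n - 6 \<le> card S \<longrightarrow>
     pr A (\<lambda>ys. cnt S (m_low n - r) ys \<le> ln n / 50) \<le> real n powr - (13/10)"
proof -
  have "\<forall>\<^sub>F n::nat in sequentially. 13/10 * ln n + 3 * (ln n / 50) \<le> (2/5 * (real n * ln n) - 2) / (real n * (real n - 1) / 2) * ((2 * real n - 6) * (9/10))"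
    by real_asymp
  then show ?thesis using eventually_sizes eventually_ge_at_top[of 4]
  proof (eventually_elim, intro allI impI)
    fix n A r S
    assume ev: "13/10 * ln (real n) + 3 * (ln (real n) / 50) \<le> (2/5 * (real n * ln n) - 2) / (real n * (real n - 1) / 2) * ((2 * real n - 6) * (9/10))"
      and sz: "m_high n + 2 < card (all_edges n) \<and> m_low n + 2 < card (all_edges n) \<and> 2 \<le> m_low n \<and> m_low n \<le> m_high n" and n: "4 \<le> n"
      and A: "A \<subseteq> all_edges n" "card (all_edges n) \<le> card A + 2" and r: "r \<le> (2::nat)" and S: "S \<subseteq> A" "2 * real n - 6 \<le> card S"
    have finA: "finite A" using A finite_subset finite_all_edges by blast
    have cA: "card A \<le> card (all_edges n)" using A by (intro card_mono) auto
    have cA0: "0 < card A" using sz A by linarith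
    have ln0: "0 \<le> ln (real n)" using n by simp
    have "pr A (\<lambda>ys. cnt S (m_low n - r) ys \<le> ln n / 50)
       \<le> exp (ln 10 * (ln n / 50) - real (m_low n - r) / card A * (card S * (1 - exp (- ln 10))))"
      using finA S A sz r by (intro pr_few) auto
    also have "\<dots> \<le> exp (- (13/10) * ln n)"
    proof -
      have "ln (10::real) \<le> 3"
      proof -
        have "(10::real) \<le> (1 + 1.5) ^ 3" by (simp add: power3_eq_cube)
        also have "(1 + 1.5) ^ 3 \<le> exp (1::real) ^ 3" using e_less_272 exp_lower_Taylor_quadratic[of 1] by (intro power_mono) auto
        also have "\<dots> = exp 3" by (simp add: exp_of_nat_mult[symmetric])
        finally show ?thesis using ln_le_cancel_iff[of 10 "exp 3"] by simp
      qed
      then have "ln 10 * (ln n / 50) \<le> 3 * (ln n / 50)" using ln0 by (intro mult_right_mono) auto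
      moreover have "(2/5 * (real n * ln n) - 2) / (real n * (real n - 1) / 2) * ((2 * real n - 6) * (9/10))
          \<le> real (m_low n - r) / card A * (card S * (1 - exp (- ln 10)))"
      proof (intro mult_mono)
        have "(2/5 * (real n * ln n) - 2) / (real n * (real n - 1) / 2) \<le> real (m_low n - r) / (real n * (real n - 1) / 2)"
          using m_low_bounds[of n] n r sz by (intro divide_right_mono) (auto simp: of_nat_diff)
        also have "\<dots> \<le> real (m_low n - r) / card A"
          using cA cA0 unfolding real_card_all_edges[symmetric] by (intro divide_left_mono) auto
        finally show "(2/5 * (real n * ln n) - 2) / (real n * (real n - 1) / 2) \<le> real (m_low n - r) / card A" .
        show "2 * real n - 6 \<le> card S" by (rule S)
      qed (use n in \<open>auto simp: exp_minus\<close>)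
      ultimately have "ln 10 * (ln n / 50) - real (m_low n - r) / card A * (card S * (1 - exp (- ln 10))) \<le> - (13/10) * ln n"
        using ev by linarith
      then show ?thesis by simp
    qed
    also have "\<dots> = real n powr - (13/10)" using n by (simp add: powr_def)
    finally show "pr A (\<lambda>ys. cnt S (m_low n - r) ys \<le> ln n / 50) \<le> real n powr - (13/10)" .
  qed
qed

definition low_degree :: "nat \<Rightarrow> nat set list \<Rightarrow> nat \<Rightarrow> bool" where
  "low_degree n xs u \<longleftrightarrow> deg n (Gnm xs (m_low n)) u \<le> ln n / 100"

text \<open>Degrees are measured at the lower threshold and adjacency at the upper one. Degrees and
  edge sets both grow with \<open>m\<close>, so excluding this single event handles all values of
  \<open>m\<close> in between.\<close>

definition close_low :: "nat \<Rightarrow> nat set list \<Rightarrow> bool" where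
  "close_low n xs \<longleftrightarrow> (\<exists>u<n. \<exists>v<n. u \<noteq> v \<and> low_degree n xs u \<and> low_degree n xs v \<and>
     ({u, v} \<in> Gnm xs (m_high n) \<or>
      (\<exists>w<n. w \<noteq> u \<and> w \<noteq> v \<and> {u, w} \<in> Gnm xs (m_high n) \<and> {v, w} \<in> Gnm xs (m_high n))))"

text \<open>Edges to \<open>u\<close>, \<open>v\<close> and \<open>w\<close> are excluded, so the
  spokes are disjoint from the one or two edges that connect \<open>u\<close> and \<open>v\<close>,
  and the two stars are disjoint from each other.\<close>

definition spokes :: "nat \<Rightarrow> nat \<Rightarrow> nat \<Rightarrow> nat \<Rightarrow> nat set set" where
  "spokes n u v w = (\<lambda>x. {u, x}) ` ({..<n} - {u, v, w}) \<union> (\<lambda>x. {v, x}) ` ({..<n} - {u, v, w})"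

lemma spokes_subset: "u < n \<Longrightarrow> v < n \<Longrightarrow> spokes n u v w \<subseteq> all_edges n"
  unfolding spokes_def all_edges_def by blast

lemma card_spokes:
  assumes "u \<noteq> v"
  shows "2 * real n - 6 \<le> card (spokes n u v w)"
proof -
  let ?W = "{..<n} - {u, v, w}"
  have "n \<le> card ?W + 3"
  proof -
    have "card {u, v, w} \<le> 3" by (simp add: card_insert_if)
    moreover have "n - card {u, v, w} \<le> card ?W" using diff_card_le_card_Diff[of "{u, v, w}" "{..<n}"] by simp
    ultimately show ?thesis by linarith
  qed
  moreover have "card (spokes n u v w) = card ?W + card ?W"
  proof -
    have i: "inj_on (\<lambda>x. {a, x}) ?W" for a by (auto simp: inj_on_def doubleton_eq_iff)
    have "card (spokes n u v w) = card ((\<lambda>x. {u, x}) ` ?W) + card ((\<lambda>x. {v, x}) ` ?W)"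
      unfolding spokes_def using assms by (intro card_Un_disjoint) (auto simp: doubleton_eq_iff)
    then show ?thesis unfolding card_image[OF i] .
  qed
  ultimately show ?thesis by simp
qed

lemma card_spoke_le_deg:
  assumes "W \<subseteq> {..<n}" "u \<notin> W"
  shows "card ((\<lambda>x. {u, x}) ` W \<inter> G) \<le> deg n G u"
proof -
  have finW: "finite W" using assms finite_subset by blast
  have "(\<lambda>x. {u, x}) ` W \<inter> G = (\<lambda>x. {u, x}) ` {x\<in>W. {u, x} \<in> G}" by auto
  then have "card ((\<lambda>x. {u, x}) ` W \<inter> G) \<le> card {x\<in>W. {u, x} \<in> G}" using finW by (simp add: card_image_le)
  also have "real (card {x\<in>W. {u, x} \<in> G}) = (\<Sum>x\<in>{x\<in>W. {u, x} \<in> G}. 1)" by simp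
  also have "\<dots> = (\<Sum>x\<in>{x\<in>W. {u, x} \<in> G}. adj G u x)" using assms by (intro sum.cong) (auto simp: adj_def)
  also have "\<dots> \<le> deg n G u" unfolding deg_def using assms by (intro sum_mono2) auto
  finally show ?thesis by simp
qed

lemma cnt_spokes_le:
  assumes "low_degree n xs u" "low_degree n xs v"
  shows "cnt (spokes n u v w) (m_low n) xs \<le> ln n / 50"
proof -
  let ?W = "{..<n} - {u, v, w}"
  let ?G = "Gnm xs (m_low n)"
  have "spokes n u v w \<inter> ?G = ((\<lambda>x. {u, x}) ` ?W \<inter> ?G) \<union> ((\<lambda>x. {v, x}) ` ?W \<inter> ?G)" by (auto simp: spokes_def)
  then have "card (spokes n u v w \<inter> ?G) \<le> card ((\<lambda>x. {u, x}) ` ?W \<inter> ?G) + card ((\<lambda>x. {v, x}) ` ?W \<inter> ?G)"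
    by (simp only: card_Un_le)
  then have "cnt (spokes n u v w) (m_low n) xs \<le> real (card ((\<lambda>x. {u, x}) ` ?W \<inter> ?G)) + card ((\<lambda>x. {v, x}) ` ?W \<inter> ?G)"
    unfolding cnt_def Gnm_def[symmetric] by linarith
  then show ?thesis
    using card_spoke_le_deg[of ?W n u ?G] card_spoke_le_deg[of ?W n v ?G] assms unfolding low_degree_def by auto
qed

text \<open>An edge is present at the upper threshold with probability of order
  \<open>ln n / n\<close>. There are at most \<open>n^2\<close> pairs needing one edge and
  \<open>n^3\<close> triples needing two, so each family contributes \<open>n\<close> times a power
  of \<open>ln n\<close>; the factor \<open>n powr - (13/10)\<close> makes both vanish.\<close>

lemma close_low_prob: "(\<lambda>n. pr (all_edges n) (close_low n)) \<longlonglongrightarrow> 0"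
proof (rule tendsto_sandwich[of "\<lambda>_. 0"])
  define q where "q = (\<lambda>n. (1000 * (real n * ln n) + 1) / (real n * (real n - 1) / 2 - 2))"
  define g where "g = (\<lambda>n::nat. real n ^ 2 * (q n * real n powr - (13/10)) + real n ^ 3 * (q n ^ 2 * real n powr - (13/10)))"
  show "g \<longlonglongrightarrow> 0" unfolding g_def q_def by real_asymp
  show "\<forall>\<^sub>F n in sequentially. 0 \<le> pr (all_edges n) (close_low n)" by (simp add: pr_nonneg)
  have "\<forall>\<^sub>F n::nat in sequentially. 0 < real n * (real n - 1) / 2 - 2" by real_asymp
  with few_close_exponent eventually_sizes eventually_ge_at_top[of 4]
  show "\<forall>\<^sub>F n in sequentially. pr (all_edges n) (close_low n) \<le> g n"
  proof eventually_elim
    case (elim n)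
    let ?A = "all_edges n"
    let ?G = "\<lambda>xs. set (take (m_high n) xs)"
    define I where "I = {(u, v). u < n \<and> v < n \<and> u \<noteq> v}"
    define J where "J = {(u, v, w). u < n \<and> v < n \<and> w < n \<and> u \<noteq> v \<and> w \<noteq> u \<and> w \<noteq> v}"
    have IJ: "finite I" "finite J" "real (card I) \<le> real n ^ 2" "real (card J) \<le> real n ^ 3"
    proof -
      have I: "I \<subseteq> {..<n} \<times> {..<n}" by (auto simp: I_def)
      have J: "J \<subseteq> {..<n} \<times> {..<n} \<times> {..<n}" by (auto simp: J_def)
      show "finite I" "finite J" using finite_subset[OF I] finite_subset[OF J] by auto
      have "card I \<le> n * n" using card_mono[OF _ I] by simp
      then have "real (card I) \<le> real (n * n)" by (rule of_nat_mono)
      then show "real (card I) \<le> real n ^ 2" by (simp add: power2_eq_square)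
      have "card J \<le> n * (n * n)" using card_mono[OF _ J] by simp
      then have "real (card J) \<le> real (n * (n * n))" by (rule of_nat_mono)
      then show "real (card J) \<le> real n ^ 3" by (simp add: power3_eq_cube)
    qed
    have q0: "0 \<le> q n" using elim by (simp add: q_def)
    have bound: "pr ?A (\<lambda>xs. R \<subseteq> ?G xs \<and> cnt (spokes n u v w) (m_low n) xs \<le> ln n / 50) \<le> q n ^ card R * real n powr - (13/10)"
      if R: "R \<subseteq> ?A" "finite R" "card R \<le> 2" "R \<inter> spokes n u v w = {}" and uv: "u < n" "v < n" "u \<noteq> v" for R u v w
    proof -
      have cAR: "card (?A - R) = card ?A - card R" using R by (intro card_Diff_subset) auto
      have "pr ?A (\<lambda>xs. R \<subseteq> ?G xs \<and> cnt (spokes n u v w) (m_low n) xs \<le> ln n / 50)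
        \<le> (real (m_high n) / real (card ?A - card R)) ^ card R * pr (?A - R) (\<lambda>ys. cnt (spokes n u v w) (m_low n - card R) ys \<le> ln n / 50)"
        using R elim(2) spokes_subset[OF uv(1,2)] by (intro pr_contain_and_few) auto
      also have "\<dots> \<le> q n ^ card R * real n powr - (13/10)"
      proof (intro mult_mono power_mono)
        have "real (m_high n) / real (card ?A - card R) \<le> (1000 * (real n * ln n) + 1) / real (card ?A - card R)"
          using m_high_bounds(2)[of n] elim(3) by (intro divide_right_mono) auto
        also have "\<dots> \<le> q n" unfolding q_def
        proof (intro divide_left_mono)
          show "real n * (real n - 1) / 2 - 2 \<le> real (card ?A - card R)"
            unfolding real_card_all_edges[symmetric] using elim(2) R by (simp add: of_nat_diff)
          then show "0 < real (card ?A - card R) * (real n * (real n - 1) / 2 - 2)" using elim(4) by (intro mult_pos_pos) auto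
        qed (use elim(3) in auto)
        finally show "real (m_high n) / real (card ?A - card R) \<le> q n" .
        show "pr (?A - R) (\<lambda>ys. cnt (spokes n u v w) (m_low n - card R) ys \<le> ln n / 50) \<le> real n powr - (13/10)"
          using R spokes_subset[OF uv(1,2), of w] card_spokes[OF uv(3), of n w]
          by (intro elim(1)[rule_format]) (auto simp: cAR)
      qed (use q0 in \<open>auto intro: pr_nonneg\<close>)
      finally show ?thesis .
    qed
    define E1 where "E1 = (\<lambda>z xs. {{fst z, snd z}} \<subseteq> ?G xs \<and> cnt (spokes n (fst z) (snd z) (snd z)) (m_low n) xs \<le> ln n / 50)"
    define E2 where "E2 = (\<lambda>(u, v, w) xs. {{u, w}, {v, w}} \<subseteq> ?G xs \<and> cnt (spokes n u v w) (m_low n) xs \<le> ln n / 50)"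
    have "pr ?A (close_low n) \<le> pr ?A (\<lambda>xs. (\<exists>z\<in>I. E1 z xs) \<or> (\<exists>z\<in>J. E2 z xs))"
    proof (rule pr_mono)
      fix xs assume "close_low n xs"
      then obtain u v where uv: "u < n" "v < n" "u \<noteq> v" "low_degree n xs u" "low_degree n xs v"
        and h: "{u, v} \<in> ?G xs \<or> (\<exists>w<n. w \<noteq> u \<and> w \<noteq> v \<and> {u, w} \<in> ?G xs \<and> {v, w} \<in> ?G xs)"
        unfolding close_low_def Gnm_def by blast
      from h show "(\<exists>z\<in>I. E1 z xs) \<or> (\<exists>z\<in>J. E2 z xs)"
      proof
        assume "{u, v} \<in> ?G xs"
        then have "E1 (u, v) xs" using cnt_spokes_le[OF uv(4,5)] by (simp add: E1_def)
        moreover have "(u, v) \<in> I" using uv by (simp add: I_def)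
        ultimately show ?thesis by blast
      next
        assume "\<exists>w<n. w \<noteq> u \<and> w \<noteq> v \<and> {u, w} \<in> ?G xs \<and> {v, w} \<in> ?G xs"
        then obtain w where w: "w < n" "w \<noteq> u" "w \<noteq> v" "{u, w} \<in> ?G xs" "{v, w} \<in> ?G xs" by blast
        then have "E2 (u, v, w) xs" using cnt_spokes_le[OF uv(4,5)] by (simp add: E2_def)
        moreover have "(u, v, w) \<in> J" using uv w by (simp add: J_def)
        ultimately show ?thesis by blast
      qed
    qed
    also have "\<dots> \<le> pr ?A (\<lambda>xs. \<exists>z\<in>I. E1 z xs) + pr ?A (\<lambda>xs. \<exists>z\<in>J. E2 z xs)" by (rule pr_or)
    also have "\<dots> \<le> (\<Sum>z\<in>I. pr ?A (E1 z)) + (\<Sum>z\<in>J. pr ?A (E2 z))" using IJ by (intro add_mono pr_union)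
    also have "\<dots> \<le> (\<Sum>z\<in>I. q n * real n powr - (13/10)) + (\<Sum>z\<in>J. q n ^ 2 * real n powr - (13/10))"
    proof (intro add_mono sum_mono)
      fix z assume "z \<in> I"
      then obtain u v where z: "z = (u, v)" "u < n" "v < n" "u \<noteq> v" by (auto simp: I_def)
      have d: "{{u, v}} \<inter> spokes n u v v = {}" by (auto simp: spokes_def doubleton_eq_iff)
      have s: "{{u, v}} \<subseteq> ?A" using z by (auto simp: all_edges_def)
      show "pr ?A (E1 z) \<le> q n * real n powr - (13/10)"
        using bound[OF s _ _ d z(2,3,4)] by (simp add: E1_def z(1))
    next
      fix z assume "z \<in> J"
      then obtain u v w where z: "z = (u, v, w)" "u < n" "v < n" "w < n" "u \<noteq> v" "w \<noteq> u" "w \<noteq> v" by (auto simp: J_def)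
      have d: "{{u, w}, {v, w}} \<inter> spokes n u v w = {}" using z by (auto simp: spokes_def doubleton_eq_iff)
      have s: "{{u, w}, {v, w}} \<subseteq> ?A" using z by (auto simp: all_edges_def)
      have c: "card {{u, w}, {v, w}} = 2" using z by (simp add: doubleton_eq_iff)
      show "pr ?A (E2 z) \<le> q n ^ 2 * real n powr - (13/10)"
        using bound[OF s _ _ d z(2,3,5)] unfolding E2_def z(1) prod.case c by simp
    qed
    also have "\<dots> \<le> g n" unfolding g_def sum_constant using IJ q0 by (intro add_mono mult_right_mono) auto
    finally show ?case .
  qed
qed simp

section \<open>Isolated vertices\<close>

definition star :: "nat \<Rightarrow> nat \<Rightarrow> nat set set" where
  "star n u = {e \<in> all_edges n. u \<in> e}"

lemma star_subset: "star n u \<subseteq> all_edges n" by (auto simp: star_def)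

lemma star_eq:
  assumes "u < n"
  shows "star n u = (\<lambda>x. {u, x}) ` ({..<n} - {u})"
proof (intro equalityI subsetI)
  fix e assume "e \<in> star n u"
  then obtain a b where ab: "a < n" "b < n" "a \<noteq> b" "e = {a, b}" "u \<in> {a, b}" unfolding star_def all_edges_def by auto
  then consider "u = a" | "u = b" by blast
  then show "e \<in> (\<lambda>x. {u, x}) ` ({..<n} - {u})"
  proof cases
    case 1 then show ?thesis using ab by (intro image_eqI[of _ _ b]) auto
  next
    case 2 then show ?thesis using ab by (intro image_eqI[of _ _ a]) auto
  qed
next
  fix e assume "e \<in> (\<lambda>x. {u, x}) ` ({..<n} - {u})"
  then obtain x where x: "x < n" "x \<noteq> u" "e = {u, x}" by auto
  then have "e \<in> all_edges n" using assms unfolding all_edges_def by (intro CollectI exI[of _ u] exI[of _ x]) simp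
  then show "e \<in> star n u" using x unfolding star_def by simp
qed

lemma card_star:
  assumes "u < n"
  shows "card (star n u) = n - 1"
proof -
  have "inj_on (\<lambda>x. {u, x}) ({..<n} - {u})" by (auto simp: inj_on_def doubleton_eq_iff)
  then show ?thesis unfolding star_eq[OF assms] using assms by (simp add: card_image)
qed

lemma card_star_Un:
  assumes "u < n" "v < n" "u \<noteq> v"
  shows "card (star n u \<union> star n v) = 2 * n - 3"
proof -
  have fin: "finite (star n a)" for a using finite_subset[OF star_subset] by simp
  have "star n u \<inter> star n v = {{u, v}}" using assms by (auto simp: star_def all_edges_def)
  then have "card (star n u \<union> star n v) + 1 = (n - 1) + (n - 1)"
    using card_Un_Int[OF fin fin, of u v] card_star[OF assms(1)] card_star[OF assms(2)] by simp
  then show ?thesis using assms by linarith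
qed

lemma isolated_imp_not_connected:
  assumes "u < n" "2 \<le> n" "star n u \<inter> G = {}" "G \<subseteq> all_edges n"
  shows "\<not> graph_connected {..<n} G"
proof
  assume c: "graph_connected {..<n} G"
  obtain v where v: "v < n" "v \<noteq> u"
  proof (cases "u = 0")
    case True then show ?thesis using that[of 1] assms by auto
  next
    case False then show ?thesis using that[of 0] assms by auto
  qed
  have "(u, v) \<in> {(x, y). x \<noteq> y \<and> {x, y} \<in> G}\<^sup>*" using c assms v unfolding graph_connected_def by auto
  then have "\<exists>z. {u, z} \<in> G"
  proof (cases rule: converse_rtranclE)
    case base then show ?thesis using v by simp
  next
    case (step z) then show ?thesis by blast
  qed
  then obtain z where "{u, z} \<in> G" ..
  then show False using assms unfolding star_def by blast
qed

lemma falling_ratio_ge: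
  fixes N m n :: nat
  assumes "m + n \<le> N" "n < N"
  shows "(1 - real m / (real N - n)) ^ n \<le> (\<Prod>j<n. (real N - m - j) / (real N - j))"
proof -
  have "(\<Prod>j<n. 1 - real m / (real N - n)) \<le> (\<Prod>j<n. (real N - m - j) / (real N - j))"
  proof (intro prod_mono conjI)
    fix j assume j: "j \<in> {..<n}"
    have "real m / (real N - n) \<le> 1" using assms by (simp add: divide_le_eq)
    then show "0 \<le> 1 - real m / (real N - n)" by simp
    have "real m / (real N - j) \<le> real m / (real N - n)" using assms j by (intro divide_left_mono) auto
    moreover have "(real N - m - j) / (real N - j) = 1 - real m / (real N - j)" using assms j by (simp add: field_simps)
    ultimately show "1 - real m / (real N - n) \<le> (real N - m - j) / (real N - j)" by simp
  qed
  then show ?thesis by simp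
qed

text \<open>Chebyshev's inequality for the number of isolated vertices, whose mean grows roughly
  like \<open>n powr (1/5)\<close>. If none exists, the squared relative deviation is 1. Two stars
  share exactly one edge, so their union has \<open>2 * n - 3\<close> edges rather than
  \<open>2 * n - 2\<close>; the two events are thus nearly independent and the ratio of joint to
  product probability tends to 1.\<close>

lemma no_isolated_prob: "(\<lambda>n. pr (all_edges n) (\<lambda>xs. \<forall>u<n. star n u \<inter> set (take (m_low n) xs) \<noteq> {})) \<longlonglongrightarrow> 0"
proof (rule tendsto_sandwich[of "\<lambda>_. 0"])
  define a where "a = (\<lambda>n::nat. 2/5 * (real n * ln n))"
  define N where "N = (\<lambda>n::nat. real n * (real n - 1) / 2)"
  define s where "s = (\<lambda>n. 1 - (a n + 1) / (N n - real n))"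
  define q where "q = (\<lambda>n. 1 - a n / N n)"
  define g where "g = (\<lambda>n::nat. 1 / (real n * s n powr (real n - 1)) + q n powr (2 * real n - 3) / s n powr (2 * real n - 2) - 1)"
  show "g \<longlonglongrightarrow> 0"
  proof -
    have 1: "(\<lambda>n. 1 / (real n * s n powr (real n - 1))) \<longlonglongrightarrow> 0" unfolding s_def a_def N_def by real_asymp
    have 2: "(\<lambda>n. q n powr (2 * real n - 3) / s n powr (2 * real n - 2)) \<longlonglongrightarrow> 1" unfolding s_def q_def a_def N_def by real_asymp
    from tendsto_diff[OF tendsto_add[OF 1 2] tendsto_const[of 1]] show ?thesis by (simp add: g_def)
  qed
  show "\<forall>\<^sub>F n in sequentially. 0 \<le> pr (all_edges n) (\<lambda>xs. \<forall>u<n. star n u \<inter> set (take (m_low n) xs) \<noteq> {})" by (simp add: pr_nonneg)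
  have e1: "\<forall>\<^sub>F n in sequentially. a n + 1 + n < N n" unfolding a_def N_def by real_asymp
  have e2: "\<forall>\<^sub>F n in sequentially. 0 < s n" unfolding s_def a_def N_def by real_asymp
  show "\<forall>\<^sub>F n in sequentially. pr (all_edges n) (\<lambda>xs. \<forall>u<n. star n u \<inter> set (take (m_low n) xs) \<noteq> {}) \<le> g n"
    using e1 e2 eventually_ge_at_top[of 4]
  proof eventually_elim
    case (elim n)
    let ?A = "all_edges n"
    define m where "m = m_low n"
    define I where "I = (\<lambda>u xs. of_bool (star n u \<inter> set (take m xs) = {}) :: real)"
    define P1 where "P1 = (\<Prod>j<n - 1. (real (card ?A) - m - j) / (real (card ?A) - j))"
    define P2 where "P2 = q n ^ (2 * n - 3)"
    have mb: "a n \<le> m" "m \<le> a n + 1" using m_low_bounds[of n] elim by (auto simp: a_def m_def)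
    have cA: "real (card ?A) = N n" by (simp add: real_card_all_edges N_def)
    have a0: "0 \<le> a n" using elim by (simp add: a_def)
    have "real m + n < real (card ?A)" unfolding cA using mb elim by linarith
    then have mn: "m + n < card ?A" by linarith
    have m1: "m \<le> card ?A" using mn by simp
    have P1_eq: "avg ?A (I u) = P1" if "u < n" for u
      unfolding I_def P1_def using avg_avoid[of "star n u" ?A m] m1 star_subset[of n u] finite_subset[OF star_subset[of n u]] card_star[OF that] by simp
    have P2_le: "avg ?A (\<lambda>xs. I u xs * I v xs) \<le> P2" if "u < n" "v < n" "u \<noteq> v" for u v
    proof -
      have "avg ?A (\<lambda>xs. I u xs * I v xs) = avg ?A (\<lambda>xs. of_bool ((star n u \<union> star n v) \<inter> set (take m xs) = {}))"
        unfolding I_def by (intro avg_cong) auto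
      also have "\<dots> \<le> (1 - real m / card ?A) ^ card (star n u \<union> star n v)"
        using m1 star_subset by (intro avg_avoid_le) auto
      also have "\<dots> \<le> P2" unfolding P2_def card_star_Un[OF that] q_def cA
        using mb m1 elim by (intro power_mono) (auto simp: divide_right_mono cA[symmetric])
      finally show ?thesis .
    qed
    have P1_ge: "s n ^ (n - 1) \<le> P1"
    proof -
      have "s n \<le> 1 - real m / (real (card ?A) - real (n - 1))"
      proof -
        have "real m / (real (card ?A) - real (n - 1)) \<le> (a n + 1) / (real (card ?A) - real (n - 1))"
          using mb mn by (intro divide_right_mono) auto
        also have "\<dots> \<le> (a n + 1) / (N n - real n)"
          using mn a0 elim unfolding cA[symmetric] by (intro divide_left_mono mult_pos_pos) auto
        finally show ?thesis by (simp add: s_def)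
      qed
      then have "s n ^ (n - 1) \<le> (1 - real m / (real (card ?A) - real (n - 1))) ^ (n - 1)" using elim by (intro power_mono) auto
      also have "\<dots> \<le> P1" unfolding P1_def using mn by (intro falling_ratio_ge) auto
      finally show ?thesis .
    qed
    have s0: "0 < s n ^ (n - 1)" using elim by simp
    have P10: "0 < P1" using s0 P1_ge by linarith
    define \<mu> where "\<mu> = real n * P1"
    have mu0: "0 < \<mu>" using P10 elim by (simp add: \<mu>_def)
    have "pr ?A (\<lambda>xs. \<forall>u<n. star n u \<inter> set (take (m_low n) xs) \<noteq> {}) \<le> avg ?A (\<lambda>xs. ((\<Sum>u<n. I u xs) / \<mu> - 1)\<^sup>2)"
    proof (rule pr_markov)
      fix xs assume "\<forall>u<n. star n u \<inter> set (take (m_low n) xs) \<noteq> {}"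
      then have "(\<Sum>u<n. I u xs) = 0" by (intro sum.neutral) (auto simp: I_def m_def)
      then show "1 \<le> ((\<Sum>u<n. I u xs) / \<mu> - 1)\<^sup>2" by simp
    qed simp
    also have "\<dots> = avg ?A (\<lambda>xs. \<Sum>u<n. \<Sum>v<n. I u xs * I v xs) / \<mu>\<^sup>2 - 2 * avg ?A (\<lambda>xs. \<Sum>u<n. I u xs) / \<mu> + 1"
    proof -
      have e: "((\<Sum>u<n. I u xs) / \<mu> - 1)\<^sup>2 = (1 / \<mu>\<^sup>2) * (\<Sum>u<n. \<Sum>v<n. I u xs * I v xs) + (- 2 / \<mu>) * (\<Sum>u<n. I u xs) + 1" for xs
        unfolding sum_product[symmetric] using mu0 by (simp add: power2_eq_square field_simps)
      have add: "avg ?A (\<lambda>xs. f xs + h xs) = avg ?A f + avg ?A h" for f h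
        unfolding avg_def by (simp add: sum.distrib add_divide_distrib)
      show ?thesis unfolding e add avg_cmult avg_const[OF finite_all_edges] by simp
    qed
    also have "avg ?A (\<lambda>xs. \<Sum>u<n. I u xs) = \<mu>" unfolding avg_sum by (simp add: P1_eq \<mu>_def)
    also have "avg ?A (\<lambda>xs. \<Sum>u<n. \<Sum>v<n. I u xs * I v xs) / \<mu>\<^sup>2 \<le> (\<mu> + real n * (real n * P2)) / \<mu>\<^sup>2"
    proof (intro divide_right_mono)
      have "avg ?A (\<lambda>xs. \<Sum>u<n. \<Sum>v<n. I u xs * I v xs) = (\<Sum>u<n. \<Sum>v<n. avg ?A (\<lambda>xs. I u xs * I v xs))"
        unfolding avg_sum ..
      also have "\<dots> \<le> (\<Sum>u<n. \<Sum>v<n. (if v = u then P1 else 0) + P2)"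
      proof (intro sum_mono)
        fix u v assume uv: "u \<in> {..<n}" "v \<in> {..<n}"
        have P20: "0 \<le> P2" unfolding P2_def q_def using a0 elim by (intro zero_le_power) (simp add: divide_le_eq)
        show "avg ?A (\<lambda>xs. I u xs * I v xs) \<le> (if v = u then P1 else 0) + P2"
        proof (cases "v = u")
          case True
          have "(\<lambda>xs. I u xs * I u xs) = I u" by (rule ext) (simp add: I_def)
          then show ?thesis using True P1_eq uv P20 by simp
        next
          case False then show ?thesis using P2_le uv by auto
        qed
      qed
      also have "\<dots> = \<mu> + real n * (real n * P2)" by (simp add: sum.distrib \<mu>_def distrib_left)
      finally show "avg ?A (\<lambda>xs. \<Sum>u<n. \<Sum>v<n. I u xs * I v xs) \<le> \<mu> + real n * (real n * P2)" .
    qed simp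
    also have "(\<mu> + real n * (real n * P2)) / \<mu>\<^sup>2 - 2 * \<mu> / \<mu> + 1 = 1 / \<mu> + P2 / P1\<^sup>2 - 1"
    proof -
      have "real n \<noteq> 0" "P1 \<noteq> 0" using elim P10 by auto
      then have "(real n * P1 + real n * (real n * P2)) / (real n * P1)\<^sup>2 = 1 / (real n * P1) + P2 / P1\<^sup>2"
        by (simp add: add_divide_distrib power2_eq_square)
      moreover have "2 * \<mu> / \<mu> = 2" using mu0 by simp
      ultimately show ?thesis unfolding \<mu>_def by linarith
    qed
    also have "\<dots> \<le> 1 / (real n * s n ^ (n - 1)) + P2 / (s n ^ (n - 1))\<^sup>2 - 1"
    proof -
      have "1 / \<mu> \<le> 1 / (real n * s n ^ (n - 1))"
        unfolding \<mu>_def using P1_ge s0 P10 elim by (intro divide_left_mono mult_left_mono mult_pos_pos) auto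
      moreover have "P2 / P1\<^sup>2 \<le> P2 / (s n ^ (n - 1))\<^sup>2"
      proof (intro divide_left_mono)
        show "(s n ^ (n - 1))\<^sup>2 \<le> P1\<^sup>2" using P1_ge s0 by (intro power_mono) auto
        show "0 \<le> P2" unfolding P2_def q_def using a0 elim by (intro zero_le_power) (simp add: divide_le_eq)
        show "0 < P1\<^sup>2 * (s n ^ (n - 1))\<^sup>2" using zero_less_power[OF P10, of 2] zero_less_power[OF s0, of 2] by (rule mult_pos_pos)
      qed
      ultimately show ?thesis by linarith
    qed
    also have "\<dots> = g n"
    proof -
      have q0: "0 < q n" unfolding q_def using a0 elim by (simp add: divide_less_eq)
      have n1: "real (n - 1) = real n - 1" "real (2 * n - 3) = 2 * real n - 3" using elim by (auto simp: of_nat_diff)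
      have "s n powr (real n - 1) = s n ^ (n - 1)" using powr_realpow[of "s n" "n - 1"] elim n1 by simp
      moreover have "q n powr (2 * real n - 3) = P2" unfolding P2_def using powr_realpow[OF q0, of "2 * n - 3"] n1 by simp
      moreover have "s n powr (2 * real n - 2) = (s n ^ (n - 1))\<^sup>2"
      proof -
        have "(s n ^ (n - 1))\<^sup>2 = s n ^ (2 * (n - 1))" by (simp add: power_mult[symmetric] mult.commute)
        also have "\<dots> = s n powr (real (2 * (n - 1)))" using powr_realpow[of "s n" "2 * (n - 1)"] elim by simp
        also have "real (2 * (n - 1)) = 2 * real n - 2" using n1 by simp
        finally show ?thesis by simp
      qed
      ultimately show ?thesis by (simp add: g_def)
    qed
    finally show ?case by simp
  qed
qed simp

section \<open>Global synchronization from the connectivity threshold on\<close>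

lemma Gnm_mono: "m \<le> m' \<Longrightarrow> Gnm xs m \<subseteq> Gnm xs m'"
  unfolding Gnm_def by (rule set_take_subset_set_take)

lemma adj_mono: "G \<subseteq> G' \<Longrightarrow> adj G u v \<le> adj G' u v"
  by (auto simp: adj_def)

lemma deg_mono: "G \<subseteq> G' \<Longrightarrow> deg n G u \<le> deg n G' u"
  unfolding deg_def by (intro sum_mono adj_mono)

lemma graph_connected_mono:
  assumes "G \<subseteq> G'" "graph_connected V G"
  shows "graph_connected V G'"
proof -
  have "{(x, y). x \<noteq> y \<and> {x, y} \<in> G}\<^sup>* \<subseteq> {(x, y). x \<noteq> y \<and> {x, y} \<in> G'}\<^sup>*"
    using assms(1) by (intro rtrancl_mono) auto
  then show ?thesis using assms(2) unfolding graph_connected_def by (meson subsetD)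
qed

lemma graph_connected_all_edges: "graph_connected {..<n} (all_edges n)"
  unfolding graph_connected_def
proof (intro ballI)
  fix u v assume uv: "u \<in> {..<n}" "v \<in> {..<n}"
  show "(u, v) \<in> {(x, y). x \<noteq> y \<and> {x, y} \<in> all_edges n}\<^sup>*"
  proof (cases "u = v")
    case False
    then have "{u, v} \<in> all_edges n" using uv unfolding all_edges_def by (intro CollectI exI[of _ u] exI[of _ v]) simp
    then show ?thesis using False by (intro r_into_rtrancl) simp
  qed simp
qed

lemma connected_imp_deg_ge_1:
  assumes "u < n" "2 \<le> n" "G \<subseteq> all_edges n" "graph_connected {..<n} G"
  shows "1 \<le> deg n G u"
proof -
  have "star n u \<inter> G \<noteq> {}" using isolated_imp_not_connected[OF assms(1,2) _ assms(3)] assms(4) by blast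
  then obtain e where "e \<in> star n u" "e \<in> G" by blast
  then obtain x where x: "x < n" "x \<noteq> u" "{u, x} \<in> G" unfolding star_eq[OF assms(1)] by auto
  have "1 = adj G u x" using x by (simp add: adj_def)
  also have "\<dots> \<le> deg n G u" unfolding deg_def using x by (intro member_le_sum) auto
  finally show ?thesis .
qed

context
  fixes n :: nat and xs :: "nat set list"
  assumes xs: "xs \<in> perms (all_edges n)"
begin

lemma Gnm_subset: "Gnm xs m \<subseteq> all_edges n"
  using xs set_take_subset[of m xs] by (auto simp: Gnm_def permutations_of_set_def)

lemma Gnm_min: "Gnm xs m = Gnm xs (min m (card (all_edges n)))"
proof -
  have "length xs = card (all_edges n)" using length_finite_permutations_of_set[OF xs] .
  then show ?thesis unfolding Gnm_def by (cases "m \<le> length xs") auto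
qed

text \<open>The set of \<open>m\<close> in the definition of the hitting time is nonempty, because
  the full list of edges gives the complete graph; connectivity then persists as edges are
  added.\<close>

lemma connected_conn_time:
  assumes "conn_time n xs \<le> m"
  shows "graph_connected {..<n} (Gnm xs m)"
proof -
  have "Gnm xs (card (all_edges n)) = all_edges n"
    using xs length_finite_permutations_of_set[OF xs] by (simp add: Gnm_def permutations_of_set_def)
  then have "graph_connected {..<n} (Gnm xs (card (all_edges n)))" using graph_connected_all_edges by simp
  then have "graph_connected {..<n} (Gnm xs (conn_time n xs))" unfolding conn_time_def by (rule LeastI)
  then show ?thesis using graph_connected_mono[OF Gnm_mono[OF assms]] by blast
qed

text \<open>The exceptional set consists of the vertices of degree below \<open>c\<close> times the
  mean. If it is nonempty then \<open>m\<close> is at most the upper threshold, so its vertices have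
  low degree at the lower threshold and any edge or path of length 2 between them would already be
  one at the upper threshold. Connectivity supplies degree at least 1.\<close>

lemma sync_of_good_graph:
  assumes n: "2 \<le> n" and m: "0 < m" and c: "0 < c" and eps: "200 * \<epsilon>\<^sup>2 < c\<^sup>2" "0 \<le> \<epsilon>" "\<epsilon> \<le> 1/10"
    and r: "16 * ((2 * real r + 1) * sqrt (41 * b) + 82 / 2 ^ r) \<le> \<epsilon>" and b: "0 < b"
    and disc: "\<not> disc_bad b n m xs" and dg: "\<And>u. u < n \<Longrightarrow> deg n (Gnm xs m) u \<le> 40 * (dens n m * n)"
    and conn: "graph_connected {..<n} (Gnm xs m)"
    and low: "\<And>u. u < n \<Longrightarrow> deg n (Gnm xs m) u < c * (dens n m * n) \<Longrightarrow> m \<le> m_high n \<and> low_degree n xs u"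
    and far: "\<not> close_low n xs"
  shows "globally_synchronizing {..<n} (Gnm xs m)"
proof (rule globally_synchronizing_if_no_spurious_equilibria)
  fix \<phi> assume st: "stable_critical {..<n} (Gnm xs m) \<phi>"
  define L where "L = {u. u < n \<and> deg n (Gnm xs m) u < c * (dens n m * n)}"
  have sub: "Gnm xs m \<subseteq> Gnm xs (m_high n)" if "u \<in> L" for u
    using low[of u] that by (intro Gnm_mono) (auto simp: L_def)
  have Llow: "u < n" "low_degree n xs u" if "u \<in> L" for u using low[of u] that by (auto simp: L_def)
  have no_edge: "{u, v} \<notin> Gnm xs m" if uv: "u \<in> L" "v \<in> L" "u \<noteq> v" for u v
    using far sub[OF uv(1)] Llow[OF uv(1)] Llow[OF uv(2)] uv(3) unfolding close_low_def by blast
  have no_path: False if uv: "u \<in> L" "v \<in> L" "u \<noteq> v" and w: "w < n" "w \<noteq> u" "w \<noteq> v" "{u, w} \<in> Gnm xs m" "{v, w} \<in> Gnm xs m" for u v w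
    using far sub[OF uv(1)] Llow[OF uv(1)] Llow[OF uv(2)] uv(3) w unfolding close_low_def by blast
  have N0: "0 < card (all_edges n)"
  proof -
    have "0 < real (card (all_edges n))" unfolding real_card_all_edges using n by simp
    then show ?thesis by simp
  qed
  show "fully_synchronized {..<n} \<phi>"
  proof (rule stable_critical_imp_synchronized[where p = "dens n m" and \<epsilon> = \<epsilon> and c = c and L = L and E = "Gnm xs m"])
    show "(\<Sum>u<n. (\<Sum>v<n. (adj (Gnm xs m) u v - dens n m) * y v)\<^sup>2) \<le> (\<epsilon> * (dens n m * n))\<^sup>2 * (\<Sum>v<n. (y v)\<^sup>2)" for y
      by (rule operator_norm_of_discrepancy[OF disc dg b r])
    show "0 < dens n m" using m N0 by (simp add: dens_def)
    show "c * (dens n m * n) \<le> (\<Sum>v<n. adj (Gnm xs m) u v)" if "u < n" "u \<notin> L" for u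
      using that by (auto simp: L_def deg_def)
    show "1 \<le> (\<Sum>v<n. adj (Gnm xs m) u v)" if "u \<in> L" for u
      using connected_imp_deg_ge_1[OF Llow(1)[OF that] n Gnm_subset conn] by (simp add: deg_def)
    show "adj (Gnm xs m) u v = 0" if "u \<in> L" "v \<in> L" for u v
      using no_edge[OF that] by (auto simp: adj_def)
    show "(\<Sum>u\<in>L. adj (Gnm xs m) u v) \<le> 1" if v: "v < n" for v
    proof -
      let ?K = "{u\<in>L. {u, v} \<in> Gnm xs m \<and> u \<noteq> v}"
      have finL: "finite L" by (auto simp: L_def)
      have "(\<Sum>u\<in>L. adj (Gnm xs m) u v) = (\<Sum>u\<in>?K. 1)"
        using finL by (intro sum.mono_neutral_cong_right) (auto simp: adj_def)
      moreover have "card ?K \<le> Suc 0"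
      proof (subst card_le_Suc0_iff_eq)
        show "\<forall>u\<in>?K. \<forall>u'\<in>?K. u = u'"
        proof (intro ballI, rule ccontr)
          fix u u' assume "u \<in> ?K" "u' \<in> ?K" "u \<noteq> u'"
          then show False using no_path[of u u' v] v by blast
        qed
      qed (use finL in simp)
      ultimately show ?thesis by simp
    qed
  qed (use n c eps st in \<open>auto simp: L_def\<close>)
qed

end

definition irregular :: "real \<Rightarrow> nat \<Rightarrow> nat \<Rightarrow> nat set list \<Rightarrow> bool" where
  "irregular b n m xs \<longleftrightarrow> disc_bad b n m xs \<or> (\<exists>u\<in>{..<n}. 40 * (dens n m * n) < deg n (Gnm xs m) u)
     \<or> (\<exists>u\<in>{..<n}. m_high n \<le> m \<and> deg n (Gnm xs m) u \<le> dens n m * n / 4)"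

lemma mean_degree_eq: "2 \<le> n \<Longrightarrow> dens n m * n = 2 * real m / (real n - 1)"
  unfolding dens_def real_card_all_edges by (simp add: field_simps)

lemma mean_degree_ge:
  assumes "2 \<le> n" "k * (real n * ln n) \<le> m" "0 \<le> k"
  shows "2 * k * ln n \<le> dens n m * n"
proof -
  have "2 * k * ln n * (real n - 1) \<le> 2 * k * ln n * real n" using assms by (intro mult_left_mono) auto
  also have "\<dots> \<le> 2 * m" using assms(2) by (simp add: mult_ac)
  finally show ?thesis unfolding mean_degree_eq[OF assms(1)] using assms by (simp add: le_divide_eq)
qed

text \<open>Each \<open>m\<close> fails with probability at most \<open>12 / n^3\<close>:
  discrepancy costs \<open>10 / n^4\<close> and the degree bounds cost \<open>2 / n^4\<close> per
  vertex. At most \<open>n^2\<close> values of \<open>m\<close> occur, so the union bound still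
  tends to 0.\<close>

lemma irregular_prob:
  assumes b: "0 < b" "b \<le> 1"
  shows "(\<lambda>n. pr (all_edges n) (\<lambda>xs. \<exists>m\<in>{m_low n..card (all_edges n)}. irregular b n m xs)) \<longlonglongrightarrow> 0"
proof (rule tendsto_sandwich[of "\<lambda>_. 0"])
  show "(\<lambda>n::nat. real n ^ 2 * (12 / real n ^ 3)) \<longlonglongrightarrow> 0" by real_asymp
  show "\<forall>\<^sub>F n in sequentially. 0 \<le> pr (all_edges n) (\<lambda>xs. \<exists>m\<in>{m_low n..card (all_edges n)}. irregular b n m xs)"
    by (simp add: pr_nonneg)
  show "\<forall>\<^sub>F n in sequentially. pr (all_edges n) (\<lambda>xs. \<exists>m\<in>{m_low n..card (all_edges n)}. irregular b n m xs) \<le> real n ^ 2 * (12 / real n ^ 3)"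
    using disc_bad_prob[OF b] eventually_sizes eventually_ge_at_top[of 2]
  proof eventually_elim
    case (elim n)
    let ?A = "all_edges n"
    have each: "pr ?A (irregular b n m) \<le> 12 / real n ^ 3" if m: "m_low n \<le> m" "m \<le> card ?A" for m
    proof -
      have "2/5 * (real n * ln n) \<le> m" using m_low_bounds(1)[of n] elim m by linarith
      then have d: "4/5 * ln (real n) \<le> dens n m * n" using mean_degree_ge[of n "2/5" m] elim by simp
      have hi: "pr ?A (\<lambda>xs. m_high n \<le> m \<and> deg n (Gnm xs m) u \<le> dens n m * n / 4) \<le> 1 / real n ^ 4" if u: "u < n" for u
      proof (cases "m_high n \<le> m")
        case True
        then have "1000 * (real n * ln n) \<le> m" using m_high_bounds(1)[of n] elim by linarith
        then have "2000 * ln n \<le> dens n m * n" using mean_degree_ge[of n 1000 m] elim by simp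
        then show ?thesis using deg_lower_prob[OF u _ m(2)] elim True by simp
      qed (simp add: pr_def avg_def)
      have "pr ?A (irregular b n m) \<le> pr ?A (disc_bad b n m) + pr ?A (\<lambda>xs. (\<exists>u\<in>{..<n}. 40 * (dens n m * n) < deg n (Gnm xs m) u)
         \<or> (\<exists>u\<in>{..<n}. m_high n \<le> m \<and> deg n (Gnm xs m) u \<le> dens n m * n / 4))"
        unfolding irregular_def by (rule pr_or)
      also have "\<dots> \<le> pr ?A (disc_bad b n m) + (pr ?A (\<lambda>xs. \<exists>u\<in>{..<n}. 40 * (dens n m * n) < deg n (Gnm xs m) u)
         + pr ?A (\<lambda>xs. \<exists>u\<in>{..<n}. m_high n \<le> m \<and> deg n (Gnm xs m) u \<le> dens n m * n / 4))"
        by (intro add_left_mono pr_or)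
      also have "\<dots> \<le> 10 / real n ^ 4 + ((\<Sum>u\<in>{..<n}. 1 / real n ^ 4) + (\<Sum>u\<in>{..<n}. 1 / real n ^ 4))"
      proof (intro add_mono)
        show "pr ?A (disc_bad b n m) \<le> 10 / real n ^ 4" using elim(1) m(2) d by simp
        show "pr ?A (\<lambda>xs. \<exists>u\<in>{..<n}. 40 * (dens n m * n) < deg n (Gnm xs m) u) \<le> (\<Sum>u\<in>{..<n}. 1 / real n ^ 4)"
          using deg_upper_prob[OF _ elim(3) m(2) d] by (intro order_trans[OF pr_union] sum_mono) auto
        show "pr ?A (\<lambda>xs. \<exists>u\<in>{..<n}. m_high n \<le> m \<and> deg n (Gnm xs m) u \<le> dens n m * n / 4) \<le> (\<Sum>u\<in>{..<n}. 1 / real n ^ 4)"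
          using hi by (intro order_trans[OF pr_union] sum_mono) auto
      qed
      also have "\<dots> = (10 + 2 * real n) / real n ^ 4" by (simp add: add_divide_distrib)
      also have "\<dots> \<le> (12 * real n) / real n ^ 4" using elim by (intro divide_right_mono) auto
      also have "\<dots> = 12 / real n ^ 3" using elim by (simp add: power_numeral_reduce)
      finally show ?thesis .
    qed
    have "pr ?A (\<lambda>xs. \<exists>m\<in>{m_low n..card ?A}. irregular b n m xs) \<le> (\<Sum>m\<in>{m_low n..card ?A}. 12 / real n ^ 3)"
      using each by (intro order_trans[OF pr_union] sum_mono) auto
    also have "\<dots> = real (card {m_low n..card ?A}) * (12 / real n ^ 3)" by simp
    also have "\<dots> \<le> real n ^ 2 * (12 / real n ^ 3)"
    proof (intro mult_right_mono)
      have "real (card {m_low n..card ?A}) \<le> card ?A" using elim by auto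
      also have "\<dots> \<le> real n ^ 2" unfolding real_card_all_edges using elim by (simp add: power2_eq_square field_simps)
      finally show "real (card {m_low n..card ?A}) \<le> real n ^ 2" .
    qed simp
    finally show ?case .
  qed
qed simp

text \<open>The cutoff \<open>r\<close> is fixed so that the far levels contribute at most half of
  \<open>\<epsilon>\<close>. Only afterwards is \<open>b = z^2 / 41\<close> made small in terms of
  \<open>r\<close>, with \<open>sqrt (41 * b) = z\<close>, to bound the near levels by the other
  half.\<close>

lemma discrepancy_parameters:
  assumes "0 < \<epsilon>" "\<epsilon> \<le> 1"
  obtains r :: nat and b :: real where "0 < b" "b \<le> 1" "16 * ((2 * real r + 1) * sqrt (41 * b) + 82 / 2 ^ r) \<le> \<epsilon>"
proof -
  obtain r where r: "16 * 82 * 2 / \<epsilon> < 2 ^ r" using real_arch_pow[of 2 "16 * 82 * 2 / \<epsilon>"] by auto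
  define z where "z = \<epsilon> / (32 * (2 * real r + 1))"
  have z: "0 < z" "z \<le> 1" using assms by (auto simp: z_def divide_le_eq)
  have sq: "sqrt (41 * (z\<^sup>2 / 41)) = z" using z by simp
  have "16 * (82 / 2 ^ r) \<le> \<epsilon> / 2" using r assms by (simp add: field_simps)
  moreover have "16 * ((2 * real r + 1) * z) = \<epsilon> / 2"
  proof -
    have "32 * (2 * real r + 1) * z = \<epsilon>" by (simp add: z_def add_nonneg_eq_0_iff)
    then show ?thesis by (simp only: mult.assoc)
  qed
  moreover have "16 * ((2 * real r + 1) * z + 82 / 2 ^ r) = 16 * ((2 * real r + 1) * z) + 16 * (82 / 2 ^ r)" by (rule distrib_left)
  ultimately have "16 * ((2 * real r + 1) * sqrt (41 * (z\<^sup>2 / 41)) + 82 / 2 ^ r) \<le> \<epsilon>" unfolding sq by simp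
  moreover have "z\<^sup>2 / 41 \<le> 1" using power_le_one[of z 2] z by simp
  ultimately show ?thesis using that[of "z\<^sup>2 / 41" r] z by simp
qed

lemma prob_ge_1_minus_pr:
  assumes "\<And>xs. xs \<in> perms (all_edges n) \<Longrightarrow> \<not> B xs \<Longrightarrow> xs \<in> X"
  shows "1 - pr (all_edges n) B \<le> measure_pmf.prob (random_graph_process n) X"
proof -
  let ?P = "perms (all_edges n)"
  have eo: "edge_orderings n = ?P" by (auto simp: edge_orderings_def permutations_of_set_def)
  have fin: "finite ?P" "?P \<noteq> {}" by auto
  have "measure_pmf.prob (random_graph_process n) (- X) = card (?P \<inter> - X) / card ?P"
    unfolding random_graph_process_def eo by (rule measure_pmf_of_set[OF fin(2,1)])
  also have "\<dots> \<le> card {xs\<in>?P. B xs} / card ?P"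
    using assms by (intro divide_right_mono of_nat_mono card_mono) auto
  also have "\<dots> = pr (all_edges n) B" unfolding pr_def avg_def by (simp add: of_bool_def sum.If_cases Int_def)
  finally show ?thesis using measure_pmf.prob_compl[of X "random_graph_process n"] by (simp add: Compl_eq_Diff_UNIV)
qed

theorem theorem1p3:
  shows "(\<lambda>n. measure_pmf.prob (random_graph_process n)
            {xs. \<forall>m\<ge>conn_time n xs. globally_synchronizing {..<n} (Gnm xs m)})
         \<longlonglongrightarrow> 1"
proof -
  \<comment> \<open>At the upper threshold the mean degree is about \<open>2000 * ln n\<close>, and
    \<open>c\<close> times this has to stay below the low degree bound \<open>ln n / 100\<close>.
    The choice \<open>\<epsilon> = c / 20\<close> then gives
    \<open>200 * \<epsilon>^2 = c^2 / 2\<close>.\<close>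
  define c :: real where "c = 1 / 10 ^ 6"
  define \<epsilon> where "\<epsilon> = c / 20"
  obtain r b where rb: "0 < b" "b \<le> 1" "16 * ((2 * real r + 1) * sqrt (41 * b) + 82 / 2 ^ r) \<le> \<epsilon>"
  proof (rule discrepancy_parameters)
    show "0 < \<epsilon>" "\<epsilon> \<le> 1" by (simp_all add: \<epsilon>_def c_def)
  qed
  define bad where "bad = (\<lambda>n xs. (\<exists>m\<in>{m_low n..card (all_edges n)}. irregular b n m xs) \<or> (close_low n xs \<or> (\<forall>u<n. star n u \<inter> set (take (m_low n) xs) \<noteq> {})))"
  define p where "p = (\<lambda>n. pr (all_edges n) (bad n))"
  have p0: "p \<longlonglongrightarrow> 0"
  proof (rule tendsto_sandwich[of "\<lambda>_. 0"])
    from tendsto_add[OF irregular_prob[OF rb(1,2)] tendsto_add[OF close_low_prob no_isolated_prob]]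
    show "(\<lambda>n. pr (all_edges n) (\<lambda>xs. \<exists>m\<in>{m_low n..card (all_edges n)}. irregular b n m xs)
       + (pr (all_edges n) (close_low n) + pr (all_edges n) (\<lambda>xs. \<forall>u<n. star n u \<inter> set (take (m_low n) xs) \<noteq> {}))) \<longlonglongrightarrow> 0" by simp
    show "\<forall>\<^sub>F n in sequentially. 0 \<le> p n" by (simp add: p_def pr_nonneg)
    have "p n \<le> pr (all_edges n) (\<lambda>xs. \<exists>m\<in>{m_low n..card (all_edges n)}. irregular b n m xs)
       + (pr (all_edges n) (close_low n) + pr (all_edges n) (\<lambda>xs. \<forall>u<n. star n u \<inter> set (take (m_low n) xs) \<noteq> {}))" for n
      unfolding p_def bad_def by (rule order_trans[OF pr_or add_left_mono[OF pr_or]])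
    then show "\<forall>\<^sub>F n in sequentially. p n \<le> pr (all_edges n) (\<lambda>xs. \<exists>m\<in>{m_low n..card (all_edges n)}. irregular b n m xs)
       + (pr (all_edges n) (close_low n) + pr (all_edges n) (\<lambda>xs. \<forall>u<n. star n u \<inter> set (take (m_low n) xs) \<noteq> {}))" by simp
  qed simp
  have "\<forall>\<^sub>F n::nat in sequentially. c * (2 * (1000 * (real n * ln n) + 1) / (real n - 1)) \<le> ln n / 100"
    unfolding c_def by real_asymp
  then have ev: "\<forall>\<^sub>F n in sequentially. 1 - p n \<le> measure_pmf.prob (random_graph_process n)
     {xs. \<forall>m\<ge>conn_time n xs. globally_synchronizing {..<n} (Gnm xs m)}"
    using eventually_sizes eventually_ge_at_top[of 2]
  proof eventually_elim
    case (elim n)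
    show ?case unfolding p_def
    proof (rule prob_ge_1_minus_pr, intro CollectI allI impI)
      fix xs k assume xs: "xs \<in> perms (all_edges n)" and good: "\<not> bad n xs" and k: "conn_time n xs \<le> k"
      \<comment> \<open>After the last edge the process stays at the complete graph, while the
        density and all probability estimates refer to \<open>m\<close> up to the total number of
        edges.\<close>
      define m where "m = min k (card (all_edges n))"
      have Gk: "Gnm xs k = Gnm xs m" unfolding m_def by (rule Gnm_min[OF xs])
      have conn: "graph_connected {..<n} (Gnm xs m)" using connected_conn_time[OF xs k] unfolding Gk .
      \<comment> \<open>An isolated vertex survives at the lower threshold, so the graph is still
        disconnected there and the hitting time is larger.\<close>
      have mlow: "m_low n \<le> m"
      proof (rule ccontr)
        assume "\<not> m_low n \<le> m"
        then have "graph_connected {..<n} (Gnm xs (m_low n))" using graph_connected_mono[OF Gnm_mono conn, of "m_low n"] by simp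
        moreover obtain u where "u < n" "star n u \<inter> Gnm xs (m_low n) = {}" using good unfolding bad_def Gnm_def by blast
        ultimately show False using isolated_imp_not_connected[OF _ elim(3) _ Gnm_subset[OF xs]] by blast
      qed
      have reg: "\<not> irregular b n m xs" using good mlow unfolding bad_def m_def by auto
      have low: "m \<le> m_high n \<and> low_degree n xs u" if u: "u < n" "deg n (Gnm xs m) u < c * (dens n m * n)" for u
      proof
        have d0: "0 \<le> dens n m * n" by (simp add: dens_nonneg)
        have "c * (dens n m * n) \<le> dens n m * n / 4" using d0 mult_right_mono[of c "1/4" "dens n m * n"] by (simp add: c_def)
        then have "\<not> m_high n \<le> m" using reg u unfolding irregular_def by force
        then show mh: "m \<le> m_high n" by simp
        have "deg n (Gnm xs (m_low n)) u \<le> deg n (Gnm xs m) u" by (intro deg_mono Gnm_mono mlow)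
        also have "\<dots> \<le> c * (2 * real m / (real n - 1))" using u unfolding mean_degree_eq[OF elim(3)] by simp
        also have "\<dots> \<le> c * (2 * (1000 * (real n * ln n) + 1) / (real n - 1))"
          using mh m_high_bounds(2)[of n] elim(3) by (intro mult_left_mono divide_right_mono) (auto simp: c_def)
        finally show "low_degree n xs u" using elim(1) unfolding low_degree_def by linarith
      qed
      have dg: "deg n (Gnm xs m) u \<le> 40 * (dens n m * n)" if "u < n" for u
        using reg that unfolding irregular_def by (auto simp: not_less)
      have eps: "200 * \<epsilon>\<^sup>2 < c\<^sup>2" "0 \<le> \<epsilon>" "\<epsilon> \<le> 1/10" "0 < c" by (auto simp: \<epsilon>_def c_def power2_eq_square)
      have m0: "0 < m" using mlow elim(2) by linarith
      have "\<not> disc_bad b n m xs" "\<not> close_low n xs" using reg good unfolding irregular_def bad_def by auto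
      then show "globally_synchronizing {..<n} (Gnm xs k)" unfolding Gk
        by (intro sync_of_good_graph[OF xs elim(3) m0 eps(4,1,2,3) rb(3,1) _ dg conn low])
    qed
  qed
  have lim: "(\<lambda>n. 1 - p n) \<longlonglongrightarrow> 1" using tendsto_diff[OF tendsto_const[of 1] p0] by simp
  show ?thesis by (rule tendsto_sandwich[OF ev _ lim tendsto_const]) simp
qed

end
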